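(* Let $\mathfrak{g}$ be a semisimple Lie algebra over $\mathbb{C}$, and let $V_1,\dots,V_k$ be pairwise non-isomorphic irreducible finite dimensional $\mathfrak{g}$-representations. Let $V$ and $W$ be finite dimensional $\mathfrak{g}$-representations with $cl(V)=\sum_{i=1}^k n_i\,cl(V_i)$ and $cl(W)=\sum_{i=1}^k m_i\,cl(V_i)$, and let $s=\sum_{i=1}^k s_i\,cl(V_i)\in R(\mathfrak{g})$ be such that $0\leq s\leq\min(cl(V),cl(W))$. Then the variety $\operatorname{Hom}_{\mathfrak{g}}(V,W)_s$ of $\mathfrak{g}$-morphisms $V\to W$ of $\mathfrak{g}$-rank $s$ is irreducible, smooth, and $$\dim\operatorname{Hom}_{\mathfrak{g}}(V,W)_s=\sum_{i=1}^k(n_i+m_i-s_i)s_i.$$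
   Context: $R(\mathfrak{g})$ is the representation ring of finite dimensional $\mathfrak{g}$-representations and $cl(V)\in R(\mathfrak{g})$ is the class of $V$; classes of irreducibles form a $\mathbb{Z}$-basis. An element $S\in R(\mathfrak{g})$ satisfies $S\geq0$ if all its coefficients on irreducible classes are non-negative, $S_1\leq S_2$ means $S_2-S_1\geq0$, and $\min$ is taken coefficientwise. For a $\mathfrak{g}$-morphism $f$, its $\mathfrak{g}$-rank is $\operatorname{rk}_{\mathfrak{g}}(f):=cl(\operatorname{im} f)\in R(\mathfrak{g})$. $\operatorname{Hom}_{\mathfrak{g}}(V,W)_s=\{f\in\operatorname{Hom}_{\mathfrak{g}}(V,W)\mid \operatorname{rk}_{\mathfrak{g}}(f)=s\}$, a subvariety of the affine space $\operatorname{Hom}_{\mathfrak{g}}(V,W)$. *)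

theory Defs
  imports
    "HOL-Analysis.Analysis"
    "HOL-Algebra.QuotRing"
    "HOL-Algebra.Generated_Groups"
    "HOL-Library.Function_Algebras"
    "HOL-Library.Nat_Bijection"
    "HOL-Library.Poly_Mapping"
begin

text \<open>
  Complex vector spaces are types of class \<^class>\<open>ab_group_add\<close> with an explicit scalar
  multiplication, as in \<^locale>\<open>vector_space\<close>.
\<close>

definition linear_on ::
    "'a::ab_group_add set \<Rightarrow> (complex \<Rightarrow> 'a \<Rightarrow> 'a) \<Rightarrow> (complex \<Rightarrow> 'b::ab_group_add \<Rightarrow> 'b) \<Rightarrow> ('a \<Rightarrow> 'b) \<Rightarrow> bool"
  where "linear_on S s1 s2 f \<longleftrightarrow>
    (\<forall>x\<in>S. \<forall>y\<in>S. f (x + y) = f x + f y) \<and> (\<forall>c. \<forall>x\<in>S. f (s1 c x) = s2 c (f x))"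


section \<open>Semisimple Lie algebras\<close>

record 'g lie =
  lie_scale :: "complex \<Rightarrow> 'g \<Rightarrow> 'g"
  bracket :: "'g \<Rightarrow> 'g \<Rightarrow> 'g"

definition lie_algebra :: "'g::ab_group_add lie \<Rightarrow> bool"
  where "lie_algebra L \<longleftrightarrow>
    vector_space (lie_scale L) \<and>
    (\<forall>x. linear_on UNIV (lie_scale L) (lie_scale L) (\<lambda>y. bracket L x y)) \<and>
    (\<forall>y. linear_on UNIV (lie_scale L) (lie_scale L) (\<lambda>x. bracket L x y)) \<and>
    (\<forall>x. bracket L x x = 0) \<and>
    (\<forall>x y z. bracket L x (bracket L y z) + bracket L y (bracket L z x)
              + bracket L z (bracket L x y) = 0)"

definition lie_ideal :: "'g::ab_group_add lie \<Rightarrow> 'g set \<Rightarrow> bool"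
  where "lie_ideal L I \<longleftrightarrow>
    module.subspace (lie_scale L) I \<and> (\<forall>x. \<forall>y\<in>I. bracket L x y \<in> I)"

definition derived_lie :: "'g::ab_group_add lie \<Rightarrow> 'g set \<Rightarrow> 'g set"
  where "derived_lie L I = module.span (lie_scale L) {bracket L x y | x y. x \<in> I \<and> y \<in> I}"

definition solvable_lie :: "'g::ab_group_add lie \<Rightarrow> 'g set \<Rightarrow> bool"
  where "solvable_lie L I \<longleftrightarrow> (\<exists>n. (derived_lie L ^^ n) I = {0})"

text \<open>Finite dimensional with zero radical.\<close>

definition semisimple :: "'g::ab_group_add lie \<Rightarrow> bool"
  where "semisimple L \<longleftrightarrow>
    lie_algebra L \<and>
    (\<exists>B. finite B \<and> module.span (lie_scale L) B = UNIV) \<and>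
    (\<forall>I. lie_ideal L I \<and> solvable_lie L I \<longrightarrow> I = {0})"


section \<open>Finite dimensional representations\<close>

text \<open>
  The underlying vector space of a representation is a subspace of an ambient complex vector
  space of vectors of type \<open>'v\<close>; values of \<open>rep_act\<close> off this subspace are irrelevant.
\<close>

record ('g, 'v) rep =
  rep_space :: "'v set"
  rep_scale :: "complex \<Rightarrow> 'v \<Rightarrow> 'v"
  rep_act :: "'g \<Rightarrow> 'v \<Rightarrow> 'v"

definition fd_rep :: "'g::ab_group_add lie \<Rightarrow> ('g, 'v::ab_group_add) rep \<Rightarrow> bool"
  where "fd_rep L V \<longleftrightarrow>
    vector_space (rep_scale V) \<and>
    module.subspace (rep_scale V) (rep_space V) \<and>
    (\<exists>B. finite B \<and> module.span (rep_scale V) B = rep_space V) \<and>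
    (\<forall>x. rep_act V x ` rep_space V \<subseteq> rep_space V) \<and>
    (\<forall>x. linear_on (rep_space V) (rep_scale V) (rep_scale V) (rep_act V x)) \<and>
    (\<forall>v\<in>rep_space V. linear_on UNIV (lie_scale L) (rep_scale V) (\<lambda>x. rep_act V x v)) \<and>
    (\<forall>x y. \<forall>v\<in>rep_space V.
       rep_act V (bracket L x y) v = rep_act V x (rep_act V y v) - rep_act V y (rep_act V x v))"

definition irreducible_rep :: "'g::ab_group_add lie \<Rightarrow> ('g, 'v::ab_group_add) rep \<Rightarrow> bool"
  where "irreducible_rep L V \<longleftrightarrow>
    fd_rep L V \<and> rep_space V \<noteq> {0} \<and>
    (\<forall>U. U \<subseteq> rep_space V \<and> module.subspace (rep_scale V) U \<and> (\<forall>x. rep_act V x ` U \<subseteq> U)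
       \<longrightarrow> U = {0} \<or> U = rep_space V)"

text \<open>Morphisms are extended by zero, so that they are determined by their values on the source.\<close>

definition Hom ::
    "('g, 'v::ab_group_add) rep \<Rightarrow> ('g, 'w::ab_group_add) rep \<Rightarrow> ('v \<Rightarrow> 'w) set"
  where "Hom V W = {f.
    f ` rep_space V \<subseteq> rep_space W \<and>
    linear_on (rep_space V) (rep_scale V) (rep_scale W) f \<and>
    (\<forall>x. \<forall>v\<in>rep_space V. f (rep_act V x v) = rep_act W x (f v)) \<and>
    (\<forall>v. v \<notin> rep_space V \<longrightarrow> f v = 0)}"

definition hom_scale :: "('g, 'w) rep \<Rightarrow> complex \<Rightarrow> ('v \<Rightarrow> 'w) \<Rightarrow> 'v \<Rightarrow> 'w"
  where "hom_scale W c f = (\<lambda>v. rep_scale W c (f v))"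

definition rep_iso :: "('g, 'v::ab_group_add) rep \<Rightarrow> ('g, 'w::ab_group_add) rep \<Rightarrow> bool"
  where "rep_iso V W \<longleftrightarrow> (\<exists>f\<in>Hom V W. bij_betw f (rep_space V) (rep_space W))"

definition image_rep :: "('g, 'v) rep \<Rightarrow> ('g, 'w) rep \<Rightarrow> ('v \<Rightarrow> 'w) \<Rightarrow> ('g, 'w) rep"
  where "image_rep V W f = W\<lparr>rep_space := f ` rep_space V\<rparr>"


section \<open>The representation ring\<close>

text \<open>
  The finite dimensional subrepresentations of the space of complex sequences form a set that
  contains a copy of every finite dimensional representation.  The representation ring is the
  Grothendieck ring on these: finite formal integer combinations, multiplied by the tensor
  product, modulo the relations given by short exact sequences.
\<close>

definition seq_scale :: "complex \<Rightarrow> (nat \<Rightarrow> complex) \<Rightarrow> nat \<Rightarrow> complex"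
  where "seq_scale c v = (\<lambda>i. c * v i)"

definition seq_reps :: "'g::ab_group_add lie \<Rightarrow> ('g, nat \<Rightarrow> complex) rep set"
  where "seq_reps L = {V. fd_rep L V \<and> rep_scale V = seq_scale}"

definition trivial_rep :: "('g, nat \<Rightarrow> complex) rep"
  where "trivial_rep =
    \<lparr>rep_space = {v. \<forall>i>0. v i = 0}, rep_scale = seq_scale, rep_act = (\<lambda>x v. 0)\<rparr>"

text \<open>
  The bilinear map \<open>tensor_vec\<close> induces an injective linear map from the tensor product of the
  space of sequences with itself to the space of sequences.  Hence on the span below the action
  is determined by its values on pure tensors.
\<close>

definition tensor_vec :: "(nat \<Rightarrow> complex) \<Rightarrow> (nat \<Rightarrow> complex) \<Rightarrow> nat \<Rightarrow> complex"
  where "tensor_vec u v = (\<lambda>k. u (fst (prod_decode k)) * v (snd (prod_decode k)))"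

definition tensor_rep ::
    "'g::ab_group_add lie \<Rightarrow> ('g, nat \<Rightarrow> complex) rep \<Rightarrow> ('g, nat \<Rightarrow> complex) rep
       \<Rightarrow> ('g, nat \<Rightarrow> complex) rep"
  where "tensor_rep L U V = (SOME T. T \<in> seq_reps L \<and>
    rep_space T = module.span seq_scale {tensor_vec u v | u v. u \<in> rep_space U \<and> v \<in> rep_space V} \<and>
    (\<forall>x. \<forall>u\<in>rep_space U. \<forall>v\<in>rep_space V. rep_act T x (tensor_vec u v)
        = tensor_vec (rep_act U x u) v + tensor_vec u (rep_act V x v)))"

type_synonym 'g formal_rep = "('g, nat \<Rightarrow> complex) rep \<Rightarrow>\<^sub>0 int"

definition formal_reps :: "'g::ab_group_add lie \<Rightarrow> 'g formal_rep ring"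
  where "formal_reps L =
    \<lparr>carrier = {a. Poly_Mapping.keys a \<subseteq> seq_reps L},
     mult = (\<lambda>a b. \<Sum>U\<in>Poly_Mapping.keys a. \<Sum>V\<in>Poly_Mapping.keys b.
       Poly_Mapping.single (tensor_rep L U V) (Poly_Mapping.lookup a U * Poly_Mapping.lookup b V)),
     one = Poly_Mapping.single trivial_rep 1,
     zero = 0,
     add = (+)\<rparr>"

definition exact_relations :: "'g::ab_group_add lie \<Rightarrow> 'g formal_rep set"
  where "exact_relations L =
    {Poly_Mapping.single V 1 - Poly_Mapping.single U 1 - Poly_Mapping.single Q 1 | U V Q.
       U \<in> seq_reps L \<and> V \<in> seq_reps L \<and> Q \<in> seq_reps L \<and>
       (\<exists>f\<in>Hom U V. \<exists>g\<in>Hom V Q. inj_on f (rep_space U) \<and> g ` rep_space V = rep_space Q \<and>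
          f ` rep_space U = {v\<in>rep_space V. g v = 0})}"

text \<open>
  As tensoring is exact, the subgroup generated by the relations is a two-sided ideal.
\<close>

definition relation_ideal :: "'g::ab_group_add lie \<Rightarrow> 'g formal_rep set"
  where "relation_ideal L = generate (add_monoid (formal_reps L)) (exact_relations L)"

definition rep_ring :: "'g::ab_group_add lie \<Rightarrow> 'g formal_rep set ring"
  where "rep_ring L = formal_reps L Quot relation_ideal L"

definition cl :: "'g::ab_group_add lie \<Rightarrow> ('g, 'v::ab_group_add) rep \<Rightarrow> 'g formal_rep set"
  where "cl L V = relation_ideal L +>\<^bsub>formal_reps L\<^esub>
    Poly_Mapping.single (SOME U. U \<in> seq_reps L \<and> rep_iso U V) 1"

definition irr_classes :: "'g::ab_group_add lie \<Rightarrow> 'g formal_rep set set"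
  where "irr_classes L = cl L ` {U \<in> seq_reps L. irreducible_rep L U}"

text \<open>Coefficients with respect to the basis of irreducible classes.\<close>

definition coeffs :: "'g::ab_group_add lie \<Rightarrow> 'g formal_rep set \<Rightarrow> 'g formal_rep set \<Rightarrow> int"
  where "coeffs L S = (THE c. finite {x. c x \<noteq> 0} \<and> {x. c x \<noteq> 0} \<subseteq> irr_classes L \<and>
    S = (\<Oplus>\<^bsub>rep_ring L\<^esub>x\<in>{x. c x \<noteq> 0}. [c x] \<cdot>\<^bsub>rep_ring L\<^esub> x))"

definition rep_nonneg :: "'g::ab_group_add lie \<Rightarrow> 'g formal_rep set \<Rightarrow> bool"
  where "rep_nonneg L S \<longleftrightarrow> (\<forall>x\<in>irr_classes L. 0 \<le> coeffs L S x)"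

definition rep_le :: "'g::ab_group_add lie \<Rightarrow> 'g formal_rep set \<Rightarrow> 'g formal_rep set \<Rightarrow> bool"
  where "rep_le L S T \<longleftrightarrow> rep_nonneg L (T \<ominus>\<^bsub>rep_ring L\<^esub> S)"

definition rep_min ::
    "'g::ab_group_add lie \<Rightarrow> 'g formal_rep set \<Rightarrow> 'g formal_rep set \<Rightarrow> 'g formal_rep set"
  where "rep_min L S T =
    (\<Oplus>\<^bsub>rep_ring L\<^esub>x\<in>{x\<in>irr_classes L. min (coeffs L S x) (coeffs L T x) \<noteq> 0}.
       [min (coeffs L S x) (coeffs L T x)] \<cdot>\<^bsub>rep_ring L\<^esub> x)"

definition rep_rank ::
    "'g::ab_group_add lie \<Rightarrow> ('g, 'v::ab_group_add) rep \<Rightarrow> ('g, 'w::ab_group_add) rep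
       \<Rightarrow> ('v \<Rightarrow> 'w) \<Rightarrow> 'g formal_rep set"
  where "rep_rank L V W f = cl L (image_rep V W f)"

definition Hom_rank ::
    "'g::ab_group_add lie \<Rightarrow> ('g, 'v::ab_group_add) rep \<Rightarrow> ('g, 'w::ab_group_add) rep
       \<Rightarrow> 'g formal_rep set \<Rightarrow> ('v \<Rightarrow> 'w) set"
  where "Hom_rank L V W S = {f \<in> Hom V W. rep_rank L V W f = S}"


section \<open>Irreducibility and dimension of topological spaces\<close>

definition irreducible_space :: "'a topology \<Rightarrow> bool"
  where "irreducible_space T \<longleftrightarrow> topspace T \<noteq> {} \<and>
    (\<forall>C D. closedin T C \<and> closedin T D \<and> topspace T = C \<union> D
       \<longrightarrow> C = topspace T \<or> D = topspace T)"

text \<open>Krull dimension; the empty space gets dimension \<open>0\<close> by convention.\<close>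

definition krull_dim :: "'a topology \<Rightarrow> enat"
  where "krull_dim T = Sup {enat n | n. \<exists>C :: nat \<Rightarrow> 'a set.
    (\<forall>i\<le>n. closedin T (C i) \<and> irreducible_space (subtopology T (C i))) \<and>
    (\<forall>i<n. C i \<subset> C (Suc i))}"

definition local_dim :: "'a topology \<Rightarrow> 'a \<Rightarrow> enat"
  where "local_dim T p = (INF U\<in>{U. openin T U \<and> p \<in> U}. krull_dim (subtopology T U))"


section \<open>Subvarieties of an affine space\<close>

text \<open>
  The affine space is a finite dimensional subspace \<open>E\<close> of a complex vector space with scalar
  multiplication \<open>sc\<close>.  Polynomial functions on \<open>E\<close> are compared on \<open>E\<close> only.
\<close>

inductive_set poly_functions ::
    "(complex \<Rightarrow> 'e::ab_group_add \<Rightarrow> 'e) \<Rightarrow> 'e set \<Rightarrow> ('e \<Rightarrow> complex) set"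
  for sc :: "complex \<Rightarrow> 'e::ab_group_add \<Rightarrow> 'e" and E :: "'e set" where
  const: "(\<lambda>x. c) \<in> poly_functions sc E"
| linear: "linear_on E sc (*) f \<Longrightarrow> f \<in> poly_functions sc E"
| add: "f \<in> poly_functions sc E \<Longrightarrow> g \<in> poly_functions sc E \<Longrightarrow> (\<lambda>x. f x + g x) \<in> poly_functions sc E"
| mult: "f \<in> poly_functions sc E \<Longrightarrow> g \<in> poly_functions sc E \<Longrightarrow> (\<lambda>x. f x * g x) \<in> poly_functions sc E"

definition zero_locus :: "'e set \<Rightarrow> ('e \<Rightarrow> complex) set \<Rightarrow> 'e set"
  where "zero_locus E P = {x\<in>E. \<forall>f\<in>P. f x = 0}"

definition zariski :: "(complex \<Rightarrow> 'e::ab_group_add \<Rightarrow> 'e) \<Rightarrow> 'e set \<Rightarrow> 'e topology"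
  where "zariski sc E = topology (\<lambda>U. \<exists>P\<subseteq>poly_functions sc E. U = E - zero_locus E P)"

lemma openin_zariski:
  "openin (zariski sc E) U \<longleftrightarrow> (\<exists>P\<subseteq>poly_functions sc E. U = E - zero_locus E P)"
proof -
  let ?op = "\<lambda>U. \<exists>P\<subseteq>poly_functions sc E. U = E - zero_locus E P"
  have "?op (U \<inter> V)" if U: "?op U" and V: "?op V" for U V
  proof -
    obtain P where P: "P \<subseteq> poly_functions sc E" "U = E - zero_locus E P"
      using U by (elim exE conjE)
    obtain Q where Q: "Q \<subseteq> poly_functions sc E" "V = E - zero_locus E Q"
      using V by (elim exE conjE)
    define R where "R = (\<lambda>(f, g) x. f x * g x) ` (P \<times> Q)"
    have "R \<subseteq> poly_functions sc E"
      unfolding R_def using P(1) Q(1) by (auto intro!: poly_functions.mult)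
    moreover have "zero_locus E R = zero_locus E P \<union> zero_locus E Q"
      unfolding zero_locus_def R_def by (auto simp: image_iff)
    then have "U \<inter> V = E - zero_locus E R"
      using P(2) Q(2) by (simp add: Diff_Un)
    ultimately show ?thesis
      by (intro exI[of _ R] conjI)
  qed
  moreover have "?op (\<Union>\<K>)" if K: "\<forall>K\<in>\<K>. ?op K" for \<K>
  proof -
    obtain P where P: "\<forall>K\<in>\<K>. P K \<subseteq> poly_functions sc E \<and> K = E - zero_locus E (P K)"
      using bchoice[OF K] by (elim exE)
    have "\<Union>\<K> = (\<Union>K\<in>\<K>. E - zero_locus E (P K))"
      using P by (metis (no_types, lifting) SUP_cong image_ident)
    also have "\<dots> = E - zero_locus E (\<Union>(P ` \<K>))"
      by (auto simp: zero_locus_def)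
    finally have "\<Union>\<K> = E - zero_locus E (\<Union>(P ` \<K>))" .
    moreover have "\<Union>(P ` \<K>) \<subseteq> poly_functions sc E"
      using P by (intro UN_least) simp
    ultimately show ?thesis
      by (intro exI[of _ "\<Union>(P ` \<K>)"] conjI)
  qed
  ultimately have "istopology ?op"
    unfolding istopology_def by (intro conjI allI impI)
  then show ?thesis
    unfolding zariski_def by (simp only: topology_inverse')
qed

lemma topspace_zariski: "topspace (zariski sc E) = E"
proof
  show "topspace (zariski sc E) \<subseteq> E"
    by (auto simp: topspace_def openin_zariski)
  have "E = E - zero_locus E {\<lambda>x. 1}"
    by (auto simp: zero_locus_def)
  then have "openin (zariski sc E) E"
    unfolding openin_zariski
    by (intro exI[of _ "{\<lambda>x. 1}"] conjI) (simp_all add: poly_functions.const)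
  then show "E \<subseteq> topspace (zariski sc E)"
    by (rule openin_subset)
qed

lemma closedin_zariski:
  "closedin (zariski sc E) C \<longleftrightarrow> (\<exists>P\<subseteq>poly_functions sc E. C = zero_locus E P)"
proof -
  have "zero_locus E P \<subseteq> E" for P
    by (auto simp: zero_locus_def)
  then have eq: "C \<subseteq> E \<and> E - C = E - zero_locus E P \<longleftrightarrow> C = zero_locus E P" for P
    by blast
  have "closedin (zariski sc E) C \<longleftrightarrow>
      (\<exists>P. P \<subseteq> poly_functions sc E \<and> (C \<subseteq> E \<and> E - C = E - zero_locus E P))"
    by (auto simp: closedin_def topspace_zariski openin_zariski)
  then show ?thesis
    by (simp only: eq)
qed

definition subvariety :: "(complex \<Rightarrow> 'e::ab_group_add \<Rightarrow> 'e) \<Rightarrow> 'e set \<Rightarrow> 'e set \<Rightarrow> bool"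
  where "subvariety sc E X \<longleftrightarrow>
    (\<exists>U C. openin (zariski sc E) U \<and> closedin (zariski sc E) C \<and> X = U \<inter> C)"

text \<open>
  The Zariski tangent space, cut out by the differentials of all polynomial functions that
  vanish on \<open>X\<close>.  For locally closed \<open>X\<close> this is the tangent space of the closure, in which
  \<open>X\<close> is open.
\<close>

definition tangent_space ::
    "(complex \<Rightarrow> 'e::ab_group_add \<Rightarrow> 'e) \<Rightarrow> 'e set \<Rightarrow> 'e set \<Rightarrow> 'e \<Rightarrow> 'e set"
  where "tangent_space sc E X p = {v\<in>E. \<forall>f\<in>poly_functions sc E.
    (\<forall>x\<in>X. f x = 0) \<longrightarrow> deriv (\<lambda>t. f (p + sc t v)) 0 = 0}"

definition smooth_variety :: "(complex \<Rightarrow> 'e::ab_group_add \<Rightarrow> 'e) \<Rightarrow> 'e set \<Rightarrow> 'e set \<Rightarrow> bool"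
  where "smooth_variety sc E X \<longleftrightarrow> (\<forall>p\<in>X.
    enat (vector_space.dim sc (tangent_space sc E X p))
      = local_dim (subtopology (zariski sc E) X) p)"

end

theory Submission
  imports
    Defs
    "HOL-Computational_Algebra.Fundamental_Theorem_Algebra"
begin

text \<open>
  By Weyl's theorem, proved here from Cartan's criterion, Engel's theorem and the Casimir element,
  every morphism \<open>p\<close> has a generalized inverse \<open>q\<close>, so \<open>hdim U V = dim Hom(U, V)\<close> is additive on exact
  sequences.  Hence it is a function on the representation ring, the coefficients of a class are the
  numbers \<open>hdim (V\<^sub>i) V\<close>, and \<open>f\<close> has rank \<open>s\<close> iff composition with \<open>f\<close> has rank \<open>s\<^sub>i\<close> on
  \<open>Hom(V\<^sub>i, V)\<close> for all \<open>i\<close>: this is a condition on minors, and the set \<open>X\<close> of such \<open>f\<close> is a single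
  orbit \<open>P p R\<close> of the automorphisms of \<open>V\<close> and \<open>W\<close>.  The parabolas \<open>(1 + t a) p (1 + t b)\<close> lie in \<open>X\<close>
  up to finitely many \<open>t\<close>; they join any two points of \<open>X\<close>, whence irreducibility.

  Near \<open>p\<close>, the quadratic map \<open>x \<mapsto> x q p + x q x (1 - q p)\<close> parametrizes \<open>X\<close> by the space of all
  \<open>x\<close> with \<open>(1 - p q) x (1 - q p) = 0\<close>, which is also the tangent space and has dimension
  \<open>\<Sum> (n\<^sub>i + m\<^sub>i - s\<^sub>i) s\<^sub>i\<close>.  The Hilbert function of \<open>X\<close> then bounds the Krull dimension from above,
  and the images of a flag of this space bound it from below in every neighbourhood of \<open>p\<close>.
\<close>

text \<open>No isotypic decomposition is ever chosen. Multiplicities are read off as dimensions of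
  Hom spaces, which makes sense for representations of different types, and every splitting comes
  from a pair with \<open>p q p = p\<close> and \<open>q p q = q\<close>: the idempotents
  \<open>q p\<close> and \<open>p q\<close> cut \<open>Hom V W\<close> into four blocks. Curves are
  the means to handle Zariski closed sets: along a parabola a polynomial function is a polynomial in
  one variable, so vanishing up to finitely many parameters is vanishing everywhere. The obstacle in
  the dimension count is that solving the chart equation for \<open>x\<close> requires the inverse
  of a block. The linear map \<open>y \<mapsto> y - cut y\<close> recovers \<open>x\<close> from
  \<open>chart x\<close> only up to an error in \<open>tang0\<close>, and exactly over
  \<open>p + tang0\<close>. Hence the flag for the lower bound has to pass through
  \<open>tang0\<close>: below it there is no error, and above it the separating functionals kill the
  error. For the upper bound only the order of growth of Hilbert functions matters. The bound is
  \<open>(2 * n + 1) ^ d\<close>, where 2 is the degree of the chart, and a chain of length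
  \<open>m\<close> forces growth of order \<open>m\<close>, so \<open>m \<le> d\<close>.\<close>

abbreviation "clinear \<equiv> Vector_Spaces.linear"

section \<open>Finite dimensional subspaces and maps that are linear on a subspace\<close>

locale cvec = vector_space scale for scale :: "complex \<Rightarrow> 'v::ab_group_add \<Rightarrow> 'v"
begin

text \<open>A finite spanning set is carried along with the subspace because \<open>dim\<close> is a
  cardinality and becomes 0 when bases are infinite; an equality such as
  \<open>dim T = dim S\<close> is informative only for such subspaces.\<close>

definition fdim :: "'v set \<Rightarrow> bool"
  where "fdim S \<longleftrightarrow> subspace S \<and> (\<exists>B. finite B \<and> span B = S)"

lemma fdim_subspace: "fdim S \<Longrightarrow> subspace S"
  by (simp add: fdim_def)

lemma fdim_span: "finite B \<Longrightarrow> fdim (span B)"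
  by (auto simp: fdim_def)

lemma fdim_independent:
  assumes "fdim S" "independent B" "B \<subseteq> S"
  shows "finite B" "card B \<le> dim S"
proof -
  obtain A where A: "finite A" "span A = S" using assms(1) by (auto simp: fdim_def)
  show fB: "finite B" using independent_span_bound[OF A(1) assms(2)] A(2) assms(3) by auto
  obtain C where C: "C \<subseteq> S" "independent C" "S \<subseteq> span C" "card C = dim S"
    using basis_exists[of S] by auto
  have "finite C" using independent_span_bound[OF A(1) C(2)] A(2) C(1) by auto
  then show "card B \<le> dim S"
    using independent_span_bound[of C B] assms(2,3) C by auto
qed

lemma fdim_extend:
  assumes "fdim S" "independent A" "A \<subseteq> S"
  obtains B where "A \<subseteq> B" "finite B" "independent B" "B \<subseteq> S" "span B = S" "card B = dim S"
proof -
  obtain B where B: "A \<subseteq> B" "B \<subseteq> S" "independent B" "S \<subseteq> span B"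
    using maximal_independent_subset_extend[OF assms(3,2)] by auto
  have "span B = S" using B(2,4) fdim_subspace[OF assms(1)] by (simp add: span_subspace)
  moreover have "finite B" using fdim_independent[OF assms(1) B(3,2)] by simp
  moreover have "card B = dim S" using B by (simp add: basis_card_eq_dim)
  ultimately show ?thesis using that B by auto
qed

lemma fdim_basis:
  assumes "fdim S"
  obtains B where "finite B" "independent B" "B \<subseteq> S" "span B = S" "card B = dim S"
  using fdim_extend[OF assms independent_empty] by auto

lemma fdim_sub:
  assumes "fdim S" "subspace T" "T \<subseteq> S"
  shows "fdim T" "dim T \<le> dim S" "dim T = dim S \<Longrightarrow> T = S"
proof -
  obtain A where A: "A \<subseteq> T" "independent A" "T \<subseteq> span A" "card A = dim T"
    using basis_exists[of T] by auto
  have sA: "span A = T" using A assms(2) by (simp add: span_subspace)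
  have AS: "A \<subseteq> S" using A(1) assms(3) by auto
  note fA = fdim_independent[OF assms(1) A(2) AS]
  show "fdim T" using fA(1) sA assms(2) by (auto simp: fdim_def)
  show "dim T \<le> dim S" using fA(2) A(4) by simp
  assume eq: "dim T = dim S"
  obtain B where B: "A \<subseteq> B" "finite B" "independent B" "B \<subseteq> S" "span B = S" "card B = dim S"
    by (rule fdim_extend[OF assms(1) A(2) AS])
  have "A = B" using B A(4) eq by (simp add: card_subset_eq)
  then show "T = S" using sA B(5) by simp
qed

lemma fdim_dim_0: "fdim S \<Longrightarrow> dim S = 0 \<longleftrightarrow> S = {0}"
proof
  assume S: "fdim S" and "dim S = 0"
  moreover obtain B where "finite B" "independent B" "B \<subseteq> S" "span B = S" "card B = dim S"
    by (rule fdim_basis[OF S])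
  ultimately show "S = {0}" by auto
next
  assume "S = {0}"
  then have "dim S = dim (span {})" by (simp add: span_empty)
  also have "\<dots> = 0" using dim_span_eq_card_independent[OF independent_empty] by simp
  finally show "dim S = 0" .
qed

lemma dim_single_0 [simp]: "dim {0} = 0"
  using fdim_dim_0[of "{0}"] fdim_span[of "{}"] by (simp add: span_empty)

lemma fdim_0: "fdim {0}"
  using fdim_span[of "{}"] by (simp add: span_empty)

text \<open>The coordinates of \<open>x\<close> with respect to \<open>B\<close> are supported both
  in \<open>A\<close> and in \<open>B - A\<close>, so all of them vanish.\<close>

lemma span_Int_disjoint:
  assumes "independent B" "A \<subseteq> B" "x \<in> span A" "x \<in> span (B - A)"
  shows "x = 0"
proof -
  have "representation B x = representation A x"
    by (rule representation_extend) (use assms in auto)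
  moreover have "representation B x = representation (B - A) x"
    by (rule representation_extend) (use assms in auto)
  ultimately have z: "representation B x b = 0" for b
    using representation_ne_zero[of A x b] representation_ne_zero[of "B - A" x b] by fastforce
  have "x \<in> span B" using assms(2,3) span_mono by blast
  then have "(\<Sum>b | representation B x b \<noteq> 0. scale (representation B x b) b) = x"
    using sum_nonzero_representation_eq[OF assms(1)] by simp
  then show ?thesis using z by simp
qed

end

text \<open>Morphisms are linear only on the subspace that carries a representation. Extending the
  values on a basis of \<open>S\<close> gives a globally linear map that agrees with
  \<open>f\<close> on \<open>S\<close>, and statements about \<open>f\<close> are reduced to
  it.\<close>

lemma linear_on_iff:
  assumes "cvec s1" "cvec s2" "linear_on S s1 s2 f" "module.subspace s1 S"
  obtains g where "clinear s1 s2 g" "\<And>x. x \<in> S \<Longrightarrow> g x = f x"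
proof -
  interpret v1: cvec s1 by fact
  interpret v2: cvec s2 by fact
  interpret vector_space_pair s1 s2 by unfold_locales
  obtain B where B: "B \<subseteq> S" "v1.independent B" "S \<subseteq> v1.span B"
    using v1.maximal_independent_subset[of S] by auto
  obtain g where g: "clinear s1 s2 g" "\<And>x. x \<in> B \<Longrightarrow> g x = f x"
    using linear_independent_extend[OF B(2)] by metis
  interpret g: Vector_Spaces.linear s1 s2 g by (rule g(1))
  have f0: "f 0 = 0"
    using assms(3) v1.subspace_0[OF assms(4)] unfolding linear_on_def by fastforce
  have "x \<in> S \<and> g x = f x" if "x \<in> v1.span B" for x
    using that
  proof (induction rule: v1.span_induct_alt)
    case base
    then show ?case using v1.subspace_0[OF assms(4)] f0 g.zero by simp
  next
    case (step c x y)
    then have "x \<in> S" using B(1) by auto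
    then show ?case using step assms(3,4) g(2)
      by (auto simp: linear_on_def v1.subspace_add v1.subspace_scale g.add g.scale)
  qed
  then show ?thesis using that g(1) B(3) by blast
qed

locale cvec2 = v1: cvec s1 + v2: cvec s2
  for s1 :: "complex \<Rightarrow> 'a::ab_group_add \<Rightarrow> 'a" and s2 :: "complex \<Rightarrow> 'b::ab_group_add \<Rightarrow> 'b"
begin

sublocale vector_space_pair s1 s2 by unfold_locales

lemma linear_onI_linear: "clinear s1 s2 g \<Longrightarrow> linear_on S s1 s2 g"
  unfolding linear_on_def using linear_add linear_scale by blast

lemma linear_on_0: "linear_on S s1 s2 f \<Longrightarrow> v1.subspace S \<Longrightarrow> f 0 = 0"
  using v1.subspace_0 unfolding linear_on_def by fastforce

lemma linear_on_add: "linear_on S s1 s2 f \<Longrightarrow> x \<in> S \<Longrightarrow> y \<in> S \<Longrightarrow> f (x + y) = f x + f y"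
  unfolding linear_on_def by blast

lemma linear_on_scale: "linear_on S s1 s2 f \<Longrightarrow> x \<in> S \<Longrightarrow> f (s1 c x) = s2 c (f x)"
  unfolding linear_on_def by blast

lemma linear_on_diff:
  "linear_on S s1 s2 f \<Longrightarrow> v1.subspace S \<Longrightarrow> x \<in> S \<Longrightarrow> y \<in> S \<Longrightarrow> f (x - y) = f x - f y"
  using linear_on_add[of S f "x - y" y] v1.subspace_diff[of S x y] by (simp add: eq_diff_eq)

lemma linear_on_sum:
  assumes "linear_on S s1 s2 f" "v1.subspace S" "\<And>i. i \<in> I \<Longrightarrow> g i \<in> S"
  shows "f (sum g I) = (\<Sum>i\<in>I. f (g i))"
  using assms(3)
proof (induction I rule: infinite_finite_induct)
  case (insert i I)
  then show ?case
    using assms(1,2) by (simp add: linear_on_add v1.subspace_sum)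
qed (use linear_on_0[OF assms(1,2)] in auto)

lemma subspace_image_on:
  assumes "linear_on S s1 s2 f" "v1.subspace S"
  shows "v2.subspace (f ` S)"
proof -
  obtain g where g: "clinear s1 s2 g" "\<And>x. x \<in> S \<Longrightarrow> g x = f x"
    using linear_on_iff[OF v1.cvec_axioms v2.cvec_axioms assms] by metis
  then show ?thesis using linear_subspace_image[OF g(1) assms(2)] by (metis image_cong)
qed

lemma subspace_preimage_on:
  assumes "linear_on S s1 s2 f" "v1.subspace S" "v2.subspace T"
  shows "v1.subspace {x\<in>S. f x \<in> T}"
  using assms linear_on_0[OF assms(1,2)]
  by (auto simp: linear_on_def v1.subspace_def v2.subspace_def)

lemma subspace_kernel_on:
  assumes "linear_on S s1 s2 f" "v1.subspace S"
  shows "v1.subspace {x\<in>S. f x = 0}"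
  using subspace_preimage_on[OF assms v2.subspace_single_0] by simp

text \<open>Rank and nullity: a basis \<open>A\<close> of the kernel is extended to a basis
  \<open>B\<close> of \<open>S\<close>, and the images of \<open>B - A\<close> form a basis of the
  image, because \<open>span A\<close> and \<open>span (B - A)\<close> meet only in 0.\<close>

lemma dim_image_kernel:
  assumes S: "v1.fdim S" and f: "linear_on S s1 s2 f"
  shows "v2.fdim (f ` S)" "v2.dim (f ` S) + v1.dim {x\<in>S. f x = 0} = v1.dim S"
proof -
  note sS = v1.fdim_subspace[OF S]
  obtain g where g: "clinear s1 s2 g" "\<And>x. x \<in> S \<Longrightarrow> g x = f x"
    using linear_on_iff[OF v1.cvec_axioms v2.cvec_axioms f sS] by metis
  let ?K = "{x\<in>S. f x = 0}"
  have K: "v1.fdim ?K" by (rule v1.fdim_sub[OF S subspace_kernel_on[OF f sS]]) auto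
  obtain A where A: "finite A" "v1.independent A" "A \<subseteq> ?K" "v1.span A = ?K" "card A = v1.dim ?K"
    by (rule v1.fdim_basis[OF K])
  obtain B where B: "A \<subseteq> B" "finite B" "v1.independent B" "B \<subseteq> S" "v1.span B = S" "card B = v1.dim S"
    by (rule v1.fdim_extend[OF S A(2)]) (use A(3) in auto)
  have inj: "inj_on g (v1.span (B - A))"
  proof (subst linear_inj_on_iff_eq_0[OF g(1)])
    show "v1.subspace (v1.span (B - A))" by simp
    show "\<forall>x\<in>v1.span (B - A). g x = 0 \<longrightarrow> x = 0"
    proof (intro ballI impI)
      fix x assume x: "x \<in> v1.span (B - A)" "g x = 0"
      then have "x \<in> S" using B(5) v1.span_mono[of "B - A" B] by auto
      then have "x \<in> v1.span A" using A(4) x(2) g(2) by auto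
      then show "x = 0" using v1.span_Int_disjoint[OF B(3,1)] x(1) by blast
    qed
  qed
  have ind: "v2.independent (g ` (B - A))"
    by (rule linear_independent_injective_image[OF g(1)])
       (use v1.independent_mono[OF B(3)] inj in auto)
  have "g ` B \<subseteq> insert 0 (g ` (B - A))"
    using A(3) g(2) by auto
  then have "v2.span (g ` B) \<subseteq> v2.span (g ` (B - A))"
    by (metis v2.span_insert_0 v2.span_mono)
  then have sp: "v2.span (g ` (B - A)) = f ` S"
    using linear_span_image[OF g(1), of B] B(5) g(2) v2.span_mono[of "g ` (B - A)" "g ` B"]
    by (metis Diff_subset image_cong image_mono subset_antisym)
  show "v2.fdim (f ` S)" using sp v2.fdim_span[of "g ` (B - A)"] B(2) by auto
  have "v2.dim (f ` S) = card (g ` (B - A))"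
    using sp v2.dim_span_eq_card_independent[OF ind] by metis
  also have "\<dots> = card (B - A)"
    using inj v1.span_superset by (metis card_image inj_on_subset)
  also have "\<dots> = v1.dim S - v1.dim ?K" using A(1,5) B(1,6) by (simp add: card_Diff_subset)
  finally show "v2.dim (f ` S) + v1.dim ?K = v1.dim S"
    using A(5) B(1,2,6) card_mono by (metis le_add_diff_inverse2)
qed

lemma dim_inj_image:
  assumes "v1.fdim S" "linear_on S s1 s2 f" "\<And>x. x \<in> S \<Longrightarrow> f x = 0 \<Longrightarrow> x = 0"
  shows "v2.dim (f ` S) = v1.dim S"
proof -
  have "{x\<in>S. f x = 0} = {0}"
    using assms(3) v1.subspace_0[OF v1.fdim_subspace[OF assms(1)]]
      linear_on_0[OF assms(2) v1.fdim_subspace[OF assms(1)]] by auto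
  then show ?thesis using dim_image_kernel[OF assms(1,2)] by simp
qed

lemma inj_on_iff_kernel:
  assumes "v1.subspace S" "linear_on S s1 s2 f"
  shows "inj_on f S \<longleftrightarrow> (\<forall>x\<in>S. f x = 0 \<longrightarrow> x = 0)"
proof
  show "inj_on f S \<Longrightarrow> \<forall>x\<in>S. f x = 0 \<longrightarrow> x = 0"
    using linear_on_0[OF assms(2,1)] v1.subspace_0[OF assms(1)] by (metis inj_onD)
  assume *: "\<forall>x\<in>S. f x = 0 \<longrightarrow> x = 0"
  show "inj_on f S"
  proof (rule inj_onI)
    fix x y assume "x \<in> S" "y \<in> S" "f x = f y"
    then show "x = y" using * linear_on_diff[OF assms(2,1)] v1.subspace_diff[OF assms(1)]
      by (metis eq_iff_diff_eq_0)
  qed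
qed

end

context cvec
begin

sublocale self: cvec2 scale scale by unfold_locales

lemma cvec2_complex: "cvec2 scale ((*) :: complex \<Rightarrow> complex \<Rightarrow> complex)"
  by unfold_locales (auto simp: algebra_simps)

text \<open>A basis of \<open>T\<close> is extended to a basis of \<open>S\<close> and the added
  vectors are sent to 0. The complement is arbitrary; where it matters,
  \<open>direct_projection\<close> takes its place.\<close>

lemma projection:
  assumes S: "fdim S" and T: "subspace T" "T \<subseteq> S"
  obtains \<pi> where "clinear scale scale \<pi>" "\<And>v. v \<in> S \<Longrightarrow> \<pi> v \<in> T" "\<And>t. t \<in> T \<Longrightarrow> \<pi> t = t"
proof -
  obtain A where A: "finite A" "independent A" "A \<subseteq> T" "span A = T" "card A = dim T"
    by (rule fdim_basis[OF fdim_sub(1)[OF S T]])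
  obtain B where B: "A \<subseteq> B" "finite B" "independent B" "B \<subseteq> S" "span B = S" "card B = dim S"
    by (rule fdim_extend[OF S A(2) order_trans[OF A(3) T(2)]])
  obtain g where g: "clinear scale scale g" "\<forall>x\<in>B. g x = (if x \<in> A then x else 0)"
    using self.linear_independent_extend[OF B(3), of "\<lambda>x. if x \<in> A then x else 0"] by metis
  have "g ` S = span (g ` B)" using self.linear_span_image[OF g(1), of B] B(5) by simp
  also have "\<dots> \<subseteq> T" by (rule span_minimal) (use g(2) A(3) T(1) subspace_0 in auto)
  finally have 1: "g v \<in> T" if "v \<in> S" for v using that by auto
  have "g t = t" if "t \<in> span A" for t
    by (rule self.linear_eq_on[OF g(1) linear_ident that]) (use g(2) B(1) in auto)
  then show ?thesis using that g(1) 1 A(4) by blast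
qed

lemma separating_functional:
  assumes S: "fdim S" and T: "subspace T" "T \<subseteq> S" and v: "v \<in> S" "v \<notin> T"
  obtains l where "clinear scale (*) l" "l v = 1" "\<And>t. t \<in> T \<Longrightarrow> l t = 0"
proof -
  interpret c: cvec2 scale "(*)" by (rule cvec2_complex)
  obtain A where A: "finite A" "independent A" "A \<subseteq> T" "span A = T" "card A = dim T"
    by (rule fdim_basis[OF fdim_sub(1)[OF S T]])
  have ind: "independent (insert v A)" using A v(2) independent_insertI by auto
  obtain l where l: "clinear scale (*) l" "\<forall>x\<in>insert v A. l x = (if x = v then 1 else 0)"
    using c.linear_independent_extend[OF ind, of "\<lambda>x. if x = v then 1 else 0"] by metis
  have "l t = 0" if "t \<in> span A" for t
    by (rule c.linear_eq_0_on_span[OF l(1) _ that]) (use l(2) A(3) v(2) in auto)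
  then show ?thesis using that l A(4) by (metis insertI1)
qed

lemma inj_imp_surj_on:
  assumes S: "fdim S" and f: "linear_on S scale scale f" "f ` S \<subseteq> S" "\<And>x. x \<in> S \<Longrightarrow> f x = 0 \<Longrightarrow> x = 0"
  shows "f ` S = S"
  using fdim_sub(3)[OF S self.subspace_image_on[OF f(1) fdim_subspace[OF S]] f(2)]
    self.dim_inj_image[OF S f(1,3)] by simp

lemma fdim_sum:
  assumes "fdim S" "fdim T"
  shows "fdim {x + y |x y. x \<in> S \<and> y \<in> T}"
proof -
  obtain A B where "finite A" "span A = S" "finite B" "span B = T"
    using assms by (auto simp: fdim_def)
  then show ?thesis using fdim_span[of "A \<union> B"] by (simp add: span_Un)
qed

text \<open>The map \<open>r = 1 - \<pi>\<close> has kernel \<open>A\<close> in \<open>S\<close> and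
  is injective on \<open>B\<close>, so its rank is \<open>dim B\<close>, even though
  \<open>\<pi>\<close> need not vanish on \<open>B\<close>.\<close>

lemma dim_direct_sum:
  assumes S: "fdim S" and A: "subspace A" "A \<subseteq> S" and B: "subspace B" "B \<subseteq> S"
    and disj: "A \<inter> B = {0}" and sum: "\<And>v. v \<in> S \<Longrightarrow> \<exists>a\<in>A. \<exists>b\<in>B. v = a + b"
  shows "dim S = dim A + dim B"
proof -
  obtain X where X: "finite X" "independent X" "X \<subseteq> A" "span X = A" "card X = dim A"
    by (rule fdim_basis[OF fdim_sub(1)[OF S A]])
  obtain \<pi> where \<pi>: "clinear scale scale \<pi>" "\<And>v. v \<in> S \<Longrightarrow> \<pi> v \<in> A" "\<And>t. t \<in> A \<Longrightarrow> \<pi> t = t"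
    using projection[OF S A] by metis
  define r where "r = (\<lambda>v. v - \<pi> v)"
  interpret \<pi>: Vector_Spaces.linear scale scale \<pi> by (rule \<pi>(1))
  have r: "linear_on S scale scale r" for S
    unfolding r_def linear_on_def by (auto simp: \<pi>.add \<pi>.scale algebra_simps)
  have rB: "x = 0" if "x \<in> B" "r x = 0" for x
    using that disj \<pi>(2)[of x] B(2) unfolding r_def by auto
  have ker: "{x\<in>S. r x = 0} = A"
    unfolding r_def using \<pi>(2,3) A(2) by (auto, metis)
  have im: "r ` S = r ` B"
  proof
    show "r ` S \<subseteq> r ` B"
    proof
      fix y assume "y \<in> r ` S"
      then obtain a b where "a \<in> A" "b \<in> B" "y = r (a + b)" using sum by blast
      then show "y \<in> r ` B" unfolding r_def using \<pi>(3) by (simp add: \<pi>.add)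
    qed
    show "r ` B \<subseteq> r ` S" using B(2) by auto
  qed
  show ?thesis
    using self.dim_image_kernel(2)[OF S r] self.dim_inj_image[OF fdim_sub(1)[OF S B] r rB]
    unfolding ker im by simp
qed

end

section \<open>Traces of endomorphisms of a subspace\<close>

context cvec
begin

text \<open>The choice of the basis is removed by \<open>tr_basis\<close>. The subspace is an
  argument because an endomorphism is given as a map on the ambient type, and its trace depends on
  where it is considered.\<close>

definition tr :: "'v set \<Rightarrow> ('v \<Rightarrow> 'v) \<Rightarrow> complex"
  where "tr S T = (let B = (SOME B. finite B \<and> independent B \<and> span B = S) in
    \<Sum>b\<in>B. representation B (T b) b)"

text \<open>Both sides expand to the same double sum over pairs from \<open>B\<close> and
  \<open>B'\<close>. With the identity for \<open>T2\<close> and two bases of one space it also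
  shows that the trace does not depend on the basis.\<close>

lemma tr_comm_bases:
  assumes B: "finite B" "independent B" and B': "finite B'" "independent B'"
    and T1: "linear_on (span B) scale scale T1" "T1 ` span B \<subseteq> span B'"
    and T2: "linear_on (span B') scale scale T2" "T2 ` span B' \<subseteq> span B"
  shows "(\<Sum>b\<in>B. representation B (T2 (T1 b)) b) = (\<Sum>b\<in>B'. representation B' (T1 (T2 b)) b)"
proof -
  have *: "representation B (T2 (T1 b)) b = (\<Sum>b'\<in>B'. representation B' (T1 b) b' * representation B (T2 b') b)"
    if B: "finite B" "independent B" and B': "finite B'" "independent B'"
    and T1: "linear_on (span B) scale scale T1" "T1 ` span B \<subseteq> span B'"
    and T2: "linear_on (span B') scale scale T2" "T2 ` span B' \<subseteq> span B" and b: "b \<in> B"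
    for B B' T1 T2 b
  proof -
    have m: "T1 b \<in> span B'" using T1(2) b span_base by auto
    have "T1 b = (\<Sum>b'\<in>B'. scale (representation B' (T1 b) b') b')"
      using sum_representation_eq[OF B'(2) m B'(1)] by auto
    then have "T2 (T1 b) = T2 (\<Sum>b'\<in>B'. scale (representation B' (T1 b) b') b')" by simp
    also have "\<dots> = (\<Sum>b'\<in>B'. T2 (scale (representation B' (T1 b) b') b'))"
      by (rule self.linear_on_sum[OF T2(1)]) (auto intro: span_base span_scale)
    also have "\<dots> = (\<Sum>b'\<in>B'. scale (representation B' (T1 b) b') (T2 b'))"
      by (rule sum.cong) (auto intro!: self.linear_on_scale[OF T2(1)] span_base)
    finally have "representation B (T2 (T1 b)) = (\<lambda>c. \<Sum>b'\<in>B'. representation B (scale (representation B' (T1 b) b') (T2 b')) c)"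
      using representation_sum[OF B(2), of B' "\<lambda>b'. scale (representation B' (T1 b) b') (T2 b')"] T2(2)
      by (auto intro: span_scale span_base simp: image_subset_iff)
    then have "representation B (T2 (T1 b)) b = (\<Sum>b'\<in>B'. representation B (scale (representation B' (T1 b) b') (T2 b')) b)" by simp
    also have "\<dots> = (\<Sum>b'\<in>B'. representation B' (T1 b) b' * representation B (T2 b') b)"
      using T2(2) span_base[of _ B'] by (intro sum.cong refl) (subst representation_scale[OF B(2)], auto)
    finally show ?thesis .
  qed
  have "(\<Sum>b\<in>B. representation B (T2 (T1 b)) b) = (\<Sum>b\<in>B. \<Sum>b'\<in>B'. representation B' (T1 b) b' * representation B (T2 b') b)"
    using *[OF assms] by (intro sum.cong refl) auto
  also have "\<dots> = (\<Sum>b'\<in>B'. \<Sum>b\<in>B. representation B (T2 b') b * representation B' (T1 b) b')"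
    by (subst sum.swap) (simp add: mult.commute)
  also have "\<dots> = (\<Sum>b\<in>B'. representation B' (T1 (T2 b)) b)"
    using *[OF B' B T2 T1] by (intro sum.cong refl) auto
  finally show ?thesis .
qed

lemma linear_on_id: "linear_on S scale scale (\<lambda>v. v)"
  by (simp add: linear_on_def)

lemma tr_basis:
  assumes B: "finite B" "independent B" "span B = S" and T: "linear_on S scale scale T" "T ` S \<subseteq> S"
  shows "tr S T = (\<Sum>b\<in>B. representation B (T b) b)"
proof -
  define A where "A = (SOME B. finite B \<and> independent B \<and> span B = S)"
  have A: "finite A \<and> independent A \<and> span A = S"
    unfolding A_def by (rule someI[of _ B]) (use B in auto)
  have "(\<Sum>b\<in>A. representation A (T b) b) = (\<Sum>b\<in>B. representation B (T b) b)"
    using tr_comm_bases[of A B T "\<lambda>v. v"] A B T linear_on_id by auto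
  then show ?thesis by (simp add: tr_def A_def[symmetric] Let_def)
qed

lemma tr_comm:
  assumes "fdim S" "fdim S'" and T1: "linear_on S scale scale T1" "T1 ` S \<subseteq> S'"
    and T2: "linear_on S' scale scale T2" "T2 ` S' \<subseteq> S"
  shows "tr S (\<lambda>v. T2 (T1 v)) = tr S' (\<lambda>v. T1 (T2 v))"
proof -
  obtain B where B: "finite B" "independent B" "B \<subseteq> S" "span B = S" "card B = dim S"
    by (rule fdim_basis[OF assms(1)])
  obtain B' where B': "finite B'" "independent B'" "B' \<subseteq> S'" "span B' = S'" "card B' = dim S'"
    by (rule fdim_basis[OF assms(2)])
  have l: "linear_on S scale scale (\<lambda>v. T2 (T1 v))" "linear_on S' scale scale (\<lambda>v. T1 (T2 v))"
    using T1 T2 unfolding linear_on_def image_subset_iff by metis+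
  have "(\<lambda>v. T2 (T1 v)) ` S \<subseteq> S" "(\<lambda>v. T1 (T2 v)) ` S' \<subseteq> S'" using T1(2) T2(2) by auto
  then show ?thesis
    using tr_basis[OF B(1,2,4) l(1)] tr_basis[OF B'(1,2,4) l(2)] tr_comm_bases[OF B(1,2) B'(1,2)] T1 T2 B(4) B'(4) by simp
qed

lemma tr_cong:
  assumes "fdim S" "\<And>v. v \<in> S \<Longrightarrow> T v = T' v"
  shows "tr S T = tr S T'"
proof -
  define A where "A = (SOME B. finite B \<and> independent B \<and> span B = S)"
  obtain B where B: "finite B" "independent B" "B \<subseteq> S" "span B = S" "card B = dim S"
    by (rule fdim_basis[OF assms(1)])
  have A: "finite A \<and> independent A \<and> span A = S"
    unfolding A_def by (rule someI[of _ B]) (use B in auto)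
  have "T b = T' b" if "b \<in> A" for b using that A assms(2) span_base by blast
  then show ?thesis by (simp add: tr_def A_def[symmetric] Let_def)
qed

text \<open>\<open>T\<close> is regarded as a map from \<open>S\<close> to \<open>S'\<close> and
  composed with the inclusion in either order.\<close>

lemma tr_sub:
  assumes "fdim S" "subspace S'" "S' \<subseteq> S" "linear_on S scale scale T" "T ` S \<subseteq> S'"
  shows "tr S T = tr S' T"
  using tr_comm[OF assms(1) fdim_sub(1)[OF assms(1-3)] assms(4,5) linear_on_id] assms(3) by auto

lemma tr_add:
  assumes S: "fdim S" and T: "linear_on S scale scale T" "T ` S \<subseteq> S"
    and U: "linear_on S scale scale U" "U ` S \<subseteq> S"
  shows "tr S (\<lambda>v. T v + U v) = tr S T + tr S U"
proof -
  obtain B where B: "finite B" "independent B" "B \<subseteq> S" "span B = S" "card B = dim S"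
    by (rule fdim_basis[OF S])
  have l: "linear_on S scale scale (\<lambda>v. T v + U v)"
    using T(1) U(1) by (auto simp: linear_on_def scale_right_distrib algebra_simps)
  have i: "(\<lambda>v. T v + U v) ` S \<subseteq> S"
    using T(2) U(2) fdim_subspace[OF S] by (auto intro!: subspace_add)
  have "representation B (T b + U b) b = representation B (T b) b + representation B (U b) b" if "b \<in> B" for b
    using that B(3,4) T(2) U(2) by (subst representation_add[OF B(2)]) auto
  then show ?thesis
    by (simp add: tr_basis[OF B(1,2,4) l i] tr_basis[OF B(1,2,4) T] tr_basis[OF B(1,2,4) U] sum.distrib)
qed

lemma tr_scale:
  assumes S: "fdim S" and T: "linear_on S scale scale T" "T ` S \<subseteq> S"
  shows "tr S (\<lambda>v. scale c (T v)) = c * tr S T"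
proof -
  obtain B where B: "finite B" "independent B" "B \<subseteq> S" "span B = S" "card B = dim S"
    by (rule fdim_basis[OF S])
  have l: "linear_on S scale scale (\<lambda>v. scale c (T v))"
    using T(1) by (auto simp: linear_on_def scale_right_distrib scale_left_commute)
  have i: "(\<lambda>v. scale c (T v)) ` S \<subseteq> S"
    using T(2) fdim_subspace[OF S] by (auto intro!: subspace_scale)
  have "representation B (scale c (T b)) b = c * representation B (T b) b" if "b \<in> B" for b
    using that B(3,4) T(2) by (subst representation_scale[OF B(2)]) auto
  then show ?thesis
    by (simp add: tr_basis[OF B(1,2,4) l i] tr_basis[OF B(1,2,4) T] sum_distrib_left)
qed

lemma tr_id: "fdim S \<Longrightarrow> tr S (\<lambda>v. v) = of_nat (dim S)"
proof -
  assume S: "fdim S"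
  obtain B where B: "finite B" "independent B" "B \<subseteq> S" "span B = S" "card B = dim S"
    by (rule fdim_basis[OF S])
  have "tr S (\<lambda>v. v) = (\<Sum>b\<in>B. representation B b b)"
    by (rule tr_basis[OF B(1,2,4) linear_on_id]) auto
  also have "\<dots> = (\<Sum>b\<in>B. 1)" by (rule sum.cong) (auto simp: representation_basis[OF B(2)])
  finally show ?thesis using B(5) by simp
qed

lemma linear_on_0_map: "linear_on S scale scale (\<lambda>v. 0)"
  by (simp add: linear_on_def)

lemma tr_0: "fdim S \<Longrightarrow> tr S (\<lambda>v. 0) = 0"
  using tr_scale[of S "\<lambda>v. 0" 0] subspace_0[OF fdim_subspace] linear_on_0_map by auto

lemma tr_diff:
  assumes S: "fdim S" and T: "linear_on S scale scale T" "T ` S \<subseteq> S"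
    and U: "linear_on S scale scale U" "U ` S \<subseteq> S"
  shows "tr S (\<lambda>v. T v - U v) = tr S T - tr S U"
proof -
  have l: "linear_on S scale scale (\<lambda>v. scale (-1) (U v))"
    using U(1) by (auto simp: linear_on_def scale_right_distrib)
  have i: "(\<lambda>v. scale (-1) (U v)) ` S \<subseteq> S"
    using U(2) fdim_subspace[OF S] by (auto intro!: subspace_neg)
  show ?thesis using tr_add[OF S T l i] tr_scale[OF S U, of "-1"] by simp
qed

lemma tr_sum:
  assumes S: "fdim S" and T: "\<And>i. i \<in> I \<Longrightarrow> linear_on S scale scale (T i)" "\<And>i. i \<in> I \<Longrightarrow> T i ` S \<subseteq> S"
  shows "tr S (\<lambda>v. \<Sum>i\<in>I. T i v) = (\<Sum>i\<in>I. tr S (T i))"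
  using T
proof (induction I rule: infinite_finite_induct)
  case (insert i I)
  have l: "linear_on S scale scale (\<lambda>v. \<Sum>i\<in>I. T i v)"
    using insert(4) by (auto simp: linear_on_def sum.distrib scale_sum_right)
  have m: "(\<lambda>v. \<Sum>i\<in>I. T i v) ` S \<subseteq> S"
    using insert(5) fdim_subspace[OF S] by (auto intro!: subspace_sum)
  show ?case using insert tr_add[OF S insert(4,5) l m, of i] by simp
qed (use tr_0[OF S] in auto)

text \<open>The trace can be computed on the image of \<open>T\<close>, which is annihilated by one
  power less.\<close>

lemma tr_nilpotent:
  assumes "fdim S" "linear_on S scale scale T" "T ` S \<subseteq> S" "\<And>v. v \<in> S \<Longrightarrow> (T ^^ n) v = 0"
  shows "tr S T = 0"
  using assms
proof (induction n arbitrary: S)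
  case 0
  then have "tr S T = tr S (\<lambda>v. 0)"
    by (intro tr_cong) (auto intro: self.linear_on_0 fdim_subspace)
  then show ?case using tr_0 0 by simp
next
  case (Suc n)
  note s = self.subspace_image_on[OF Suc(3) fdim_subspace[OF Suc(2)]]
  have "tr S T = tr (T ` S) T"
    by (rule tr_sub[OF Suc(2) s Suc(4,3)]) auto
  also have "\<dots> = 0"
  proof (rule Suc.IH)
    show "fdim (T ` S)" by (rule fdim_sub(1)[OF Suc(2) s Suc(4)])
    show "linear_on (T ` S) scale scale T" using Suc(3,4) by (auto simp: linear_on_def image_subset_iff)
    show "T ` T ` S \<subseteq> T ` S" using Suc(4) by auto
    show "(T ^^ n) v = 0" if "v \<in> T ` S" for v
      using that Suc(5) by (auto simp: funpow_swap1)
  qed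
  finally show ?case .
qed

text \<open>The component in \<open>A\<close> is unique, and linearity follows from this uniqueness.
  Here the complement \<open>B\<close> is prescribed; in the application it is invariant under an
  endomorphism.\<close>

lemma direct_projection:
  assumes A: "subspace A" and B: "subspace B" and disj: "A \<inter> B = {0}"
    and sum: "\<And>v. v \<in> S \<Longrightarrow> \<exists>a\<in>A. \<exists>b\<in>B. v = a + b" and S: "subspace S"
  obtains \<pi> where "linear_on S scale scale \<pi>" "\<And>v. v \<in> S \<Longrightarrow> \<pi> v \<in> A" "\<And>v. v \<in> S \<Longrightarrow> v - \<pi> v \<in> B"
    "\<And>a. a \<in> A \<Longrightarrow> \<pi> a = a" "\<And>b. b \<in> B \<Longrightarrow> \<pi> b = 0"
proof -
  define \<pi> where "\<pi> = (\<lambda>v. SOME a. a \<in> A \<and> v - a \<in> B)"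
  have uniq: "\<pi> v = a" if "a \<in> A" "v - a \<in> B" for a v
  proof -
    have *: "\<pi> v \<in> A \<and> v - \<pi> v \<in> B" unfolding \<pi>_def by (rule someI[of _ a]) (use that in auto)
    then have "\<pi> v - a \<in> A" using subspace_diff[OF A] that by auto
    moreover have "\<pi> v - a \<in> B" using subspace_diff[OF B that(2), of "v - \<pi> v"] * by (simp add: algebra_simps)
    ultimately have "\<pi> v - a \<in> A \<inter> B" by blast
    then show ?thesis unfolding disj by simp
  qed
  have ex: "\<pi> v \<in> A \<and> v - \<pi> v \<in> B" if v: "v \<in> S" for v
  proof -
    obtain a b where ab: "a \<in> A" "b \<in> B" "v = a + b" using sum[OF v] by auto
    then have "\<pi> v = a" by (intro uniq) auto
    then show ?thesis using ab by simp
  qed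
  have "linear_on S scale scale \<pi>"
    unfolding linear_on_def
  proof (intro conjI ballI allI)
    fix x y assume "x \<in> S" "y \<in> S"
    then show "\<pi> (x + y) = \<pi> x + \<pi> y"
      using ex[of x] ex[of y] subspace_add[OF B, of "x - \<pi> x" "y - \<pi> y"] subspace_add[OF A]
      by (intro uniq) (auto simp: algebra_simps)
  next
    fix c x assume "x \<in> S"
    then show "\<pi> (scale c x) = scale c (\<pi> x)"
      using ex[of x] subspace_scale[OF B, of "x - \<pi> x" c] subspace_scale[OF A]
      by (intro uniq) (auto simp: scale_right_diff_distrib)
  qed
  then show ?thesis using that[of \<pi>] ex uniq subspace_0[OF A] subspace_0[OF B] by simp
qed

lemma independent_card_Suc_dim:
  assumes "fdim S" "inj_on h {..dim S}" "h ` {..dim S} \<subseteq> S"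
  shows "dependent (h ` {..dim S})"
  using fdim_independent(2)[OF assms(1) _ assms(3)] card_image[OF assms(2)] by auto

end

section \<open>Eigenvectors and generalized eigenspaces\<close>

context cvec
begin

context
  fixes S T
  assumes S: "fdim S" and T: "linear_on S scale scale T" "T ` S \<subseteq> S"
begin

text \<open>The vector \<open>p(T) v\<close> by Horner's scheme. It avoids polynomials of operators
  and asks for linearity of \<open>T\<close> on \<open>S\<close> only.\<close>

definition horner :: "'v \<Rightarrow> complex poly \<Rightarrow> 'v"
  where "horner v p = fold_coeffs (\<lambda>c w. scale c v + T w) p 0"

lemma horner_0 [simp]: "horner v 0 = 0"
  by (simp add: horner_def)

lemma horner_pCons [simp]: "horner v (pCons c p) = scale c v + T (horner v p)"
  using self.linear_on_0[OF T(1) fdim_subspace[OF S]]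
  by (cases "p = 0"; cases "c = 0") (auto simp: horner_def)

lemma horner_in: "v \<in> S \<Longrightarrow> horner v p \<in> S"
  using subspace_0[OF fdim_subspace[OF S]] subspace_add[OF fdim_subspace[OF S]] subspace_scale[OF fdim_subspace[OF S]] T(2)
  by (induction p) auto

lemma horner_add: "v \<in> S \<Longrightarrow> horner v (p + q) = horner v p + horner v q"
  by (induction p q rule: poly_induct2)
     (simp_all add: scale_left_distrib self.linear_on_add[OF T(1)] horner_in algebra_simps)

lemma horner_smult: "v \<in> S \<Longrightarrow> horner v (smult a p) = scale a (horner v p)"
  by (induction p) (simp_all add: scale_right_distrib self.linear_on_scale[OF T(1)] horner_in)

lemma horner_sum: "v \<in> S \<Longrightarrow> horner v (\<Sum>i\<in>I. f i) = (\<Sum>i\<in>I. horner v (f i))"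
  by (induction I rule: infinite_finite_induct) (simp_all add: horner_add)

text \<open>Otherwise the vectors \<open>T^i v\<close> with \<open>i \<le> dim S\<close> would be
  \<open>dim S + 1\<close> distinct and independent elements of \<open>S\<close>.\<close>

lemma horner_annihilator:
  assumes v: "v \<in> S"
  shows "\<exists>p. p \<noteq> 0 \<and> horner v p = 0"
proof (rule ccontr)
  assume "\<nexists>p. p \<noteq> 0 \<and> horner v p = 0"
  then have inj: "horner v p = 0 \<Longrightarrow> p = 0" for p by blast
  define h where "h i = horner v (monom 1 i)" for i :: nat
  have injh: "inj_on h A" for A
  proof (rule inj_onI)
    fix i j assume "h i = h j"
    then have "horner v (monom 1 i + smult (-1) (monom 1 j)) = 0"
      unfolding h_def horner_add[OF v] horner_smult[OF v] by simp
    then have "monom 1 i = (monom 1 j :: complex poly)" using inj by fastforce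
    then show "i = j" by (metis coeff_monom zero_neq_one)
  qed
  have "independent (h ` {..dim S})"
  proof (rule independent_if_scalars_zero)
    fix f x assume s: "(\<Sum>x\<in>h ` {..dim S}. scale (f x) x) = 0" and x: "x \<in> h ` {..dim S}"
    have "0 = (\<Sum>i\<le>dim S. scale (f (h i)) (h i))"
      using s by (simp add: sum.reindex[OF injh])
    also have "\<dots> = horner v (\<Sum>i\<le>dim S. smult (f (h i)) (monom 1 i))"
      by (simp add: horner_sum[OF v] horner_smult[OF v] h_def del: smult_monom)
    finally have z: "(\<Sum>i\<le>dim S. smult (f (h i)) (monom 1 i)) = 0" using inj by metis
    obtain i where i: "x = h i" "i \<le> dim S" using x by auto
    have "coeff (\<Sum>i\<le>dim S. smult (f (h i)) (monom 1 i)) i = f (h i)"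
      using i(2) by (simp add: coeff_sum coeff_monom if_distrib cong: if_cong)
    then show "f x = 0" using z i(1) by simp
  qed auto
  moreover have "h ` {..dim S} \<subseteq> S" using horner_in[OF v] by (auto simp: h_def)
  ultimately show False using independent_card_Suc_dim[OF S injh] by blast
qed

text \<open>Some \<open>p \<noteq> 0\<close> annihilates a nonzero \<open>v\<close>. For a root
  \<open>a\<close> of \<open>p\<close> and \<open>p = (X - a) q\<close>, either
  \<open>q(T) v\<close> is an eigenvector, or \<open>q\<close> annihilates \<open>v\<close> and has
  smaller degree.\<close>

lemma eigenvector_exists:
  assumes "S \<noteq> {0}"
  obtains a v where "v \<in> S" "v \<noteq> 0" "T v = scale a v"
proof -
  obtain v where v: "v \<in> S" "v \<noteq> 0" using assms subspace_0[OF fdim_subspace[OF S]] by auto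
  have "\<exists>a w. w \<in> S \<and> w \<noteq> 0 \<and> T w = scale a w" if "p \<noteq> 0" "horner v p = 0" for p
    using that
  proof (induction "degree p" arbitrary: p rule: less_induct)
    case less
    show ?case
    proof (cases "degree p = 0")
      case True
      then obtain c where "p = [:c:]" by (metis degree_eq_zeroE)
      then show ?thesis using less.prems v self.linear_on_0[OF T(1) fdim_subspace[OF S]] by auto
    next
      case False
      then obtain a where "poly p a = 0"
        using fundamental_theorem_of_algebra[of p] by (auto simp: constant_degree)
      then obtain q where q: "p = [:-a, 1:] * q" by (auto simp: poly_eq_0_iff_dvd elim: dvdE)
      have q0: "q \<noteq> 0" using q less.prems by auto
      have "p = smult (-a) q + pCons 0 q" using q by simp
      then have "horner v p = horner v (smult (-a) q) + horner v (pCons 0 q)"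
        by (simp only: horner_add[OF v(1)])
      then have "horner v p = scale (-a) (horner v q) + T (horner v q)"
        unfolding horner_smult[OF v(1)] by simp
      then have e: "T (horner v q) = scale a (horner v q)" using less.prems by (simp add: eq_neg_iff_add_eq_0 add.commute)
      show ?thesis
      proof (cases "horner v q = 0")
        case True
        have "degree p = Suc (degree q)" using q q0 by (subst q, subst degree_mult_eq) auto
        then show ?thesis using less.hyps[of q] q0 True by simp
      next
        case False
        then show ?thesis using e horner_in[OF v(1)] by blast
      qed
    qed
  qed
  then show ?thesis using that horner_annihilator[OF v(1)] by metis
qed

end

definition genspace :: "'v set \<Rightarrow> ('v \<Rightarrow> 'v) \<Rightarrow> complex \<Rightarrow> 'v set"
  where "genspace S T a = {v\<in>S. \<exists>k. ((\<lambda>v. T v - scale a v) ^^ k) v = 0}"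

lemma linear_funpow: "clinear scale scale T \<Longrightarrow> clinear scale scale (T ^^ n)"
proof (induction n)
  case 0
  then show ?case using linear_id by (simp add: id_def)
next
  case (Suc n)
  then show ?case using Vector_Spaces.linear_compose[of scale scale "T ^^ n" scale T] by (simp add: o_def)
qed

lemma linear_shift: "clinear scale scale T \<Longrightarrow> clinear scale scale (\<lambda>v. T v - scale a v)"
  by (intro self.linear_compose_sub linear_scale_self)

lemma funpow_in: "T ` S \<subseteq> S \<Longrightarrow> v \<in> S \<Longrightarrow> (T ^^ k) v \<in> S"
  by (induction k) auto

lemma funpow_zero_mono:
  assumes "clinear scale scale T" "(T ^^ k) v = 0" "k \<le> n"
  shows "(T ^^ n) v = 0"
proof -
  have "(T ^^ n) v = (T ^^ (n - k)) ((T ^^ k) v)"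
    using fun_cong[OF funpow_add[of "n - k" k T], of v] assms(3) by simp
  then show ?thesis using assms(2) self.linear_0[OF linear_funpow[OF assms(1)]] by simp
qed

lemma subspace_genspace:
  assumes T: "clinear scale scale T" and S: "subspace S"
  shows "subspace (genspace S T a)"
proof (rule subspaceI)
  let ?N = "\<lambda>v. T v - scale a v"
  have l: "clinear scale scale (?N ^^ k)" for k by (intro linear_funpow linear_shift T)
  show "0 \<in> genspace S T a" using subspace_0[OF S] by (auto simp: genspace_def intro!: exI[of _ 0])
  show "x + y \<in> genspace S T a" if xy: "x \<in> genspace S T a" "y \<in> genspace S T a" for x y
  proof -
    obtain i j where ij: "(?N ^^ i) x = 0" "(?N ^^ j) y = 0" using xy by (auto simp: genspace_def)
    have "(?N ^^ (max i j)) x = 0" "(?N ^^ (max i j)) y = 0"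
      using funpow_zero_mono[OF linear_shift[OF T]] ij by auto
    then have "(?N ^^ (max i j)) (x + y) = 0" using self.linear_add[OF l] by simp
    then show ?thesis using xy subspace_add[OF S] by (auto simp: genspace_def)
  qed
  show "scale c x \<in> genspace S T a" if "x \<in> genspace S T a" for c x
    using that subspace_scale[OF S] self.linear_scale[OF l] by (fastforce simp: genspace_def)
qed

text \<open>The exponents that annihilate the members of a finite basis have a maximum.\<close>

lemma genspace_power:
  assumes S: "fdim S" and T: "clinear scale scale T"
  obtains n where "genspace S T a = {v\<in>S. ((\<lambda>v. T v - scale a v) ^^ n) v = 0}"
proof -
  let ?N = "\<lambda>v. T v - scale a v"
  let ?A = "genspace S T a"
  have A: "fdim ?A" by (rule fdim_sub(1)[OF S subspace_genspace[OF T fdim_subspace[OF S]]]) (auto simp: genspace_def)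
  obtain B where B: "finite B" "independent B" "B \<subseteq> ?A" "span B = ?A" "card B = dim ?A"
    by (rule fdim_basis[OF A])
  have "\<forall>b\<in>B. \<exists>k. (?N ^^ k) b = 0" using B(3) by (auto simp: genspace_def)
  from bchoice[OF this] obtain k where k: "\<And>b. b \<in> B \<Longrightarrow> (?N ^^ k b) b = 0" by blast
  define n where "n = Max (insert 0 (k ` B))"
  have nb: "(?N ^^ n) b = 0" if "b \<in> B" for b
    using funpow_zero_mono[OF linear_shift[OF T] k[OF that], of n] that B(1) by (simp add: n_def)
  have "(?N ^^ n) v = 0" if "v \<in> ?A" for v
    by (rule self.linear_eq_0_on_span[OF linear_funpow[OF linear_shift[OF T]] nb]) (use that B(4) in auto)
  then have "?A = {v\<in>S. (?N ^^ n) v = 0}" by (auto simp: genspace_def)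
  then show ?thesis using that by blast
qed

lemma genspace_invariant:
  assumes T: "clinear scale scale T" "T ` S \<subseteq> S" and v: "v \<in> genspace S T a"
  shows "T v \<in> genspace S T a"
proof -
  let ?N = "\<lambda>v. T v - scale a v"
  have comm: "T ((?N ^^ k) v) = (?N ^^ k) (T v)" for k v
    by (induction k) (simp_all add: self.linear_diff[OF T(1)] self.linear_scale[OF T(1)])
  obtain k where "v \<in> S" "(?N ^^ k) v = 0" using v unfolding genspace_def by blast
  then have "T v \<in> S" "(?N ^^ k) (T v) = 0"
    using T(2) comm[of k v] self.linear_0[OF T(1)] by auto
  then show ?thesis unfolding genspace_def by blast
qed

text \<open>For \<open>N = T - a\<close> and the exponent \<open>n\<close> that annihilates the
  generalized eigenspace, the complement is \<open>N^n S\<close>: if \<open>N^n v\<close> lies in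
  the eigenspace, then so does \<open>v\<close>, hence \<open>N^n v = 0\<close>. For
  \<open>b \<noteq> a\<close> the map \<open>N\<close> is injective and thus bijective on the
  eigenspace of \<open>b\<close>, which puts that space inside \<open>N^n S\<close>.\<close>

lemma fitting:
  assumes S: "fdim S" and T: "clinear scale scale T" "T ` S \<subseteq> S"
  obtains B where "subspace B" "B \<subseteq> S" "T ` B \<subseteq> B" "genspace S T a \<inter> B = {0}"
    "\<And>v. v \<in> S \<Longrightarrow> \<exists>x\<in>genspace S T a. \<exists>y\<in>B. v = x + y"
    "dim S = dim (genspace S T a) + dim B"
    "\<And>b. b \<noteq> a \<Longrightarrow> genspace S T b \<subseteq> B"
proof -
  define N where "N = (\<lambda>v. T v - scale a v)"
  define A where "A = genspace S T a"
  note sS = fdim_subspace[OF S]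
  have N: "clinear scale scale N" unfolding N_def by (rule linear_shift[OF T(1)])
  have NS: "N ` S \<subseteq> S" using T(2) subspace_diff[OF sS] subspace_scale[OF sS] by (auto simp: N_def)
  have Nk: "clinear scale scale (N ^^ k)" for k by (rule linear_funpow[OF N])
  obtain n where n: "A = {v\<in>S. (N ^^ n) v = 0}" unfolding A_def N_def by (rule genspace_power[OF S T(1)])
  define B where "B = (N ^^ n) ` S"
  have BS: "B \<subseteq> S" unfolding B_def using funpow_in[OF NS] by auto
  have sB: "subspace B" unfolding B_def by (rule self.linear_subspace_image[OF Nk sS])
  have sA: "subspace A" unfolding A_def by (rule subspace_genspace[OF T(1) sS])
  have AS: "A \<subseteq> S" by (auto simp: A_def genspace_def)
  have comm: "T ((N ^^ k) v) = (N ^^ k) (T v)" for k v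
    by (induction k) (simp_all add: N_def self.linear_diff[OF T(1)] self.linear_scale[OF T(1)])
  have TB: "T ` B \<subseteq> B" unfolding B_def using T(2) by (auto simp: comm)
  have disj: "A \<inter> B = {0}"
  proof -
    have "x = 0" if x: "x \<in> A" "x \<in> B" for x
    proof -
      obtain v where v: "v \<in> S" "x = (N ^^ n) v" using x(2) by (auto simp: B_def)
      have "(N ^^ (n + n)) v = 0" using x(1) v(2) n by (simp add: funpow_add)
      then have "v \<in> A" using v(1) by (auto simp: A_def genspace_def N_def)
      then show ?thesis using v(2) n by auto
    qed
    then show ?thesis using subspace_0[OF sA] subspace_0[OF sB] by blast
  qed
  have d: "dim S = dim A + dim B"
    using self.dim_image_kernel(2)[OF S self.linear_onI_linear[OF Nk[of n]]] by (simp add: n B_def)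
  have fA: "fdim A" by (rule fdim_sub(1)[OF S sA AS])
  have fB: "fdim B" by (rule fdim_sub(1)[OF S sB BS])
  define U where "U = {x + y |x y. x \<in> A \<and> y \<in> B}"
  have U: "fdim U" unfolding U_def by (rule fdim_sum[OF fA fB])
  have AU: "A \<subseteq> U"
  proof
    fix x assume "x \<in> A"
    then show "x \<in> U" using subspace_0[OF sB] unfolding U_def by (intro CollectI exI[of _ x] exI[of _ 0]) simp
  qed
  have BU: "B \<subseteq> U"
  proof
    fix x assume "x \<in> B"
    then show "x \<in> U" using subspace_0[OF sA] unfolding U_def by (intro CollectI exI[of _ 0] exI[of _ x]) simp
  qed
  have "dim U = dim A + dim B"
    by (rule dim_direct_sum[OF U sA AU sB BU disj]) (auto simp: U_def)
  moreover have "U \<subseteq> S" unfolding U_def using AS BS subspace_add[OF sS] by auto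
  ultimately have "U = S" using fdim_sub(3)[OF S fdim_subspace[OF U]] d by simp
  then have sum: "\<exists>x\<in>A. \<exists>y\<in>B. v = x + y" if "v \<in> S" for v using that by (auto simp: U_def)
  have other: "genspace S T b \<subseteq> B" if "b \<noteq> a" for b
  proof -
    let ?G = "genspace S T b"
    have sG: "subspace ?G" by (rule subspace_genspace[OF T(1) sS])
    have GS: "?G \<subseteq> S" by (auto simp: genspace_def)
    have fG: "fdim ?G" by (rule fdim_sub(1)[OF S sG GS])
    let ?M = "\<lambda>v. T v - scale b v"
    have Mk: "clinear scale scale (?M ^^ k)" for k by (rule linear_funpow[OF linear_shift[OF T(1)]])
    have TG: "T v \<in> ?G" if "v \<in> ?G" for v by (rule genspace_invariant[OF T that])
    have NG: "N ` ?G \<subseteq> ?G" using TG subspace_diff[OF sG] subspace_scale[OF sG] by (auto simp: N_def)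
    have inj: "v = 0" if "v \<in> ?G" "N v = 0" for v
    proof -
      have "T v = scale a v" using that(2) by (simp add: N_def)
      then have "(?M ^^ k) v = scale ((a - b) ^ k) v" for k
        by (induction k) (simp_all add: self.linear_scale[OF T(1)] scale_left_diff_distrib algebra_simps)
      then show ?thesis using that(1) \<open>b \<noteq> a\<close> by (auto simp: genspace_def)
    qed
    have NG: "N ` ?G = ?G"
      by (rule inj_imp_surj_on[OF fG self.linear_onI_linear[OF N] NG inj])
    have "(N ^^ k) ` ?G = ?G" for k
    proof (induction k)
      case (Suc k)
      have "(N ^^ Suc k) ` ?G = N ` (N ^^ k) ` ?G" by (simp add: image_comp o_def)
      then show ?case using Suc NG by simp
    qed simp
    then have "?G = (N ^^ n) ` ?G" by simp
    also have "\<dots> \<subseteq> B" using GS by (auto simp: B_def)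
    finally show ?thesis .
  qed
  show ?thesis
    by (rule that[OF sB BS TB]) (use disj sum d other in \<open>auto simp: A_def\<close>)
qed

text \<open>\<open>T - a\<close> is nilpotent on this space and so has trace 0.\<close>

lemma tr_genspace:
  assumes S: "fdim S" and T: "clinear scale scale T" "T ` S \<subseteq> S"
  shows "tr (genspace S T a) T = a * of_nat (dim (genspace S T a))"
proof -
  let ?A = "genspace S T a"
  let ?N = "\<lambda>v. T v - scale a v"
  have sA: "subspace ?A" by (rule subspace_genspace[OF T(1) fdim_subspace[OF S]])
  have A: "fdim ?A" by (rule fdim_sub(1)[OF S sA]) (auto simp: genspace_def)
  have TA: "T ` ?A \<subseteq> ?A" using genspace_invariant[OF T] by blast
  have NA: "?N ` ?A \<subseteq> ?A" using TA subspace_diff[OF sA] subspace_scale[OF sA] by auto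
  obtain n where n: "?A = {v\<in>S. (?N ^^ n) v = 0}" by (rule genspace_power[OF S T(1)])
  have Nl: "linear_on ?A scale scale ?N" by (rule self.linear_onI_linear[OF linear_shift[OF T(1)]])
  have "tr ?A ?N = 0" by (rule tr_nilpotent[OF A Nl NA, of n]) (use n in auto)
  moreover have "tr ?A ?N = tr ?A T - tr ?A (scale a)"
    using sA by (intro tr_diff[OF A self.linear_onI_linear[OF T(1)] TA self.linear_onI_linear[OF linear_scale_self]])
      (auto intro: subspace_scale)
  moreover have "tr ?A (scale a) = a * of_nat (dim ?A)"
    using tr_scale[OF A linear_on_id, of a] tr_id[OF A] by auto
  ultimately show ?thesis by simp
qed

text \<open>The map \<open>Y\<close> is the complex conjugate of the semisimple part of \<open>T\<close>.\<close>

lemma conjugate_semisimple_part: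
  assumes "clinear scale scale T" "fdim S" "T ` S \<subseteq> S"
  shows "\<exists>Y. linear_on S scale scale Y \<and> Y ` S \<subseteq> S \<and>
    (\<forall>a. \<forall>v\<in>genspace S T a. Y v = scale (cnj a) v) \<and>
    (\<exists>r\<ge>0. tr S (\<lambda>v. T (Y v)) = complex_of_real r \<and> (r = 0 \<longrightarrow> (\<forall>v\<in>S. \<exists>k. (T ^^ k) v = 0))) \<and>
    S \<subseteq> span (\<Union>a. genspace S T a)"
  using assms(2,3)
proof (induction "dim S" arbitrary: S rule: less_induct)
  case (less S)
  note S = less.prems(1) and TS = less.prems(2) and T = assms(1)
  note sS = fdim_subspace[OF S]
  show ?case
  proof (cases "S = {0}")
    case True
    have "tr S (\<lambda>v. T 0) = tr S (\<lambda>v. 0)" by (simp add: self.linear_0[OF T])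
    then have t: "tr S (\<lambda>v. T 0) = 0" using tr_0[OF S] by simp
    have k: "\<exists>k. (T ^^ k) 0 = 0" by (rule exI[of _ 0]) simp
    show ?thesis
      by (rule exI[of _ "\<lambda>v. 0"], intro conjI exI[of _ "0::real"])
         (use True t k linear_on_0_map in \<open>auto simp: genspace_def span_zero\<close>)
  next
    case False
    \<comment> \<open>One generalized eigenspace \<open>A\<close> is split off, and the map that the
      induction provides on its Fitting complement \<open>B\<close> is glued to multiplication by
      \<open>cnj a\<close> on \<open>A\<close>.\<close>
    obtain a v where av: "v \<in> S" "v \<noteq> 0" "T v = scale a v"
      by (rule eigenvector_exists[OF S self.linear_onI_linear[OF T] TS False])
    define A where "A = genspace S T a"
    obtain B where B: "subspace B" "B \<subseteq> S" "T ` B \<subseteq> B" "A \<inter> B = {0}"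
      "\<And>v. v \<in> S \<Longrightarrow> \<exists>x\<in>A. \<exists>y\<in>B. v = x + y" "dim S = dim A + dim B"
      "\<And>b. b \<noteq> a \<Longrightarrow> genspace S T b \<subseteq> B"
      using fitting[OF S T TS, of a] unfolding A_def by blast
    have sA: "subspace A" unfolding A_def by (rule subspace_genspace[OF T sS])
    have AS: "A \<subseteq> S" by (auto simp: A_def genspace_def)
    have fA: "fdim A" by (rule fdim_sub(1)[OF S sA AS])
    have fB: "fdim B" by (rule fdim_sub(1)[OF S B(1,2)])
    have "v \<in> A" using av by (auto simp: A_def genspace_def intro!: exI[of _ 1])
    then have "dim A \<noteq> 0" using fdim_dim_0[OF fA] av(2) by auto
    then have "dim B < dim S" using B(6) by simp
    from less.hyps[OF this fB B(3)]
    obtain Y' r' where Y': "linear_on B scale scale Y'" "Y' ` B \<subseteq> B"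
      "\<And>b v. v \<in> genspace B T b \<Longrightarrow> Y' v = scale (cnj b) v"
      "r' \<ge> 0" "tr B (\<lambda>v. T (Y' v)) = complex_of_real r'" "r' = 0 \<Longrightarrow> (\<forall>v\<in>B. \<exists>k. (T ^^ k) v = 0)"
      "B \<subseteq> span (\<Union>a. genspace B T a)"
      by (elim exE conjE) blast
    obtain \<pi> where \<pi>: "linear_on S scale scale \<pi>" "\<And>v. v \<in> S \<Longrightarrow> \<pi> v \<in> A" "\<And>v. v \<in> S \<Longrightarrow> v - \<pi> v \<in> B"
      "\<And>a. a \<in> A \<Longrightarrow> \<pi> a = a" "\<And>b. b \<in> B \<Longrightarrow> \<pi> b = 0"
      using direct_projection[OF sA B(1,4,5) sS] by blast
    have TA: "T ` A \<subseteq> A" unfolding A_def using genspace_invariant[OF T TS] by blast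
    define Z where "Z = (\<lambda>v. Y' (v - \<pi> v))"
    define Y where "Y = (\<lambda>v. scale (cnj a) (\<pi> v) + Z v)"
    have Zl: "linear_on S scale scale Z"
      unfolding linear_on_def
    proof (intro conjI ballI allI)
      fix x y assume xy: "x \<in> S" "y \<in> S"
      have "x + y - \<pi> (x + y) = (x - \<pi> x) + (y - \<pi> y)" using self.linear_on_add[OF \<pi>(1) xy] by simp
      then show "Z (x + y) = Z x + Z y"
        unfolding Z_def by (simp only: self.linear_on_add[OF Y'(1) \<pi>(3)[OF xy(1)] \<pi>(3)[OF xy(2)]])
    next
      fix c x assume x: "x \<in> S"
      have "scale c x - \<pi> (scale c x) = scale c (x - \<pi> x)"
        using self.linear_on_scale[OF \<pi>(1) x] by (simp add: scale_right_diff_distrib)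
      then show "Z (scale c x) = scale c (Z x)"
        unfolding Z_def by (simp only: self.linear_on_scale[OF Y'(1) \<pi>(3)[OF x]])
    qed
    have ZB: "Z ` S \<subseteq> B" using Y'(2) \<pi>(3) by (auto simp: Z_def)
    have Yl: "linear_on S scale scale Y"
      using \<pi>(1) Zl by (auto simp: Y_def linear_on_def scale_right_distrib scale_left_commute algebra_simps)
    have YS: "Y ` S \<subseteq> S"
      using \<pi>(2) AS ZB B(2) subspace_add[OF sS] subspace_scale[OF sS] unfolding Y_def by (auto simp: image_subset_iff subset_iff)
    have YA: "Y v = scale (cnj a) v" if "v \<in> A" for v
      using that \<pi>(4) self.linear_on_0[OF Y'(1) B(1)] by (simp add: Y_def Z_def)
    have YB: "Y v = Y' v" if "v \<in> B" for v using that \<pi>(5) by (simp add: Y_def Z_def)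
    have gB: "genspace B T b \<subseteq> genspace S T b" for b using B(2) by (auto simp: genspace_def)
    have gen: "Y v = scale (cnj b) v" if "v \<in> genspace S T b" for b v
    proof (cases "b = a")
      case True
      then show ?thesis using YA that by (simp add: A_def)
    next
      case False
      then have "v \<in> B" using B(7) that by auto
      then have "v \<in> genspace B T b" using that by (auto simp: genspace_def)
      then show ?thesis using Y'(3) YB[OF \<open>v \<in> B\<close>] by simp
    qed
    have T\<pi>: "linear_on S scale scale (\<lambda>v. T (\<pi> v))" "(\<lambda>v. T (\<pi> v)) ` S \<subseteq> A"
      using \<pi>(1) self.linear_add[OF T] self.linear_scale[OF T] TA \<pi>(2) by (auto simp: linear_on_def)
    have TZ: "linear_on S scale scale (\<lambda>v. T (Z v))" "(\<lambda>v. T (Z v)) ` S \<subseteq> B"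
      using Zl self.linear_add[OF T] self.linear_scale[OF T] B(3) ZB by (auto simp: linear_on_def image_subset_iff)
    have 1: "tr S (\<lambda>v. T (\<pi> v)) = a * of_nat (dim A)"
    proof -
      have "tr S (\<lambda>v. T (\<pi> v)) = tr A (\<lambda>v. T (\<pi> v))" by (rule tr_sub[OF S sA AS T\<pi>])
      also have "\<dots> = tr A T" by (rule tr_cong[OF fA]) (simp add: \<pi>(4))
      finally show ?thesis using tr_genspace[OF S T TS, of a] by (simp add: A_def)
    qed
    have 2: "tr S (\<lambda>v. T (Z v)) = complex_of_real r'"
    proof -
      have "tr S (\<lambda>v. T (Z v)) = tr B (\<lambda>v. T (Z v))" by (rule tr_sub[OF S B(1,2) TZ])
      also have "\<dots> = tr B (\<lambda>v. T (Y' v))" by (rule tr_cong[OF fB]) (simp add: \<pi>(5) Z_def)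
      finally show ?thesis using Y'(5) by simp
    qed
    \<comment> \<open>On \<open>A\<close> the composition of \<open>T\<close> and \<open>Y\<close>
      has trace \<open>a * cnj a * dim A\<close>. As \<open>dim A \<noteq> 0\<close>, a vanishing
      \<open>r\<close> forces \<open>a = 0\<close>, which makes \<open>T\<close> nilpotent on
      \<open>A\<close> as well as on \<open>B\<close>.\<close>
    define r where "r = (cmod a)\<^sup>2 * dim A + r'"
    have T\<pi>S: "(\<lambda>v. T (\<pi> v)) ` S \<subseteq> S" and TZS: "(\<lambda>v. T (Z v)) ` S \<subseteq> S" using T\<pi>(2) TZ(2) AS B(2) by auto
    have cl: "linear_on S scale scale (\<lambda>v. scale (cnj a) (T (\<pi> v)))"
      using T\<pi>(1) by (auto simp: linear_on_def scale_right_distrib scale_left_commute)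
    have cS: "(\<lambda>v. scale (cnj a) (T (\<pi> v))) ` S \<subseteq> S" using T\<pi>S subspace_scale[OF sS] by auto
    have "tr S (\<lambda>v. T (Y v)) = tr S (\<lambda>v. scale (cnj a) (T (\<pi> v)) + T (Z v))"
      by (simp add: Y_def self.linear_add[OF T] self.linear_scale[OF T])
    also have "\<dots> = tr S (\<lambda>v. scale (cnj a) (T (\<pi> v))) + tr S (\<lambda>v. T (Z v))"
      by (rule tr_add[OF S cl cS TZ(1) TZS])
    also have "\<dots> = cnj a * (a * of_nat (dim A)) + r'"
      using tr_scale[OF S T\<pi>(1) T\<pi>S] 1 2 by simp
    also have "\<dots> = complex_of_real r"
      using complex_norm_square[of a] by (simp add: r_def mult.commute mult.left_commute)
    finally have t: "tr S (\<lambda>v. T (Y v)) = complex_of_real r" .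
    have r0: "r \<ge> 0" using Y'(4) by (simp add: r_def)
    have nil: "\<exists>k. (T ^^ k) v = 0" if that_r: "r = 0" "v \<in> S" for v
    proof -
      have "(cmod a)\<^sup>2 * dim A = 0 \<and> r' = 0" using that_r(1) Y'(4) unfolding r_def
        by (metis add_nonneg_eq_0_iff mult_nonneg_nonneg of_nat_0_le_iff zero_le_power2)
      then have a0: "a = 0" and r': "r' = 0" using \<open>dim A \<noteq> 0\<close> by auto
      obtain x y where xy: "x \<in> A" "y \<in> B" "v = x + y" using B(5)[OF that_r(2)] by auto
      obtain k where k: "(T ^^ k) x = 0" using xy(1) a0 by (auto simp: A_def genspace_def)
      obtain l where l: "(T ^^ l) y = 0" using xy(2) Y'(6)[OF r'] by auto
      have "(T ^^ max k l) x = 0" "(T ^^ max k l) y = 0" using funpow_zero_mono[OF T] k l by auto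
      then have "(T ^^ max k l) v = 0" using self.linear_add[OF linear_funpow[OF T]] xy(3) by simp
      then show ?thesis by blast
    qed
    have sp: "S \<subseteq> span (\<Union>a. genspace S T a)"
    proof
      fix v assume "v \<in> S"
      then obtain x y where xy: "x \<in> A" "y \<in> B" "v = x + y" using B(5) by blast
      have "x \<in> span (\<Union>a. genspace S T a)" using xy(1) by (auto simp: A_def intro: span_base)
      moreover have "(\<Union>a. genspace B T a) \<subseteq> (\<Union>a. genspace S T a)" using gB by blast
      then have "y \<in> span (\<Union>a. genspace S T a)" using xy(2) Y'(7) span_mono by blast
      ultimately show "v \<in> span (\<Union>a. genspace S T a)" using xy(3) span_add by simp
    qed
    show ?thesis
      by (rule exI[of _ Y], intro conjI exI[of _ r] impI) (use Yl YS gen r0 t nil sp in auto)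
  qed
qed

end

section \<open>Complete reducibility\<close>

locale liealg =
  fixes L :: "'g::ab_group_add lie"
  assumes lie: "lie_algebra L"
begin

abbreviation br :: "'g \<Rightarrow> 'g \<Rightarrow> 'g" where "br \<equiv> bracket L"

sublocale g: cvec "lie_scale L"
  using lie by (simp add: lie_algebra_def cvec_def)

lemma br_linear: "clinear (lie_scale L) (lie_scale L) (br x)"
  and br_linear_left: "clinear (lie_scale L) (lie_scale L) (\<lambda>x. br x y)"
  using lie by (auto simp: lie_algebra_def linear_on_def Vector_Spaces.linear_iff g.cvec_axioms g.vector_space_axioms)

lemmas br_simps = g.self.linear_add[OF br_linear] g.self.linear_add[OF br_linear_left]
  g.self.linear_diff[OF br_linear] g.self.linear_diff[OF br_linear_left]
  g.self.linear_scale[OF br_linear] g.self.linear_scale[OF br_linear_left]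
  g.self.linear_0[OF br_linear] g.self.linear_0[OF br_linear_left]
  g.self.linear_neg[OF br_linear] g.self.linear_neg[OF br_linear_left]

lemma br_self: "br x x = 0"
  using lie by (simp add: lie_algebra_def)

lemma br_anti: "br x y = - br y x"
proof -
  have "br (x + y) (x + y) = br x x + br y x + (br x y + br y y)" by (simp only: br_simps)
  then have "br x y + br y x = 0" by (simp add: br_self add.commute)
  then show ?thesis by (simp add: eq_neg_iff_add_eq_0)
qed

lemma jacobi: "br (br x y) z = br x (br y z) - br y (br x z)"
proof -
  have "br x (br y z) + br y (br z x) + br z (br x y) = 0"
    using lie by (simp add: lie_algebra_def)
  moreover have "br y (br z x) = - br y (br x z)" using br_anti[of z x] by (simp add: br_simps)
  moreover have "br z (br x y) = - br (br x y) z" by (rule br_anti)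
  ultimately show ?thesis by (simp add: algebra_simps)
qed

lemma ideal_subspace: "lie_ideal L I \<Longrightarrow> g.subspace I"
  and ideal_br: "lie_ideal L I \<Longrightarrow> y \<in> I \<Longrightarrow> br x y \<in> I"
  by (auto simp: lie_ideal_def)

lemma ideal_br_left: "lie_ideal L I \<Longrightarrow> y \<in> I \<Longrightarrow> br y x \<in> I"
  using ideal_br[of I y x] g.subspace_neg[OF ideal_subspace] br_anti[of y x] by simp

text \<open>The ideal \<open>[I, g]\<close>, where the second entry ranges over the whole algebra;
  it contains \<open>[I, I]\<close>, which is \<open>derived_lie L I\<close>.\<close>

definition lbr :: "'g set \<Rightarrow> 'g set"
  where "lbr I = g.span {br u v |u v. u \<in> I}"

lemma ideal_span:
  assumes "\<And>x y. y \<in> X \<Longrightarrow> br x y \<in> g.span X"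
  shows "lie_ideal L (g.span X)"
  unfolding lie_ideal_def
proof (intro conjI allI ballI)
  fix x y assume "y \<in> g.span X"
  then show "br x y \<in> g.span X"
    by (induction rule: g.span_induct_alt)
       (auto simp: br_simps intro!: g.span_zero g.span_add g.span_scale assms)
qed simp

lemma lbr_ideal: "lie_ideal L I \<Longrightarrow> lie_ideal L (lbr I)"
  unfolding lbr_def
proof (rule ideal_span)
  fix x y assume I: "lie_ideal L I" and "y \<in> {br u v |u v. u \<in> I}"
  then obtain u v where uv: "y = br u v" "u \<in> I" by auto
  have "br x y = br (br x u) v + br u (br x v)" using jacobi[of x u v] uv by (simp add: algebra_simps)
  moreover have "br (br x u) v \<in> {br u v |u v. u \<in> I}" "br u (br x v) \<in> {br u v |u v. u \<in> I}"
    using uv(2) ideal_br[OF I] by blast+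
  ultimately show "br x y \<in> g.span {br u v |u v. u \<in> I}"
    using g.span_add[OF g.span_base g.span_base] by simp
qed

lemma lbr_subset: "lie_ideal L I \<Longrightarrow> lbr I \<subseteq> I"
  unfolding lbr_def by (rule g.span_minimal) (auto intro: ideal_br_left ideal_subspace)

lemma derived_ideal: "lie_ideal L I \<Longrightarrow> lie_ideal L (derived_lie L I)"
  unfolding derived_lie_def
proof (rule ideal_span)
  fix x y assume I: "lie_ideal L I" and "y \<in> {br u v |u v. u \<in> I \<and> v \<in> I}"
  then obtain u v where uv: "y = br u v" "u \<in> I" "v \<in> I" by auto
  have "br x y = br (br x u) v + br u (br x v)" using jacobi[of x u v] uv by (simp add: algebra_simps)
  moreover have "br (br x u) v \<in> {br u v |u v. u \<in> I \<and> v \<in> I}" "br u (br x v) \<in> {br u v |u v. u \<in> I \<and> v \<in> I}"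
    using uv(2,3) ideal_br[OF I] by blast+
  ultimately show "br x y \<in> g.span {br u v |u v. u \<in> I \<and> v \<in> I}"
    using g.span_add[OF g.span_base g.span_base] by simp
qed

lemma derived_subset: "lie_ideal L I \<Longrightarrow> derived_lie L I \<subseteq> I"
  unfolding derived_lie_def by (rule g.span_minimal) (auto intro: ideal_br ideal_subspace)

end

section \<open>Modules, their trace forms and the nilpotency criterion\<close>

locale fdlie = liealg +
  assumes fdL: "g.fdim UNIV"

text \<open>The operators \<open>\<rho> x\<close> are required to be linear on the ambient space and
  not only on \<open>S\<close>, so that their powers and generalized eigenspaces fall under the
  lemmas on global linear maps. \<open>rep_lmod\<close> produces such operators from a
  representation.\<close>

locale lmod = fdlie L + v: cvec sc
  for L :: "'g::ab_group_add lie" and sc :: "complex \<Rightarrow> 'v::ab_group_add \<Rightarrow> 'v" +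
  fixes S :: "'v set" and \<rho> :: "'g \<Rightarrow> 'v \<Rightarrow> 'v"
  assumes fd: "v.fdim S"
    and stable: "v \<in> S \<Longrightarrow> \<rho> x v \<in> S"
    and lin: "clinear sc sc (\<rho> x)"
    and linx: "v \<in> S \<Longrightarrow> clinear (lie_scale L) sc (\<lambda>x. \<rho> x v)"
    and rho_br: "v \<in> S \<Longrightarrow> \<rho> (bracket L x y) v = \<rho> x (\<rho> y v) - \<rho> y (\<rho> x v)"
begin

sublocale gv: cvec2 "lie_scale L" sc by unfold_locales

lemmas sS = v.fdim_subspace[OF fd]

lemmas rho_lin = v.self.linear_add[OF lin] v.self.linear_diff[OF lin] v.self.linear_scale[OF lin]
  v.self.linear_0[OF lin] v.self.linear_neg[OF lin]

lemmas rho_linx = gv.linear_add[OF linx] gv.linear_diff[OF linx] gv.linear_scale[OF linx]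
  gv.linear_0[OF linx] gv.linear_neg[OF linx]

lemma rho_on: "linear_on S sc sc (\<rho> x)"
  by (rule v.self.linear_onI_linear[OF lin])

lemma rho_comp: "linear_on S sc sc f \<Longrightarrow> linear_on S sc sc (\<lambda>v. \<rho> x (f v))"
  by (auto simp: linear_on_def rho_lin)

lemma rho_img: "\<rho> x ` S \<subseteq> S"
  using stable by auto

text \<open>The trace form of the module; for the adjoint module it is the Killing form.\<close>

definition tform :: "'g \<Rightarrow> 'g \<Rightarrow> complex"
  where "tform x y = v.tr S (\<lambda>v. \<rho> x (\<rho> y v))"

lemma tform_sym: "tform x y = tform y x"
  unfolding tform_def by (rule v.tr_comm[OF fd fd rho_on rho_img rho_on rho_img])

lemma tform_linear: "clinear (lie_scale L) (*) (\<lambda>x. tform x y)"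
proof -
  interpret c: cvec2 "lie_scale L" "(*)" by (rule g.cvec2_complex)
  have l: "linear_on S sc sc (\<lambda>v. \<rho> x (\<rho> y v))" for x by (rule rho_comp[OF rho_on])
  have i: "(\<lambda>v. \<rho> x (\<rho> y v)) ` S \<subseteq> S" for x using stable by auto
  show ?thesis
  proof (subst Vector_Spaces.linear_iff, intro conjI allI)
    fix x x' c
    have "tform (x + x') y = v.tr S (\<lambda>v. \<rho> x (\<rho> y v) + \<rho> x' (\<rho> y v))"
      unfolding tform_def by (rule v.tr_cong[OF fd]) (simp add: rho_linx stable)
    then show "tform (x + x') y = tform x y + tform x' y"
      using v.tr_add[OF fd l i l i] by (simp add: tform_def)
    have "tform (lie_scale L c x) y = v.tr S (\<lambda>v. sc c (\<rho> x (\<rho> y v)))"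
      unfolding tform_def by (rule v.tr_cong[OF fd]) (simp add: rho_linx stable)
    then show "tform (lie_scale L c x) y = c * tform x y"
      using v.tr_scale[OF fd l i] by (simp add: tform_def)
  qed (use g.cvec2_complex in \<open>auto simp: cvec2_def cvec_def\<close>)
qed

text \<open>The trace of \<open>x y z - y x z\<close> equals that of \<open>x y z - x z y\<close> by
  cyclicity.\<close>

lemma tform_inv: "tform (br x y) z = tform x (br y z)"
proof -
  have l: "linear_on S sc sc (\<lambda>v. \<rho> x (\<rho> y (\<rho> z v)))" for x y z by (intro rho_comp rho_on)
  have l2: "linear_on S sc sc (\<lambda>v. \<rho> x (\<rho> y v))" for x y by (intro rho_comp rho_on)
  have i: "(\<lambda>v. \<rho> x (\<rho> y (\<rho> z v))) ` S \<subseteq> S" for x y z using stable by auto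
  have i2: "(\<lambda>v. \<rho> x (\<rho> y v)) ` S \<subseteq> S" for x y using stable by auto
  have "tform (br x y) z = v.tr S (\<lambda>v. \<rho> x (\<rho> y (\<rho> z v)) - \<rho> y (\<rho> x (\<rho> z v)))"
    unfolding tform_def by (rule v.tr_cong[OF fd]) (simp add: rho_br stable)
  also have "\<dots> = v.tr S (\<lambda>v. \<rho> x (\<rho> y (\<rho> z v))) - v.tr S (\<lambda>v. \<rho> y (\<rho> x (\<rho> z v)))"
    by (rule v.tr_diff[OF fd l i l i])
  also have "v.tr S (\<lambda>v. \<rho> y (\<rho> x (\<rho> z v))) = v.tr S (\<lambda>v. \<rho> x (\<rho> z (\<rho> y v)))"
    by (rule v.tr_comm[OF fd fd l2 i2 rho_on rho_img])
  also have "v.tr S (\<lambda>v. \<rho> x (\<rho> y (\<rho> z v))) - \<dots> = v.tr S (\<lambda>v. \<rho> x (\<rho> y (\<rho> z v)) - \<rho> x (\<rho> z (\<rho> y v)))"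
    by (rule v.tr_diff[OF fd l i l i, symmetric])
  also have "\<dots> = tform x (br y z)"
    unfolding tform_def by (rule v.tr_cong[OF fd]) (simp add: rho_br stable rho_lin)
  finally show ?thesis .
qed

lemma tform_perp_ideal:
  assumes D: "lie_ideal L D"
  shows "lie_ideal L {x. \<forall>y\<in>D. tform x y = 0}"
proof -
  interpret c: cvec2 "lie_scale L" "(*)" by (rule g.cvec2_complex)
  have "g.subspace {x. \<forall>y\<in>D. tform x y = 0}"
    by (rule g.subspaceI) (auto simp: c.linear_add[OF tform_linear] c.linear_scale[OF tform_linear] c.linear_0[OF tform_linear])
  moreover have "tform (br x y) z = 0" if "\<forall>z\<in>D. tform y z = 0" "z \<in> D" for x y z
  proof -
    have "tform (br x y) z = - tform (br y x) z"
      using br_anti[of x y] c.linear_neg[OF tform_linear] by simp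
    also have "\<dots> = 0" using tform_inv[of y x z] that ideal_br[OF D] by simp
    finally show ?thesis .
  qed
  ultimately show ?thesis unfolding lie_ideal_def by auto
qed

text \<open>With \<open>K = \<rho> x - (a + \<mu>)\<close> one has \<open>K (\<rho> w v) = \<rho>
  ((ad x - \<mu>) w) v + \<rho> w ((\<rho> x - a) v)\<close>. Each application of \<open>K\<close>
  uses up one of the powers that annihilate \<open>w\<close> or \<open>v\<close>, so the sum of the
  two exponents suffices.\<close>

lemma rho_genspace:
  assumes "w \<in> g.genspace UNIV (br x) \<mu>" "v \<in> v.genspace S (\<rho> x) a"
  shows "\<rho> w v \<in> v.genspace S (\<rho> x) (a + \<mu>)"
proof -
  let ?N = "\<lambda>v. \<rho> x v - sc a v" and ?M = "\<lambda>w. br x w - lie_scale L \<mu> w" and ?K = "\<lambda>v. \<rho> x v - sc (a + \<mu>) v"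
  have K: "clinear sc sc (?K ^^ n)" for n
    by (intro v.linear_funpow v.linear_shift lin)
  have N0: "?N 0 = 0" by (simp add: rho_lin)
  have M0: "?M 0 = 0" by (simp add: br_simps)
  have *: "(?K ^^ n) (\<rho> w v) = 0" if "i + j = n" "v \<in> S" "(?N ^^ i) v = 0" "(?M ^^ j) w = 0" for n i j v w
    using that
  proof (induction n arbitrary: i j v w)
    case 0
    then show ?case by (simp add: rho_lin)
  next
    case (Suc n)
    have in1: "?N v \<in> S" using stable Suc.prems(2) v.subspace_diff[OF sS] v.subspace_scale[OF sS] by simp
    have e: "?K (\<rho> w v) = \<rho> (?M w) v + \<rho> w (?N v)"
      using Suc.prems(2) by (simp add: rho_linx rho_lin rho_br v.scale_left_distrib)
    have a: "(?K ^^ n) (\<rho> (?M w) v) = 0"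
    proof (cases j)
      case 0
      then have w: "w = 0" using Suc.prems by simp
      have "?M w = 0" using M0 w by simp
      then have "\<rho> (?M w) v = 0" using rho_linx(4)[OF Suc.prems(2)] by simp
      then show ?thesis using v.self.linear_0[OF K] by simp
    next
      case (Suc j')
      then show ?thesis using Suc.prems Suc.IH[of i j' v "?M w"] by (simp add: funpow_Suc_right del: funpow.simps)
    qed
    have b: "(?K ^^ n) (\<rho> w (?N v)) = 0"
    proof (cases i)
      case 0
      then have w: "v = 0" using Suc.prems by simp
      have "?N v = 0" using N0 w by simp
      then have "\<rho> w (?N v) = 0" using rho_lin(4) by simp
      then show ?thesis using v.self.linear_0[OF K] by simp
    next
      case (Suc i')
      then show ?thesis using Suc.prems Suc.IH[of i' j "?N v" w] in1 by (simp add: funpow_Suc_right del: funpow.simps)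
    qed
    have "(?K ^^ Suc n) (\<rho> w v) = (?K ^^ n) (?K (\<rho> w v))"
      by (simp add: funpow_Suc_right del: funpow.simps)
    also have "\<dots> = 0" unfolding e using a b v.self.linear_add[OF K] by simp
    finally show ?case .
  qed
  obtain i j where ij: "(?N ^^ i) v = 0" "(?M ^^ j) w = 0" "v \<in> S"
    using assms unfolding v.genspace_def g.genspace_def by blast
  show ?thesis using *[OF refl ij(3,1,2)] stable[OF ij(3)] unfolding v.genspace_def by blast
qed

text \<open>\<open>\<mu> w\<close> is the difference of \<open>[x, w]\<close>, which lies in
  \<open>R\<close>, and of \<open>(ad x - \<mu>) w\<close>, which lies in \<open>R\<close> by
  induction on the annihilating exponent.\<close>

lemma ideal_absorbs_genspace:
  assumes R: "lie_ideal L R" and x: "x \<in> R" and mu: "\<mu> \<noteq> 0" and w: "w \<in> g.genspace UNIV (br x) \<mu>"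
  shows "w \<in> R"
proof -
  note sR = ideal_subspace[OF R]
  have *: "w \<in> R" if "((\<lambda>w. br x w - lie_scale L \<mu> w) ^^ k) w = 0" for k w
    using that
  proof (induction k arbitrary: w)
    case 0
    then show ?case using g.subspace_0[OF sR] by simp
  next
    case (Suc k)
    have "br x w - lie_scale L \<mu> w \<in> R" by (rule Suc.IH) (use Suc.prems in \<open>simp add: funpow_Suc_right del: funpow.simps\<close>)
    then have "br x w - (br x w - lie_scale L \<mu> w) \<in> R"
      by (rule g.subspace_diff[OF sR ideal_br_left[OF R x]])
    then have "lie_scale L \<mu> w \<in> R" by simp
    then have "lie_scale L (inverse \<mu>) (lie_scale L \<mu> w) \<in> R" by (rule g.subspace_scale[OF sR])
    then show ?case using mu by simp
  qed
  show ?thesis using w * unfolding g.genspace_def by blast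
qed

text \<open>
  The half of Cartan's criterion that is needed.  If \<open>Y\<close> is the conjugate semisimple part of
  \<open>\<rho> x\<close>, then the trace of \<open>\<rho> x \<circ> Y\<close> is the sum of the squared absolute values of the
  eigenvalues of \<open>\<rho> x\<close>; on the other hand commutators with \<open>Y\<close> stay inside \<open>\<rho> R\<close>.
\<close>

lemma cartan_nilpotent:
  assumes R: "lie_ideal L R" and tf: "\<And>x y. x \<in> R \<Longrightarrow> y \<in> R \<Longrightarrow> tform x y = 0"
    and x: "x \<in> lbr R" and v: "v \<in> S"
  shows "\<exists>k. (\<rho> x ^^ k) v = 0"
proof -
  have xR: "x \<in> R" using x lbr_subset[OF R] by auto
  from v.conjugate_semisimple_part[OF lin fd rho_img, of x]
  obtain Y r where Y: "linear_on S sc sc Y" "Y ` S \<subseteq> S"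
    "\<And>a v. v \<in> v.genspace S (\<rho> x) a \<Longrightarrow> Y v = sc (cnj a) v"
    "v.tr S (\<lambda>v. \<rho> x (Y v)) = complex_of_real r" "r = 0 \<Longrightarrow> (\<forall>v\<in>S. \<exists>k. (\<rho> x ^^ k) v = 0)"
    "S \<subseteq> v.span (\<Union>a. v.genspace S (\<rho> x) a)"
    by (elim exE conjE) blast
  have "(\<Union>a. g.genspace UNIV (br x) a) \<subseteq> UNIV" by simp
  have spL: "w \<in> g.span (\<Union>a. g.genspace UNIV (br x) a)" for w
    using g.conjugate_semisimple_part[OF br_linear fdL subset_UNIV, of x] by (elim exE conjE) blast
  have YS: "v \<in> S \<Longrightarrow> Y v \<in> S" for v using Y(2) by auto
  have lY: "linear_on S sc sc (\<lambda>v. f (Y v))" if "linear_on S sc sc f" for f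
    using that Y(1) YS by (simp add: linear_on_def)
  \<comment> \<open>At \<open>x\<close> the value is the number \<open>r\<close>. So
    \<open>\<tau>\<close> is to be shown to vanish on the generators \<open>[u, w]\<close> of
    \<open>lbr R\<close>, and by linearity \<open>w\<close> may be taken from a generalized
    eigenspace of \<open>ad x\<close>.\<close>
  define \<tau> where "\<tau> z = v.tr S (\<lambda>v. \<rho> z (Y v))" for z
  have lz: "linear_on S sc sc (\<lambda>v. \<rho> z (Y v))" for z by (rule lY[OF rho_on])
  have iz: "(\<lambda>v. \<rho> z (Y v)) ` S \<subseteq> S" for z using stable YS by auto
  have \<tau>_add: "\<tau> (y + z) = \<tau> y + \<tau> z" for y z
  proof -
    have "\<tau> (y + z) = v.tr S (\<lambda>v. \<rho> y (Y v) + \<rho> z (Y v))"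
      unfolding \<tau>_def by (rule v.tr_cong[OF fd]) (simp add: rho_linx YS)
    then show ?thesis using v.tr_add[OF fd lz iz lz iz] by (simp add: \<tau>_def)
  qed
  have \<tau>_scale: "\<tau> (lie_scale L c z) = c * \<tau> z" for c z
  proof -
    have "\<tau> (lie_scale L c z) = v.tr S (\<lambda>v. sc c (\<rho> z (Y v)))"
      unfolding \<tau>_def by (rule v.tr_cong[OF fd]) (simp add: rho_linx YS)
    then show ?thesis using v.tr_scale[OF fd lz iz] by (simp add: \<tau>_def)
  qed
  have \<tau>_0: "\<tau> 0 = 0" using \<tau>_scale[of 0 0] by simp
  have gen: "\<tau> (br u w) = 0" if u: "u \<in> R" and w: "w \<in> g.genspace UNIV (br x) \<mu>" for u w \<mu>
  proof -
    \<comment> \<open>The commutator of \<open>Y\<close> and \<open>\<rho> w\<close> is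
      \<open>cnj \<mu>\<close> times \<open>\<rho> w\<close>, since \<open>\<rho> w\<close> raises
      the eigenvalue of \<open>\<rho> x\<close> by \<open>\<mu>\<close> and \<open>Y\<close>
      multiplies by the conjugate eigenvalue.\<close>
    have comm: "v \<in> S \<and> Y (\<rho> w v) = \<rho> w (Y v) + sc (cnj \<mu>) (\<rho> w v)"
      if "v \<in> v.span (\<Union>a. v.genspace S (\<rho> x) a)" for v
      using that
    proof (induction rule: v.span_induct_alt)
      case base
      then show ?case using v.self.linear_on_0[OF Y(1) sS] v.subspace_0[OF sS] by (simp add: rho_lin)
    next
      case (step c p q)
      obtain a where a: "p \<in> v.genspace S (\<rho> x) a" using step(1) by auto
      have pS: "p \<in> S" using a by (simp add: v.genspace_def)
      have "Y (\<rho> w p) = sc (cnj (a + \<mu>)) (\<rho> w p)" by (rule Y(3)[OF rho_genspace[OF w a]])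
      then have e: "Y (\<rho> w p) = \<rho> w (Y p) + sc (cnj \<mu>) (\<rho> w p)"
        using Y(3)[OF a] by (simp add: rho_lin v.scale_left_distrib)
      have qS: "q \<in> S" and eq: "Y (\<rho> w q) = \<rho> w (Y q) + sc (cnj \<mu>) (\<rho> w q)" using step by auto
      have "Y (\<rho> w (sc c p + q)) = sc c (Y (\<rho> w p)) + Y (\<rho> w q)"
        using pS qS stable v.subspace_scale[OF sS]
        by (simp add: rho_lin v.self.linear_on_add[OF Y(1)] v.self.linear_on_scale[OF Y(1)])
      also have "\<dots> = \<rho> w (Y (sc c p + q)) + sc (cnj \<mu>) (\<rho> w (sc c p + q))"
        unfolding e eq using pS qS v.subspace_scale[OF sS]
        by (simp add: rho_lin v.self.linear_on_add[OF Y(1)] v.self.linear_on_scale[OF Y(1)]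
            v.scale_right_distrib v.scale_left_commute)
      finally show ?case using pS qS v.subspace_scale[OF sS] v.subspace_add[OF sS] by simp
    qed
    have comm: "Y (\<rho> w v) = \<rho> w (Y v) + sc (cnj \<mu>) (\<rho> w v)" if "v \<in> S" for v
      using comm[of v] that Y(6) by auto
    have l1: "linear_on S sc sc (\<lambda>v. \<rho> a (\<rho> b (Y v)))" for a b by (intro rho_comp lz)
    have i1: "(\<lambda>v. \<rho> a (\<rho> b (Y v))) ` S \<subseteq> S" for a b using stable YS by auto
    have l2: "linear_on S sc sc (\<lambda>v. \<rho> u (\<rho> w v))" by (intro rho_comp rho_on)
    have i2: "(\<lambda>v. \<rho> u (\<rho> w v)) ` S \<subseteq> S" using stable by auto
    have l3: "linear_on S sc sc (\<lambda>v. sc (cnj \<mu>) (\<rho> u (\<rho> w v)))"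
      using l2 by (auto simp: linear_on_def v.scale_right_distrib v.scale_left_commute)
    have i3: "(\<lambda>v. sc (cnj \<mu>) (\<rho> u (\<rho> w v))) ` S \<subseteq> S" using stable v.subspace_scale[OF sS] by auto
    have "\<tau> (br u w) = v.tr S (\<lambda>v. \<rho> u (\<rho> w (Y v)) - \<rho> w (\<rho> u (Y v)))"
      unfolding \<tau>_def by (rule v.tr_cong[OF fd]) (simp add: rho_br YS)
    also have "\<dots> = v.tr S (\<lambda>v. \<rho> u (\<rho> w (Y v))) - v.tr S (\<lambda>v. \<rho> w (\<rho> u (Y v)))"
      by (rule v.tr_diff[OF fd l1 i1 l1 i1])
    also have "v.tr S (\<lambda>v. \<rho> w (\<rho> u (Y v))) = v.tr S (\<lambda>v. \<rho> u (Y (\<rho> w v)))"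
      by (rule v.tr_comm[OF fd fd lz iz rho_on rho_img])
    also have "\<dots> = v.tr S (\<lambda>v. \<rho> u (\<rho> w (Y v)) + sc (cnj \<mu>) (\<rho> u (\<rho> w v)))"
      by (rule v.tr_cong[OF fd]) (simp add: comm rho_lin)
    also have "\<dots> = v.tr S (\<lambda>v. \<rho> u (\<rho> w (Y v))) + cnj \<mu> * tform u w"
      using v.tr_add[OF fd l1 i1 l3 i3] v.tr_scale[OF fd l2 i2] by (simp add: tform_def)
    finally have "\<tau> (br u w) = - (cnj \<mu> * tform u w)" by simp
    \<comment> \<open>If \<open>\<mu> \<noteq> 0\<close>, then \<open>w\<close> belongs to
      \<open>R\<close> and the trace form vanishes on \<open>R\<close>; if \<open>\<mu> = 0\<close>,
      the first factor is 0.\<close>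
    moreover have "cnj \<mu> * tform u w = 0"
      using tf[OF u] ideal_absorbs_genspace[OF R xR _ w] by (cases "\<mu> = 0") auto
    ultimately show ?thesis by simp
  qed
  have all: "\<tau> (br u w) = 0" if u: "u \<in> R" for u w
    using spL[of w]
  proof (induction rule: g.span_induct_alt)
    case base
    then show ?case by (simp add: br_simps \<tau>_0)
  next
    case (step c p q)
    then show ?case using gen[OF u] by (auto simp: br_simps \<tau>_add \<tau>_scale)
  qed
  have "\<tau> z = 0" if "z \<in> lbr R" for z
    using that unfolding lbr_def
    by (induction rule: g.span_induct_alt) (auto simp: \<tau>_0 \<tau>_add \<tau>_scale all)
  then have "r = 0" using x Y(4) by (simp add: \<tau>_def)
  then show ?thesis using Y(5) v by auto
qed

subsection \<open>Engel's theorem\<close>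

text \<open>The ascending annihilator series: \<open>ann H i\<close> consists of the vectors in
  \<open>S\<close> that are killed by all products of \<open>i\<close> operators from
  \<open>H\<close>. Thus \<open>ann H k = S\<close> says that \<open>H\<close> acts nilpotently with
  uniform length \<open>k\<close>.\<close>

primrec ann :: "'g set \<Rightarrow> nat \<Rightarrow> 'v set"
  where "ann H 0 = {0}"
  | "ann H (Suc i) = {v\<in>S. \<forall>h\<in>H. \<rho> h v \<in> ann H i}"

lemma ann_subspace: "v.subspace (ann H i)"
proof (induction i)
  case (Suc i)
  then show ?case
    using v.subspace_0[OF sS] v.subspace_0[OF Suc] v.subspace_add[OF sS] v.subspace_add[OF Suc]
      v.subspace_scale[OF sS] v.subspace_scale[OF Suc]
    by (intro v.subspaceI) (auto simp: rho_lin)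
qed simp

lemma ann_S: "ann H i \<subseteq> S"
  by (cases i) (use v.subspace_0[OF sS] in auto)

lemma ann_Suc: "ann H i \<subseteq> ann H (Suc i)"
proof (induction i)
  case 0
  then show ?case using v.subspace_0[OF sS] by (auto simp: rho_lin)
next
  case (Suc i)
  then show ?case by auto
qed

lemma ann_mono: "i \<le> j \<Longrightarrow> ann H i \<subseteq> ann H j"
  by (rule lift_Suc_mono_le[of "ann H", OF ann_Suc])

lemma ann_step: "v \<in> ann H i \<Longrightarrow> h \<in> H \<Longrightarrow> \<rho> h v \<in> ann H (i - 1)"
  by (cases i) (auto simp: rho_lin)

text \<open>Subalgebras of \<open>J\<close> that are known to act nilpotently. The elements of
  \<open>J\<close> that act as 0 are included from the start, so that an element of \<open>J\<close>
  outside \<open>H\<close> acts nontrivially and \<open>J\<close> does not have to be replaced by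
  its image in the endomorphisms.\<close>

definition engel_good :: "'g set \<Rightarrow> 'g set \<Rightarrow> bool"
  where "engel_good J H \<longleftrightarrow> g.subspace H \<and> H \<subseteq> J \<and> (\<forall>x\<in>H. \<forall>y\<in>H. br x y \<in> H) \<and>
    {x\<in>J. \<forall>v\<in>S. \<rho> x v = 0} \<subseteq> H \<and> (\<exists>k. ann H k = S)"

text \<open>If no element outside \<open>H\<close> normalizes \<open>H\<close>, then from
  \<open>z \<in> J - H\<close> one can pass to some \<open>[z, h] \<in> J - H\<close> again and
  again. Each bracket lowers the degree of the operator with respect to the annihilator series by
  one, so in the end an element outside \<open>H\<close> acts as 0.\<close>

lemma engel_normalizer:
  assumes J: "\<And>x y. x \<in> J \<Longrightarrow> y \<in> J \<Longrightarrow> br x y \<in> J" and H: "engel_good J H" "H \<noteq> J"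
  obtains z where "z \<in> J" "z \<notin> H" "\<And>h. h \<in> H \<Longrightarrow> br z h \<in> H"
proof (rule ccontr)
  assume "\<not> thesis"
  with that have no: "\<And>z. z \<in> J \<Longrightarrow> z \<notin> H \<Longrightarrow> \<exists>h\<in>H. br z h \<notin> H" by blast
  have HJ: "H \<subseteq> J" and ker: "{x\<in>J. \<forall>v\<in>S. \<rho> x v = 0} \<subseteq> H" using H by (auto simp: engel_good_def)
  obtain k where k: "ann H k = S" using H by (auto simp: engel_good_def)
  \<comment> \<open>For \<open>d = 0\<close> every \<open>z\<close> qualifies, because
    \<open>ann H k\<close> is all of \<open>S\<close>; for \<open>i = k\<close> and
    \<open>d = k + k\<close> the claim says that \<open>z\<close> kills \<open>S\<close>.\<close>
  have "\<exists>z\<in>J - H. \<forall>i. \<forall>v\<in>ann H i. \<rho> z v \<in> ann H (i + k - d)" for d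
  proof (induction d)
    case 0
    obtain z where z: "z \<in> J - H" using HJ H(2) by auto
    have "\<rho> z v \<in> ann H (i + k)" if "v \<in> ann H i" for i v
      using subsetD[OF ann_mono[of k "i + k" H]] stable[OF subsetD[OF ann_S that]] k by simp
    then show ?case using z by auto
  next
    case (Suc d)
    then obtain z where z: "z \<in> J - H" "\<And>i v. v \<in> ann H i \<Longrightarrow> \<rho> z v \<in> ann H (i + k - d)" by blast
    obtain h where h: "h \<in> H" "br z h \<notin> H" using no z(1) by auto
    have "\<rho> (br z h) v \<in> ann H (i + k - Suc d)" if v: "v \<in> ann H i" for i v
    proof (cases i)
      case 0
      then show ?thesis using v v.subspace_0[OF ann_subspace] by (simp add: rho_lin)
    next
      case (Suc j)
      have "\<rho> h v \<in> ann H j" using v h(1) Suc by auto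
      then have a: "\<rho> z (\<rho> h v) \<in> ann H (i + k - Suc d)" using z(2)[of "\<rho> h v" j] Suc by simp
      have b: "\<rho> h (\<rho> z v) \<in> ann H (i + k - Suc d)" using ann_step[OF z(2)[OF v] h(1)] by simp
      show ?thesis using v.subspace_diff[OF ann_subspace a b] rho_br[OF subsetD[OF ann_S v], of z h] by simp
    qed
    moreover have "br z h \<in> J - H" using h HJ z(1) J by auto
    ultimately show ?case by blast
  qed
  then obtain z where z: "z \<in> J - H" "\<And>i v. v \<in> ann H i \<Longrightarrow> \<rho> z v \<in> ann H (i + k - (k + k))" by blast
  have "\<rho> z v = 0" if "v \<in> S" for v using z(2)[of v k] that k by simp
  then show False using z(1) ker by auto
qed

lemma nilpotent_uniform:
  assumes "\<And>v. v \<in> S \<Longrightarrow> \<exists>k. (\<rho> x ^^ k) v = 0"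
  obtains N where "\<And>v. v \<in> S \<Longrightarrow> (\<rho> x ^^ N) v = 0"
proof -
  obtain n where n: "v.genspace S (\<rho> x) 0 = {v\<in>S. ((\<lambda>v. \<rho> x v - sc 0 v) ^^ n) v = 0}"
    by (rule v.genspace_power[OF fd lin])
  have e: "(\<lambda>v. \<rho> x v - sc 0 v) = \<rho> x" by simp
  have "v.genspace S (\<rho> x) 0 = S" using assms by (auto simp: v.genspace_def)
  then show ?thesis using that n unfolding e by auto
qed

text \<open>As \<open>z\<close> normalizes \<open>H\<close>, it preserves every
  \<open>ann H i\<close>. From \<open>ann H (i + 1)\<close> the operators of \<open>H\<close> lead
  to \<open>ann H i\<close> at once, and \<open>z\<close> leads to 0 after \<open>N\<close> steps;
  so each layer of the old series costs at most \<open>N\<close> layers of the new one.\<close>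

lemma engel_extend:
  assumes sJ: "g.subspace J" and J: "\<And>x y. x \<in> J \<Longrightarrow> y \<in> J \<Longrightarrow> br x y \<in> J"
    and nil: "\<And>x v. x \<in> J \<Longrightarrow> v \<in> S \<Longrightarrow> \<exists>k. (\<rho> x ^^ k) v = 0"
    and H: "engel_good J H" and z: "z \<in> J" "\<And>h. h \<in> H \<Longrightarrow> br z h \<in> H"
  shows "engel_good J (g.span (insert z H))"
proof -
  let ?H = "g.span (insert z H)"
  have sH: "g.subspace H" and HJ: "H \<subseteq> J" and HH: "\<And>x y. x \<in> H \<Longrightarrow> y \<in> H \<Longrightarrow> br x y \<in> H"
    and ker: "{x\<in>J. \<forall>v\<in>S. \<rho> x v = 0} \<subseteq> H" using H by (auto simp: engel_good_def)
  obtain k where k: "ann H k = S" using H by (auto simp: engel_good_def)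
  have elem: "\<exists>h c. h \<in> H \<and> x = h + lie_scale L c z" if xH: "x \<in> ?H" for x
  proof -
    obtain c where c: "x - lie_scale L c z \<in> g.span H"
      using iffD1[OF g.span_breakdown_eq xH] by blast
    have "x - lie_scale L c z \<in> H" using c sH by (metis g.span_eq_iff)
    then show ?thesis by (intro exI[of _ "x - lie_scale L c z"] exI[of _ c]) simp
  qed
  have HsH: "H \<subseteq> ?H" using g.span_superset by blast
  have hz: "br h z \<in> H" if "h \<in> H" for h
    using z(2)[OF that] g.subspace_neg[OF sH] br_anti[of h z] by simp
  have closed: "br x y \<in> ?H" if xy: "x \<in> ?H" "y \<in> ?H" for x y
  proof -
    obtain h c h' c' where e: "h \<in> H" "x = h + lie_scale L c z" "h' \<in> H" "y = h' + lie_scale L c' z"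
      using elem[OF xy(1)] elem[OF xy(2)] by auto
    have "br x y = br h h' + lie_scale L c' (br h z) + lie_scale L c (br z h')"
      using e by (simp add: br_simps br_self algebra_simps)
    also have "\<dots> \<in> H"
      by (intro g.subspace_add[OF sH] g.subspace_scale[OF sH] HH hz z(2) e)
    finally show ?thesis using HsH by auto
  qed
  obtain N where N: "\<And>v. v \<in> S \<Longrightarrow> (\<rho> z ^^ N) v = 0"
    using nilpotent_uniform[of z] nil[OF z(1)] by blast
  have zst: "\<rho> z v \<in> ann H i" if "v \<in> ann H i" for i v
    using that
  proof (induction i arbitrary: v)
    case 0
    then show ?case by (simp add: rho_lin)
  next
    case (Suc i)
    have vS: "v \<in> S" using Suc.prems by simp
    have "\<rho> h (\<rho> z v) \<in> ann H i" if h: "h \<in> H" for h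
    proof -
      have "\<rho> h (\<rho> z v) = \<rho> z (\<rho> h v) + \<rho> (br h z) v" using rho_br[OF vS, of h z] by simp
      moreover have "\<rho> z (\<rho> h v) \<in> ann H i" using Suc.IH Suc.prems h by auto
      moreover have "\<rho> (br h z) v \<in> ann H i" using Suc.prems hz[OF h] by auto
      ultimately show ?thesis using v.subspace_add[OF ann_subspace] by simp
    qed
    then show ?case using stable[OF vS] by simp
  qed
  have sub: "ann H i \<subseteq> ann ?H (i * N)" for i
  proof (induction i)
    case (Suc i)
    show ?case
    proof
      fix v assume v: "v \<in> ann H (Suc i)"
      have pw: "(\<rho> z ^^ j) v \<in> ann H (Suc i)" for j
        by (induction j) (simp_all add: v zst del: ann.simps)
      have "l \<le> N \<Longrightarrow> (\<rho> z ^^ (N - l)) v \<in> ann ?H (i * N + l)" for l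
      proof (induction l)
        case 0
        then show ?case using N v v.subspace_0[OF ann_subspace] by simp
      next
        case (Suc l)
        define w where "w = (\<rho> z ^^ (N - Suc l)) v"
        have w: "w \<in> ann H (Suc i)" using pw by (simp add: w_def)
        have wS: "w \<in> S" using w by simp
        have "Suc (N - Suc l) = N - l" using Suc.prems by simp
        then have "\<rho> z w = (\<rho> z ^^ (N - l)) v" unfolding w_def by (metis comp_apply funpow.simps(2))
        then have zw: "\<rho> z w \<in> ann ?H (i * N + l)" using Suc by simp
        have hw: "\<rho> h w \<in> ann ?H (i * N + l)" if "h \<in> H" for h
        proof -
          have "\<rho> h w \<in> ann H i" using w that by auto
          then show ?thesis using \<open>ann H i \<subseteq> ann ?H (i * N)\<close> ann_mono[of "i * N" "i * N + l" ?H] by auto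
        qed
        have "\<rho> x w \<in> ann ?H (i * N + l)" if x: "x \<in> ?H" for x
        proof -
          obtain h c where e: "h \<in> H" "x = h + lie_scale L c z" using elem[OF x] by auto
          show ?thesis using e wS hw[OF e(1)] zw
            by (simp add: rho_linx v.subspace_add[OF ann_subspace] v.subspace_scale[OF ann_subspace])
        qed
        then show ?case using wS unfolding w_def by simp
      qed
      from this[of N] show "v \<in> ann ?H (Suc i * N)" by (simp add: add.commute)
    qed
  qed simp
  have "ann ?H (k * N) = S" using sub[of k] ann_S k by auto
  moreover have "?H \<subseteq> J" by (rule g.span_minimal) (use z HJ sJ in auto)
  ultimately show ?thesis
    unfolding engel_good_def using closed ker HsH by (intro conjI) (auto intro: exI)
qed

text \<open>A good subalgebra of maximal dimension is \<open>J\<close> itself, since it could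
  otherwise be enlarged by a normalizing element. Then \<open>ann J 1 \<noteq> {0}\<close>, because
  a series that stays at 0 in its first step never leaves it.\<close>

lemma engel:
  assumes sJ: "g.subspace J" and J: "\<And>x y. x \<in> J \<Longrightarrow> y \<in> J \<Longrightarrow> br x y \<in> J"
    and nil: "\<And>x v. x \<in> J \<Longrightarrow> v \<in> S \<Longrightarrow> \<exists>k. (\<rho> x ^^ k) v = 0" and S0: "S \<noteq> {0}"
  obtains m where "m \<in> S" "m \<noteq> 0" "\<And>x. x \<in> J \<Longrightarrow> \<rho> x m = 0"
proof -
  let ?K = "{x\<in>J. \<forall>v\<in>S. \<rho> x v = 0}"
  have "g.subspace ?K"
    using g.subspace_0[OF sJ] g.subspace_add[OF sJ] g.subspace_scale[OF sJ]
    by (intro g.subspaceI) (auto simp: rho_linx)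
  moreover have "ann ?K (Suc 0) = S" by auto
  moreover have "br x y \<in> ?K" if "x \<in> ?K" "y \<in> ?K" for x y
    using that J by (auto simp: rho_br rho_lin)
  ultimately have K: "engel_good J ?K" unfolding engel_good_def by blast
  have bound: "\<forall>H. engel_good J H \<longrightarrow> g.dim H < Suc (g.dim UNIV)"
    using g.fdim_sub(2)[OF fdL] by (auto simp: engel_good_def less_Suc_eq_le)
  obtain H where H: "engel_good J H" "\<And>H'. engel_good J H' \<Longrightarrow> g.dim H' \<le> g.dim H"
    using ex_has_greatest_nat[of "engel_good J", OF K bound] by blast
  have "H = J"
  proof (rule ccontr)
    assume "H \<noteq> J"
    then obtain z where z: "z \<in> J" "z \<notin> H" "\<And>h. h \<in> H \<Longrightarrow> br z h \<in> H"
      using engel_normalizer[OF J H(1)] by blast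
    let ?H = "g.span (insert z H)"
    have le: "g.dim ?H \<le> g.dim H" by (rule H(2)[OF engel_extend[OF sJ J nil H(1) z(1,3)]])
    have sub: "H \<subseteq> ?H" using g.span_superset by blast
    have sH: "g.subspace H" using H(1) by (simp add: engel_good_def)
    have fH: "g.fdim ?H" by (rule g.fdim_sub(1)[OF fdL]) auto
    have "H = ?H" using g.fdim_sub(2,3)[OF fH sH sub] le by simp
    then show False using z(2) g.span_base[of z "insert z H"] by auto
  qed
  then obtain k where k: "ann J k = S" using H(1) by (auto simp: engel_good_def)
  have "ann J 1 \<noteq> {0}"
  proof
    assume a: "ann J 1 = {0}"
    have "ann J i = {0}" for i
    proof (induction i)
      case (Suc i)
      then show ?case using a by simp
    qed simp
    then show False using k S0 by simp
  qed
  then obtain m where "m \<in> ann J 1" "m \<noteq> 0" using v.subspace_0[OF ann_subspace[of J 1]] by blast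
  then show ?thesis using that by auto
qed

lemma lmod_sub:
  assumes "v.subspace U" "U \<subseteq> S" "\<And>x v. v \<in> U \<Longrightarrow> \<rho> x v \<in> U"
  shows "lmod L sc U \<rho>"
proof (intro lmod.intro lmod_axioms.intro fdlie_axioms v.cvec_axioms)
  show "v.fdim U" by (rule v.fdim_sub(1)[OF fd assms(1,2)])
  show "clinear (lie_scale L) sc (\<lambda>x. \<rho> x v)" if "v \<in> U" for v
    using linx that assms(2) by blast
  show "\<rho> (br x y) v = \<rho> x (\<rho> y v) - \<rho> y (\<rho> x v)" if "v \<in> U" for v x y
    using rho_br that assms(2) by blast
qed (use assms(3) lin in blast)+

end

section \<open>Nondegenerate symmetric forms and dual bases\<close>

context cvec
begin

lemma subspace_nonzero:
  assumes "subspace P" "P \<noteq> {0}"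
  obtains z where "z \<in> P" "z \<noteq> 0"
  using assms subspace_0 by blast

text \<open>Every functional cuts the dimension down by at most 1.\<close>

lemma common_kernel_dim:
  assumes S: "fdim S" and F: "finite F" "\<And>f. f \<in> F \<Longrightarrow> clinear scale (*) f"
  shows "fdim {y\<in>S. \<forall>f\<in>F. f y = 0}" "dim S \<le> dim {y\<in>S. \<forall>f\<in>F. f y = 0} + card F"
proof -
  interpret c: cvec2 scale "(*)" by (rule cvec2_complex)
  have "fdim {y\<in>S. \<forall>f\<in>F. f y = 0} \<and> dim S \<le> dim {y\<in>S. \<forall>f\<in>F. f y = 0} + card F"
    using F
  proof (induction F rule: finite_induct)
    case empty
    then show ?case using S by simp
  next
    case (insert f F)
    let ?K = "{y\<in>S. \<forall>f\<in>F. f y = 0}"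
    have IH: "fdim ?K" "dim S \<le> dim ?K + card F" using insert by auto
    have e: "{y\<in>S. \<forall>f\<in>insert f F. f y = 0} = {y\<in>?K. f y = 0}" by auto
    note f = c.linear_onI_linear[of f ?K] insert(4)[of f]
    have "fdim {y\<in>?K. f y = 0}"
      by (rule fdim_sub(1)[OF IH(1) c.subspace_kernel_on[OF _ fdim_subspace[OF IH(1)]]]) (use f in auto)
    moreover have vs: "vector_space ((*) :: complex \<Rightarrow> complex \<Rightarrow> complex)"
      using cvec2_complex by (simp add: cvec2_def cvec_def)
    have "vector_space.dim (*) (f ` ?K) \<le> card {1::complex}"
      by (rule vector_space.dim_le_card[OF vs])
         (auto simp: module.span_singleton[OF iffD2[OF module_iff_vector_space vs]])
    then have "dim ?K \<le> dim {y\<in>?K. f y = 0} + 1"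
      using c.dim_image_kernel(2)[OF IH(1), of f] f by simp
    ultimately show ?case unfolding e using IH(2) insert(1,2) by simp
  qed
  then show "fdim {y\<in>S. \<forall>f\<in>F. f y = 0}" "dim S \<le> dim {y\<in>S. \<forall>f\<in>F. f y = 0} + card F" by auto
qed

text \<open>The conditions for \<open>x \<in> X - {y}\<close> are fewer than \<open>dim C\<close>,
  so they have a nonzero common solution \<open>z\<close>. Nondegeneracy gives
  \<open>B y z \<noteq> 0\<close>, and \<open>z\<close> is rescaled.\<close>

lemma form_dual_basis:
  assumes C: "fdim C" and X: "finite X" "independent X" "span X = C"
    and B: "\<And>y. clinear scale (*) (\<lambda>x. B x y)" and sym: "\<And>x y. B x y = B y x"
    and nd: "\<And>x. x \<in> C \<Longrightarrow> (\<And>y. y \<in> C \<Longrightarrow> B x y = 0) \<Longrightarrow> x = 0"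
  obtains d where "\<And>x. x \<in> X \<Longrightarrow> d x \<in> C" "\<And>x y. x \<in> X \<Longrightarrow> y \<in> X \<Longrightarrow> B x (d y) = (if x = y then 1 else 0)"
proof -
  interpret c: cvec2 scale "(*)" by (rule cvec2_complex)
  have cX: "card X = dim C" using X(2,3) dim_span_eq_card_independent by metis
  have "\<exists>d\<in>C. \<forall>x\<in>X. B x d = (if x = y then 1 else 0)" if y: "y \<in> X" for y
  proof -
    let ?P = "{z\<in>C. \<forall>f\<in>(\<lambda>x z. B z x) ` (X - {y}). f z = 0}"
    have lt: "card ((\<lambda>x z. B z x) ` (X - {y})) < card X"
      using card_image_le[of "X - {y}" "\<lambda>x z. B z x"] X(1) y card_Diff1_less[OF X(1) y] by simp
    have Fl: "clinear scale (*) f" if "f \<in> (\<lambda>x z. B z x) ` (X - {y})" for f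
      using that B by auto
    have fF: "finite ((\<lambda>x z. B z x) ` (X - {y}))" using X(1) by simp
    have fP: "fdim ?P" by (rule common_kernel_dim(1)[OF C fF Fl])
    have "dim C \<le> dim ?P + card ((\<lambda>x z. B z x) ` (X - {y}))"
      by (rule common_kernel_dim(2)[OF C fF Fl])
    then have "dim ?P \<noteq> 0" using lt cX by linarith
    then have "?P \<noteq> {0}" using fdim_dim_0[OF fP] by simp
    then obtain z where z: "z \<in> ?P" "z \<noteq> 0" by (rule subspace_nonzero[OF fdim_subspace[OF fP]])
    have zC: "z \<in> C" using z(1) by simp
    have zX: "B x z = 0" if "x \<in> X" "x \<noteq> y" for x
    proof -
      have "B z x = 0" using z(1) that by auto
      then show ?thesis by (simp only: sym[of x z])
    qed
    have nz: "B y z \<noteq> 0"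
    proof
      assume "B y z = 0"
      then have all: "B x z = 0" if "x \<in> X" for x using zX that by (cases "x = y") auto
      have "B x z = 0" if "x \<in> span X" for x
        using c.linear_eq_0_on_span[OF B, of X z x] all that by blast
      then have "B z x = 0" if "x \<in> C" for x using that unfolding X(3) sym[of z] by blast
      moreover have "z \<in> C" using z by simp
      ultimately show False using nd z(2) by blast
    qed
    have r: "B x (scale a z) = a * B x z" for x a
      unfolding sym[of x] by (rule c.linear_scale[OF B])
    show ?thesis
    proof (rule bexI[of _ "scale (inverse (B y z)) z"])
      show "\<forall>x\<in>X. B x (scale (inverse (B y z)) z) = (if x = y then 1 else 0)"
        using zX nz by (auto simp: r)
      show "scale (inverse (B y z)) z \<in> C" using z subspace_scale[OF fdim_subspace[OF C]] by simp
    qed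
  qed
  then have "\<forall>y\<in>X. \<exists>d. d \<in> C \<and> (\<forall>x\<in>X. B x d = (if x = y then 1 else 0))" by blast
  from bchoice[OF this] show ?thesis using that by blast
qed

lemma form_expand:
  assumes C: "fdim C" and X: "finite X" "independent X" "span X = C"
    and B: "\<And>y. clinear scale (*) (\<lambda>x. B x y)" and sym: "\<And>x y. B x y = B y x"
    and nd: "\<And>x. x \<in> C \<Longrightarrow> (\<And>y. y \<in> C \<Longrightarrow> B x y = 0) \<Longrightarrow> x = 0"
    and d: "\<And>x. x \<in> X \<Longrightarrow> d x \<in> C" "\<And>x y. x \<in> X \<Longrightarrow> y \<in> X \<Longrightarrow> B x (d y) = (if x = y then 1 else 0)"
    and z: "z \<in> C"
  shows "z = (\<Sum>x\<in>X. scale (B z (d x)) x)" "z = (\<Sum>x\<in>X. scale (B x z) (d x))"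
proof -
  interpret c: cvec2 scale "(*)" by (rule cvec2_complex)
  have r: "B x (\<Sum>i\<in>I. scale (a i) (f i)) = (\<Sum>i\<in>I. a i * B x (f i))" for x I a and f :: "_ \<Rightarrow> 'v"
    unfolding sym[of x] by (simp add: c.linear_sum[OF B] c.linear_scale[OF B])
  have z1: "z = (\<Sum>x\<in>X. scale (representation X z x) x)"
    using sum_representation_eq[OF X(2) _ X(1)] X(3) z by simp
  have "B z (d y) = representation X z y" if y: "y \<in> X" for y
  proof -
    have "B z (d y) = (\<Sum>x\<in>X. representation X z x * B x (d y))"
      by (subst z1) (simp add: c.linear_sum[OF B] c.linear_scale[OF B])
    also have "\<dots> = (\<Sum>x\<in>X. if x = y then representation X z x else 0)"
      by (rule sum.cong) (auto simp: d(2) y)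
    finally show ?thesis using y X(1) by simp
  qed
  then show "z = (\<Sum>x\<in>X. scale (B z (d x)) x)" using z1 by simp
  let ?w = "z - (\<Sum>x\<in>X. scale (B x z) (d x))"
  have wC: "?w \<in> C"
    by (intro subspace_diff[OF fdim_subspace[OF C]] z subspace_sum subspace_scale fdim_subspace[OF C] d)
  have "B y ?w = 0" if y: "y \<in> X" for y
  proof -
    have "B y (\<Sum>x\<in>X. scale (B x z) (d x)) = (\<Sum>x\<in>X. if x = y then B x z else 0)"
      unfolding r by (rule sum.cong) (auto simp: d(2) y)
    then have "B y (\<Sum>x\<in>X. scale (B x z) (d x)) = B y z" using y X(1) by simp
    moreover have "B y ?w = B y z - B y (\<Sum>x\<in>X. scale (B x z) (d x))"
      unfolding sym[of y] by (rule c.linear_diff[OF B])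
    ultimately show ?thesis by simp
  qed
  then have "B y ?w = 0" if "y \<in> span X" for y
    using c.linear_eq_0_on_span[OF B, of X ?w y] that by blast
  then have "B ?w y = 0" if "y \<in> C" for y using that unfolding X(3) sym[of ?w] by blast
  then have "?w = 0" by (rule nd[OF wC])
  then show "z = (\<Sum>x\<in>X. scale (B x z) (d x))" by simp
qed

end

section \<open>Semisimple Lie algebras: the Killing form and perfect ideals\<close>

locale sslie = liealg +
  assumes ss: "semisimple L"
begin

sublocale fdlie
  by unfold_locales (use ss in \<open>auto simp: g.fdim_def semisimple_def\<close>)

lemma abelian_ideal:
  assumes I: "lie_ideal L I" and ab: "\<And>x y. x \<in> I \<Longrightarrow> y \<in> I \<Longrightarrow> br x y = 0"
  shows "I = {0}"
proof -
  have "derived_lie L I \<subseteq> {0}"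
    unfolding derived_lie_def by (rule g.span_minimal) (use ab in auto)
  moreover have "0 \<in> derived_lie L I" unfolding derived_lie_def by (rule g.span_zero)
  ultimately have "(derived_lie L ^^ 1) I = {0}" by auto
  then show ?thesis using ss I unfolding semisimple_def solvable_lie_def by blast
qed

lemma ad_lmod: "lmod L (lie_scale L) UNIV br"
proof (intro lmod.intro lmod_axioms.intro fdlie_axioms g.cvec_axioms)
  show "br (br x y) v = br x (br y v) - br y (br x v)" for x y v by (rule jacobi)
qed (use fdL br_linear br_linear_left in auto)

sublocale ad: lmod L "lie_scale L" UNIV br
  by (rule ad_lmod)

text \<open>By the nilpotency criterion \<open>[J, g]\<close> consists of ad-nilpotent elements. If
  it were nonzero, Engel's theorem would give it a nonzero center, which is an abelian ideal. Hence
  \<open>[J, g] = 0\<close>, and \<open>J\<close> itself is abelian.\<close>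

lemma killing_zero_ideal:
  assumes J: "lie_ideal L J" and z: "\<And>x y. x \<in> J \<Longrightarrow> y \<in> J \<Longrightarrow> ad.tform x y = 0"
  shows "J = {0}"
proof -
  let ?J = "lbr J"
  note iJ = lbr_ideal[OF J]
  have nil: "\<exists>k. (br x ^^ k) v = 0" if "x \<in> ?J" for x v
    by (rule ad.cartan_nilpotent[OF J z that]) auto
  have "?J = {0}"
  proof (rule ccontr)
    assume ne: "?J \<noteq> {0}"
    interpret m: lmod L "lie_scale L" ?J br
      by (rule ad.lmod_sub) (use ideal_subspace[OF iJ] ideal_br[OF iJ] in auto)
    obtain m where m: "m \<in> ?J" "m \<noteq> 0" "\<And>x. x \<in> ?J \<Longrightarrow> br x m = 0"
      using m.engel[OF ideal_subspace[OF iJ] ideal_br[OF iJ] nil ne] by blast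
    let ?Z = "{m\<in>?J. \<forall>x\<in>?J. br x m = 0}"
    have "lie_ideal L ?Z"
      unfolding lie_ideal_def
    proof (intro conjI allI ballI)
      show "g.subspace ?Z"
        using ideal_subspace[OF iJ] by (intro g.subspaceI) (auto simp: br_simps g.subspace_0 g.subspace_add g.subspace_scale)
      fix y m assume m: "m \<in> ?Z"
      have "br x (br y m) = 0" if x: "x \<in> ?J" for x
        using jacobi[of x y m] m x ideal_br_left[OF iJ x, of y] by (simp add: br_simps)
      then show "br y m \<in> ?Z" using m ideal_br[OF iJ] by simp
    qed
    then have "?Z = {0}" by (rule abelian_ideal) auto
    then show False using m by blast
  qed
  then have "br u v = 0" if "u \<in> J" for u v
    using g.span_base[of "br u v" "{br u v |u v. u \<in> J}"] that unfolding lbr_def by blast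
  then show ?thesis by (intro abelian_ideal[OF J]) auto
qed

lemma ideal_perp: "lie_ideal L D \<Longrightarrow> D \<inter> {x. \<forall>y\<in>D. ad.tform x y = 0} = {0}"
proof (rule killing_zero_ideal)
  assume D: "lie_ideal L D"
  show "lie_ideal L (D \<inter> {x. \<forall>y\<in>D. ad.tform x y = 0})"
    using D ad.tform_perp_ideal[OF D] g.subspace_inter unfolding lie_ideal_def by auto
qed auto

text \<open>The Killing form is nondegenerate on the derived ideal \<open>D\<close> of
  \<open>R\<close>, so \<open>R\<close> is the sum of \<open>D\<close> and of the part of
  \<open>R\<close> orthogonal to \<open>D\<close>. Brackets within this part lie in \<open>D\<close>
  and are orthogonal to it, so the part is an abelian ideal and vanishes.\<close>

lemma ideal_perfect:
  assumes R: "lie_ideal L R"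
  shows "derived_lie L R = R"
proof
  let ?D = "derived_lie L R"
  let ?P = "{x. \<forall>y\<in>?D. ad.tform x y = 0}"
  note iD = derived_ideal[OF R]
  note iP = ad.tform_perp_ideal[OF iD]
  note DR = derived_subset[OF R]
  interpret c: cvec2 "lie_scale L" "(*)" by (rule g.cvec2_complex)
  show "?D \<subseteq> R" by (rule DR)
  have fD: "g.fdim ?D" by (rule g.fdim_sub(1)[OF fdL ideal_subspace[OF iD]]) simp
  obtain X where X: "finite X" "g.independent X" "X \<subseteq> ?D" "g.span X = ?D" "card X = g.dim ?D"
    by (rule g.fdim_basis[OF fD])
  have nd: "x = 0" if "x \<in> ?D" "\<And>y. y \<in> ?D \<Longrightarrow> ad.tform x y = 0" for x
    using ideal_perp[OF iD] that by blast
  obtain d where d: "\<And>x. x \<in> X \<Longrightarrow> d x \<in> ?D"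
      "\<And>x y. x \<in> X \<Longrightarrow> y \<in> X \<Longrightarrow> ad.tform x (d y) = (if x = y then 1 else 0)"
    using g.form_dual_basis[OF fD X(1,2,4) ad.tform_linear ad.tform_sym nd] by blast
  let ?J = "R \<inter> ?P"
  have iJ: "lie_ideal L ?J"
    using R iP g.subspace_inter unfolding lie_ideal_def by auto
  have J0: "?J = {0}"
  proof (rule abelian_ideal[OF iJ])
    fix x y assume xy: "x \<in> ?J" "y \<in> ?J"
    have "br x y \<in> ?D" unfolding derived_lie_def using xy by (intro g.span_base) blast
    moreover have "br x y \<in> ?P" using ideal_br[OF iP] xy by blast
    ultimately show "br x y = 0" using ideal_perp[OF iD] by blast
  qed
  show "R \<subseteq> ?D"
  proof
    fix x assume x: "x \<in> R"
    \<comment> \<open>The orthogonal projection of \<open>x\<close> to the derived ideal, written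
      with the dual bases.\<close>
    define e where "e = (\<Sum>b\<in>X. lie_scale L (ad.tform x (d b)) b)"
    have eD: "e \<in> ?D" unfolding e_def
      by (intro g.subspace_sum g.subspace_scale ideal_subspace[OF iD]) (use X(3) in auto)
    have "ad.tform (x - e) y = 0" if y: "y \<in> ?D" for y
    proof -
      have "ad.tform e y = (\<Sum>b\<in>X. ad.tform x (d b) * ad.tform b y)"
        unfolding e_def by (simp add: c.linear_sum[OF ad.tform_linear] c.linear_scale[OF ad.tform_linear])
      also have "\<dots> = ad.tform (\<Sum>b\<in>X. lie_scale L (ad.tform b y) (d b)) x"
        by (simp add: c.linear_sum[OF ad.tform_linear] c.linear_scale[OF ad.tform_linear] ad.tform_sym[of x] mult.commute)
      also have "(\<Sum>b\<in>X. lie_scale L (ad.tform b y) (d b)) = y"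
        by (rule g.form_expand(2)[OF fD X(1,2,4) ad.tform_linear ad.tform_sym nd d y, symmetric])
      finally show ?thesis using ad.tform_sym[of x y] by (simp add: c.linear_diff[OF ad.tform_linear])
    qed
    then have "x - e \<in> ?J" using x eD DR g.subspace_diff[OF ideal_subspace[OF R]] by auto
    then have "x - e \<in> {0}" unfolding J0 .
    then have "x = e" by simp
    then show "x \<in> ?D" using eD by simp
  qed
qed

end

text \<open>
  In the irreducible case the radical of the trace form acts by scalars of trace zero, hence
  trivially; the Casimir element built from the trace form on a complement of the radical is
  then injective, and it turns the averaged cocycle into a primitive.
\<close>

locale irr_lmod = sslie L + lmod L sc S \<rho>
  for L :: "'g::ab_group_add lie" and sc :: "complex \<Rightarrow> 'v::ab_group_add \<Rightarrow> 'v" and S \<rho> +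
  assumes S0: "S \<noteq> {0}"
    and irr: "v.subspace U \<Longrightarrow> U \<subseteq> S \<Longrightarrow> (\<And>x v. v \<in> U \<Longrightarrow> \<rho> x v \<in> U) \<Longrightarrow> U = {0} \<or> U = S"
begin

lemma UNIV_derived: "x \<in> g.span {br u v |u v. True}"
  using ideal_perfect[of UNIV] by (auto simp: lie_ideal_def derived_lie_def)

definition rad where "rad = {x. \<forall>y\<in>UNIV. tform x y = 0}"

lemma rad_ideal: "lie_ideal L rad"
  unfolding rad_def by (rule tform_perp_ideal) (auto simp: lie_ideal_def)

text \<open>The algebra is spanned by brackets, and commutators have trace 0.\<close>

lemma tr_rho: "v.tr S (\<rho> x) = 0"
proof -
  have l2: "linear_on S sc sc (\<lambda>v. \<rho> x (\<rho> y v))" for x y by (intro rho_comp rho_on)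
  have i2: "(\<lambda>v. \<rho> x (\<rho> y v)) ` S \<subseteq> S" for x y using stable by auto
  have b: "v.tr S (\<rho> (br u w)) = 0" for u w
  proof -
    have "v.tr S (\<rho> (br u w)) = v.tr S (\<lambda>v. \<rho> u (\<rho> w v) - \<rho> w (\<rho> u v))"
      by (rule v.tr_cong[OF fd]) (simp add: rho_br)
    also have "\<dots> = tform u w - tform w u" unfolding tform_def by (rule v.tr_diff[OF fd l2 i2 l2 i2])
    finally show ?thesis using tform_sym[of u w] by simp
  qed
  have add: "v.tr S (\<rho> (x + y)) = v.tr S (\<rho> x) + v.tr S (\<rho> y)" for x y
  proof -
    have "v.tr S (\<rho> (x + y)) = v.tr S (\<lambda>v. \<rho> x v + \<rho> y v)"
      by (rule v.tr_cong[OF fd]) (simp add: rho_linx)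
    then show ?thesis using v.tr_add[OF fd rho_on rho_img rho_on rho_img] by simp
  qed
  have sc: "v.tr S (\<rho> (lie_scale L c x)) = c * v.tr S (\<rho> x)" for x c
  proof -
    have "v.tr S (\<rho> (lie_scale L c x)) = v.tr S (\<lambda>v. sc c (\<rho> x v))"
      by (rule v.tr_cong[OF fd]) (simp add: rho_linx)
    then show ?thesis using v.tr_scale[OF fd rho_on rho_img] by simp
  qed
  have z: "v.tr S (\<rho> 0) = 0" using sc[of 0 0] by simp
  show ?thesis
    using UNIV_derived[of x] by (induction rule: g.span_induct_alt) (auto simp: z add sc b)
qed

text \<open>The nilpotency criterion and Engel's theorem produce a nonzero vector killed by
  \<open>[rad, g]\<close>. Such vectors form a submodule, which is \<open>S\<close> by
  irreducibility. So \<open>\<rho> r\<close> commutes with the action, and an eigenspace of it is a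
  submodule and again equal to \<open>S\<close>.\<close>

lemma rad_trivial:
  assumes r: "r \<in> rad" and v: "v \<in> S"
  shows "\<rho> r v = 0"
proof -
  let ?J = "lbr rad"
  note iJ = lbr_ideal[OF rad_ideal]
  have tz: "tform x y = 0" if "x \<in> rad" "y \<in> rad" for x y using that by (simp add: rad_def)
  have nil: "\<exists>k. (\<rho> x ^^ k) v = 0" if "x \<in> ?J" "v \<in> S" for x v
    by (rule cartan_nilpotent[OF rad_ideal tz that])
  obtain m where m: "m \<in> S" "m \<noteq> 0" "\<And>x. x \<in> ?J \<Longrightarrow> \<rho> x m = 0"
    using engel[OF ideal_subspace[OF iJ] ideal_br[OF iJ] nil S0] by blast
  let ?N = "{m\<in>S. \<forall>x\<in>?J. \<rho> x m = 0}"
  have "?N = {0} \<or> ?N = S"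
  proof (rule irr)
    show "v.subspace ?N" using sS by (intro v.subspaceI) (auto simp: rho_lin v.subspace_0 v.subspace_add v.subspace_scale)
    fix y m assume m: "m \<in> ?N"
    have "\<rho> x (\<rho> y m) = 0" if x: "x \<in> ?J" for x
    proof -
      have "\<rho> (br x y) m = 0" using m ideal_br_left[OF iJ x, of y] by blast
      then show ?thesis using rho_br[of m x y] m x by (simp add: rho_lin)
    qed
    then show "\<rho> y m \<in> ?N" using m stable by simp
  qed auto
  then have N: "?N = S" using m by blast
  have comm: "\<rho> r (\<rho> y v) = \<rho> y (\<rho> r v)" if "v \<in> S" for y v
  proof -
    have "br r y \<in> ?J" unfolding lbr_def by (intro g.span_base) (use r in blast)
    then have "\<rho> (br r y) v = 0" using N that by blast
    then show ?thesis using rho_br[OF that, of r y] by simp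
  qed
  obtain a w where aw: "w \<in> S" "w \<noteq> 0" "\<rho> r w = sc a w"
    by (rule v.eigenvector_exists[OF fd rho_on rho_img S0])
  let ?E = "{w\<in>S. \<rho> r w = sc a w}"
  have "?E = {0} \<or> ?E = S"
  proof (rule irr)
    show "v.subspace ?E"
      using sS by (intro v.subspaceI) (auto simp: rho_lin v.subspace_0 v.subspace_add v.subspace_scale v.scale_right_distrib v.scale_left_commute)
    show "\<rho> y m \<in> ?E" if "m \<in> ?E" for y m using that comm stable by (simp add: rho_lin)
  qed auto
  then have E: "\<rho> r v = sc a v" if "v \<in> S" for v using aw that by blast
  have "0 = v.tr S (\<lambda>v. sc a v)" using tr_rho[of r] v.tr_cong[OF fd, of "\<rho> r" "sc a"] E by simp
  also have "\<dots> = a * of_nat (v.dim S)"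
    using v.tr_scale[OF fd v.linear_on_id, of a] v.tr_id[OF fd] by auto
  finally have "a = 0" using v.fdim_dim_0[OF fd] S0 by simp
  then show ?thesis using E[OF v] by simp
qed

lemma cocycle_coboundary:
  assumes c: "clinear (lie_scale L) sc c" "\<And>x. c x \<in> S"
    "\<And>x y. c (br x y) = \<rho> x (c y) - \<rho> y (c x)"
  shows "\<exists>m\<in>S. \<forall>x. c x = \<rho> x m"
proof (cases "\<forall>x. \<forall>v\<in>S. \<rho> x v = 0")
  case True
  have b: "c (br u w) = 0" for u w using True c(2,3) by simp
  have "c x = 0" for x
    using UNIV_derived[of x]
    by (induction rule: g.span_induct_alt) (auto simp: gv.linear_0[OF c(1)] gv.linear_add[OF c(1)] gv.linear_scale[OF c(1)] b)
  then show ?thesis using True v.subspace_0[OF sS] by auto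
next
  case False
  note lc = gv.linear_0[OF c(1)] gv.linear_add[OF c(1)] gv.linear_scale[OF c(1)]
  have "c (br x y) = 0" if "x \<in> rad" "y \<in> rad" for x y
    using rad_trivial that c(2,3) by simp
  \<comment> \<open>The ideal \<open>rad\<close> is perfect and acts as 0, and then the cocycle
    identity makes \<open>c\<close> vanish on its brackets.\<close>
  then have c0: "c x = 0" if "x \<in> rad" for x
  proof -
    have "x \<in> g.span {br u v |u v. u \<in> rad \<and> v \<in> rad}"
      using ideal_perfect[OF rad_ideal] that by (simp add: derived_lie_def)
    then show ?thesis
      using \<open>\<And>x y. x \<in> rad \<Longrightarrow> y \<in> rad \<Longrightarrow> c (br x y) = 0\<close>
      by (induction rule: g.span_induct_alt) (auto simp: lc)
  qed
  obtain \<pi> where \<pi>: "clinear (lie_scale L) (lie_scale L) \<pi>" "\<And>v. v \<in> UNIV \<Longrightarrow> \<pi> v \<in> rad"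
      "\<And>t. t \<in> rad \<Longrightarrow> \<pi> t = t"
    using g.projection[OF fdL ideal_subspace[OF rad_ideal]] by blast
  interpret \<pi>: Vector_Spaces.linear "lie_scale L" "lie_scale L" \<pi> by (rule \<pi>(1))
  interpret cc: cvec2 "lie_scale L" "(*)" by (rule g.cvec2_complex)
  \<comment> \<open>A linear complement of \<open>rad\<close>, chosen without regard to the bracket.
    The trace form is nondegenerate on it.\<close>
  define C where "C = {x. \<pi> x = 0}"
  have fC: "g.fdim C" unfolding C_def by (rule g.fdim_sub(1)[OF fdL \<pi>.subspace_kernel]) simp
  have split: "x - \<pi> x \<in> C" for x using \<pi>(2,3) by (simp add: C_def \<pi>.diff)
  have tp: "tform (\<pi> x) y = 0" "tform y (\<pi> x) = 0" for x y
    using \<pi>(2)[of x] tform_sym[of y] by (auto simp: rad_def)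
  have nd: "x = 0" if x: "x \<in> C" "\<And>y. y \<in> C \<Longrightarrow> tform x y = 0" for x
  proof -
    have "tform x y = 0" for y
    proof -
      have "tform y x = tform (y - \<pi> y) x + tform (\<pi> y) x"
        using cc.linear_add[OF tform_linear, of "y - \<pi> y" "\<pi> y" x] by simp
      then show ?thesis using x(2)[OF split[of y]] tp tform_sym by simp
    qed
    then have "x \<in> rad" by (simp add: rad_def)
    then show ?thesis using \<pi>(3) x(1) by (simp add: C_def)
  qed
  obtain X where X: "finite X" "g.independent X" "X \<subseteq> C" "g.span X = C" "card X = g.dim C"
    by (rule g.fdim_basis[OF fC])
  obtain d where d: "\<And>x. x \<in> X \<Longrightarrow> d x \<in> C"
      "\<And>x y. x \<in> X \<Longrightarrow> y \<in> X \<Longrightarrow> tform x (d y) = (if x = y then 1 else 0)"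
    using g.form_dual_basis[OF fC X(1,2,4) tform_linear tform_sym nd] by blast
  have expand1: "w = (\<Sum>x\<in>X. lie_scale L (tform w (d x)) x)" if w: "w \<in> C" for w
    by (rule g.form_expand(1)[OF fC X(1,2,4) tform_linear tform_sym nd d w])
  have expand2: "w = (\<Sum>x\<in>X. lie_scale L (tform x w) (d x))" if w: "w \<in> C" for w
    by (rule g.form_expand(2)[OF fC X(1,2,4) tform_linear tform_sym nd d w])
  \<comment> \<open>Expansions in the dual bases hold modulo \<open>rad\<close>; they become
    identities after applying a linear map that vanishes on \<open>rad\<close>.\<close>
  have exp1: "F z = (\<Sum>x\<in>X. sc (tform z (d x)) (F x))"
    and exp2: "F z = (\<Sum>x\<in>X. sc (tform x z) (F (d x)))"
    if F: "clinear (lie_scale L) sc F" "\<And>x. x \<in> rad \<Longrightarrow> F x = 0" for F z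
  proof -
    have "F z = F (z - \<pi> z) + F (\<pi> z)" using gv.linear_add[OF F(1), of "z - \<pi> z" "\<pi> z"] by simp
    then have Fz: "F z = F (z - \<pi> z)" using F(2) \<pi>(2) by simp
    have "tform (z - \<pi> z) y = tform z y" "tform y (z - \<pi> z) = tform y z" for y
      using tform_sym[of y "z - \<pi> z"] tform_sym[of y z] by (simp_all add: cc.linear_diff[OF tform_linear] tp)
    then have e: "z - \<pi> z = (\<Sum>x\<in>X. lie_scale L (tform z (d x)) x)" "z - \<pi> z = (\<Sum>x\<in>X. lie_scale L (tform x z) (d x))"
      using expand1[OF split[of z]] expand2[OF split[of z]] by simp_all
    show "F z = (\<Sum>x\<in>X. sc (tform z (d x)) (F x))"
      unfolding Fz by (subst e(1)) (simp add: gv.linear_sum[OF F(1)] gv.linear_scale[OF F(1)])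
    show "F z = (\<Sum>x\<in>X. sc (tform x z) (F (d x)))"
      unfolding Fz by (subst e(2)) (simp add: gv.linear_sum[OF F(1)] gv.linear_scale[OF F(1)])
  qed
  have Flin: "clinear (lie_scale L) sc (\<lambda>x. \<rho> x v)" "\<And>x. x \<in> rad \<Longrightarrow> \<rho> x v = 0" if "v \<in> S" for v
    using linx rad_trivial that by auto
  \<comment> \<open>Modulo \<open>rad\<close>, invariance of the form makes the matrix of
    \<open>ad z\<close> in the dual basis the negative transpose of the one in \<open>X\<close>, so
    the two sums cancel. The map \<open>F\<close> will be the action on a fixed vector, and the
    cocycle.\<close>
  have casimir: "(\<Sum>x\<in>X. \<rho> (br z x) (F (d x)) + \<rho> x (F (br z (d x)))) = 0"
    if F: "clinear (lie_scale L) sc F" "\<And>x. x \<in> rad \<Longrightarrow> F x = 0" "\<And>x. F x \<in> S" for F z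
  proof -
    have "(\<Sum>x\<in>X. \<rho> (br z x) (F (d x))) = (\<Sum>x\<in>X. \<Sum>y\<in>X. sc (tform (br z x) (d y)) (\<rho> y (F (d x))))"
      by (rule sum.cong[OF refl]) (rule exp1[OF Flin[OF F(3)]])
    also have "\<dots> = (\<Sum>y\<in>X. \<Sum>x\<in>X. sc (tform (br z x) (d y)) (\<rho> y (F (d x))))"
      by (rule sum.swap)
    finally have 1: "(\<Sum>x\<in>X. \<rho> (br z x) (F (d x))) = (\<Sum>y\<in>X. \<Sum>x\<in>X. sc (tform (br z x) (d y)) (\<rho> y (F (d x))))" .
    have "(\<Sum>x\<in>X. \<rho> x (F (br z (d x)))) = (\<Sum>x\<in>X. \<Sum>y\<in>X. sc (tform y (br z (d x))) (\<rho> x (F (d y))))"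
    proof (rule sum.cong[OF refl])
      fix x
      have "F (br z (d x)) = (\<Sum>y\<in>X. sc (tform y (br z (d x))) (F (d y)))" by (rule exp2[OF F(1,2)])
      then show "\<rho> x (F (br z (d x))) = (\<Sum>y\<in>X. sc (tform y (br z (d x))) (\<rho> x (F (d y))))"
        by (simp add: v.self.linear_sum[OF lin] rho_lin)
    qed
    moreover have "tform y (br z w) = - tform (br z y) w" for y w
      using tform_inv[of y z w] br_anti[of y z] cc.linear_neg[OF tform_linear] by simp
    ultimately have 2: "(\<Sum>x\<in>X. \<rho> x (F (br z (d x)))) = (\<Sum>x\<in>X. \<Sum>y\<in>X. - sc (tform (br z y) (d x)) (\<rho> x (F (d y))))"
      by simp
    show ?thesis unfolding sum.distrib 1 2 by (simp add: sum_negf)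
  qed
  \<comment> \<open>The Casimir operator. It commutes with the action, and its trace is
    \<open>card X\<close>, which is positive because the action is nontrivial.\<close>
  define \<Omega> where "\<Omega> = (\<lambda>v. \<Sum>x\<in>X. \<rho> x (\<rho> (d x) v))"
  have \<Omega>l: "linear_on S sc sc \<Omega>"
    by (auto simp: \<Omega>_def linear_on_def rho_lin sum.distrib v.scale_sum_right)
  have \<Omega>S: "\<Omega> v \<in> S" if "v \<in> S" for v
    unfolding \<Omega>_def by (intro v.subspace_sum[OF sS] stable that)
  have \<Omega>comm: "\<rho> z (\<Omega> v) = \<Omega> (\<rho> z v)" if v: "v \<in> S" for z v
  proof -
    have "\<rho> z (\<rho> x (\<rho> (d x) v)) = \<rho> x (\<rho> (d x) (\<rho> z v)) + (\<rho> (br z x) (\<rho> (d x) v) + \<rho> x (\<rho> (br z (d x)) v))" for x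
      using v by (simp add: rho_br stable rho_lin)
    then have "\<rho> z (\<Omega> v) = \<Omega> (\<rho> z v) + (\<Sum>x\<in>X. \<rho> (br z x) (\<rho> (d x) v) + \<rho> x (\<rho> (br z (d x)) v))"
      by (simp add: \<Omega>_def v.self.linear_sum[OF lin] sum.distrib)
    also have "(\<Sum>x\<in>X. \<rho> (br z x) (\<rho> (d x) v) + \<rho> x (\<rho> (br z (d x)) v)) = 0"
      by (rule casimir[OF Flin[OF v] stable[OF v]])
    finally show ?thesis by simp
  qed
  have tr\<Omega>: "v.tr S \<Omega> = of_nat (card X)"
  proof -
    have "v.tr S \<Omega> = (\<Sum>x\<in>X. tform x (d x))"
      unfolding \<Omega>_def tform_def by (rule v.tr_sum[OF fd]) (use stable in \<open>auto intro!: rho_comp rho_on\<close>)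
    also have "\<dots> = (\<Sum>x\<in>X. 1)" by (rule sum.cong) (auto simp: d(2))
    finally show ?thesis by simp
  qed
  have "X \<noteq> {}"
  proof
    assume "X = {}"
    then have "C = {0}" using X(4) by simp
    then have "x - \<pi> x = 0" for x using split[of x] by blast
    then have "x \<in> rad" for x using \<pi>(2)[of x] by simp
    then show False using False rad_trivial by blast
  qed
  then have tr0: "v.tr S \<Omega> \<noteq> 0" using tr\<Omega> X(1) by simp
  let ?K = "{v\<in>S. \<Omega> v = 0}"
  have "?K = {0} \<or> ?K = S"
  proof (rule irr)
    show "v.subspace ?K" by (rule v.self.subspace_kernel_on[OF \<Omega>l sS])
    show "\<rho> x v \<in> ?K" if "v \<in> ?K" for x v using that \<Omega>comm[of v x] stable by (simp add: rho_lin)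
  qed auto
  moreover have "?K \<noteq> S"
  proof
    assume "?K = S"
    then have "v.tr S \<Omega> = v.tr S (\<lambda>v. 0)" by (intro v.tr_cong[OF fd]) auto
    then show False using tr0 v.tr_0[OF fd] by simp
  qed
  ultimately have inj: "v = 0" if "v \<in> S" "\<Omega> v = 0" for v using that by blast
  have surj: "\<Omega> ` S = S" by (rule v.inj_imp_surj_on[OF fd \<Omega>l _ inj]) (use \<Omega>S in auto)
  \<comment> \<open>The cocycle contracted with the dual bases. The cancellation gives
    \<open>\<rho> z m' = \<Omega> (c z)\<close>, so the preimage \<open>m\<close> of
    \<open>m'\<close> under \<open>\<Omega>\<close> is a primitive of \<open>c\<close>.\<close>
  define m' where "m' = (\<Sum>x\<in>X. \<rho> x (c (d x)))"
  have "m' \<in> S" unfolding m'_def by (intro v.subspace_sum[OF sS] stable c(2))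
  then obtain m where m: "m \<in> S" "\<Omega> m = m'" using surj by (metis imageE)
  have "c z = \<rho> z m" for z
  proof -
    have "\<rho> z (\<rho> x (c (d x))) = \<rho> x (\<rho> (d x) (c z)) + (\<rho> (br z x) (c (d x)) + \<rho> x (c (br z (d x))))" for x
      using c(2,3) by (simp add: rho_br stable rho_lin)
    then have "\<rho> z m' = \<Omega> (c z) + (\<Sum>x\<in>X. \<rho> (br z x) (c (d x)) + \<rho> x (c (br z (d x))))"
      by (simp add: m'_def \<Omega>_def v.self.linear_sum[OF lin] sum.distrib)
    also have "(\<Sum>x\<in>X. \<rho> (br z x) (c (d x)) + \<rho> x (c (br z (d x)))) = 0"
      by (rule casimir[OF c(1) c0 c(2)])
    finally have "\<Omega> (\<rho> z m) = \<Omega> (c z)" using \<Omega>comm[OF m(1), of z] m(2) by simp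
    then have "\<Omega> (c z - \<rho> z m) = 0"
      using v.self.linear_on_diff[OF \<Omega>l sS c(2)] stable[OF m(1)] by simp
    then have "c z - \<rho> z m = 0" using inj v.subspace_diff[OF sS c(2) stable[OF m(1)]] by blast
    then show ?thesis by simp
  qed
  then show ?thesis using m(1) by blast
qed

end

text \<open>Whitehead's first lemma by induction on the dimension. For a proper submodule
  \<open>U\<close> the quotient is realized on a complement \<open>C\<close> with the action
  \<open>\<kappa> \<rho>\<close>, where \<open>\<kappa> = 1 - \<pi>\<close> removes a component in
  \<open>U\<close>. A primitive modulo \<open>U\<close> leaves a cocycle with values in
  \<open>U\<close>, to which the induction applies again.\<close>

lemma (in sslie) cocycle_coboundary:
  fixes sc :: "complex \<Rightarrow> 'v::ab_group_add \<Rightarrow> 'v"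
  assumes "lmod L sc S \<rho>" "clinear (lie_scale L) sc c" "\<And>x. c x \<in> S"
    "\<And>x y. c (br x y) = \<rho> x (c y) - \<rho> y (c x)"
  shows "\<exists>m\<in>S. \<forall>x. c x = \<rho> x m"
  using assms
proof (induction "vector_space.dim sc S" arbitrary: S \<rho> c rule: less_induct)
  case (less S \<rho> c)
  interpret m: lmod L sc S \<rho> by (rule less.prems(1))
  note c = less.prems(2-4)
  note sS = m.sS
  show ?case
  proof (cases "S = {0}")
    case True
    then have "c x = 0" for x using c(2)[of x] by blast
    then show ?thesis using True by (simp add: m.rho_lin)
  next
    case S0: False
    show ?thesis
    proof (cases "\<exists>U. m.v.subspace U \<and> U \<subseteq> S \<and> (\<forall>x. \<forall>v\<in>U. \<rho> x v \<in> U) \<and> U \<noteq> {0} \<and> U \<noteq> S")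
      case False
      have "irr_lmod L sc S \<rho>"
        by (intro irr_lmod.intro sslie_axioms less.prems(1) irr_lmod_axioms.intro S0) (use False in blast)
      from irr_lmod.cocycle_coboundary[OF this c] show ?thesis .
    next
      case True
      then obtain U where U: "m.v.subspace U" "U \<subseteq> S" "\<And>x v. v \<in> U \<Longrightarrow> \<rho> x v \<in> U" "U \<noteq> {0}" "U \<noteq> S"
        by blast
      interpret u: lmod L sc U \<rho> by (rule m.lmod_sub[OF U(1-3)])
      have dU: "m.v.dim U < m.v.dim S"
        using m.v.fdim_sub(2,3)[OF m.fd U(1,2)] U(5) by fastforce
      have dU0: "m.v.dim U \<noteq> 0" using m.v.fdim_dim_0[OF u.fd] U(4) by simp
      obtain \<pi> where \<pi>: "clinear sc sc \<pi>" "\<And>v. v \<in> S \<Longrightarrow> \<pi> v \<in> U" "\<And>t. t \<in> U \<Longrightarrow> \<pi> t = t"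
        using m.v.projection[OF m.fd U(1,2)] by blast
      note \<pi>l = m.v.self.linear_add[OF \<pi>(1)] m.v.self.linear_diff[OF \<pi>(1)] m.v.self.linear_scale[OF \<pi>(1)] m.v.self.linear_0[OF \<pi>(1)]
      define \<kappa> where "\<kappa> = (\<lambda>v. v - \<pi> v)"
      have \<kappa>: "clinear sc sc \<kappa>"
        unfolding \<kappa>_def by (intro m.v.self.linear_compose_sub m.v.linear_ident \<pi>(1))
      note \<kappa>l = m.v.self.linear_add[OF \<kappa>] m.v.self.linear_diff[OF \<kappa>] m.v.self.linear_scale[OF \<kappa>] m.v.self.linear_0[OF \<kappa>]
      have \<kappa>U: "\<kappa> u = 0" if "u \<in> U" for u using \<pi>(3)[OF that] by (simp add: \<kappa>_def)
      define C where "C = {v\<in>S. \<pi> v = 0}"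
      have \<kappa>S: "\<kappa> v \<in> C" if "v \<in> S" for v
        using that \<pi>(2)[OF that] \<pi>(3)[OF \<pi>(2)[OF that]] U(2) m.v.subspace_diff[OF sS that] by (auto simp: C_def \<kappa>_def \<pi>l)
      have sC: "m.v.subspace C" unfolding C_def
        by (rule m.v.self.subspace_kernel_on[OF m.v.self.linear_onI_linear[OF \<pi>(1)] sS])
      have CS: "C \<subseteq> S" by (auto simp: C_def)
      have fC: "m.v.fdim C" by (rule m.v.fdim_sub(1)[OF m.fd sC CS])
      have "\<pi> ` S = U" using \<pi>(2,3) U(2) by force
      then have "m.v.dim U + m.v.dim C = m.v.dim S"
        using m.v.self.dim_image_kernel(2)[OF m.fd m.v.self.linear_onI_linear[OF \<pi>(1)]] by (simp add: C_def)
      then have dC: "m.v.dim C < m.v.dim S" using dU0 by simp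
      have \<kappa>\<rho>: "\<kappa> (\<rho> x (\<kappa> v)) = \<kappa> (\<rho> x v)" if "v \<in> S" for x v
      proof -
        have "\<kappa> (\<rho> x (\<pi> v)) = 0" by (intro \<kappa>U U(3) \<pi>(2) that)
        then show ?thesis by (simp add: \<kappa>_def[of] m.rho_lin \<pi>l)
      qed
      have "lmod L sc C (\<lambda>x v. \<kappa> (\<rho> x v))"
      proof (intro lmod.intro lmod_axioms.intro fdlie_axioms m.v.cvec_axioms fC)
        show "\<kappa> (\<rho> x v) \<in> C" if "v \<in> C" for x v using that \<kappa>S m.stable CS by blast
        show "clinear sc sc (\<lambda>v. \<kappa> (\<rho> x v))" for x
          using Vector_Spaces.linear_compose[OF m.lin \<kappa>] by (simp add: o_def)
        show "clinear (lie_scale L) sc (\<lambda>x. \<kappa> (\<rho> x v))" if "v \<in> C" for v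
          using Vector_Spaces.linear_compose[OF m.linx \<kappa>, of v] that CS by (auto simp: o_def)
        show "\<kappa> (\<rho> (br x y) v) = \<kappa> (\<rho> x (\<kappa> (\<rho> y v))) - \<kappa> (\<rho> y (\<kappa> (\<rho> x v)))" if "v \<in> C" for x y v
        proof -
          have "v \<in> S" using that CS by auto
          then show ?thesis by (simp add: m.rho_br \<kappa>l \<kappa>\<rho> m.stable)
        qed
      qed
      moreover have "clinear (lie_scale L) sc (\<lambda>x. \<kappa> (c x))"
        using Vector_Spaces.linear_compose[OF c(1) \<kappa>] by (simp add: o_def)
      moreover have "\<kappa> (c x) \<in> C" for x using \<kappa>S c(2) by blast
      moreover have "\<kappa> (c (br x y)) = \<kappa> (\<rho> x (\<kappa> (c y))) - \<kappa> (\<rho> y (\<kappa> (c x)))" for x y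
        using c(2,3) by (simp add: \<kappa>l \<kappa>\<rho>)
      ultimately have "\<exists>m\<in>C. \<forall>x. \<kappa> (c x) = \<kappa> (\<rho> x m)"
        by (rule less.hyps[OF dC])
      then obtain a where a: "a \<in> C" "\<And>x. \<kappa> (c x) = \<kappa> (\<rho> x a)" by blast
      have aS: "a \<in> S" using a(1) CS by auto
      define c' where "c' = (\<lambda>x. c x - \<rho> x a)"
      have c'lin: "clinear (lie_scale L) sc c'"
        unfolding c'_def by (intro m.gv.linear_compose_sub c(1) m.linx aS)
      have c'U: "c' x \<in> U" for x
      proof -
        have "c' x \<in> S" unfolding c'_def by (intro m.v.subspace_diff[OF sS] c(2) m.stable aS)
        moreover have "\<kappa> (c' x) = 0" using a(2) by (simp add: c'_def \<kappa>l)
        then have "c' x = \<pi> (c' x)" by (simp add: \<kappa>_def)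
        ultimately show ?thesis using \<pi>(2)[of "c' x"] by simp
      qed
      have "c' (br x y) = \<rho> x (c' y) - \<rho> y (c' x)" for x y
        using aS by (simp add: c'_def c(3) m.rho_br m.rho_lin)
      from less.hyps[OF dU u.lmod_axioms c'lin c'U this]
      obtain b where b: "b \<in> U" "\<And>x. c' x = \<rho> x b" by blast
      have "c x = \<rho> x (a + b)" for x using b(2)[of x] by (simp add: c'_def m.rho_lin algebra_simps)
      moreover have "a + b \<in> S" using aS b(1) U(2) m.v.subspace_add[OF sS] by auto
      ultimately show ?thesis by blast
    qed
  qed
qed

section \<open>Spaces of linear maps and equivariant projections\<close>

lemma sum_fun_apply: "(\<Sum>i\<in>I. f i) x = (\<Sum>i\<in>I. f i x)"
  for f :: "'i \<Rightarrow> 'x \<Rightarrow> 'b::ab_group_add"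
  by (induction I rule: infinite_finite_induct) auto

definition fun_scale :: "(complex \<Rightarrow> 'b \<Rightarrow> 'b) \<Rightarrow> complex \<Rightarrow> ('a \<Rightarrow> 'b) \<Rightarrow> 'a \<Rightarrow> 'b"
  where "fun_scale s c f = (\<lambda>v. s c (f v))"

context cvec2
begin

text \<open>The maps vanish outside \<open>S\<close>, so that they are determined by their values on
  \<open>S\<close> and form a finite dimensional space.\<close>

definition homs :: "'a set \<Rightarrow> 'b set \<Rightarrow> ('a \<Rightarrow> 'b) set"
  where "homs S T = {f. linear_on S s1 s2 f \<and> f ` S \<subseteq> T \<and> (\<forall>v. v \<notin> S \<longrightarrow> f v = 0)}"

lemma cvec_fun: "cvec (fun_scale s2 :: complex \<Rightarrow> ('x \<Rightarrow> 'b) \<Rightarrow> _)"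
  by unfold_locales
     (auto simp: fun_scale_def fun_eq_iff v2.scale_right_distrib v2.scale_left_distrib)

interpretation f: cvec "fun_scale s2 :: complex \<Rightarrow> ('a \<Rightarrow> 'b) \<Rightarrow> _"
  by (rule cvec_fun)

lemma linear_on_plus:
  assumes f: "linear_on S s1 s2 f" and g: "linear_on S s1 s2 g"
  shows "linear_on S s1 s2 (\<lambda>v. f v + g v)"
  unfolding linear_on_def
proof (intro conjI ballI allI)
  show "f (x + y) + g (x + y) = f x + g x + (f y + g y)" if "x \<in> S" "y \<in> S" for x y
    unfolding linear_on_add[OF f that] linear_on_add[OF g that] by (simp add: algebra_simps)
  show "f (s1 c x) + g (s1 c x) = s2 c (f x + g x)" if "x \<in> S" for c x
    unfolding linear_on_scale[OF f that] linear_on_scale[OF g that] v2.scale_right_distrib ..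
qed

lemma linear_on_scaled:
  assumes f: "linear_on S s1 s2 f"
  shows "linear_on S s1 s2 (\<lambda>v. s2 c (f v))"
  unfolding linear_on_def
proof (intro conjI ballI allI)
  show "s2 c (f (x + y)) = s2 c (f x) + s2 c (f y)" if "x \<in> S" "y \<in> S" for x y
    unfolding linear_on_add[OF f that] v2.scale_right_distrib ..
  show "s2 c (f (s1 a x)) = s2 a (s2 c (f x))" if "x \<in> S" for a x
    unfolding linear_on_scale[OF f that] by (rule v2.scale_left_commute)
qed

lemma linear_on_zero: "linear_on S s1 s2 (\<lambda>v. 0)"
  by (simp add: linear_on_def)

lemma linear_on_minus:
  assumes f: "linear_on S s1 s2 f" and g: "linear_on S s1 s2 g"
  shows "linear_on S s1 s2 (\<lambda>v. f v - g v)"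
  using linear_on_plus[OF f linear_on_scaled[OF g, of "-1"]] by simp

lemma subspace_homs:
  assumes T: "v2.subspace T"
  shows "f.subspace (homs S T)"
proof (rule f.subspaceI)
  show "0 \<in> homs S T"
    using v2.subspace_0[OF T] linear_on_zero by (auto simp: homs_def zero_fun_def)
  fix x y assume "x \<in> homs S T" "y \<in> homs S T"
  then show "x + y \<in> homs S T"
    using linear_on_plus v2.subspace_add[OF T] by (simp add: homs_def plus_fun_def image_subset_iff)
next
  fix c x assume "x \<in> homs S T"
  then show "fun_scale s2 c x \<in> homs S T"
    using linear_on_scaled v2.subspace_scale[OF T] by (simp add: homs_def fun_scale_def image_subset_iff)
qed

text \<open>The elementary maps, which send one basis vector of \<open>S\<close> to a basis vector
  of \<open>T\<close> and the others to 0, span the space.\<close>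

lemma fdim_homs:
  assumes S: "v1.fdim S" and T: "v2.fdim T"
  shows "f.fdim (homs S T)"
proof -
  obtain X where X: "finite X" "v1.independent X" "X \<subseteq> S" "v1.span X = S" "card X = v1.dim S"
    by (rule v1.fdim_basis[OF S])
  obtain Y where Y: "finite Y" "v2.independent Y" "Y \<subseteq> T" "v2.span Y = T" "card Y = v2.dim T"
    by (rule v2.fdim_basis[OF T])
  define E where "E = (\<lambda>(x, y) v. if v \<in> S then s2 (v1.representation X v x) y else 0)"
  have "f \<in> f.span (E ` (X \<times> Y))" if f: "f \<in> homs S T" for f
  proof -
    have "f v = (\<Sum>p\<in>X \<times> Y. fun_scale s2 (v2.representation Y (f (fst p)) (snd p)) (E p)) v" for v
    proof (cases "v \<in> S")
      case False
      then have "(\<Sum>p\<in>X \<times> Y. fun_scale s2 (v2.representation Y (f (fst p)) (snd p)) (E p)) v = 0"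
        by (simp add: sum_fun_apply fun_scale_def E_def case_prod_beta)
      then show ?thesis using f False by (simp add: homs_def)
    next
      case True
      have fl: "linear_on S s1 s2 f" and fT: "f x \<in> T" if "x \<in> S" for x using f that by (auto simp: homs_def)
      have "f v = f (\<Sum>x\<in>X. s1 (v1.representation X v x) x)"
        using v1.sum_representation_eq[OF X(2) _ X(1)] X(4) True by simp
      also have "\<dots> = (\<Sum>x\<in>X. s2 (v1.representation X v x) (f x))"
        using linear_on_sum[OF fl[OF True] v1.fdim_subspace[OF S], of X "\<lambda>x. s1 (v1.representation X v x) x"]
          X(3) v1.subspace_scale[OF v1.fdim_subspace[OF S]] linear_on_scale[OF fl[OF True]]
        by (simp add: subset_iff)
      also have "\<dots> = (\<Sum>x\<in>X. \<Sum>y\<in>Y. s2 (v2.representation Y (f x) y) (s2 (v1.representation X v x) y))"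
      proof (rule sum.cong[OF refl])
        fix x assume "x \<in> X"
        then have "f x \<in> v2.span Y" using X(3) Y(4) fT by auto
        then have "f x = (\<Sum>y\<in>Y. s2 (v2.representation Y (f x) y) y)"
          using v2.sum_representation_eq[OF Y(2) _ Y(1)] by simp
        then have "s2 (v1.representation X v x) (f x) = s2 (v1.representation X v x) (\<Sum>y\<in>Y. s2 (v2.representation Y (f x) y) y)"
          by simp
        also have "\<dots> = (\<Sum>y\<in>Y. s2 (v2.representation Y (f x) y) (s2 (v1.representation X v x) y))"
          by (simp only: v2.scale_sum_right v2.scale_left_commute)
        finally show "s2 (v1.representation X v x) (f x) = (\<Sum>y\<in>Y. s2 (v2.representation Y (f x) y) (s2 (v1.representation X v x) y))" .
      qed
      also have "\<dots> = (\<Sum>p\<in>X \<times> Y. fun_scale s2 (v2.representation Y (f (fst p)) (snd p)) (E p)) v"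
        using True by (simp add: sum_fun_apply fun_scale_def E_def case_prod_beta sum.cartesian_product)
      finally show ?thesis .
    qed
    then have e: "f = (\<Sum>p\<in>X \<times> Y. fun_scale s2 (v2.representation Y (f (fst p)) (snd p)) (E p))" by blast
    show ?thesis by (subst e) (intro f.span_sum f.span_scale f.span_base imageI)
  qed
  then have sub: "homs S T \<subseteq> f.span (E ` (X \<times> Y))" by blast
  have "finite (E ` (X \<times> Y))" using X(1) Y(1) by simp
  then show ?thesis
    by (rule f.fdim_sub(1)[OF f.fdim_span subspace_homs[OF v2.fdim_subspace[OF T]] sub])
qed

end

text \<open>
  Measuring how far a linear projection onto \<open>U\<close> is from being equivariant gives a cocycle with
  values in the maps \<open>S \<rightarrow> U\<close> vanishing on \<open>U\<close>.
\<close>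

lemma (in sslie) equivariant_projection:
  fixes sc :: "complex \<Rightarrow> 'v::ab_group_add \<Rightarrow> 'v"
  assumes "lmod L sc S \<rho>" and U: "module.subspace sc U" "U \<subseteq> S" "\<And>x v. v \<in> U \<Longrightarrow> \<rho> x v \<in> U"
  obtains e where "linear_on S sc sc e" "\<And>v. v \<in> S \<Longrightarrow> e v \<in> U" "\<And>u. u \<in> U \<Longrightarrow> e u = u"
    "\<And>x v. v \<in> S \<Longrightarrow> e (\<rho> x v) = \<rho> x (e v)"
proof -
  interpret m: lmod L sc S \<rho> by (rule assms(1))
  note sS = m.sS
  obtain \<pi> where \<pi>: "clinear sc sc \<pi>" "\<And>v. v \<in> S \<Longrightarrow> \<pi> v \<in> U" "\<And>t. t \<in> U \<Longrightarrow> \<pi> t = t"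
    using m.v.projection[OF m.fd U(1,2)] by blast
  note \<pi>l = m.v.self.linear_add[OF \<pi>(1)] m.v.self.linear_diff[OF \<pi>(1)] m.v.self.linear_scale[OF \<pi>(1)] m.v.self.linear_0[OF \<pi>(1)]
  interpret f: cvec "fun_scale sc :: complex \<Rightarrow> ('v \<Rightarrow> 'v) \<Rightarrow> _" by (rule m.v.self.cvec_fun)
  define M where "M = {f\<in>m.v.self.homs S U. \<forall>u\<in>U. f u = 0}"
  define act where "act = (\<lambda>x f v. if v \<in> S then \<rho> x (f v) - f (\<rho> x v) else 0)"
  have fU: "m.v.fdim U" by (rule m.v.fdim_sub(1)[OF m.fd U(1,2)])
  have sH: "f.subspace (m.v.self.homs S U)" by (rule m.v.self.subspace_homs[OF U(1)])
  have sM: "f.subspace M"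
    using sH unfolding M_def f.subspace_def by (auto simp: fun_scale_def)
  have fM: "f.fdim M"
    by (rule f.fdim_sub(1)[OF m.v.self.fdim_homs[OF m.fd fU] sM]) (auto simp: M_def)
  have Mlin: "linear_on S sc sc f" and MU: "v \<in> S \<Longrightarrow> f v \<in> U" and M0: "u \<in> U \<Longrightarrow> f u = 0"
    and Mout: "v \<notin> S \<Longrightarrow> f v = 0" if "f \<in> M" for f u v
    using that by (auto simp: M_def m.v.self.homs_def)
  have MI: "f \<in> M" if "linear_on S sc sc f" "\<And>v. v \<in> S \<Longrightarrow> f v \<in> U" "\<And>u. u \<in> U \<Longrightarrow> f u = 0" "\<And>v. v \<notin> S \<Longrightarrow> f v = 0" for f
    using that by (auto simp: M_def m.v.self.homs_def)
  have comm_lin: "linear_on S sc sc (\<lambda>v. if v \<in> S then \<rho> x (f v) - f (\<rho> x v) else 0)"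
    if f: "linear_on S sc sc f" for f x
    using m.v.self.linear_on_add[OF f] m.v.self.linear_on_scale[OF f] m.v.subspace_add[OF sS] m.v.subspace_scale[OF sS]
    unfolding linear_on_def by (simp add: m.rho_lin m.stable m.v.scale_right_diff_distrib)
  have "lmod L (fun_scale sc) M act"
  proof (intro lmod.intro lmod_axioms.intro fdlie_axioms m.v.self.cvec_fun fM)
    show "act x f \<in> M" if f: "f \<in> M" for x f
    proof (rule MI)
      show "linear_on S sc sc (act x f)" unfolding act_def by (rule comm_lin[OF Mlin[OF f]])
      show "act x f v \<in> U" if "v \<in> S" for v
        using that MU[OF f] m.stable U(3) m.v.subspace_diff[OF U(1)] by (simp add: act_def)
      show "act x f u = 0" if "u \<in> U" for u
        using that M0[OF f] U(3) by (simp add: act_def m.rho_lin)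
      show "act x f v = 0" if "v \<notin> S" for v using that by (simp add: act_def)
    qed
    show "clinear (fun_scale sc) (fun_scale sc) (act x)" for x
      unfolding Vector_Spaces.linear_iff
      using f.vector_space_axioms
      by (auto simp: act_def fun_scale_def fun_eq_iff m.rho_lin m.v.scale_right_diff_distrib)
    show "clinear (lie_scale L) (fun_scale sc) (\<lambda>x. act x f)" if f: "f \<in> M" for f
    proof -
      have fS: "f v \<in> S" if "v \<in> S" for v using MU[OF f that] U(2) by auto
      show ?thesis
        unfolding Vector_Spaces.linear_iff
        using f.vector_space_axioms g.vector_space_axioms m.v.self.linear_on_add[OF Mlin[OF f]] m.v.self.linear_on_scale[OF Mlin[OF f]]
        by (auto simp: act_def fun_scale_def fun_eq_iff m.rho_linx fS m.stable m.v.scale_right_diff_distrib)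
    qed
    show "act (br x y) f = act x (act y f) - act y (act x f)" if f: "f \<in> M" for x y f
    proof
      fix v
      have fS: "f v \<in> S" if "v \<in> S" for v using MU[OF f that] U(2) by auto
      show "act (br x y) f v = (act x (act y f) - act y (act x f)) v"
        using m.v.self.linear_on_diff[OF Mlin[OF f] sS]
        by (simp add: act_def m.rho_br fS m.stable m.rho_lin)
    qed
  qed
  note lm = this
  define p where "p = (\<lambda>v. if v \<in> S then \<pi> v else 0)"
  have pl: "linear_on S sc sc p"
    using m.v.subspace_add[OF sS] m.v.subspace_scale[OF sS] by (simp add: p_def linear_on_def \<pi>l)
  have pS: "p v \<in> U" "p v \<in> S" if "v \<in> S" for v using \<pi>(2)[OF that] U(2) that by (auto simp: p_def)
  \<comment> \<open>The map \<open>p\<close> is the identity on \<open>U\<close> and so need not lie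
    in \<open>M\<close>, but its commutators with the action vanish on \<open>U\<close>. Hence
    \<open>c\<close> is formally the coboundary of \<open>p\<close> but has values in
    \<open>M\<close>; a primitive \<open>h\<close> in \<open>M\<close> corrects \<open>p\<close> to
    an equivariant map without changing it on \<open>U\<close>.\<close>
  define c where "c = (\<lambda>x. act x p)"
  have cM: "c x \<in> M" for x
  proof (rule MI)
    show "linear_on S sc sc (c x)" unfolding c_def act_def by (rule comm_lin[OF pl])
    show "c x v \<in> U" if "v \<in> S" for v
      using that pS m.stable U(3) m.v.subspace_diff[OF U(1)] by (simp add: c_def act_def)
    show "c x u = 0" if u: "u \<in> U" for u
    proof -
      have "u \<in> S" "\<rho> x u \<in> U" "\<rho> x u \<in> S" using u U(2,3) m.stable by blast+
      then show ?thesis using \<pi>(3) u by (simp add: c_def act_def p_def)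
    qed
    show "c x v = 0" if "v \<notin> S" for v using that by (simp add: c_def act_def)
  qed
  have clin: "clinear (lie_scale L) (fun_scale sc) c"
    unfolding Vector_Spaces.linear_iff
    using f.vector_space_axioms g.vector_space_axioms m.v.self.linear_on_add[OF pl] m.v.self.linear_on_scale[OF pl]
    by (auto simp: c_def act_def fun_scale_def fun_eq_iff m.rho_linx pS m.stable m.v.scale_right_diff_distrib)
  have cc: "c (br x y) = act x (c y) - act y (c x)" for x y
  proof
    fix v
    show "c (br x y) v = (act x (c y) - act y (c x)) v"
      using m.v.self.linear_on_diff[OF pl sS]
      by (simp add: c_def act_def m.rho_br pS m.stable m.rho_lin)
  qed
  obtain h where h: "h \<in> M" "\<And>x. c x = act x h"
    using cocycle_coboundary[OF lm clin cM cc] by blast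
  show ?thesis
  proof (rule that[of "\<lambda>v. p v - h v"])
    show "linear_on S sc sc (\<lambda>v. p v - h v)"
      by (rule m.v.self.linear_on_minus[OF pl Mlin[OF h(1)]])
    show "p v - h v \<in> U" if "v \<in> S" for v
      using that pS MU[OF h(1)] m.v.subspace_diff[OF U(1)] by blast
    show "p u - h u = u" if u: "u \<in> U" for u
    proof -
      have "u \<in> S" using u U(2) by blast
      then show ?thesis using M0[OF h(1)] \<pi>(3) u by (simp add: p_def)
    qed
    show "p (\<rho> x v) - h (\<rho> x v) = \<rho> x (p v - h v)" if "v \<in> S" for x v
    proof -
      have "act x p v = act x h v" using h(2)[of x] by (simp add: c_def)
      then show ?thesis using that by (simp add: act_def m.rho_lin algebra_simps)
    qed
  qed
qed

section \<open>Morphisms of representations\<close>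

lemma hom_scale_eq: "hom_scale W = fun_scale (rep_scale W)"
  by (simp add: fun_eq_iff hom_scale_def fun_scale_def)

lemma fd_cvec: "fd_rep L V \<Longrightarrow> cvec (rep_scale V)"
  by (simp add: fd_rep_def cvec_def)

lemma fd_fdim: "fd_rep L V \<Longrightarrow> cvec.fdim (rep_scale V) (rep_space V)"
  by (simp add: cvec.fdim_def[OF fd_cvec]) (simp add: fd_rep_def)

lemma fd_subspace: "fd_rep L V \<Longrightarrow> module.subspace (rep_scale V) (rep_space V)"
  by (simp add: fd_rep_def)

lemma fd_act: "fd_rep L V \<Longrightarrow> v \<in> rep_space V \<Longrightarrow> rep_act V x v \<in> rep_space V"
  by (auto simp: fd_rep_def)

lemma fd_act_linear: "fd_rep L V \<Longrightarrow> linear_on (rep_space V) (rep_scale V) (rep_scale V) (rep_act V x)"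
  by (simp add: fd_rep_def)

lemma fd_zero: "fd_rep L V \<Longrightarrow> 0 \<in> rep_space V"
  and fd_add: "fd_rep L V \<Longrightarrow> v \<in> rep_space V \<Longrightarrow> w \<in> rep_space V \<Longrightarrow> v + w \<in> rep_space V"
  and fd_scale: "fd_rep L V \<Longrightarrow> v \<in> rep_space V \<Longrightarrow> rep_scale V c v \<in> rep_space V"
  and fd_diff: "fd_rep L V \<Longrightarrow> v \<in> rep_space V \<Longrightarrow> w \<in> rep_space V \<Longrightarrow> v - w \<in> rep_space V"
proof -
  assume V: "fd_rep L V"
  interpret v: cvec "rep_scale V" by (rule fd_cvec[OF V])
  note s = fd_subspace[OF V]
  show "0 \<in> rep_space V" by (rule v.subspace_0[OF s])
  show "v \<in> rep_space V \<Longrightarrow> w \<in> rep_space V \<Longrightarrow> v + w \<in> rep_space V" by (rule v.subspace_add[OF s])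
  show "v \<in> rep_space V \<Longrightarrow> rep_scale V c v \<in> rep_space V" by (rule v.subspace_scale[OF s])
  show "v \<in> rep_space V \<Longrightarrow> w \<in> rep_space V \<Longrightarrow> v - w \<in> rep_space V" by (rule v.subspace_diff[OF s])
qed

lemma act_add: "fd_rep L V \<Longrightarrow> v \<in> rep_space V \<Longrightarrow> w \<in> rep_space V \<Longrightarrow> rep_act V x (v + w) = rep_act V x v + rep_act V x w"
  and act_scale: "fd_rep L V \<Longrightarrow> v \<in> rep_space V \<Longrightarrow> rep_act V x (rep_scale V c v) = rep_scale V c (rep_act V x v)"
  and act_zero: "fd_rep L V \<Longrightarrow> rep_act V x 0 = 0"
  and act_diff: "fd_rep L V \<Longrightarrow> v \<in> rep_space V \<Longrightarrow> w \<in> rep_space V \<Longrightarrow> rep_act V x (v - w) = rep_act V x v - rep_act V x w"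
proof -
  assume V: "fd_rep L V"
  interpret v: cvec "rep_scale V" by (rule fd_cvec[OF V])
  note s = fd_subspace[OF V] and l = fd_act_linear[OF V]
  show "v \<in> rep_space V \<Longrightarrow> w \<in> rep_space V \<Longrightarrow> rep_act V x (v + w) = rep_act V x v + rep_act V x w"
    by (rule v.self.linear_on_add[OF l])
  show "v \<in> rep_space V \<Longrightarrow> rep_act V x (rep_scale V c v) = rep_scale V c (rep_act V x v)"
    by (rule v.self.linear_on_scale[OF l])
  show "rep_act V x 0 = 0" by (rule v.self.linear_on_0[OF l s])
  show "v \<in> rep_space V \<Longrightarrow> w \<in> rep_space V \<Longrightarrow> rep_act V x (v - w) = rep_act V x v - rep_act V x w"
    by (rule v.self.linear_on_diff[OF l s])
qed

lemma Hom_in: "f \<in> Hom V W \<Longrightarrow> v \<in> rep_space V \<Longrightarrow> f v \<in> rep_space W"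
  and Hom_linear: "f \<in> Hom V W \<Longrightarrow> linear_on (rep_space V) (rep_scale V) (rep_scale W) f"
  and Hom_act: "f \<in> Hom V W \<Longrightarrow> v \<in> rep_space V \<Longrightarrow> f (rep_act V x v) = rep_act W x (f v)"
  and Hom_out: "f \<in> Hom V W \<Longrightarrow> v \<notin> rep_space V \<Longrightarrow> f v = 0"
  unfolding Hom_def by auto

lemma Hom_add: "f \<in> Hom V W \<Longrightarrow> v \<in> rep_space V \<Longrightarrow> w \<in> rep_space V \<Longrightarrow> f (v + w) = f v + f w"
  and Hom_scale: "f \<in> Hom V W \<Longrightarrow> v \<in> rep_space V \<Longrightarrow> f (rep_scale V c v) = rep_scale W c (f v)"
  using Hom_linear unfolding linear_on_def by blast+

lemma Hom_diff: "f \<in> Hom V W \<Longrightarrow> fd_rep L V \<Longrightarrow> v \<in> rep_space V \<Longrightarrow> w \<in> rep_space V \<Longrightarrow> f (v - w) = f v - f w"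
  using Hom_add[of f V W "v - w" w] fd_diff[of L V v w] by (simp add: eq_diff_eq)

lemma Hom_0: "f \<in> Hom V W \<Longrightarrow> fd_rep L V \<Longrightarrow> f 0 = 0"
  using Hom_diff[of f V W L 0 0] fd_zero[of L V] by simp

lemma HomI:
  assumes "\<And>v. v \<in> rep_space V \<Longrightarrow> f v \<in> rep_space W"
    "\<And>v w. v \<in> rep_space V \<Longrightarrow> w \<in> rep_space V \<Longrightarrow> f (v + w) = f v + f w"
    "\<And>c v. v \<in> rep_space V \<Longrightarrow> f (rep_scale V c v) = rep_scale W c (f v)"
    "\<And>x v. v \<in> rep_space V \<Longrightarrow> f (rep_act V x v) = rep_act W x (f v)"
    "\<And>v. v \<notin> rep_space V \<Longrightarrow> f v = 0"
  shows "f \<in> Hom V W"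
  unfolding Hom_def linear_on_def using assms by auto

lemma Hom_eqI: "f \<in> Hom V W \<Longrightarrow> g \<in> Hom V W \<Longrightarrow> (\<And>v. v \<in> rep_space V \<Longrightarrow> f v = g v) \<Longrightarrow> f = g"
  using Hom_out by (metis ext)

lemma Hom_nonzero:
  assumes "f \<in> Hom V W" "f \<noteq> 0"
  shows "\<exists>u\<in>rep_space V. f u \<noteq> 0"
  using assms Hom_out[OF assms(1)] by (metis ext zero_fun_apply)

text \<open>The identity has to be cut off outside the space in order to be an element of
  \<open>Hom V V\<close>.\<close>

definition rep_id :: "('g, 'v::ab_group_add) rep \<Rightarrow> 'v \<Rightarrow> 'v"
  where "rep_id V v = (if v \<in> rep_space V then v else 0)"

lemma rep_id_in [simp]: "v \<in> rep_space V \<Longrightarrow> rep_id V v = v"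
  by (simp add: rep_id_def)

lemma rep_id_Hom: "fd_rep L V \<Longrightarrow> rep_id V \<in> Hom V V"
  by (rule HomI) (auto simp: rep_id_def fd_add fd_scale fd_act)

lemma Hom_comp:
  assumes f: "f \<in> Hom V W" and g: "g \<in> Hom W Z" and W: "fd_rep L W"
  shows "(\<lambda>v. g (f v)) \<in> Hom V Z"
proof (rule HomI)
  show "g (f (v + w)) = g (f v) + g (f w)" if "v \<in> rep_space V" "w \<in> rep_space V" for v w
    by (simp only: Hom_add[OF f that] Hom_add[OF g Hom_in[OF f that(1)] Hom_in[OF f that(2)]])
  show "g (f (rep_scale V c v)) = rep_scale Z c (g (f v))" if "v \<in> rep_space V" for c v
    by (simp only: Hom_scale[OF f that] Hom_scale[OF g Hom_in[OF f that]])
  show "g (f (rep_act V x v)) = rep_act Z x (g (f v))" if "v \<in> rep_space V" for x v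
    by (simp only: Hom_act[OF f that] Hom_act[OF g Hom_in[OF f that]])
  show "g (f v) \<in> rep_space Z" if "v \<in> rep_space V" for v
    by (rule Hom_in[OF g Hom_in[OF f that]])
  show "g (f v) = 0" if "v \<notin> rep_space V" for v
    using Hom_out[OF f that] Hom_0[OF g W] by simp
qed

lemma Hom_plus:
  assumes W: "fd_rep L W" and f: "f \<in> Hom V W" and g: "g \<in> Hom V W"
  shows "(\<lambda>v. f v + g v) \<in> Hom V W"
proof -
  interpret w: cvec "rep_scale W" by (rule fd_cvec[OF W])
  show ?thesis
  proof (rule HomI)
    show "f (v + w) + g (v + w) = f v + g v + (f w + g w)" if "v \<in> rep_space V" "w \<in> rep_space V" for v w
      unfolding Hom_add[OF f that] Hom_add[OF g that] by (simp add: algebra_simps)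
    show "f (rep_scale V c v) + g (rep_scale V c v) = rep_scale W c (f v + g v)" if "v \<in> rep_space V" for c v
      unfolding Hom_scale[OF f that] Hom_scale[OF g that] w.scale_right_distrib ..
    show "f (rep_act V x v) + g (rep_act V x v) = rep_act W x (f v + g v)" if "v \<in> rep_space V" for x v
      unfolding Hom_act[OF f that] Hom_act[OF g that] act_add[OF W Hom_in[OF f that] Hom_in[OF g that]] ..
    show "f v + g v \<in> rep_space W" if "v \<in> rep_space V" for v
      by (rule fd_add[OF W Hom_in[OF f that] Hom_in[OF g that]])
    show "f v + g v = 0" if "v \<notin> rep_space V" for v using Hom_out[OF f that] Hom_out[OF g that] by simp
  qed
qed

lemma Hom_scaled:
  assumes W: "fd_rep L W" and f: "f \<in> Hom V W"
  shows "(\<lambda>v. rep_scale W c (f v)) \<in> Hom V W"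
proof -
  interpret w: cvec "rep_scale W" by (rule fd_cvec[OF W])
  show ?thesis
  proof (rule HomI)
    show "rep_scale W c (f (v + w)) = rep_scale W c (f v) + rep_scale W c (f w)" if "v \<in> rep_space V" "w \<in> rep_space V" for v w
      unfolding Hom_add[OF f that] w.scale_right_distrib ..
    show "rep_scale W c (f (rep_scale V d v)) = rep_scale W d (rep_scale W c (f v))" if "v \<in> rep_space V" for d v
      unfolding Hom_scale[OF f that] by (rule w.scale_left_commute)
    show "rep_scale W c (f (rep_act V x v)) = rep_act W x (rep_scale W c (f v))" if "v \<in> rep_space V" for x v
      unfolding Hom_act[OF f that] act_scale[OF W Hom_in[OF f that]] ..
    show "rep_scale W c (f v) \<in> rep_space W" if "v \<in> rep_space V" for v
      by (rule fd_scale[OF W Hom_in[OF f that]])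
    show "rep_scale W c (f v) = 0" if "v \<notin> rep_space V" for v using Hom_out[OF f that] by simp
  qed
qed

lemma Hom_zero: "fd_rep L W \<Longrightarrow> (\<lambda>v. 0) \<in> Hom V W"
proof -
  assume W: "fd_rep L W"
  interpret w: cvec "rep_scale W" by (rule fd_cvec[OF W])
  show ?thesis by (rule HomI) (auto simp: fd_zero[OF W] act_zero[OF W])
qed

lemma Hom_minus:
  assumes W: "fd_rep L W" and f: "f \<in> Hom V W" and g: "g \<in> Hom V W"
  shows "(\<lambda>v. f v - g v) \<in> Hom V W"
proof -
  interpret w: cvec "rep_scale W" by (rule fd_cvec[OF W])
  show ?thesis using Hom_plus[OF W f Hom_scaled[OF W g, of "-1"]] by simp
qed

lemma hom_cvec: "fd_rep L W \<Longrightarrow> cvec (hom_scale W :: complex \<Rightarrow> ('v \<Rightarrow> 'w::ab_group_add) \<Rightarrow> _)"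
proof -
  assume W: "fd_rep L W"
  interpret w: cvec "rep_scale W" by (rule fd_cvec[OF W])
  show ?thesis unfolding hom_scale_eq by (rule w.self.cvec_fun)
qed

lemma Hom_subspace:
  fixes V :: "('g::ab_group_add, 'v::ab_group_add) rep" and W :: "('g, 'w::ab_group_add) rep"
  assumes W: "fd_rep L W"
  shows "module.subspace (hom_scale W) (Hom V W)"
proof -
  interpret h: cvec "hom_scale W :: complex \<Rightarrow> ('v \<Rightarrow> 'w) \<Rightarrow> _" by (rule hom_cvec[OF W])
  show ?thesis
    by (rule h.subspaceI)
      (auto simp: hom_scale_def plus_fun_def zero_fun_def Hom_zero[OF W] Hom_plus[OF W] Hom_scaled[OF W])
qed

lemma Hom_fdim:
  fixes V :: "('g::ab_group_add, 'v::ab_group_add) rep" and W :: "('g, 'w::ab_group_add) rep"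
  assumes V: "fd_rep L V" and W: "fd_rep L W"
  shows "cvec.fdim (hom_scale W) (Hom V W)"
proof -
  interpret vw: cvec2 "rep_scale V" "rep_scale W"
    using fd_cvec[OF V] fd_cvec[OF W] by (simp add: cvec2_def)
  interpret h: cvec "hom_scale W :: complex \<Rightarrow> ('v \<Rightarrow> 'w) \<Rightarrow> _" by (rule hom_cvec[OF W])
  have "h.fdim (vw.homs (rep_space V) (rep_space W))"
    unfolding hom_scale_eq by (rule vw.fdim_homs[OF fd_fdim[OF V] fd_fdim[OF W]])
  then show ?thesis
    by (rule h.fdim_sub(1)[OF _ Hom_subspace[OF W]]) (auto simp: vw.homs_def Hom_def)
qed

definition hdim :: "('g, 'v::ab_group_add) rep \<Rightarrow> ('g, 'w::ab_group_add) rep \<Rightarrow> nat"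
  where "hdim V W = vector_space.dim (hom_scale W) (Hom V W)"

section \<open>Subrepresentations and the splitting of morphisms\<close>

definition sub_rep :: "('g, 'v) rep \<Rightarrow> 'v set \<Rightarrow> ('g, 'v) rep"
  where "sub_rep V U = V\<lparr>rep_space := U\<rparr>"

lemma sub_rep_simps [simp]: "rep_space (sub_rep V U) = U" "rep_scale (sub_rep V U) = rep_scale V"
  "rep_act (sub_rep V U) = rep_act V"
  by (simp_all add: sub_rep_def)

lemma image_rep_eq: "image_rep V W f = sub_rep W (f ` rep_space V)"
  by (simp add: image_rep_def sub_rep_def)

definition subrep :: "('g, 'v::ab_group_add) rep \<Rightarrow> 'v set \<Rightarrow> bool"
  where "subrep V U \<longleftrightarrow> U \<subseteq> rep_space V \<and> module.subspace (rep_scale V) U \<and> (\<forall>x. \<forall>u\<in>U. rep_act V x u \<in> U)"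

lemma sub_rep_fd:
  assumes V: "fd_rep L V" and U: "subrep V U"
  shows "fd_rep L (sub_rep V U)"
proof -
  interpret v: cvec "rep_scale V" by (rule fd_cvec[OF V])
  have "v.fdim U" by (rule v.fdim_sub(1)[OF fd_fdim[OF V]]) (use U in \<open>auto simp: subrep_def\<close>)
  moreover have "linear_on U (rep_scale V) (rep_scale V) (rep_act V x)" for x
    using fd_act_linear[OF V, of x] U unfolding linear_on_def subrep_def by blast
  ultimately show ?thesis
    using V U unfolding fd_rep_def subrep_def v.fdim_def
    by (auto simp: image_subset_iff subset_iff)
qed

lemma kernel_subrep: "fd_rep L V \<Longrightarrow> fd_rep L W \<Longrightarrow> f \<in> Hom V W \<Longrightarrow> subrep V {v\<in>rep_space V. f v = 0}"
proof -
  assume V: "fd_rep L V" and W: "fd_rep L W" and f: "f \<in> Hom V W"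
  interpret vw: cvec2 "rep_scale V" "rep_scale W"
    using fd_cvec[OF V] fd_cvec[OF W] by (simp add: cvec2_def)
  show ?thesis
    unfolding subrep_def using vw.subspace_kernel_on[OF Hom_linear[OF f] fd_subspace[OF V]]
    by (auto simp: fd_act[OF V] Hom_act[OF f] act_zero[OF W])
qed

lemma image_subrep: "fd_rep L V \<Longrightarrow> fd_rep L W \<Longrightarrow> f \<in> Hom V W \<Longrightarrow> subrep W (f ` rep_space V)"
proof -
  assume V: "fd_rep L V" and W: "fd_rep L W" and f: "f \<in> Hom V W"
  interpret vw: cvec2 "rep_scale V" "rep_scale W"
    using fd_cvec[OF V] fd_cvec[OF W] by (simp add: cvec2_def)
  show ?thesis
    unfolding subrep_def using vw.subspace_image_on[OF Hom_linear[OF f] fd_subspace[OF V]]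
    by (auto simp: Hom_in[OF f] Hom_act[OF f, symmetric] fd_act[OF V])
qed

lemma inclusion_Hom: "fd_rep L V \<Longrightarrow> subrep V U \<Longrightarrow> rep_id (sub_rep V U) \<in> Hom (sub_rep V U) V"
proof -
  assume V: "fd_rep L V" and U: "subrep V U"
  interpret v: cvec "rep_scale V" by (rule fd_cvec[OF V])
  have s: "v.subspace U" using U by (simp add: subrep_def)
  show ?thesis
    by (rule HomI) (use U in \<open>auto simp: subrep_def rep_id_def v.subspace_add[OF s] v.subspace_scale[OF s]\<close>)
qed

lemma Hom_sub_target: "f \<in> Hom V (sub_rep W U) \<longleftrightarrow> f \<in> Hom V W \<and> f ` rep_space V \<subseteq> U" if "U \<subseteq> rep_space W"
  using that unfolding Hom_def by (auto simp: sub_rep_def)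

lemma Hom_restrict:
  assumes V: "fd_rep L V" and U: "subrep V U" and f: "f \<in> Hom V W"
  shows "(\<lambda>v. if v \<in> U then f v else 0) \<in> Hom (sub_rep V U) W"
proof -
  interpret v: cvec "rep_scale V" by (rule fd_cvec[OF V])
  have s: "v.subspace U" and UV: "U \<subseteq> rep_space V" using U by (auto simp: subrep_def)
  have a: "rep_act V x u \<in> U" if "u \<in> U" for x u using U that by (auto simp: subrep_def)
  show ?thesis
    by (rule HomI) (use UV in \<open>auto simp: a v.subspace_add[OF s] v.subspace_scale[OF s] Hom_in[OF f] Hom_add[OF f]
      Hom_scale[OF f] Hom_act[OF f] subset_iff\<close>)
qed

text \<open>\<open>rep_act\<close> is linear on \<open>rep_space V\<close> only. Precomposition with
  a global linear projection \<open>\<pi>\<close> onto this space turns it into linear operators on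
  the whole ambient type.\<close>

lemma rep_lmod:
  fixes V :: "('g::ab_group_add, 'v::ab_group_add) rep"
  assumes "semisimple L" and V: "fd_rep L V"
  obtains \<rho> where "lmod L (rep_scale V) (rep_space V) \<rho>"
    "\<And>x v. v \<in> rep_space V \<Longrightarrow> \<rho> x v = rep_act V x v"
proof -
  interpret sslie L by unfold_locales (use assms in \<open>auto simp: semisimple_def\<close>)
  interpret v: cvec "rep_scale V" by (rule fd_cvec[OF V])
  let ?S = "rep_space V"
  note sS = fd_subspace[OF V]
  obtain B where B: "finite B" "v.independent B" "B \<subseteq> ?S" "v.span B = ?S" "card B = v.dim ?S"
    by (rule v.fdim_basis[OF fd_fdim[OF V]])
  obtain \<pi> where \<pi>: "clinear (rep_scale V) (rep_scale V) \<pi>" "\<forall>x\<in>B. \<pi> x = x" "range \<pi> = v.span B"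
    using v.self.linear_independent_extend_subspace[OF B(2), of "\<lambda>x. x"] by auto
  have pid: "\<pi> v = v" if "v \<in> ?S" for v
    using v.self.linear_eq_on[OF \<pi>(1) v.linear_ident, of v B] that \<pi>(2) B(4) by auto
  have pS: "\<pi> v \<in> ?S" for v using \<pi>(3) B(4) by auto
  note pl = v.self.linear_add[OF \<pi>(1)] v.self.linear_scale[OF \<pi>(1)]
  have "lmod L (rep_scale V) ?S (\<lambda>x v. rep_act V x (\<pi> v))"
  proof (intro lmod.intro lmod_axioms.intro fdlie_axioms v.cvec_axioms fd_fdim[OF V])
    show "rep_act V x (\<pi> v) \<in> ?S" for v x by (rule fd_act[OF V pS])
    show "clinear (rep_scale V) (rep_scale V) (\<lambda>v. rep_act V x (\<pi> v))" for x
      unfolding Vector_Spaces.linear_iff using v.vector_space_axioms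
      by (simp add: pl act_add[OF V pS pS] act_scale[OF V pS])
    show "clinear (lie_scale L) (rep_scale V) (\<lambda>x. rep_act V x (\<pi> v))" for v
    proof -
      have "linear_on UNIV (lie_scale L) (rep_scale V) (\<lambda>x. rep_act V x (\<pi> v))"
        using V pS unfolding fd_rep_def by blast
      then show ?thesis
        unfolding Vector_Spaces.linear_iff linear_on_def using v.vector_space_axioms g.vector_space_axioms by blast
    qed
    show "rep_act V (br x y) (\<pi> v) = rep_act V x (\<pi> (rep_act V y (\<pi> v))) - rep_act V y (\<pi> (rep_act V x (\<pi> v)))" for x y v
      unfolding pid[OF fd_act[OF V pS]] using V pS[of v] unfolding fd_rep_def by blast
  qed
  then show ?thesis by (rule that) (simp add: pid)
qed

theorem complete_reducibility:
  assumes ss: "semisimple L" and V: "fd_rep L V" and U: "subrep V U"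
  obtains e where "e \<in> Hom V V" "\<And>v. v \<in> rep_space V \<Longrightarrow> e v \<in> U" "\<And>u. u \<in> U \<Longrightarrow> e u = u"
proof -
  interpret sslie L by unfold_locales (use assms in \<open>auto simp: semisimple_def\<close>)
  obtain \<rho> where \<rho>: "lmod L (rep_scale V) (rep_space V) \<rho>"
    "\<And>x v. v \<in> rep_space V \<Longrightarrow> \<rho> x v = rep_act V x v"
    using rep_lmod[OF ss V] by blast
  have U': "module.subspace (rep_scale V) U" "U \<subseteq> rep_space V" "\<And>x v. v \<in> U \<Longrightarrow> \<rho> x v \<in> U"
    using U \<rho>(2) by (auto simp: subrep_def subset_iff)
  obtain e where e: "linear_on (rep_space V) (rep_scale V) (rep_scale V) e" "\<And>v. v \<in> rep_space V \<Longrightarrow> e v \<in> U"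
      "\<And>u. u \<in> U \<Longrightarrow> e u = u" "\<And>x v. v \<in> rep_space V \<Longrightarrow> e (\<rho> x v) = \<rho> x (e v)"
    using equivariant_projection[OF \<rho>(1) U'] by blast
  have eV: "e v \<in> rep_space V" if "v \<in> rep_space V" for v using e(2)[OF that] U'(2) by auto
  show ?thesis
  proof (rule that[of "\<lambda>v. if v \<in> rep_space V then e v else 0"])
    show "(\<lambda>v. if v \<in> rep_space V then e v else 0) \<in> Hom V V"
    proof (rule HomI)
      show "(if rep_act V x v \<in> rep_space V then e (rep_act V x v) else 0) = rep_act V x (if v \<in> rep_space V then e v else 0)"
        if v: "v \<in> rep_space V" for x v
        using e(4)[OF v, of x] \<rho>(2)[OF v] \<rho>(2)[OF eV[OF v]] fd_act[OF V v] v by simp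
    qed (use e(1) eV in \<open>auto simp: fd_add[OF V] fd_scale[OF V] linear_on_def\<close>)
    show "(if u \<in> rep_space V then e u else 0) = u" if "u \<in> U" for u using that e(3) U'(2) by auto
  qed (use e(2) in simp)
qed

text \<open>The category of finite dimensional representations is von Neumann regular.\<close>

lemma generalized_inverse:
  assumes ss: "semisimple L" and V: "fd_rep L V" and W: "fd_rep L W" and p: "p \<in> Hom V W"
  obtains q where "q \<in> Hom W V" "\<And>v. p (q (p v)) = p v" "\<And>w. q (p (q w)) = q w"
proof -
  obtain e where e: "e \<in> Hom V V" "\<And>v. v \<in> rep_space V \<Longrightarrow> e v \<in> {v\<in>rep_space V. p v = 0}"
    "\<And>u. u \<in> {v\<in>rep_space V. p v = 0} \<Longrightarrow> e u = u"
    using complete_reducibility[OF ss V kernel_subrep[OF V W p]] by blast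
  obtain i where i: "i \<in> Hom W W" "\<And>v. v \<in> rep_space W \<Longrightarrow> i v \<in> p ` rep_space V"
    "\<And>u. u \<in> p ` rep_space V \<Longrightarrow> i u = u"
    using complete_reducibility[OF ss W image_subrep[OF V W p]] by blast
  \<comment> \<open>\<open>i\<close> projects \<open>w\<close> to the image of \<open>p\<close>,
    \<open>v\<close> is any preimage of the result, and subtracting the kernel component
    \<open>e v\<close> makes the value independent of the choice of \<open>v\<close>.\<close>
  define q where "q w = (if w \<in> rep_space W then (let v = (SOME v. v \<in> rep_space V \<and> p v = i w) in v - e v) else 0)" for w
  have qv: "q w = v - e v" if "w \<in> rep_space W" "v \<in> rep_space V" "p v = i w" for v w
  proof -
    define u where "u = (SOME v. v \<in> rep_space V \<and> p v = i w)"
    have u: "u \<in> rep_space V \<and> p u = i w" unfolding u_def by (rule someI[of _ v]) (use that in auto)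
    have "p (u - v) = 0" using u that Hom_diff[OF p V, of u v] by simp
    then have "e (u - v) = u - v" using e(3)[of "u - v"] u that fd_diff[OF V] by simp
    moreover have "e (u - v) = e u - e v" by (rule Hom_diff[OF e(1) V]) (use u that in auto)
    ultimately have "u - e u = v - e v" by (simp add: algebra_simps)
    then show ?thesis using that(1) by (simp add: q_def u_def Let_def)
  qed
  have ex: "\<exists>v\<in>rep_space V. p v = i w" if "w \<in> rep_space W" for w using i(2)[OF that] by (metis imageE)
  have qV: "q w \<in> rep_space V" if "w \<in> rep_space W" for w
    using ex[OF that] qv[OF that] fd_diff[OF V] Hom_in[OF e(1)] by metis
  have pe: "p (v - e v) = p v" if "v \<in> rep_space V" for v
    using Hom_diff[OF p V that Hom_in[OF e(1) that]] e(2)[OF that] by simp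
  have pq: "p (q w) = i w" if "w \<in> rep_space W" for w
    using ex[OF that] qv[OF that] pe by metis
  have qH: "q \<in> Hom W V"
  proof (rule HomI)
    fix w w' assume w: "w \<in> rep_space W" "w' \<in> rep_space W"
    obtain v v' where v: "v \<in> rep_space V" "p v = i w" "v' \<in> rep_space V" "p v' = i w'" using ex w by metis
    have "p (v + v') = i (w + w')" using v Hom_add[OF p v(1,3)] Hom_add[OF i(1) w] by simp
    then have "q (w + w') = (v + v') - e (v + v')" by (rule qv[OF fd_add[OF W w] fd_add[OF V v(1,3)]])
    then show "q (w + w') = q w + q w'"
      unfolding qv[OF w(1) v(1,2)] qv[OF w(2) v(3,4)] Hom_add[OF e(1) v(1,3)] by simp
  next
    fix c w assume w: "w \<in> rep_space W"
    obtain v where v: "v \<in> rep_space V" "p v = i w" using ex w by metis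
    interpret v: cvec "rep_scale V" by (rule fd_cvec[OF V])
    have "p (rep_scale V c v) = i (rep_scale W c w)" using v Hom_scale[OF p v(1)] Hom_scale[OF i(1) w] by simp
    then have "q (rep_scale W c w) = rep_scale V c v - e (rep_scale V c v)"
      by (rule qv[OF fd_scale[OF W w] fd_scale[OF V v(1)]])
    then show "q (rep_scale W c w) = rep_scale V c (q w)"
      unfolding qv[OF w v] Hom_scale[OF e(1) v(1)] by (simp add: v.scale_right_diff_distrib)
  next
    fix x w assume w: "w \<in> rep_space W"
    obtain v where v: "v \<in> rep_space V" "p v = i w" using ex w by metis
    have "p (rep_act V x v) = i (rep_act W x w)" using v Hom_act[OF p v(1)] Hom_act[OF i(1) w] by simp
    then have "q (rep_act W x w) = rep_act V x v - e (rep_act V x v)"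
      by (rule qv[OF fd_act[OF W w] fd_act[OF V v(1)]])
    then show "q (rep_act W x w) = rep_act V x (q w)"
      unfolding qv[OF w v] Hom_act[OF e(1) v(1)] by (simp add: act_diff[OF V v(1) Hom_in[OF e(1) v(1)]])
  qed (use qV in \<open>auto simp: q_def\<close>)
  show ?thesis
  proof (rule that[OF qH])
    show "p (q (p v)) = p v" for v
    proof (cases "v \<in> rep_space V")
      case True
      then show ?thesis using pq[OF Hom_in[OF p True]] i(3)[of "p v"] by simp
    next
      case False
      then show ?thesis using Hom_out[OF p False] Hom_0[OF qH W] Hom_0[OF p V] by simp
    qed
    show "q (p (q w)) = q w" for w
    proof (cases "w \<in> rep_space W")
      case True
      obtain v where v: "v \<in> rep_space V" "p v = i w" using ex[OF True] by blast
      have "p v = i (i w)" using v i(2)[OF True] i(3) by simp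
      then have "q (i w) = v - e v" by (rule qv[OF Hom_in[OF i(1) True] v(1)])
      then show ?thesis using qv[OF True v] pq[OF True] by simp
    next
      case False
      then show ?thesis using Hom_out[OF qH False] Hom_0[OF qH W] Hom_0[OF p V] by simp
    qed
  qed
qed

section \<open>Dimensions of Hom spaces\<close>

lemma hdim_sum:
  fixes A :: "('g::ab_group_add, 'a::ab_group_add) rep" and B :: "('g, 'b::ab_group_add) rep"
    and C :: "('g, 'c::ab_group_add) rep" and D :: "('g, 'd::ab_group_add) rep"
    and E :: "('g, 'e::ab_group_add) rep" and F :: "('g, 'f::ab_group_add) rep"
  assumes "fd_rep L A" "fd_rep L B" "fd_rep L C" "fd_rep L D" "fd_rep L E" "fd_rep L F"
    and inj: "\<And>a. a \<in> Hom A B \<Longrightarrow> i a \<in> Hom C D" "\<And>a. a \<in> Hom A B \<Longrightarrow> i a = 0 \<Longrightarrow> a = 0"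
      "linear_on (Hom A B) (hom_scale B) (hom_scale D) i"
    and sur: "\<And>c. c \<in> Hom C D \<Longrightarrow> j c \<in> Hom E F" "\<And>e. e \<in> Hom E F \<Longrightarrow> \<exists>c\<in>Hom C D. j c = e"
      "linear_on (Hom C D) (hom_scale D) (hom_scale F) j"
    and ex: "\<And>a. a \<in> Hom A B \<Longrightarrow> j (i a) = 0" "\<And>c. c \<in> Hom C D \<Longrightarrow> j c = 0 \<Longrightarrow> \<exists>a\<in>Hom A B. i a = c"
  shows "hdim C D = hdim A B + hdim E F"
proof -
  interpret ab: cvec2 "hom_scale B :: complex \<Rightarrow> ('a \<Rightarrow> 'b) \<Rightarrow> _" "hom_scale D :: complex \<Rightarrow> ('c \<Rightarrow> 'd) \<Rightarrow> _"
    using assms(2,4)[THEN hom_cvec] by (auto simp: cvec2_def)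
  interpret cd: cvec2 "hom_scale D :: complex \<Rightarrow> ('c \<Rightarrow> 'd) \<Rightarrow> _" "hom_scale F :: complex \<Rightarrow> ('e \<Rightarrow> 'f) \<Rightarrow> _"
    using assms(4,6)[THEN hom_cvec] by (auto simp: cvec2_def)
  note fAB = Hom_fdim[OF assms(1,2)] and fCD = Hom_fdim[OF assms(3,4)]
  have "j ` Hom C D = Hom E F" using sur(1,2) by force
  moreover have "{c\<in>Hom C D. j c = 0} = i ` Hom A B" using inj(1) ex by force
  moreover have "ab.v2.dim (i ` Hom A B) = ab.v1.dim (Hom A B)"
    by (rule ab.dim_inj_image[OF fAB inj(3,2)])
  ultimately show ?thesis using cd.dim_image_kernel(2)[OF fCD sur(3)] by (simp add: hdim_def)
qed

lemma linear_on_post: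
  assumes f: "f \<in> Hom W Z" and W: "fd_rep L W"
  shows "linear_on (Hom V W) (hom_scale W) (hom_scale Z) (\<lambda>\<phi> v. f (\<phi> v))"
  unfolding linear_on_def
proof (intro conjI ballI allI ext)
  fix \<phi> \<psi> v assume h: "\<phi> \<in> Hom V W" "\<psi> \<in> Hom V W"
  have "\<phi> v \<in> rep_space W" "\<psi> v \<in> rep_space W"
    using Hom_in[OF h(1)] Hom_in[OF h(2)] Hom_out[OF h(1)] Hom_out[OF h(2)] fd_zero[OF W] by metis+
  then show "f ((\<phi> + \<psi>) v) = ((\<lambda>v. f (\<phi> v)) + (\<lambda>v. f (\<psi> v))) v" using Hom_add[OF f] by simp
next
  fix c \<phi> v assume h: "\<phi> \<in> Hom V W"
  have "\<phi> v \<in> rep_space W" using Hom_in[OF h] Hom_out[OF h] fd_zero[OF W] by metis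
  then show "f (hom_scale W c \<phi> v) = hom_scale Z c (\<lambda>v. f (\<phi> v)) v" using Hom_scale[OF f] by (simp add: hom_scale_def)
qed

lemma linear_on_pre: "linear_on S (hom_scale W) (hom_scale W) (\<lambda>\<phi> v. \<phi> (f v))"
  by (simp add: linear_on_def hom_scale_def fun_eq_iff)

text \<open>Generalized inverses split the sequence: \<open>f'\<close> is a left inverse of
  \<open>f\<close> and \<open>g'\<close> a right inverse of \<open>g\<close>. Therefore composition
  with \<open>f\<close> and \<open>g\<close> is exact in either variable of Hom.\<close>

lemma hdim_exact:
  assumes ss: "semisimple L" and U: "fd_rep L U" and A: "fd_rep L A" and B: "fd_rep L B" and C: "fd_rep L C"
    and f: "f \<in> Hom A B" "inj_on f (rep_space A)" and g: "g \<in> Hom B C" "g ` rep_space B = rep_space C"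
    and ex: "f ` rep_space A = {v\<in>rep_space B. g v = 0}"
  shows "hdim U B = hdim U A + hdim U C" "hdim B U = hdim C U + hdim A U"
proof -
  obtain f' where f': "f' \<in> Hom B A" "\<And>v. f (f' (f v)) = f v" "\<And>w. f' (f (f' w)) = f' w"
    using generalized_inverse[OF ss A B f(1)] by blast
  obtain g' where g': "g' \<in> Hom C B" "\<And>v. g (g' (g v)) = g v" "\<And>w. g' (g (g' w)) = g' w"
    using generalized_inverse[OF ss B C g(1)] by blast
  have gg': "g (g' w) = w" if "w \<in> rep_space C" for w using that g(2) g'(2) by force
  have f'f: "f' (f v) = v" if "v \<in> rep_space A" for v
    using inj_onD[OF f(2) f'(2)] that Hom_in[OF f'(1) Hom_in[OF f(1) that]] by blast
  have gf: "g (f v) = 0" for v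
  proof (cases "v \<in> rep_space A")
    case True
    then show ?thesis using ex by blast
  qed (simp add: Hom_out[OF f(1)] Hom_0[OF g(1) B])
  have ff': "f (f' v) = v" if v: "v \<in> rep_space B" "g v = 0" for v
  proof -
    obtain a where "v = f a" using ex v by blast
    then show ?thesis using f'(2) by simp
  qed
  show "hdim U B = hdim U A + hdim U C"
  proof (rule hdim_sum[OF U A U B U C, where i="\<lambda>\<phi> u. f (\<phi> u)" and j="\<lambda>\<phi> u. g (\<phi> u)"])
    show "(\<lambda>u. f (a u)) \<in> Hom U B" if "a \<in> Hom U A" for a by (rule Hom_comp[OF that f(1) A])
    show "a = 0" if a: "a \<in> Hom U A" "(\<lambda>u. f (a u)) = 0" for a
    proof
      fix u
      have "f (a u) = 0" using fun_cong[OF a(2), of u] by simp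
      then have "f' (f (a u)) = 0" using Hom_0[OF f'(1) B] by simp
      then show "a u = 0 u" using f'f[OF Hom_in[OF a(1)]] Hom_out[OF a(1)] by (cases "u \<in> rep_space U") auto
    qed
    show "linear_on (Hom U A) (hom_scale A) (hom_scale B) (\<lambda>\<phi> u. f (\<phi> u))" by (rule linear_on_post[OF f(1) A])
    show "linear_on (Hom U B) (hom_scale B) (hom_scale C) (\<lambda>\<phi> u. g (\<phi> u))" by (rule linear_on_post[OF g(1) B])
    show "(\<lambda>u. g (c u)) \<in> Hom U C" if "c \<in> Hom U B" for c by (rule Hom_comp[OF that g(1) B])
    show "\<exists>c\<in>Hom U B. (\<lambda>u. g (c u)) = e" if e: "e \<in> Hom U C" for e
    proof (rule bexI[of _ "\<lambda>u. g' (e u)"])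
      show h: "(\<lambda>u. g' (e u)) \<in> Hom U B" by (rule Hom_comp[OF e g'(1) C])
      show "(\<lambda>u. g (g' (e u))) = e"
        by (rule Hom_eqI[OF Hom_comp[OF h g(1) B] e]) (rule gg'[OF Hom_in[OF e]])
    qed
    show "(\<lambda>u. g (f (a u))) = 0" for a using gf by auto
    show "\<exists>a\<in>Hom U A. (\<lambda>u. f (a u)) = c" if c: "c \<in> Hom U B" "(\<lambda>u. g (c u)) = 0" for c
    proof (rule bexI[of _ "\<lambda>u. f' (c u)"])
      show h: "(\<lambda>u. f' (c u)) \<in> Hom U A" by (rule Hom_comp[OF c(1) f'(1) B])
      show "(\<lambda>u. f (f' (c u))) = c"
        by (rule Hom_eqI[OF Hom_comp[OF h f(1) A] c(1)]) (use ff' Hom_in[OF c(1)] fun_cong[OF c(2)] in auto)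
    qed
  qed
  show "hdim B U = hdim C U + hdim A U"
  proof (rule hdim_sum[OF C U B U A U, where i="\<lambda>\<phi> u. \<phi> (g u)" and j="\<lambda>\<phi> u. \<phi> (f u)"])
    show "(\<lambda>u. a (g u)) \<in> Hom B U" if "a \<in> Hom C U" for a by (rule Hom_comp[OF g(1) that C])
    show "a = 0" if a: "a \<in> Hom C U" "(\<lambda>u. a (g u)) = 0" for a
    proof
      fix u
      have "a (g (g' u)) = 0" using fun_cong[OF a(2), of "g' u"] by simp
      then show "a u = 0 u" using gg'[of u] Hom_out[OF a(1)] by (cases "u \<in> rep_space C") auto
    qed
    show "(\<lambda>u. c (f u)) \<in> Hom A U" if "c \<in> Hom B U" for c by (rule Hom_comp[OF f(1) that B])
    show "\<exists>c\<in>Hom B U. (\<lambda>u. c (f u)) = e" if e: "e \<in> Hom A U" for e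
    proof (rule bexI[of _ "\<lambda>u. e (f' u)"])
      show h: "(\<lambda>u. e (f' u)) \<in> Hom B U" by (rule Hom_comp[OF f'(1) e A])
      show "(\<lambda>u. e (f' (f u))) = e"
        by (rule Hom_eqI[OF Hom_comp[OF f(1) h B] e]) (simp add: f'f)
    qed
    show "(\<lambda>u. a (g (f u))) = 0" if "a \<in> Hom C U" for a using gf Hom_0[OF that C] by auto
    show "\<exists>a\<in>Hom C U. (\<lambda>u. a (g u)) = c" if c: "c \<in> Hom B U" "(\<lambda>u. c (f u)) = 0" for c
    proof (rule bexI[of _ "\<lambda>u. c (g' u)"])
      show h: "(\<lambda>u. c (g' u)) \<in> Hom C U" by (rule Hom_comp[OF g'(1) c(1) B])
      show "(\<lambda>u. c (g' (g u))) = c"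
      proof (rule Hom_eqI[OF Hom_comp[OF g(1) h C] c(1)])
        fix v assume v: "v \<in> rep_space B"
        have v': "g' (g v) \<in> rep_space B" by (rule Hom_in[OF g'(1) Hom_in[OF g(1) v]])
        have "g (v - g' (g v)) = 0" using Hom_diff[OF g(1) B v v'] g'(2) by simp
        then have "f (f' (v - g' (g v))) = v - g' (g v)" by (rule ff'[OF fd_diff[OF B v v']])
        then have "c (v - g' (g v)) = 0" using fun_cong[OF c(2), of "f' (v - g' (g v))"] by simp
        then show "c (g' (g v)) = c v" using Hom_diff[OF c(1) B v v'] by simp
      qed
    qed
  qed (rule linear_on_pre)+
qed

lemma Hom_zero_mem: "fd_rep L W \<Longrightarrow> 0 \<in> Hom V W"
  using Hom_zero[of L W V] by (simp add: zero_fun_def)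

lemma Hom_to_0: "rep_space Z = {0} \<Longrightarrow> f \<in> Hom V Z \<Longrightarrow> f = 0"
  using Hom_in[of f V Z] Hom_out[of f V Z] by (auto simp: fun_eq_iff)

lemma hdim_0:
  fixes U :: "('g::ab_group_add, 'u::ab_group_add) rep" and Z :: "('g, 'z::ab_group_add) rep"
  assumes U: "fd_rep L U" and Z: "fd_rep L Z" "rep_space Z = {0}"
  shows "hdim U Z = 0" "hdim Z U = 0"
proof -
  interpret h: cvec "hom_scale Z :: complex \<Rightarrow> ('u \<Rightarrow> 'z) \<Rightarrow> _" by (rule hom_cvec[OF Z(1)])
  interpret h2: cvec "hom_scale U :: complex \<Rightarrow> ('z \<Rightarrow> 'u) \<Rightarrow> _" by (rule hom_cvec[OF U])
  have "Hom U Z = {0}" using Hom_to_0[OF Z(2)] Hom_zero_mem[OF Z(1), of U] by blast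
  then show "hdim U Z = 0" by (simp add: hdim_def)
  have "f = 0" if "f \<in> Hom Z U" for f
  proof
    fix v show "f v = 0 v" using Hom_0[OF that Z(1)] Hom_out[OF that, of v] Z(2) by (cases "v = 0") auto
  qed
  then have "Hom Z U = {0}" using Hom_zero_mem[OF U, of Z] by blast
  then show "hdim Z U = 0" by (simp add: hdim_def)
qed

lemma zero_subrep: "fd_rep L V \<Longrightarrow> subrep V {0}"
proof -
  assume V: "fd_rep L V"
  interpret v: cvec "rep_scale V" by (rule fd_cvec[OF V])
  show ?thesis by (simp add: subrep_def fd_zero[OF V] act_zero[OF V])
qed

text \<open>An isomorphism is an exact sequence with the zero subrepresentation as left
  term.\<close>

lemma hdim_iso:
  assumes ss: "semisimple L" and U: "fd_rep L U" and A: "fd_rep L A" and B: "fd_rep L B" and iso: "rep_iso A B"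
  shows "hdim U A = hdim U B" "hdim A U = hdim B U"
proof -
  obtain f where f: "f \<in> Hom A B" "bij_betw f (rep_space A) (rep_space B)" using iso by (auto simp: rep_iso_def)
  let ?Z = "sub_rep A {0}"
  note Z = sub_rep_fd[OF A zero_subrep[OF A]]
  have 1: "rep_id ?Z \<in> Hom ?Z A" by (rule inclusion_Hom[OF A zero_subrep[OF A]])
  have 2: "inj_on (rep_id ?Z) (rep_space ?Z)" by simp
  have 3: "f ` rep_space A = rep_space B" using f(2) by (simp add: bij_betw_def)
  have "v = 0" if "v \<in> rep_space A" "f v = 0" for v
    using inj_onD[of f "rep_space A" v 0] f(2) that Hom_0[OF f(1) A] fd_zero[OF A] by (auto simp: bij_betw_def)
  then have 4: "rep_id ?Z ` rep_space ?Z = {v\<in>rep_space A. f v = 0}"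
    using fd_zero[OF A] Hom_0[OF f(1) A] by (auto simp: rep_id_def)
  have "hdim U ?Z = 0" "hdim ?Z U = 0" using hdim_0[OF U Z] by auto
  then show "hdim U A = hdim U B" "hdim A U = hdim B U"
    using hdim_exact[OF ss U Z A B 1 2 f(1) 3 4] by auto
qed

lemma iso_inverse:
  assumes A: "fd_rep L A" and B: "fd_rep L B" and f: "f \<in> Hom A B" "bij_betw f (rep_space A) (rep_space B)"
  obtains g where "g \<in> Hom B A" "\<And>v. v \<in> rep_space A \<Longrightarrow> g (f v) = v" "\<And>w. w \<in> rep_space B \<Longrightarrow> f (g w) = w"
proof -
  define g where "g w = (if w \<in> rep_space B then inv_into (rep_space A) f w else 0)" for w
  have gA: "g w \<in> rep_space A" and fg: "f (g w) = w" if "w \<in> rep_space B" for w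
    using that f(2) by (auto simp: g_def bij_betw_def intro: inv_into_into f_inv_into_f)
  have gf: "g (f v) = v" if "v \<in> rep_space A" for v
    using that f Hom_in[OF f(1)] by (auto simp: g_def bij_betw_def)
  have uniq: "g w = v" if "v \<in> rep_space A" "f v = w" for v w using gf that by auto
  have "g \<in> Hom B A"
  proof (rule HomI)
    show "g (v + w) = g v + g w" if "v \<in> rep_space B" "w \<in> rep_space B" for v w
      by (rule uniq) (use that gA fg in \<open>auto simp: Hom_add[OF f(1)] fd_add[OF A]\<close>)
    show "g (rep_scale B c v) = rep_scale A c (g v)" if "v \<in> rep_space B" for c v
      by (rule uniq) (use that gA fg in \<open>auto simp: Hom_scale[OF f(1)] fd_scale[OF A]\<close>)
    show "g (rep_act B x v) = rep_act A x (g v)" if "v \<in> rep_space B" for x v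
      by (rule uniq) (use that gA fg in \<open>auto simp: Hom_act[OF f(1)] fd_act[OF A]\<close>)
  qed (use gA in \<open>auto simp: g_def\<close>)
  then show ?thesis using that gf fg by blast
qed

lemma rep_iso_sym:
  assumes A: "fd_rep L A" and B: "fd_rep L B" and iso: "rep_iso A B"
  shows "rep_iso B A"
proof -
  obtain f where f: "f \<in> Hom A B" "bij_betw f (rep_space A) (rep_space B)" using iso by (auto simp: rep_iso_def)
  obtain g where g: "g \<in> Hom B A" "\<And>v. v \<in> rep_space A \<Longrightarrow> g (f v) = v" "\<And>w. w \<in> rep_space B \<Longrightarrow> f (g w) = w"
    using iso_inverse[OF A B f] by blast
  have "bij_betw g (rep_space B) (rep_space A)"
    by (rule bij_betw_byWitness[of _ f]) (use g Hom_in[OF f(1)] Hom_in[OF g(1)] in auto)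
  then show ?thesis using g(1) by (auto simp: rep_iso_def)
qed

lemma rep_iso_trans:
  assumes B: "fd_rep L B" and "rep_iso A B" "rep_iso B C"
  shows "rep_iso A C"
proof -
  obtain f where f: "f \<in> Hom A B" "bij_betw f (rep_space A) (rep_space B)" using assms by (auto simp: rep_iso_def)
  obtain g where g: "g \<in> Hom B C" "bij_betw g (rep_space B) (rep_space C)" using assms by (auto simp: rep_iso_def)
  have "bij_betw (\<lambda>v. g (f v)) (rep_space A) (rep_space C)"
    using bij_betw_trans[OF f(2) g(2)] by (simp add: o_def)
  then show ?thesis using Hom_comp[OF f(1) g(1) B] by (auto simp: rep_iso_def)
qed

lemma rep_iso_refl: "fd_rep L A \<Longrightarrow> rep_iso A A"
  using rep_id_Hom[of L A] by (auto simp: rep_iso_def bij_betw_def inj_on_def intro!: bexI[of _ "rep_id A"])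

section \<open>Schur's lemma and irreducible subrepresentations\<close>

lemma irr_fd: "irreducible_rep L V \<Longrightarrow> fd_rep L V"
  by (simp add: irreducible_rep_def)

lemma irr_sub: "irreducible_rep L V \<Longrightarrow> subrep V U \<Longrightarrow> U = {0} \<or> U = rep_space V"
  unfolding irreducible_rep_def subrep_def by blast

lemma schur_iso:
  assumes U: "irreducible_rep L U" and V: "irreducible_rep L V" and f: "f \<in> Hom U V" "f \<noteq> 0"
  shows "bij_betw f (rep_space U) (rep_space V)"
proof -
  note fU = irr_fd[OF U] and fV = irr_fd[OF V]
  interpret uv: cvec2 "rep_scale U" "rep_scale V"
    using fd_cvec[OF fU] fd_cvec[OF fV] by (simp add: cvec2_def)
  obtain u where u: "u \<in> rep_space U" "f u \<noteq> 0" using Hom_nonzero[OF f] by blast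
  have "f ` rep_space U \<noteq> {0}" using u by blast
  then have im: "f ` rep_space U = rep_space V" using irr_sub[OF V image_subrep[OF fU fV f(1)]] by blast
  have "{v\<in>rep_space U. f v = 0} \<noteq> rep_space U" using u by blast
  then have "{v\<in>rep_space U. f v = 0} = {0}" using irr_sub[OF U kernel_subrep[OF fU fV f(1)]] by blast
  then have "inj_on f (rep_space U)"
    using uv.inj_on_iff_kernel[OF fd_subspace[OF fU] Hom_linear[OF f(1)]] by blast
  then show ?thesis using im by (simp add: bij_betw_def)
qed

lemma schur_0:
  fixes U :: "('g::ab_group_add, 'u::ab_group_add) rep" and V :: "('g, 'v::ab_group_add) rep"
  assumes U: "irreducible_rep L U" and V: "irreducible_rep L V" and n: "\<not> rep_iso U V"
  shows "hdim U V = 0"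
proof -
  interpret h: cvec "hom_scale V :: complex \<Rightarrow> ('u \<Rightarrow> 'v) \<Rightarrow> _" by (rule hom_cvec[OF irr_fd[OF V]])
  have "Hom U V = {0}"
    using schur_iso[OF U V] n Hom_zero_mem[OF irr_fd[OF V], of U] unfolding rep_iso_def by blast
  then show ?thesis by (simp add: hdim_def)
qed

text \<open>After subtraction of an eigenvalue times the identity an endomorphism has a nonzero
  kernel; not being bijective, it is 0.\<close>

lemma schur_1:
  fixes U :: "('g::ab_group_add, 'u::ab_group_add) rep"
  assumes U: "irreducible_rep L U"
  shows "hdim U U = 1"
proof -
  note fU = irr_fd[OF U]
  interpret u: cvec "rep_scale U" by (rule fd_cvec[OF fU])
  interpret h: cvec "hom_scale U :: complex \<Rightarrow> ('u \<Rightarrow> 'u) \<Rightarrow> _" by (rule hom_cvec[OF fU])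
  have ne: "rep_space U \<noteq> {0}" using U by (simp add: irreducible_rep_def)
  have "f \<in> h.span {rep_id U}" if f: "f \<in> Hom U U" for f
  proof -
    have im: "f ` rep_space U \<subseteq> rep_space U" using Hom_in[OF f] by auto
    obtain a v where av: "v \<in> rep_space U" "v \<noteq> 0" "f v = rep_scale U a v"
      by (rule u.eigenvector_exists[OF fd_fdim[OF fU] Hom_linear[OF f] im ne])
    let ?g = "\<lambda>v. f v - rep_scale U a (rep_id U v)"
    have g: "?g \<in> Hom U U" by (rule Hom_minus[OF fU f Hom_scaled[OF fU rep_id_Hom[OF fU]]])
    have "?g = 0"
    proof (rule ccontr)
      assume "?g \<noteq> 0"
      then have "inj_on ?g (rep_space U)" using schur_iso[OF U U g] by (simp add: bij_betw_def)
      then have "v = 0" using inj_onD[of ?g "rep_space U" v 0] av fd_zero[OF fU] Hom_0[OF g fU] by simp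
      then show False using av by simp
    qed
    then have "f = hom_scale U a (rep_id U)" by (auto simp: fun_eq_iff hom_scale_def)
    then show ?thesis using h.span_scale[OF h.span_base, of "rep_id U" "{rep_id U}"] by simp
  qed
  moreover have "h.span {rep_id U} \<subseteq> Hom U U"
    by (rule h.span_minimal) (use rep_id_Hom[OF fU] Hom_subspace[OF fU] in auto)
  ultimately have e: "Hom U U = h.span {rep_id U}" by blast
  obtain v where "v \<in> rep_space U" "v \<noteq> 0" using ne fd_zero[OF fU] by blast
  then have "rep_id U \<noteq> 0" by (metis rep_id_in zero_fun_apply)
  then have "h.independent {rep_id U}" by simp
  then show ?thesis using h.dim_span_eq_card_independent[of "{rep_id U}"] e by (simp add: hdim_def)
qed

text \<open>A nonzero subrepresentation of least dimension is irreducible.\<close>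

lemma irreducible_subrep_exists:
  assumes V: "fd_rep L V" and ne: "rep_space V \<noteq> {0}"
  obtains U where "subrep V U" "irreducible_rep L (sub_rep V U)"
proof -
  interpret v: cvec "rep_scale V" by (rule fd_cvec[OF V])
  let ?P = "\<lambda>U. subrep V U \<and> U \<noteq> {0}"
  have "?P (rep_space V)" using V ne fd_subspace[OF V] fd_act[OF V] by (auto simp: subrep_def)
  then obtain U where U: "?P U" "\<And>T. ?P T \<Longrightarrow> v.dim U \<le> v.dim T"
    using ex_has_least_nat[of ?P "rep_space V" v.dim] by blast
  note fU = sub_rep_fd[OF V conjunct1[OF U(1)]]
  have "irreducible_rep L (sub_rep V U)"
    unfolding irreducible_rep_def sub_rep_simps
  proof (intro conjI allI impI fU)
    show "U \<noteq> {0}" using U by simp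
    fix T assume T: "T \<subseteq> U \<and> v.subspace T \<and> (\<forall>x. rep_act V x ` T \<subseteq> T)"
    show "T = {0} \<or> T = U"
    proof (rule disjCI)
      assume "T \<noteq> U"
      then have "v.dim T < v.dim U"
        using v.fdim_sub(2,3)[of U T] fd_fdim[OF fU] T by fastforce
      moreover have "subrep V T" using T U(1) unfolding subrep_def by (blast dest: image_subset_iff[THEN iffD1])
      ultimately show "T = {0}" using U(2)[of T] by fastforce
    qed
  qed
  then show ?thesis using that U(1) by blast
qed

lemma irreducible_iso:
  assumes A: "irreducible_rep L A" and B: "fd_rep L B" and iso: "rep_iso A B"
  shows "irreducible_rep L B"
proof -
  obtain f where f: "f \<in> Hom A B" "bij_betw f (rep_space A) (rep_space B)" using iso by (auto simp: rep_iso_def)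
  note fA = irr_fd[OF A]
  interpret ab: cvec2 "rep_scale A" "rep_scale B"
    using fd_cvec[OF fA] fd_cvec[OF B] by (simp add: cvec2_def)
  have im: "f ` rep_space A = rep_space B" and inj: "inj_on f (rep_space A)" using f(2) by (auto simp: bij_betw_def)
  have ne: "rep_space A \<noteq> {0}" using A by (simp add: irreducible_rep_def)
  have "rep_space B \<noteq> {0}"
  proof
    assume "rep_space B = {0}"
    then have "f v = f 0" if "v \<in> rep_space A" for v
      using Hom_in[OF f(1) that] Hom_0[OF f(1) fA] by simp
    then have "v = 0" if "v \<in> rep_space A" for v using inj_onD[OF inj] that fd_zero[OF fA] by blast
    then show False using ne fd_zero[OF fA] by blast
  qed
  moreover have "T = {0} \<or> T = rep_space B" if T: "subrep B T" for T
  proof -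
    let ?U = "{v\<in>rep_space A. f v \<in> T}"
    have TB: "T \<subseteq> rep_space B" "ab.v2.subspace T" "\<And>x u. u \<in> T \<Longrightarrow> rep_act B x u \<in> T" using T by (auto simp: subrep_def)
    have "subrep A ?U"
      unfolding subrep_def using ab.subspace_preimage_on[OF Hom_linear[OF f(1)] fd_subspace[OF fA] TB(2)] TB(3)
      by (auto simp: fd_act[OF fA] Hom_act[OF f(1)])
    then have "?U = {0} \<or> ?U = rep_space A" by (rule irr_sub[OF A])
    moreover have "T \<subseteq> f ` rep_space A" using TB(1) im by simp
    then have "T = f ` ?U" by auto
    moreover have "f ` {0} = {0}" using Hom_0[OF f(1) fA] by simp
    ultimately show ?thesis using im by (elim disjE) simp_all
  qed
  ultimately show ?thesis using B unfolding irreducible_rep_def subrep_def by (simp add: image_subset_iff)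
qed

section \<open>Copies inside the space of sequences\<close>

lemma transport_rep:
  assumes V: "fd_rep L V" and sc: "cvec sc" and \<phi>: "linear_on (rep_space V) (rep_scale V) sc \<phi>" "inj_on \<phi> (rep_space V)"
  obtains T where "fd_rep L T" "rep_scale T = sc" "rep_iso V T"
proof -
  interpret vw: cvec2 "rep_scale V" sc
    using fd_cvec[OF V] sc by (simp add: cvec2_def)
  let ?S = "rep_space V"
  define T where "T = \<lparr>rep_space = \<phi> ` ?S, rep_scale = sc, rep_act = (\<lambda>x u. \<phi> (rep_act V x (inv_into ?S \<phi> u)))\<rparr>"
  have iv: "inv_into ?S \<phi> (\<phi> v) = v" if "v \<in> ?S" for v using that \<phi>(2) by simp
  have act: "rep_act T x (\<phi> v) = \<phi> (rep_act V x v)" if "v \<in> ?S" for x v using iv that by (simp add: T_def)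
  note pa = vw.linear_on_add[OF \<phi>(1)] and ps = vw.linear_on_scale[OF \<phi>(1)]
  have Tsp: "rep_space T = \<phi> ` ?S" and Tsc: "rep_scale T = sc" by (simp_all add: T_def)
  have fd: "vw.v2.fdim (\<phi> ` ?S)" by (rule vw.dim_image_kernel(1)[OF fd_fdim[OF V] \<phi>(1)])
  have "fd_rep L T"
    unfolding fd_rep_def Tsp Tsc
  proof (intro conjI allI ballI)
    show "vector_space sc" by (rule vw.v2.vector_space_axioms)
    show "vw.v2.subspace (\<phi> ` ?S)" "\<exists>B. finite B \<and> vw.v2.span B = \<phi> ` ?S" using fd by (auto simp: vw.v2.fdim_def)
    show "rep_act T x ` \<phi> ` ?S \<subseteq> \<phi> ` ?S" for x using fd_act[OF V] act by auto
    show "linear_on (\<phi> ` ?S) sc sc (rep_act T x)" for x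
      unfolding linear_on_def
    proof (intro conjI ballI allI)
      fix a b assume "a \<in> \<phi> ` ?S" "b \<in> \<phi> ` ?S"
      then obtain v w where v: "v \<in> ?S" "w \<in> ?S" "a = \<phi> v" "b = \<phi> w" by blast
      have "rep_act T x (\<phi> v + \<phi> w) = rep_act T x (\<phi> (v + w))" by (simp only: pa[OF v(1,2)])
      also have "\<dots> = \<phi> (rep_act V x v + rep_act V x w)"
        by (simp only: act[OF fd_add[OF V v(1,2)]] act_add[OF V v(1,2)])
      also have "\<dots> = rep_act T x (\<phi> v) + rep_act T x (\<phi> w)"
        by (simp only: pa[OF fd_act[OF V v(1)] fd_act[OF V v(2)]] act[OF v(1)] act[OF v(2)])
      finally show "rep_act T x (a + b) = rep_act T x a + rep_act T x b" using v by simp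
    next
      fix c a assume "a \<in> \<phi> ` ?S"
      then obtain v where v: "v \<in> ?S" "a = \<phi> v" by blast
      have "rep_act T x (sc c (\<phi> v)) = rep_act T x (\<phi> (rep_scale V c v))" by (simp only: ps[OF v(1)])
      also have "\<dots> = sc c (rep_act T x (\<phi> v))"
        by (simp only: act[OF fd_scale[OF V v(1)]] act_scale[OF V v(1)] ps[OF fd_act[OF V v(1)]] act[OF v(1)])
      finally show "rep_act T x (sc c a) = sc c (rep_act T x a)" using v by simp
    qed
    fix a assume "a \<in> \<phi> ` ?S"
    then obtain v where v: "v \<in> ?S" "a = \<phi> v" by blast
    have l: "linear_on UNIV (lie_scale L) (rep_scale V) (\<lambda>x. rep_act V x v)" using V v(1) unfolding fd_rep_def by blast
    show "linear_on UNIV (lie_scale L) sc (\<lambda>x. rep_act T x a)"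
      unfolding linear_on_def v(2) act[OF v(1)]
    proof (intro conjI ballI allI)
      fix x y
      have "rep_act V (x + y) v = rep_act V x v + rep_act V y v" using l unfolding linear_on_def by blast
      then show "\<phi> (rep_act V (x + y) v) = \<phi> (rep_act V x v) + \<phi> (rep_act V y v)"
        by (simp only: pa[OF fd_act[OF V v(1)] fd_act[OF V v(1)]])
    next
      fix c x
      have "rep_act V (lie_scale L c x) v = rep_scale V c (rep_act V x v)" using l unfolding linear_on_def by blast
      then show "\<phi> (rep_act V (lie_scale L c x) v) = sc c (\<phi> (rep_act V x v))"
        by (simp only: ps[OF fd_act[OF V v(1)]])
    qed
  next
    fix x y a assume "a \<in> \<phi> ` ?S"
    then obtain v where v: "v \<in> ?S" "a = \<phi> v" by blast
    have "rep_act V (bracket L x y) v = rep_act V x (rep_act V y v) - rep_act V y (rep_act V x v)"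
      using V v(1) unfolding fd_rep_def by blast
    then show "rep_act T (bracket L x y) a = rep_act T x (rep_act T y a) - rep_act T y (rep_act T x a)"
      using v by (simp add: act fd_act[OF V] vw.linear_on_diff[OF \<phi>(1) fd_subspace[OF V]])
  qed
  moreover have "rep_iso V T"
    unfolding rep_iso_def
  proof (rule bexI[of _ "\<lambda>v. if v \<in> ?S then \<phi> v else 0"])
    have "bij_betw \<phi> ?S (rep_space T)" using \<phi>(2) by (simp add: bij_betw_def Tsp)
    then show "bij_betw (\<lambda>v. if v \<in> ?S then \<phi> v else 0) ?S (rep_space T)"
      by (rule bij_betw_cong[THEN iffD1, rotated]) simp
    show "(\<lambda>v. if v \<in> ?S then \<phi> v else 0) \<in> Hom V T"
      by (rule HomI) (auto simp: Tsp Tsc fd_add[OF V] fd_scale[OF V] fd_act[OF V] pa ps act)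
  qed
  ultimately show ?thesis using that Tsc by blast
qed

lemma seq_cvec: "cvec seq_scale"
  by unfold_locales (auto simp: seq_scale_def fun_eq_iff algebra_simps)

text \<open>Coordinates with respect to a finite basis embed the space into the sequences, and the
  action is carried along. It follows that the choice in the definition of \<open>cl\<close> has a
  witness.\<close>

lemma seq_copy:
  assumes V: "fd_rep L V"
  obtains U where "U \<in> seq_reps L" "rep_iso U V"
proof -
  interpret v: cvec "rep_scale V" by (rule fd_cvec[OF V])
  interpret vs: cvec2 "rep_scale V" seq_scale using fd_cvec[OF V] seq_cvec by (simp add: cvec2_def)
  obtain B where B: "finite B" "v.independent B" "B \<subseteq> rep_space V" "v.span B = rep_space V" "card B = v.dim (rep_space V)"
    by (rule v.fdim_basis[OF fd_fdim[OF V]])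
  obtain e :: "nat \<Rightarrow> 'b" and n where e: "B = e ` {i. i < n}" "inj_on e {i. i < n}"
    using finite_imp_nat_seg_image_inj_on[OF B(1)] by blast
  define \<phi> where "\<phi> v = (\<lambda>i. if i < n then v.representation B v (e i) else 0)" for v
  have l: "linear_on (rep_space V) (rep_scale V) seq_scale \<phi>"
    unfolding linear_on_def
  proof (intro conjI ballI allI)
    show "\<phi> (x + y) = \<phi> x + \<phi> y" if "x \<in> rep_space V" "y \<in> rep_space V" for x y
      using that B(4) by (simp add: \<phi>_def fun_eq_iff v.representation_add[OF B(2)])
    show "\<phi> (rep_scale V c x) = seq_scale c (\<phi> x)" if "x \<in> rep_space V" for c x
      using that B(4) by (simp add: \<phi>_def fun_eq_iff v.representation_scale[OF B(2)] seq_scale_def)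
  qed
  have "v = 0" if "v \<in> rep_space V" "\<phi> v = 0" for v
  proof -
    have "v.representation B v b = 0" if bB: "b \<in> B" for b
    proof -
      obtain i where "b = e i" "i < n" using bB e(1) by auto
      then show ?thesis using fun_cong[OF \<open>\<phi> v = 0\<close>, of i] by (simp add: \<phi>_def)
    qed
    then have "(\<Sum>b\<in>B. rep_scale V (v.representation B v b) b) = 0" by simp
    then show ?thesis using v.sum_representation_eq[OF B(2) _ B(1), of v] that(1) B(4) by simp
  qed
  then have "inj_on \<phi> (rep_space V)" using vs.inj_on_iff_kernel[OF fd_subspace[OF V] l] by blast
  then obtain T where T: "fd_rep L T" "rep_scale T = seq_scale" "rep_iso V T"
    using transport_rep[OF V seq_cvec l] by blast
  then show ?thesis using that[of T] rep_iso_sym[OF V T(1,3)] by (simp add: seq_reps_def)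
qed

lemma split_subrep:
  assumes ss: "semisimple L" and V: "fd_rep L V" and U: "subrep V U"
  obtains e K where "e \<in> Hom V (sub_rep V U)" "e ` rep_space V = U" "K = {v\<in>rep_space V. e v = 0}"
    "\<forall>u\<in>U. e u = u" "subrep V K" "fd_rep L (sub_rep V K)"
proof -
  obtain e where e: "e \<in> Hom V V" "\<And>v. v \<in> rep_space V \<Longrightarrow> e v \<in> U" "\<And>u. u \<in> U \<Longrightarrow> e u = u"
    using complete_reducibility[OF ss V U] by blast
  have UV: "U \<subseteq> rep_space V" using U by (simp add: subrep_def)
  have 1: "e \<in> Hom V (sub_rep V U)" using Hom_sub_target[OF UV] e(1,2) by blast
  have 2: "e ` rep_space V = U" using e(2,3) UV by force
  show ?thesis
    by (rule that[OF 1 2 refl _ kernel_subrep[OF V V e(1)] sub_rep_fd[OF V kernel_subrep[OF V V e(1)]]])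
      (use e(3) in blast)
qed

lemma inclusion_exact:
  assumes "K = {v\<in>rep_space V. e v = 0}"
  shows "inj_on (rep_id (sub_rep V K)) (rep_space (sub_rep V K))"
    "rep_id (sub_rep V K) ` rep_space (sub_rep V K) = {v\<in>rep_space V. e v = 0}"
  using assms by (auto simp: inj_on_def rep_id_def)

text \<open>The decrease that drives the inductions in which irreducible summands are peeled
  off.\<close>

lemma dim_split:
  assumes V: "fd_rep L V" and U: "subrep V U" "U \<noteq> {0}"
    and e: "e \<in> Hom V (sub_rep V U)" "e ` rep_space V = U"
  shows "vector_space.dim (rep_scale V) {v\<in>rep_space V. e v = 0} < vector_space.dim (rep_scale V) (rep_space V)"
proof -
  interpret v: cvec "rep_scale V" by (rule fd_cvec[OF V])
  have "v.dim (e ` rep_space V) + v.dim {v\<in>rep_space V. e v = 0} = v.dim (rep_space V)"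
    by (rule v.self.dim_image_kernel(2)[OF fd_fdim[OF V]]) (use Hom_linear[OF e(1)] in simp)
  moreover have "v.dim U \<noteq> 0" using fd_fdim[OF sub_rep_fd[OF V U(1)]] v.fdim_dim_0[of U] U(2) by simp
  ultimately show ?thesis using e(2) by simp
qed

section \<open>Classes in the representation ring\<close>

lemma formal_reps_simps: "carrier (formal_reps L) = {a. Poly_Mapping.keys a \<subseteq> seq_reps L}"
  "add (formal_reps L) = (+)" "zero (formal_reps L) = 0"
  by (simp_all add: formal_reps_def)

lemma formal_group: "comm_group (add_monoid (formal_reps L))"
proof (rule comm_groupI)
  fix a b :: "'a formal_rep"
  assume "a \<in> carrier (add_monoid (formal_reps L))" "b \<in> carrier (add_monoid (formal_reps L))"
  then show "a \<otimes>\<^bsub>add_monoid (formal_reps L)\<^esub> b \<in> carrier (add_monoid (formal_reps L))"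
    using Poly_Mapping.keys_add[of a b] by (auto simp: formal_reps_simps)
next
  fix a :: "'a formal_rep"
  assume a: "a \<in> carrier (add_monoid (formal_reps L))"
  show "\<exists>b\<in>carrier (add_monoid (formal_reps L)). b \<otimes>\<^bsub>add_monoid (formal_reps L)\<^esub> a = \<one>\<^bsub>add_monoid (formal_reps L)\<^esub>"
    by (rule bexI[of _ "- a"]) (use a in \<open>auto simp: formal_reps_simps\<close>)
qed (auto simp: formal_reps_simps add.assoc add.commute)

lemma single_carrier: "U \<in> seq_reps L \<Longrightarrow> Poly_Mapping.single U c \<in> carrier (formal_reps L)"
  by (auto simp: formal_reps_simps)

lemma formal_diff: "a \<in> carrier (formal_reps L) \<Longrightarrow> b \<in> carrier (formal_reps L) \<Longrightarrow> a - b \<in> carrier (formal_reps L)"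
  using Poly_Mapping.keys_add[of a "- b"] by (auto simp: formal_reps_simps)

lemma exact_relationsI:
  assumes "U \<in> seq_reps L" "V \<in> seq_reps L" "Z \<in> seq_reps L" "f \<in> Hom U V" "g \<in> Hom V Z"
    "inj_on f (rep_space U)" "g ` rep_space V = rep_space Z" "f ` rep_space U = {v\<in>rep_space V. g v = 0}"
  shows "Poly_Mapping.single V 1 - Poly_Mapping.single U 1 - Poly_Mapping.single Z 1 \<in> exact_relations L"
  unfolding exact_relations_def using assms by blast

lemma exact_relations_carrier: "exact_relations L \<subseteq> carrier (formal_reps L)"
proof
  fix h assume "h \<in> exact_relations L"
  then obtain U V Q where "h = Poly_Mapping.single V 1 - Poly_Mapping.single U 1 - Poly_Mapping.single Q 1"
    "U \<in> seq_reps L" "V \<in> seq_reps L" "Q \<in> seq_reps L"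
    unfolding exact_relations_def by blast
  then show "h \<in> carrier (formal_reps L)"
    using formal_diff[OF formal_diff[OF single_carrier single_carrier] single_carrier] by simp
qed

lemma relation_subgroup: "subgroup (relation_ideal L) (add_monoid (formal_reps L))"
proof -
  interpret comm_group "add_monoid (formal_reps L)" by (rule formal_group)
  show ?thesis unfolding relation_ideal_def
    by (rule generate_is_subgroup) (use exact_relations_carrier in simp)
qed

text \<open>It lets the factor group construction supply the abelian group laws of the
  representation ring.\<close>

lemma add_monoid_rep_ring: "add_monoid (rep_ring L) = add_monoid (formal_reps L) Mod relation_ideal L"
  by (simp add: rep_ring_def FactRing_def FactGroup_def A_RCOSETS_def set_add_def)

lemma rep_ring_abelian: "abelian_group (rep_ring L)"
proof -
  interpret comm_group "add_monoid (formal_reps L)" by (rule formal_group)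
  have "comm_group (add_monoid (rep_ring L))"
    unfolding add_monoid_rep_ring by (rule abelian_FactGroup[OF relation_subgroup])
  then show ?thesis
    by (auto simp: abelian_group_def abelian_group_axioms_def abelian_monoid_def comm_group_def)
qed

definition coset :: "'g::ab_group_add lie \<Rightarrow> 'g formal_rep \<Rightarrow> 'g formal_rep set"
  where "coset L a = relation_ideal L +>\<^bsub>formal_reps L\<^esub> a"

lemma coset_iff: "x \<in> coset L a \<longleftrightarrow> (\<exists>h\<in>relation_ideal L. x = h + a)"
  by (auto simp: coset_def a_r_coset_def r_coset_def formal_reps_simps)

lemma rep_ring_carrier: "carrier (rep_ring L) = coset L ` carrier (formal_reps L)"
  by (auto simp: rep_ring_def FactRing_def A_RCOSETS_def RCOSETS_def coset_def a_r_coset_def)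

lemma coset_add:
  assumes "a \<in> carrier (formal_reps L)" "b \<in> carrier (formal_reps L)"
  shows "coset L a \<oplus>\<^bsub>rep_ring L\<^esub> coset L b = coset L (a + b)"
proof -
  interpret comm_group "add_monoid (formal_reps L)" by (rule formal_group)
  interpret N: normal "relation_ideal L" "add_monoid (formal_reps L)"
    by (rule subgroup_imp_normal[OF relation_subgroup])
  show ?thesis
    using N.rcos_sum[of a b] assms
    by (simp add: rep_ring_def FactRing_def coset_def a_r_coset_def set_add_def formal_reps_simps)
qed

lemma coset_zero: "\<zero>\<^bsub>rep_ring L\<^esub> = coset L 0"
proof -
  have "coset L 0 = relation_ideal L" by (auto simp: coset_iff)
  then show ?thesis by (simp add: rep_ring_def FactRing_def)
qed

lemma coset_eqI:
  assumes "a \<in> carrier (formal_reps L)" "b \<in> carrier (formal_reps L)" "a - b \<in> relation_ideal L"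
  shows "coset L a = coset L b"
proof -
  interpret comm_group "add_monoid (formal_reps L)" by (rule formal_group)
  have "a \<in> coset L b" unfolding coset_iff using assms(3) by (intro bexI[of _ "a - b"]) auto
  then have "coset L b = coset L a"
    unfolding coset_def a_r_coset_def using assms(2) by (intro repr_independence[OF _ _ relation_subgroup]) auto
  then show ?thesis ..
qed

section \<open>Pairing of classes with representations\<close>

definition formal_mult :: "('g::ab_group_add, 'u::ab_group_add) rep \<Rightarrow> 'g formal_rep \<Rightarrow> int"
  where "formal_mult U a = (\<Sum>V\<in>Poly_Mapping.keys a. Poly_Mapping.lookup a V * int (hdim U V))"

lemma formal_mult_superset:
  "finite A \<Longrightarrow> Poly_Mapping.keys a \<subseteq> A \<Longrightarrow> formal_mult U a = (\<Sum>V\<in>A. Poly_Mapping.lookup a V * int (hdim U V))"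
  unfolding formal_mult_def by (rule sum.mono_neutral_left) (auto simp: in_keys_iff)

lemma formal_mult_add: "formal_mult U (a + b) = formal_mult U a + formal_mult U b"
proof -
  let ?A = "Poly_Mapping.keys a \<union> Poly_Mapping.keys b"
  have "Poly_Mapping.keys (a + b) \<subseteq> ?A" by (rule Poly_Mapping.keys_add)
  then show ?thesis
    by (simp add: formal_mult_superset[of ?A] lookup_add ring_distribs sum.distrib)
qed

lemma formal_mult_0 [simp]: "formal_mult U 0 = 0"
  by (simp add: formal_mult_def)

lemma formal_mult_diff: "formal_mult U (a - b) = formal_mult U a - formal_mult U b"
  using formal_mult_add[of U "a - b" b] by simp

lemma formal_mult_single [simp]: "formal_mult U (Poly_Mapping.single V c) = c * int (hdim U V)"
  by (cases "c = 0") (simp_all add: formal_mult_def)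

text \<open>The generators go to 0 because \<open>hdim U\<close> is additive on exact sequences.
  This is what makes the pairing with \<open>U\<close> descend to classes.\<close>

lemma formal_mult_relation:
  assumes ss: "semisimple L" and U: "fd_rep L U" and a: "a \<in> relation_ideal L"
  shows "formal_mult U a = 0"
proof -
  interpret comm_group "add_monoid (formal_reps L)" by (rule formal_group)
  have incl: "formal_mult U h = 0" if h: "h \<in> exact_relations L" for h
  proof -
    obtain A B C f g where e: "h = Poly_Mapping.single B 1 - Poly_Mapping.single A 1 - Poly_Mapping.single C 1"
      "A \<in> seq_reps L" "B \<in> seq_reps L" "C \<in> seq_reps L" "f \<in> Hom A B" "g \<in> Hom B C"
      "inj_on f (rep_space A)" "g ` rep_space B = rep_space C" "f ` rep_space A = {v\<in>rep_space B. g v = 0}"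
      using h unfolding exact_relations_def by blast
    have "hdim U B = hdim U A + hdim U C"
      by (rule hdim_exact(1)[OF ss U _ _ _ e(5,7,6,8,9)]) (use e(2-4) in \<open>auto simp: seq_reps_def\<close>)
    then show ?thesis by (simp add: e(1) formal_mult_diff)
  qed
  show ?thesis
    using a unfolding relation_ideal_def
  proof (induction rule: generate.induct)
    case (inv h)
    then have "h \<in> carrier (add_monoid (formal_reps L))" using exact_relations_carrier by auto
    then have "h + inv\<^bsub>add_monoid (formal_reps L)\<^esub> h = 0"
      using r_inv[of h] by (simp add: formal_reps_simps)
    then have "formal_mult U h + formal_mult U (inv\<^bsub>add_monoid (formal_reps L)\<^esub> h) = 0"
      by (metis formal_mult_add formal_mult_0)
    then show ?case using incl[OF inv] by simp
  qed (use incl in \<open>auto simp: formal_mult_add formal_reps_simps\<close>)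
qed

text \<open>An arbitrary representative of the class is taken; \<open>class_mult_coset\<close> shows
  that the choice does not matter.\<close>

definition class_mult :: "('g::ab_group_add, 'u::ab_group_add) rep \<Rightarrow> 'g formal_rep set \<Rightarrow> int"
  where "class_mult U S = formal_mult U (SOME a. a \<in> S)"

lemma class_mult_coset:
  assumes "semisimple L" "fd_rep L U"
  shows "class_mult U (coset L a) = formal_mult U a"
proof -
  interpret comm_group "add_monoid (formal_reps L)" by (rule formal_group)
  have "0 \<in> relation_ideal L" using subgroup.one_closed[OF relation_subgroup[of L]] by (simp add: formal_reps_simps)
  then have "a \<in> coset L a" by (auto simp: coset_iff)
  then have "(SOME b. b \<in> coset L a) \<in> coset L a" by (rule someI)
  then obtain h where "h \<in> relation_ideal L" "(SOME b. b \<in> coset L a) = h + a" by (auto simp: coset_iff)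
  then show ?thesis using formal_mult_relation[OF assms] by (simp add: class_mult_def formal_mult_add)
qed

lemma class_mult_add:
  assumes "semisimple L" "fd_rep L U" "S \<in> carrier (rep_ring L)" "T \<in> carrier (rep_ring L)"
  shows "class_mult U (S \<oplus>\<^bsub>rep_ring L\<^esub> T) = class_mult U S + class_mult U T"
  using assms(3,4) unfolding rep_ring_carrier
  by (auto simp: coset_add class_mult_coset[OF assms(1,2)] formal_mult_add)

lemma class_mult_zero:
  assumes "semisimple L" "fd_rep L U"
  shows "class_mult U \<zero>\<^bsub>rep_ring L\<^esub> = 0"
  by (simp add: coset_zero class_mult_coset[OF assms])

lemma class_mult_pow:
  fixes k :: int
  assumes "semisimple L" "fd_rep L U" and S: "S \<in> carrier (rep_ring L)"
  shows "class_mult U ([k] \<cdot>\<^bsub>rep_ring L\<^esub> S) = k * class_mult U S"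
proof -
  interpret abelian_group "rep_ring L" by (rule rep_ring_abelian)
  have n: "class_mult U ([n] \<cdot>\<^bsub>rep_ring L\<^esub> S) = int n * class_mult U S" for n :: nat
    by (induction n) (simp_all add: class_mult_zero[OF assms(1,2)] class_mult_add[OF assms(1,2)] S ring_distribs)
  show ?thesis
  proof (cases "k \<ge> 0")
    case True
    then show ?thesis using n[of "nat k"] by (simp add: add_pow_int_ge)
  next
    case False
    have c: "[nat (- k)] \<cdot>\<^bsub>rep_ring L\<^esub> S \<in> carrier (rep_ring L)" using S by simp
    have "class_mult U ([nat (- k)] \<cdot>\<^bsub>rep_ring L\<^esub> S \<oplus>\<^bsub>rep_ring L\<^esub> \<ominus>\<^bsub>rep_ring L\<^esub> ([nat (- k)] \<cdot>\<^bsub>rep_ring L\<^esub> S)) = 0"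
      using c r_neg class_mult_zero[OF assms(1,2)] by simp
    then have "class_mult U (\<ominus>\<^bsub>rep_ring L\<^esub> ([nat (- k)] \<cdot>\<^bsub>rep_ring L\<^esub> S)) = - class_mult U ([nat (- k)] \<cdot>\<^bsub>rep_ring L\<^esub> S)"
      using class_mult_add[OF assms(1,2) c] c by simp
    then show ?thesis using False n[of "nat (- k)"] by (simp add: add_pow_int_lt)
  qed
qed

lemma class_mult_finsum:
  assumes "semisimple L" "fd_rep L U" "finite I" "\<And>i. i \<in> I \<Longrightarrow> f i \<in> carrier (rep_ring L)"
  shows "class_mult U (\<Oplus>\<^bsub>rep_ring L\<^esub>i\<in>I. f i) = (\<Sum>i\<in>I. class_mult U (f i))"
proof -
  interpret abelian_group "rep_ring L" by (rule rep_ring_abelian)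
  show ?thesis
    using assms(3,4)
  proof (induction I rule: finite_induct)
    case (insert i I)
    then have "(\<Oplus>\<^bsub>rep_ring L\<^esub>i\<in>I. f i) \<in> carrier (rep_ring L)" by (intro finsum_closed) auto
    then show ?case using insert by (simp add: finsum_insert Pi_iff class_mult_add[OF assms(1,2)])
  qed (simp add: class_mult_zero[OF assms(1,2)])
qed

definition zero_rep :: "('g, nat \<Rightarrow> complex) rep"
  where "zero_rep = \<lparr>rep_space = {0}, rep_scale = seq_scale, rep_act = (\<lambda>x v. 0)\<rparr>"

lemma zero_rep: "lie_algebra L \<Longrightarrow> zero_rep \<in> seq_reps L"
proof -
  assume "lie_algebra L"
  interpret s: cvec seq_scale by (rule seq_cvec)
  show ?thesis
    using s.fdim_0 s.vector_space_axioms unfolding s.fdim_def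
    by (auto simp: seq_reps_def zero_rep_def fd_rep_def linear_on_def)
qed

lemma relation_mem: "a \<in> exact_relations L \<Longrightarrow> a \<in> relation_ideal L"
  unfolding relation_ideal_def by (rule generate.incl)

lemma relation_add: "a \<in> relation_ideal L \<Longrightarrow> b \<in> relation_ideal L \<Longrightarrow> a + b \<in> relation_ideal L"
  using subgroup.m_closed[OF relation_subgroup[of L], of a b] by (simp add: formal_reps_simps)

lemma relation_uminus: "a \<in> relation_ideal L \<Longrightarrow> - a \<in> relation_ideal L"
proof -
  assume a: "a \<in> relation_ideal L"
  interpret comm_group "add_monoid (formal_reps L)" by (rule formal_group)
  have ac: "a \<in> carrier (add_monoid (formal_reps L))" by (rule subgroup.mem_carrier[OF relation_subgroup a])
  have "- a + a = 0" by simp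
  then have "inv\<^bsub>add_monoid (formal_reps L)\<^esub> a = - a"
    using ac by (intro inv_equality) (auto simp: formal_reps_simps)
  then show ?thesis using subgroup.m_inv_closed[OF relation_subgroup a] by simp
qed

text \<open>The exact sequence that consists of zero representations gives the relation
  \<open>[0] - [0] - [0]\<close>, which is \<open>- [0]\<close>.\<close>

lemma relation_zero_rep:
  assumes "lie_algebra L"
  shows "Poly_Mapping.single zero_rep 1 \<in> relation_ideal L"
proof -
  note Z = zero_rep[OF assms]
  have fZ: "fd_rep L (zero_rep :: ('a, nat \<Rightarrow> complex) rep)" using Z by (simp add: seq_reps_def)
  have sp: "rep_space zero_rep = {0}" by (simp add: zero_rep_def)
  have z: "(\<lambda>v. 0) \<in> Hom (zero_rep :: ('a, nat \<Rightarrow> complex) rep) zero_rep" by (rule Hom_zero[OF fZ])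
  let ?s = "Poly_Mapping.single (zero_rep :: ('a, nat \<Rightarrow> complex) rep) (1::int)"
  have "?s - ?s - ?s \<in> exact_relations L"
    by (rule exact_relationsI[OF Z Z Z z z]) (simp_all add: sp)
  then have "- (?s - ?s - ?s) \<in> relation_ideal L" by (rule relation_uminus[OF relation_mem])
  then show ?thesis by simp
qed

text \<open>An isomorphism is an exact sequence with left term \<open>zero_rep\<close>, and the
  generator of \<open>zero_rep\<close> is itself a relation.\<close>

lemma coset_single_iso:
  assumes L: "lie_algebra L" and A: "A \<in> seq_reps L" and B: "B \<in> seq_reps L" and iso: "rep_iso A B"
  shows "coset L (Poly_Mapping.single A 1) = coset L (Poly_Mapping.single B 1)"
proof (rule coset_eqI[OF single_carrier[OF A] single_carrier[OF B]])
  have fA: "fd_rep L A" using A by (simp add: seq_reps_def)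
  obtain f where f: "f \<in> Hom A B" "bij_betw f (rep_space A) (rep_space B)" using iso by (auto simp: rep_iso_def)
  have z: "(\<lambda>v. 0) \<in> Hom (zero_rep :: ('a, nat \<Rightarrow> complex) rep) A" by (rule Hom_zero[OF fA])
  have sp: "rep_space zero_rep = {0}" by (simp add: zero_rep_def)
  have "(\<lambda>v. 0) ` rep_space (zero_rep :: ('a, nat \<Rightarrow> complex) rep) = {v\<in>rep_space A. f v = 0}"
    using f(2) fd_zero[OF fA] Hom_0[OF f(1) fA] by (auto simp: sp bij_betw_def inj_on_def)
  then have "Poly_Mapping.single A 1 - Poly_Mapping.single zero_rep 1 - Poly_Mapping.single B 1 \<in> exact_relations L"
    using f(2) by (intro exact_relationsI[OF zero_rep[OF L] A B z f(1)]) (simp_all only: sp bij_betw_def inj_on_insert inj_on_empty, simp)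
  from relation_add[OF relation_mem[OF this] relation_zero_rep[OF L]]
  show "Poly_Mapping.single A 1 - Poly_Mapping.single B 1 \<in> relation_ideal L" by (simp add: algebra_simps)
qed

lemma cl_eq_coset:
  assumes L: "lie_algebra L" and V: "fd_rep L V" and U: "U \<in> seq_reps L" "rep_iso U V"
  shows "cl L V = coset L (Poly_Mapping.single U 1)"
proof -
  let ?U = "SOME U. U \<in> seq_reps L \<and> rep_iso U V"
  have s: "?U \<in> seq_reps L \<and> rep_iso ?U V" by (rule someI[of _ U]) (use U in simp)
  have fU: "fd_rep L U" "fd_rep L ?U" using s U(1) by (auto simp: seq_reps_def)
  have "rep_iso ?U U" by (rule rep_iso_trans[OF V conjunct2[OF s] rep_iso_sym[OF fU(1) V U(2)]])
  then show ?thesis using coset_single_iso[OF L _ U(1), of ?U] s by (simp add: cl_def coset_def)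
qed

lemma cl_carrier:
  assumes L: "lie_algebra L" and V: "fd_rep L V"
  shows "cl L V \<in> carrier (rep_ring L)"
proof -
  obtain U where U: "U \<in> seq_reps L" "rep_iso U V" using seq_copy[OF V] by blast
  show ?thesis
    unfolding cl_eq_coset[OF L V U] rep_ring_carrier by (rule imageI[OF single_carrier[OF U(1)]])
qed

lemma cl_iso:
  assumes L: "lie_algebra L" and V: "fd_rep L V" and W: "fd_rep L W" and iso: "rep_iso V W"
  shows "cl L V = cl L W"
proof -
  obtain U where "U \<in> seq_reps L" "rep_iso U V" using seq_copy[OF V] by blast
  then show ?thesis using cl_eq_coset[OF L V] cl_eq_coset[OF L W] rep_iso_trans[OF V _ iso] by metis
qed

lemma ss_lie: "semisimple L \<Longrightarrow> lie_algebra L"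
  by (simp add: semisimple_def)

lemma class_mult_cl:
  assumes ss: "semisimple L" and U: "fd_rep L U" and V: "fd_rep L V"
  shows "class_mult U (cl L V) = int (hdim U V)"
proof -
  obtain V' where V': "V' \<in> seq_reps L" "rep_iso V' V" using seq_copy[OF V] by blast
  have fV': "fd_rep L V'" using V'(1) by (simp add: seq_reps_def)
  show ?thesis
    using cl_eq_coset[OF ss_lie[OF ss] V V'] class_mult_coset[OF ss U] hdim_iso(1)[OF ss U fV' V V'(2)] by simp
qed

text \<open>The relations speak about representations on sequences only, so the maps are conjugated
  with isomorphisms to such copies and exactness is carried over.\<close>

lemma cl_exact:
  fixes A :: "('g::ab_group_add, 'a::ab_group_add) rep" and B :: "('g, 'b::ab_group_add) rep"
    and C :: "('g, 'c::ab_group_add) rep"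
  assumes L: "lie_algebra L" and A: "fd_rep L A" and B: "fd_rep L B" and C: "fd_rep L C"
    and f: "f \<in> Hom A B" "inj_on f (rep_space A)" and g: "g \<in> Hom B C" "g ` rep_space B = rep_space C"
    and ex: "f ` rep_space A = {v\<in>rep_space B. g v = 0}"
  shows "cl L B = cl L A \<oplus>\<^bsub>rep_ring L\<^esub> cl L C"
proof -
  obtain A' where A': "A' \<in> seq_reps L" "rep_iso A' A" using seq_copy[OF A] by blast
  obtain B' where B': "B' \<in> seq_reps L" "rep_iso B' B" using seq_copy[OF B] by blast
  obtain C' where C': "C' \<in> seq_reps L" "rep_iso C' C" using seq_copy[OF C] by blast
  have fd: "fd_rep L A'" "fd_rep L B'" "fd_rep L C'" using A' B' C' by (auto simp: seq_reps_def)
  obtain a where a: "a \<in> Hom A' A" "bij_betw a (rep_space A') (rep_space A)" using A'(2) by (auto simp: rep_iso_def)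
  obtain b where b: "b \<in> Hom B' B" "bij_betw b (rep_space B') (rep_space B)" using B'(2) by (auto simp: rep_iso_def)
  obtain c where c: "c \<in> Hom C' C" "bij_betw c (rep_space C') (rep_space C)" using C'(2) by (auto simp: rep_iso_def)
  obtain b' where b': "b' \<in> Hom B B'" "\<And>v. v \<in> rep_space B' \<Longrightarrow> b' (b v) = v" "\<And>w. w \<in> rep_space B \<Longrightarrow> b (b' w) = w"
    using iso_inverse[OF fd(2) B b] by blast
  obtain c' where c': "c' \<in> Hom C C'" "\<And>v. v \<in> rep_space C' \<Longrightarrow> c' (c v) = v" "\<And>w. w \<in> rep_space C \<Longrightarrow> c (c' w) = w"
    using iso_inverse[OF fd(3) C c] by blast
  define f' where "f' = (\<lambda>v. b' (f (a v)))"
  define g' where "g' = (\<lambda>v. c' (g (b v)))"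
  have f'H: "f' \<in> Hom A' B'" unfolding f'_def by (rule Hom_comp[OF Hom_comp[OF a(1) f(1) A] b'(1) B])
  have g'H: "g' \<in> Hom B' C'" unfolding g'_def by (rule Hom_comp[OF Hom_comp[OF b(1) g(1) B] c'(1) C])
  have aA: "a ` rep_space A' = rep_space A" and bB: "b ` rep_space B' = rep_space B" using a(2) b(2) by (auto simp: bij_betw_def)
  have f'inj: "inj_on f' (rep_space A')"
  proof (rule inj_onI)
    fix x y assume xy: "x \<in> rep_space A'" "y \<in> rep_space A'" "f' x = f' y"
    have m: "a x \<in> rep_space A" "a y \<in> rep_space A" using Hom_in[OF a(1)] xy by auto
    have "b (f' x) = b (f' y)" using xy by simp
    then have "f (a x) = f (a y)" using b'(3) Hom_in[OF f(1)] m by (simp add: f'_def)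
    then have "a x = a y" using inj_onD[OF f(2)] m by blast
    then show "x = y" using a(2) xy by (auto simp: bij_betw_def dest: inj_onD)
  qed
  have g'im: "g' ` rep_space B' = rep_space C'"
  proof
    show "g' ` rep_space B' \<subseteq> rep_space C'" using Hom_in[OF g'H] by auto
    show "rep_space C' \<subseteq> g' ` rep_space B'"
    proof
      fix w assume w: "w \<in> rep_space C'"
      have "c w \<in> g ` rep_space B" using Hom_in[OF c(1) w] g(2) by simp
      then obtain v where v: "v \<in> rep_space B" "c w = g v" by blast
      have "g' (b' v) = w" using v b'(3)[OF v(1)] c'(2)[OF w] by (simp add: g'_def)
      then show "w \<in> g' ` rep_space B'" using Hom_in[OF b'(1) v(1)] by blast
    qed
  qed
  have ex': "f' ` rep_space A' = {v\<in>rep_space B'. g' v = 0}"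
  proof
    show "f' ` rep_space A' \<subseteq> {v\<in>rep_space B'. g' v = 0}"
    proof clarify
      fix x assume x: "x \<in> rep_space A'"
      have fa: "f (a x) \<in> rep_space B" "g (f (a x)) = 0" using ex Hom_in[OF a(1) x] by blast+
      then show "f' x \<in> rep_space B' \<and> g' (f' x) = 0"
        using Hom_in[OF f'H x] b'(3)[OF fa(1)] Hom_0[OF c'(1) C] by (simp add: f'_def g'_def)
    qed
    show "{v\<in>rep_space B'. g' v = 0} \<subseteq> f' ` rep_space A'"
    proof clarify
      fix v assume v: "v \<in> rep_space B'" "g' v = 0"
      have bv: "b v \<in> rep_space B" by (rule Hom_in[OF b(1) v(1)])
      have "c (c' (g (b v))) = 0" using v(2) Hom_0[OF c(1) fd(3)] by (simp add: g'_def)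
      then have "g (b v) = 0" using c'(3) Hom_in[OF g(1) bv] by simp
      then have "b v \<in> f ` rep_space A" using bv ex by blast
      then obtain x where x: "x \<in> rep_space A" "b v = f x" by blast
      obtain y where y: "y \<in> rep_space A'" "x = a y" using x(1) aA by blast
      have "f' y = v" using b'(2)[OF v(1)] x(2) y(2) by (simp add: f'_def)
      then show "v \<in> f' ` rep_space A'" using y(1) by blast
    qed
  qed
  have "Poly_Mapping.single B' 1 - Poly_Mapping.single A' 1 - Poly_Mapping.single C' 1 \<in> exact_relations L"
    by (rule exact_relationsI[OF A'(1) B'(1) C'(1) f'H g'H f'inj g'im ex'])
  then have r: "Poly_Mapping.single B' 1 - (Poly_Mapping.single A' 1 + Poly_Mapping.single C' 1) \<in> relation_ideal L"
    using relation_mem by (simp add: algebra_simps)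
  have sc: "Poly_Mapping.single A' 1 + Poly_Mapping.single C' 1 \<in> carrier (formal_reps L)"
    using Poly_Mapping.keys_add[of "Poly_Mapping.single A' 1" "Poly_Mapping.single C' (1::int)"] A'(1) C'(1)
    by (auto simp: formal_reps_simps)
  show ?thesis
    unfolding cl_eq_coset[OF L A A'] cl_eq_coset[OF L B B'] cl_eq_coset[OF L C C']
      coset_add[OF single_carrier[OF A'(1)] single_carrier[OF C'(1)]]
    by (rule coset_eqI[OF single_carrier[OF B'(1)] sc r])
qed

lemma (in abelian_monoid) finsum_superset:
  assumes "finite B" "A \<subseteq> B" "f \<in> B \<rightarrow> carrier G" "\<And>x. x \<in> B - A \<Longrightarrow> f x = \<zero>"
  shows "finsum G f B = finsum G f A"
proof -
  have "B = A \<union> (B - A)" using assms(2) by auto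
  then have "finsum G f B = finsum G f (A \<union> (B - A))" by simp
  also have "\<dots> = finsum G f A \<oplus> finsum G f (B - A)"
    by (rule finsum_Un_disjoint) (use assms in \<open>auto intro: finite_subset\<close>)
  also have "finsum G f (B - A) = \<zero>" by (rule add.finprod_one_eqI) (use assms(4) in auto)
  finally show ?thesis using assms by (simp add: finsum_closed Pi_iff subset_iff)
qed

section \<open>Combinations of the given irreducible classes\<close>

locale isotypic =
  fixes L :: "'g::ab_group_add lie" and I :: "nat set" and Vs :: "nat \<Rightarrow> ('g, 'u::ab_group_add) rep"
  assumes ss: "semisimple L"
    and finI: "finite I"
    and irr: "\<And>i. i \<in> I \<Longrightarrow> irreducible_rep L (Vs i)"
    and noniso: "\<And>i j. i \<in> I \<Longrightarrow> j \<in> I \<Longrightarrow> i \<noteq> j \<Longrightarrow> \<not> rep_iso (Vs i) (Vs j)"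
begin

sublocale R: abelian_group "rep_ring L"
  by (rule rep_ring_abelian)

lemmas lieL = ss_lie[OF ss]

abbreviation "Q \<equiv> rep_ring L"

definition cls :: "nat \<Rightarrow> 'g formal_rep set" where "cls i = cl L (Vs i)"

definition comb :: "(nat \<Rightarrow> int) \<Rightarrow> 'g formal_rep set"
  where "comb n = (\<Oplus>\<^bsub>Q\<^esub>i\<in>I. [n i] \<cdot>\<^bsub>Q\<^esub> cls i)"

lemma irr_fd': "i \<in> I \<Longrightarrow> fd_rep L (Vs i)"
  by (rule irr_fd[OF irr])

lemma cls_carrier: "i \<in> I \<Longrightarrow> cls i \<in> carrier Q"
  unfolding cls_def by (rule cl_carrier[OF lieL irr_fd'])

lemma pow_carrier: "S \<in> carrier Q \<Longrightarrow> [c] \<cdot>\<^bsub>Q\<^esub> S \<in> carrier Q" for c :: int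
  using R.add.int_pow_closed[of S c] by (simp add: add_pow_def)

lemma pow_zero: "[(0::int)] \<cdot>\<^bsub>Q\<^esub> S = \<zero>\<^bsub>Q\<^esub>"
  by (simp add: add_pow_def)

lemma hdim_Vs: "i \<in> I \<Longrightarrow> j \<in> I \<Longrightarrow> hdim (Vs i) (Vs j) = (if i = j then 1 else 0)"
  using schur_1[OF irr] schur_0[OF irr irr noniso] by auto

lemma class_mult_cls: "fd_rep L U \<Longrightarrow> i \<in> I \<Longrightarrow> class_mult U (cls i) = int (hdim U (Vs i))"
  unfolding cls_def by (rule class_mult_cl[OF ss _ irr_fd'])

lemma comb_carrier: "comb n \<in> carrier Q"
  unfolding comb_def by (rule R.finsum_closed) (auto intro!: pow_carrier cls_carrier)

lemma comb_cong: "(\<And>i. i \<in> I \<Longrightarrow> n i = m i) \<Longrightarrow> comb n = comb m"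
  unfolding comb_def by (rule R.finsum_cong') (auto intro!: pow_carrier cls_carrier)

lemma class_mult_comb:
  assumes "fd_rep L U"
  shows "class_mult U (comb n) = (\<Sum>i\<in>I. n i * int (hdim U (Vs i)))"
proof -
  have "class_mult U (comb n) = (\<Sum>i\<in>I. class_mult U ([n i] \<cdot>\<^bsub>Q\<^esub> cls i))"
    unfolding comb_def by (rule class_mult_finsum[OF ss assms finI]) (intro pow_carrier cls_carrier)
  also have "\<dots> = (\<Sum>i\<in>I. n i * int (hdim U (Vs i)))"
    by (rule sum.cong) (simp_all add: class_mult_pow[OF ss assms cls_carrier] class_mult_cls[OF assms])
  finally show ?thesis .
qed

text \<open>By Schur's lemma the pairings with the \<open>Vs j\<close> are dual to the classes
  \<open>cls i\<close>.\<close>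

lemma class_mult_Vs_comb:
  assumes j: "j \<in> I"
  shows "class_mult (Vs j) (comb n) = n j"
proof -
  have "class_mult (Vs j) (comb n) = (\<Sum>i\<in>I. if i = j then n i else 0)"
    unfolding class_mult_comb[OF irr_fd'[OF j]] by (rule sum.cong) (auto simp: hdim_Vs j)
  then show ?thesis using j finI by simp
qed

lemma cls_inj: "inj_on cls I"
proof (rule inj_onI)
  fix i j assume ij: "i \<in> I" "j \<in> I" "cls i = cls j"
  have "class_mult (Vs i) (cls j) = 1"
    using class_mult_cl[OF ss irr_fd'[OF ij(1)] irr_fd'[OF ij(1)]] ij hdim_Vs[OF ij(1,1)] by (simp add: cls_def)
  then have "hdim (Vs i) (Vs j) = 1" using class_mult_cl[OF ss irr_fd'[OF ij(1)] irr_fd'[OF ij(2)]] by (simp add: cls_def)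
  then show "i = j" using hdim_Vs[OF ij(1,2)] by (cases "i = j") auto
qed

lemma cls_irr: "i \<in> I \<Longrightarrow> cls i \<in> irr_classes L"
proof -
  assume i: "i \<in> I"
  obtain U where U: "U \<in> seq_reps L" "rep_iso U (Vs i)" using seq_copy[OF irr_fd'[OF i]] by blast
  have fU: "fd_rep L U" using U(1) by (simp add: seq_reps_def)
  have "irreducible_rep L U" by (rule irreducible_iso[OF irr[OF i] fU rep_iso_sym[OF fU irr_fd'[OF i] U(2)]])
  moreover have "cls i = cl L U" unfolding cls_def by (rule cl_iso[OF lieL fU irr_fd'[OF i] U(2), symmetric])
  ultimately show ?thesis using U(1) unfolding irr_classes_def by blast
qed

lemma comb_add: "comb n \<oplus>\<^bsub>Q\<^esub> comb m = comb (\<lambda>i. n i + m i)"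
proof -
  have "comb n \<oplus>\<^bsub>Q\<^esub> comb m = (\<Oplus>\<^bsub>Q\<^esub>i\<in>I. [n i] \<cdot>\<^bsub>Q\<^esub> cls i \<oplus>\<^bsub>Q\<^esub> [m i] \<cdot>\<^bsub>Q\<^esub> cls i)"
    unfolding comb_def by (rule R.finsum_addf[symmetric]) (auto intro!: pow_carrier cls_carrier)
  also have "\<dots> = comb (\<lambda>i. n i + m i)"
    unfolding comb_def
  proof (rule R.finsum_cong')
    show "[n i] \<cdot>\<^bsub>Q\<^esub> cls i \<oplus>\<^bsub>Q\<^esub> [m i] \<cdot>\<^bsub>Q\<^esub> cls i = [(n i + m i)] \<cdot>\<^bsub>Q\<^esub> cls i" if "i \<in> I" for i
      using R.add.int_pow_mult[OF cls_carrier[OF that], of "n i" "m i"] by (simp add: add_pow_def)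
  qed (auto intro!: pow_carrier cls_carrier)
  finally show ?thesis .
qed

lemma comb_zero: "comb (\<lambda>i. 0) = \<zero>\<^bsub>Q\<^esub>"
  unfolding comb_def by (rule R.add.finprod_one_eqI) (simp add: add_pow_def)

lemma comb_diff: "comb n \<ominus>\<^bsub>Q\<^esub> comb m = comb (\<lambda>i. n i - m i)"
proof -
  have "comb (\<lambda>i. n i - m i) \<oplus>\<^bsub>Q\<^esub> comb m = comb n" by (simp add: comb_add)
  then have "comb n \<ominus>\<^bsub>Q\<^esub> comb m = (comb (\<lambda>i. n i - m i) \<oplus>\<^bsub>Q\<^esub> comb m) \<oplus>\<^bsub>Q\<^esub> \<ominus>\<^bsub>Q\<^esub> comb m"
    by (simp only: R.minus_eq)
  also have "\<dots> = comb (\<lambda>i. n i - m i)"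
    by (simp only: R.a_assoc[OF comb_carrier comb_carrier R.a_inv_closed[OF comb_carrier]] R.r_neg[OF comb_carrier] R.r_zero[OF comb_carrier])
  finally show ?thesis .
qed

lemma comb_delta: "j \<in> I \<Longrightarrow> comb (\<lambda>i. if i = j then 1 else 0) = cls j"
proof -
  assume j: "j \<in> I"
  have "comb (\<lambda>i. if i = j then 1 else 0) = (\<Oplus>\<^bsub>Q\<^esub>i\<in>{j}. [(if i = j then (1::int) else 0)] \<cdot>\<^bsub>Q\<^esub> cls i)"
    unfolding comb_def
    by (rule R.finsum_superset) (use j finI in \<open>auto intro!: pow_carrier cls_carrier simp: pow_zero\<close>)
  also have "\<dots> = [(1::int)] \<cdot>\<^bsub>Q\<^esub> cls j"
  proof -
    define f where "f = (\<lambda>i. [(if i = j then (1::int) else 0)] \<cdot>\<^bsub>Q\<^esub> cls i)"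
    have fj: "f j \<in> carrier Q" unfolding f_def by (rule pow_carrier[OF cls_carrier[OF j]])
    then have "finsum Q f {j} = f j" using R.finsum_insert[of "{}" j f] by (simp add: R.finsum_empty)
    then show ?thesis by (simp add: f_def)
  qed
  also have "\<dots> = cls j" using R.add.int_pow_1[OF cls_carrier[OF j]] by (simp add: add_pow_def)
  finally show ?thesis .
qed

text \<open>
  Pairing with the class multiplicities of irreducible representations determines the
  coefficients, so the definite description in \<^const>\<open>coeffs\<close> is met by at most one function.
\<close>

lemma coeffs_comb_fun: "coeffs L (comb n) = (\<lambda>x. if x \<in> cls ` I then n (inv_into I cls x) else 0)"
  (is "_ = ?c")
proof -
  let ?P = "\<lambda>c :: 'g formal_rep set \<Rightarrow> int. finite {x. c x \<noteq> 0} \<and> {x. c x \<noteq> 0} \<subseteq> irr_classes L \<and>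
    comb n = (\<Oplus>\<^bsub>Q\<^esub>x\<in>{x. c x \<noteq> 0}. [c x] \<cdot>\<^bsub>Q\<^esub> x)"
  have irc: "x \<in> carrier Q" if "x \<in> irr_classes L" for x
    using that cl_carrier[OF lieL] irr_fd by (auto simp: irr_classes_def)
  have supp: "{x. ?c x \<noteq> 0} \<subseteq> cls ` I" by auto
  have "?P ?c"
  proof (intro conjI)
    show "finite {x. ?c x \<noteq> 0}" by (rule finite_subset[OF supp]) (simp add: finI)
    show "{x. ?c x \<noteq> 0} \<subseteq> irr_classes L" using supp cls_irr by blast
    have car: "(\<lambda>x. [?c x] \<cdot>\<^bsub>Q\<^esub> x) \<in> cls ` I \<rightarrow> carrier Q"
      by (auto intro!: pow_carrier cls_carrier)
    have "(\<Oplus>\<^bsub>Q\<^esub>x\<in>{x. ?c x \<noteq> 0}. [?c x] \<cdot>\<^bsub>Q\<^esub> x) = (\<Oplus>\<^bsub>Q\<^esub>x\<in>cls ` I. [?c x] \<cdot>\<^bsub>Q\<^esub> x)"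
      by (rule R.finsum_superset[OF _ supp car, symmetric]) (auto simp: pow_zero finI)
    also have "\<dots> = (\<Oplus>\<^bsub>Q\<^esub>i\<in>I. [?c (cls i)] \<cdot>\<^bsub>Q\<^esub> cls i)"
      by (rule R.add.finprod_reindex[OF _ cls_inj, folded finsum_def add_pow_def]) (use car in auto)
    also have "\<dots> = comb n"
      unfolding comb_def
      by (rule R.finsum_cong') (auto intro!: pow_carrier cls_carrier simp: inv_into_f_f[OF cls_inj])
    finally show "comb n = (\<Oplus>\<^bsub>Q\<^esub>x\<in>{x. ?c x \<noteq> 0}. [?c x] \<cdot>\<^bsub>Q\<^esub> x)" ..
  qed
  moreover have det: "c (cl L U) = class_mult U (comb n)" if c: "?P c" and U: "U \<in> seq_reps L" "irreducible_rep L U" for c U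
  proof -
    let ?S = "{x. c x \<noteq> 0}"
    have fS: "finite ?S" and iS: "?S \<subseteq> irr_classes L" using c by auto
    note fU = irr_fd[OF U(2)]
    have "class_mult U (comb n) = (\<Sum>x\<in>?S. class_mult U ([c x] \<cdot>\<^bsub>Q\<^esub> x))"
      using c class_mult_finsum[OF ss fU fS, of "\<lambda>x. [c x] \<cdot>\<^bsub>Q\<^esub> x"] iS irc pow_carrier by auto
    also have "\<dots> = (\<Sum>x\<in>?S. if x = cl L U then c x else 0)"
    proof (rule sum.cong[OF refl])
      fix x assume "x \<in> ?S"
      then obtain U' where U': "U' \<in> seq_reps L" "irreducible_rep L U'" "x = cl L U'" using iS unfolding irr_classes_def by blast
      note fU' = irr_fd[OF U'(2)]
      have e: "class_mult U ([c x] \<cdot>\<^bsub>Q\<^esub> x) = c x * int (hdim U U')"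
        using class_mult_pow[OF ss fU cl_carrier[OF lieL fU']] class_mult_cl[OF ss fU fU'] U'(3) by simp
      show "class_mult U ([c x] \<cdot>\<^bsub>Q\<^esub> x) = (if x = cl L U then c x else 0)"
      proof (cases "x = cl L U")
        case True
        then have "int (hdim U U') = int (hdim U U)" using class_mult_cl[OF ss fU fU'] class_mult_cl[OF ss fU fU] U'(3) by simp
        then show ?thesis using e True schur_1[OF U(2)] by simp
      next
        case False
        then have "\<not> rep_iso U U'" using cl_iso[OF lieL fU fU'] U'(3) by blast
        then show ?thesis using e False schur_0[OF U(2) U'(2)] by simp
      qed
    qed
    also have "\<dots> = c (cl L U)" using fS by simp
    finally show ?thesis ..
  qed
  moreover have "c = c'" if "?P c" "?P c'" for c c'
  proof
    fix x
    show "c x = c' x"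
    proof (cases "x \<in> irr_classes L")
      case True
      then obtain U where U: "U \<in> seq_reps L" "irreducible_rep L U" "x = cl L U" unfolding irr_classes_def by blast
      then show ?thesis using det[OF that(1) U(1,2)] det[OF that(2) U(1,2)] by simp
    next
      case False
      then have "c x = 0" "c' x = 0" using that by blast+
      then show ?thesis by simp
    qed
  qed
  ultimately show ?thesis unfolding coeffs_def by (intro the_equality) blast+
qed

lemma coeffs_comb: "i \<in> I \<Longrightarrow> coeffs L (comb n) (cls i) = n i"
  using inv_into_f_f[OF cls_inj] by (simp add: coeffs_comb_fun)

lemma coeffs_comb_other: "x \<notin> cls ` I \<Longrightarrow> coeffs L (comb n) x = 0"
  by (simp add: coeffs_comb_fun)

lemma nonneg_comb: "rep_nonneg L (comb n) \<Longrightarrow> i \<in> I \<Longrightarrow> 0 \<le> n i"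
proof -
  assume "rep_nonneg L (comb n)" and i: "i \<in> I"
  then have "0 \<le> coeffs L (comb n) (cls i)" using cls_irr unfolding rep_nonneg_def by blast
  then show ?thesis by (simp only: coeffs_comb[OF i])
qed

text \<open>Irreducible classes other than the \<open>cls i\<close> have coefficient 0 in both
  combinations, so the sum over all irreducible classes reduces to \<open>I\<close>.\<close>

lemma min_comb: "rep_min L (comb n) (comb m) = comb (\<lambda>i. min (n i) (m i))"
proof -
  let ?c = "\<lambda>x. min (coeffs L (comb n) x) (coeffs L (comb m) x)"
  have sub: "{x\<in>irr_classes L. ?c x \<noteq> 0} \<subseteq> cls ` I"
  proof (rule subsetI, rule ccontr)
    fix x assume "x \<in> {x\<in>irr_classes L. ?c x \<noteq> 0}" and x: "x \<notin> cls ` I"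
    then have "?c x \<noteq> 0" by blast
    then show False using coeffs_comb_other[OF x] by simp
  qed
  have car: "(\<lambda>x. [?c x] \<cdot>\<^bsub>Q\<^esub> x) \<in> cls ` I \<rightarrow> carrier Q"
    by (auto intro!: pow_carrier cls_carrier)
  have "rep_min L (comb n) (comb m) = (\<Oplus>\<^bsub>Q\<^esub>x\<in>cls ` I. [?c x] \<cdot>\<^bsub>Q\<^esub> x)"
    unfolding rep_min_def
    by (rule R.finsum_superset[OF _ sub car, symmetric]) (use cls_irr finI in \<open>auto simp: pow_zero\<close>)
  also have "\<dots> = (\<Oplus>\<^bsub>Q\<^esub>i\<in>I. [?c (cls i)] \<cdot>\<^bsub>Q\<^esub> cls i)"
    by (rule R.add.finprod_reindex[OF _ cls_inj, folded finsum_def add_pow_def]) (use car in auto)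
  also have "\<dots> = comb (\<lambda>i. min (n i) (m i))"
    unfolding comb_def[of "\<lambda>i. min (n i) (m i)"]
    by (rule R.finsum_cong') (auto intro!: pow_carrier cls_carrier simp: coeffs_comb)
  finally show ?thesis .
qed

text \<open>Every irreducible constituent of \<open>V\<close> is to be among the
  \<open>Vs i\<close>. Testing with \<open>U\<close> in \<open>seq_reps L\<close> fixes one type for
  \<open>U\<close>, and by \<open>seq_copy\<close> all irreducible representations have copies
  there.\<close>

definition supported :: "('g, 'w::ab_group_add) rep \<Rightarrow> bool"
  where "supported V \<longleftrightarrow> (\<forall>U\<in>seq_reps L. irreducible_rep L U \<longrightarrow> hdim U V \<noteq> 0 \<longrightarrow> (\<exists>i\<in>I. rep_iso U (Vs i)))"

text \<open>Pairing the combination with an irreducible \<open>U\<close> that is isomorphic to none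
  of the \<open>Vs i\<close> gives 0.\<close>

lemma supported_comb:
  assumes V: "fd_rep L V" and e: "cl L V = comb n"
  shows "supported V" "i \<in> I \<Longrightarrow> int (hdim (Vs i) V) = n i"
proof -
  show "i \<in> I \<Longrightarrow> int (hdim (Vs i) V) = n i"
    using class_mult_cl[OF ss irr_fd' V] class_mult_Vs_comb e by simp
  show "supported V"
    unfolding supported_def
  proof (intro ballI impI)
    fix U assume U: "U \<in> seq_reps L" "irreducible_rep L U" "hdim U V \<noteq> 0"
    have "int (hdim U V) = (\<Sum>i\<in>I. n i * int (hdim U (Vs i)))"
      using class_mult_cl[OF ss irr_fd[OF U(2)] V] class_mult_comb[OF irr_fd[OF U(2)]] e by simp
    then have "\<not> (\<forall>i\<in>I. hdim U (Vs i) = 0)" using U(3) by (intro notI) simp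
    then show "\<exists>i\<in>I. rep_iso U (Vs i)" using schur_0[OF U(2) irr] by blast
  qed
qed
end

section \<open>Multiplicities and ranks\<close>

lemma im_target: "fd_rep L V \<Longrightarrow> fd_rep L W \<Longrightarrow> f \<in> Hom V W \<Longrightarrow> f \<in> Hom V (sub_rep W (f ` rep_space V))"
proof -
  assume "fd_rep L V" "fd_rep L W" and f: "f \<in> Hom V W"
  then have "f ` rep_space V \<subseteq> rep_space W" using Hom_in by blast
  then show ?thesis using Hom_sub_target f by blast
qed

lemma hdim_ker_im:
  assumes ss: "semisimple L" and U: "fd_rep L U" and V: "fd_rep L V" and W: "fd_rep L W" and f: "f \<in> Hom V W"
  shows "hdim U V = hdim U (sub_rep V {v\<in>rep_space V. f v = 0}) + hdim U (sub_rep W (f ` rep_space V))"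
    "hdim V U = hdim (sub_rep W (f ` rep_space V)) U + hdim (sub_rep V {v\<in>rep_space V. f v = 0}) U"
  using hdim_exact[OF ss U sub_rep_fd[OF V kernel_subrep[OF V W f]] V sub_rep_fd[OF W image_subrep[OF V W f]]
      inclusion_Hom[OF V kernel_subrep[OF V W f]] inclusion_exact(1)[OF refl] im_target[OF V W f]]
    inclusion_exact(2)[OF refl, of V f] by simp_all

lemma cl_ker_im:
  assumes L: "lie_algebra L" and V: "fd_rep L V" and W: "fd_rep L W" and f: "f \<in> Hom V W"
  shows "cl L V = cl L (sub_rep V {v\<in>rep_space V. f v = 0}) \<oplus>\<^bsub>rep_ring L\<^esub> cl L (sub_rep W (f ` rep_space V))"
  using cl_exact[OF L sub_rep_fd[OF V kernel_subrep[OF V W f]] V sub_rep_fd[OF W image_subrep[OF V W f]]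
      inclusion_Hom[OF V kernel_subrep[OF V W f]] inclusion_exact(1)[OF refl] im_target[OF V W f]]
    inclusion_exact(2)[OF refl, of V f] by simp

text \<open>\<open>p q\<close> is an idempotent of \<open>W\<close> with the kernel of
  \<open>q\<close> and the image of \<open>p\<close>, so the kernel of \<open>q\<close> stands in
  for the cokernel of \<open>p\<close>.\<close>

lemma hdim_coker:
  assumes ss: "semisimple L" and U: "fd_rep L U" and V: "fd_rep L V" and W: "fd_rep L W"
    and p: "p \<in> Hom V W" and q: "q \<in> Hom W V" and pqp: "\<And>v. p (q (p v)) = p v" and qpq: "\<And>w. q (p (q w)) = q w"
  shows "hdim U W = hdim U (sub_rep W {w\<in>rep_space W. q w = 0}) + hdim U (sub_rep W (p ` rep_space V))"
proof -
  have pq: "(\<lambda>w. p (q w)) \<in> Hom W W" by (rule Hom_comp[OF q p V])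
  have "q w = 0" if "p (q w) = 0" for w using qpq[of w] that Hom_0[OF q W] by simp
  then have 1: "{w\<in>rep_space W. p (q w) = 0} = {w\<in>rep_space W. q w = 0}" using Hom_0[OF p V] by auto
  have 2: "(\<lambda>w. p (q w)) ` rep_space W = p ` rep_space V"
  proof
    show "(\<lambda>w. p (q w)) ` rep_space W \<subseteq> p ` rep_space V" using Hom_in[OF q] by blast
    show "p ` rep_space V \<subseteq> (\<lambda>w. p (q w)) ` rep_space W"
    proof
      fix w assume "w \<in> p ` rep_space V"
      then obtain v where "v \<in> rep_space V" "w = p v" by blast
      then show "w \<in> (\<lambda>w. p (q w)) ` rep_space W" using pqp[of v] Hom_in[OF p, of v] by (intro image_eqI[of _ _ "p v"]) auto
    qed
  qed
  show ?thesis using hdim_ker_im(1)[OF ss U W W pq] unfolding 1 2 .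
qed

lemma hdim_pos:
  fixes U :: "('g::ab_group_add, 'u::ab_group_add) rep" and V :: "('g, 'v::ab_group_add) rep"
  assumes V: "fd_rep L V" and "hdim U V \<noteq> 0"
  obtains f where "f \<in> Hom U V" "f \<noteq> 0"
proof -
  interpret h: cvec "hom_scale V :: complex \<Rightarrow> ('u \<Rightarrow> 'v) \<Rightarrow> _" by (rule hom_cvec[OF V])
  have "Hom U V \<noteq> {0}"
  proof
    assume "Hom U V = {0}"
    then show False using assms(2) by (simp add: hdim_def)
  qed
  then show ?thesis by (rule h.subspace_nonzero[OF Hom_subspace[OF V] _ that])
qed

lemma irr_Hom_inj:
  assumes U: "irreducible_rep L U" and W: "fd_rep L W" and f: "f \<in> Hom U W" "f \<noteq> 0"
  shows "inj_on f (rep_space U)"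
proof -
  note fU = irr_fd[OF U]
  interpret uw: cvec2 "rep_scale U" "rep_scale W"
    using fd_cvec[OF fU] fd_cvec[OF W] by (simp add: cvec2_def)
  obtain u where u: "u \<in> rep_space U" "f u \<noteq> 0" using Hom_nonzero[OF f] by blast
  then have "{v\<in>rep_space U. f v = 0} \<noteq> rep_space U" by blast
  then have "{v\<in>rep_space U. f v = 0} = {0}" using irr_sub[OF U kernel_subrep[OF fU W f(1)]] by blast
  then show ?thesis
    using uw.inj_on_iff_kernel[OF fd_subspace[OF fU] Hom_linear[OF f(1)]] by blast
qed

text \<open>A map into the image of \<open>f\<close> lifts to \<open>V\<close> along a generalized
  inverse of \<open>f\<close>. The multiplicity in the image is thereby the rank of the linear map
  \<open>\<phi> \<mapsto> f \<phi>\<close>, which is what brings minors into play.\<close>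

lemma hdim_image:
  fixes U :: "('g::ab_group_add, 'u::ab_group_add) rep" and V :: "('g, 'v::ab_group_add) rep" and W :: "('g, 'w::ab_group_add) rep"
  assumes ss: "semisimple L" and U: "fd_rep L U" and V: "fd_rep L V" and W: "fd_rep L W" and f: "f \<in> Hom V W"
  shows "hdim U (sub_rep W (f ` rep_space V)) = vector_space.dim (hom_scale W) ((\<lambda>\<phi> u. f (\<phi> u)) ` Hom U V)"
proof -
  obtain f' where f': "f' \<in> Hom W V" "\<And>v. f (f' (f v)) = f v" "\<And>w. f' (f (f' w)) = f' w"
    using generalized_inverse[OF ss V W f] by blast
  let ?T = "f ` rep_space V"
  have TW: "?T \<subseteq> rep_space W" using Hom_in[OF f] by blast
  have "(\<lambda>\<phi> u. f (\<phi> u)) ` Hom U V = Hom U (sub_rep W ?T)"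
  proof
    show "(\<lambda>\<phi> u. f (\<phi> u)) ` Hom U V \<subseteq> Hom U (sub_rep W ?T)"
      using Hom_comp[OF _ im_target[OF V W f] V, of _ U] by blast
    show "Hom U (sub_rep W ?T) \<subseteq> (\<lambda>\<phi> u. f (\<phi> u)) ` Hom U V"
    proof
      fix \<psi> assume \<psi>: "\<psi> \<in> Hom U (sub_rep W ?T)"
      then have \<psi>W: "\<psi> \<in> Hom U W" using Hom_sub_target[OF TW] by blast
      have h: "(\<lambda>u. f' (\<psi> u)) \<in> Hom U V" by (rule Hom_comp[OF \<psi>W f'(1) W])
      have "(\<lambda>u. f (f' (\<psi> u))) = \<psi>"
      proof (rule Hom_eqI[OF Hom_comp[OF h f V] \<psi>W])
        fix u assume "u \<in> rep_space U"
        then have "\<psi> u \<in> ?T" using Hom_in[OF \<psi>] by simp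
        then obtain v where "\<psi> u = f v" by blast
        then show "f (f' (\<psi> u)) = \<psi> u" using f'(2) by simp
      qed
      then show "\<psi> \<in> (\<lambda>\<phi> u. f (\<phi> u)) ` Hom U V" using h by (intro image_eqI[of _ _ "\<lambda>u. f' (\<psi> u)"]) auto
    qed
  qed
  moreover have "(hom_scale (sub_rep W ?T) :: complex \<Rightarrow> ('u \<Rightarrow> 'w) \<Rightarrow> _) = hom_scale W"
    by (simp add: hom_scale_eq)
  ultimately show ?thesis by (simp add: hdim_def)
qed

lemma (in isotypic) supported_mono:
  "supported V \<Longrightarrow> (\<And>U. U \<in> seq_reps L \<Longrightarrow> irreducible_rep L U \<Longrightarrow> hdim U Z \<le> hdim U V) \<Longrightarrow> supported Z"
  unfolding supported_def by fastforce

lemma (in isotypic) supported_ker: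
  assumes V: "fd_rep L V" and W: "fd_rep L W" and f: "f \<in> Hom V W" and s: "supported V"
  shows "supported (sub_rep V {v\<in>rep_space V. f v = 0})"
  by (rule supported_mono[OF s]) (simp add: hdim_ker_im(1)[OF ss irr_fd V W f])

lemma (in isotypic) supported_im:
  assumes V: "fd_rep L V" and W: "fd_rep L W" and f: "f \<in> Hom V W" and s: "supported V"
  shows "supported (sub_rep W (f ` rep_space V))"
  by (rule supported_mono[OF s]) (simp add: hdim_ker_im(1)[OF ss irr_fd V W f])

section \<open>Decomposition into irreducible summands\<close>

context isotypic
begin

text \<open>An irreducible subrepresentation is a direct summand and hence contributes to
  \<open>hdim\<close>; the support of \<open>V\<close> then identifies it with some
  \<open>Vs j\<close>. The projection \<open>e\<close> makes it the induction step for the results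
  below.\<close>

lemma irreducible_part:
  assumes V: "fd_rep L V" and s: "supported V" and ne: "rep_space V \<noteq> {0}"
  obtains A e j where "subrep V A" "A \<noteq> {0}" "fd_rep L (sub_rep V A)" "j \<in> I" "rep_iso (sub_rep V A) (Vs j)"
    "e \<in> Hom V (sub_rep V A)" "e ` rep_space V = A"
proof -
  obtain A where A: "subrep V A" "irreducible_rep L (sub_rep V A)"
    using irreducible_subrep_exists[OF V ne] by blast
  note fA = irr_fd[OF A(2)]
  obtain e K where e: "e \<in> Hom V (sub_rep V A)" "e ` rep_space V = A" "K = {v\<in>rep_space V. e v = 0}"
      "\<forall>u\<in>A. e u = u" and K: "subrep V K" "fd_rep L (sub_rep V K)"
      by (rule split_subrep[OF ss V A(1)])
  obtain U where U: "U \<in> seq_reps L" "rep_iso U (sub_rep V A)" using seq_copy[OF fA] by blast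
  have fU: "fd_rep L U" using U(1) by (simp add: seq_reps_def)
  have iU: "irreducible_rep L U" by (rule irreducible_iso[OF A(2) fU rep_iso_sym[OF fU fA U(2)]])
  have "hdim U (sub_rep V A) = 1" using hdim_iso(1)[OF ss fU fU fA U(2)] schur_1[OF iU] by simp
  moreover have "hdim U V = hdim U (sub_rep V {v\<in>rep_space V. e v = 0}) + hdim U (sub_rep V A)"
    using hdim_ker_im(1)[OF ss fU V fA e(1)] e(2) by (simp add: sub_rep_def)
  ultimately have "hdim U V \<noteq> 0" by simp
  then obtain j where j: "j \<in> I" "rep_iso U (Vs j)" using s U(1) iU unfolding supported_def by blast
  have "rep_iso (sub_rep V A) (Vs j)" by (rule rep_iso_trans[OF fU rep_iso_sym[OF fU fA U(2)] j(2)])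
  moreover have "A \<noteq> {0}" using A(2) by (simp add: irreducible_rep_def)
  ultimately show ?thesis using that[OF A(1) _ fA j(1) _ e(1,2)] by blast
qed

text \<open>When a summand isomorphic to \<open>Vs j\<close> is peeled off, both sides lose the
  class \<open>cls j\<close>.\<close>

lemma cl_supported:
  assumes "fd_rep L V" "supported V"
  shows "cl L V = comb (\<lambda>i. int (hdim (Vs i) V))"
  using assms
proof (induction "vector_space.dim (rep_scale V) (rep_space V)" arbitrary: V rule: less_induct)
  case (less V)
  note V = less.prems(1)
  show ?case
  proof (cases "rep_space V = {0}")
    case True
    have "(\<lambda>v. 0) \<in> Hom V V" by (rule Hom_zero[OF V])
    moreover have "bij_betw (\<lambda>v. 0) (rep_space V) (rep_space (zero_rep :: ('g, nat \<Rightarrow> complex) rep))"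
      using True by (simp add: bij_betw_def zero_rep_def)
    moreover have Z: "fd_rep L (zero_rep :: ('g, nat \<Rightarrow> complex) rep)" using zero_rep[OF lieL] by (simp add: seq_reps_def)
    ultimately have "rep_iso V (zero_rep :: ('g, nat \<Rightarrow> complex) rep)"
      using Hom_zero[OF Z, of V] unfolding rep_iso_def by blast
    then have "cl L V = cl L (zero_rep :: ('g, nat \<Rightarrow> complex) rep)" by (rule cl_iso[OF lieL V Z])
    also have "\<dots> = coset L (Poly_Mapping.single zero_rep 1)"
      by (rule cl_eq_coset[OF lieL Z zero_rep[OF lieL] rep_iso_refl[OF Z]])
    also have "\<dots> = coset L 0"
      by (rule coset_eqI[OF single_carrier[OF zero_rep[OF lieL]]])
        (use relation_zero_rep[OF lieL] in \<open>auto simp: formal_reps_simps\<close>)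
    also have "\<dots> = comb (\<lambda>i. 0)" by (simp add: comb_zero coset_zero)
    also have "\<dots> = comb (\<lambda>i. int (hdim (Vs i) V))"
      by (rule comb_cong) (simp add: hdim_0(1)[OF irr_fd' V True])
    finally show ?thesis .
  next
    case False
    obtain A e j where A: "subrep V A" "A \<noteq> {0}" "fd_rep L (sub_rep V A)" "j \<in> I" "rep_iso (sub_rep V A) (Vs j)"
      and e: "e \<in> Hom V (sub_rep V A)" "e ` rep_space V = A"
      by (rule irreducible_part[OF V less.prems(2) False])
    let ?K = "{v\<in>rep_space V. e v = 0}"
    have fK: "fd_rep L (sub_rep V ?K)" by (rule sub_rep_fd[OF V kernel_subrep[OF V A(3) e(1)]])
    have ss': "sub_rep (sub_rep V A) A = sub_rep V A" by (simp add: sub_rep_def)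
    have IH: "cl L (sub_rep V ?K) = comb (\<lambda>i. int (hdim (Vs i) (sub_rep V ?K)))"
      by (rule less.hyps[OF _ fK supported_ker[OF V A(3) e(1) less.prems(2)]])
        (use dim_split[OF V A(1,2) e] in simp)
    have "cl L V = cl L (sub_rep V ?K) \<oplus>\<^bsub>Q\<^esub> cl L (sub_rep V A)"
      using cl_ker_im[OF lieL V A(3) e(1)] e(2) ss' by simp
    also have "cl L (sub_rep V A) = cls j" unfolding cls_def by (rule cl_iso[OF lieL A(3) irr_fd'[OF A(4)] A(5)])
    also have "cls j = comb (\<lambda>i. if i = j then 1 else 0)" by (rule comb_delta[OF A(4), symmetric])
    also have "cl L (sub_rep V ?K) \<oplus>\<^bsub>Q\<^esub> \<dots> = comb (\<lambda>i. int (hdim (Vs i) (sub_rep V ?K)) + (if i = j then 1 else 0))"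
      unfolding IH by (rule comb_add)
    also have "\<dots> = comb (\<lambda>i. int (hdim (Vs i) V))"
    proof (rule comb_cong)
      fix i assume i: "i \<in> I"
      have "hdim (Vs i) V = hdim (Vs i) (sub_rep V ?K) + hdim (Vs i) (sub_rep V A)"
        using hdim_ker_im(1)[OF ss irr_fd'[OF i] V A(3) e(1)] e(2) ss' by simp
      moreover have "hdim (Vs i) (sub_rep V A) = hdim (Vs i) (Vs j)"
        by (rule hdim_iso(1)[OF ss irr_fd'[OF i] A(3) irr_fd'[OF A(4)] A(5)])
      ultimately show "int (hdim (Vs i) (sub_rep V ?K)) + (if i = j then 1 else 0) = int (hdim (Vs i) V)"
        using hdim_Vs[OF i A(4)] by simp
    qed
    finally show ?thesis .
  qed
qed

text \<open>When a summand isomorphic to \<open>Vs j\<close> is peeled off, both sides lose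
  \<open>hdim (Vs j) W\<close>.\<close>

lemma hdim_supported:
  assumes "fd_rep L V" "supported V" and W: "fd_rep L W"
  shows "hdim V W = (\<Sum>i\<in>I. hdim (Vs i) V * hdim (Vs i) W)"
  using assms(1,2)
proof (induction "vector_space.dim (rep_scale V) (rep_space V)" arbitrary: V rule: less_induct)
  case (less V)
  note V = less.prems(1)
  show ?case
  proof (cases "rep_space V = {0}")
    case True
    then show ?thesis using hdim_0(2)[OF W V True] hdim_0(1)[OF irr_fd' V True] by simp
  next
    case False
    obtain A e j where A: "subrep V A" "A \<noteq> {0}" "fd_rep L (sub_rep V A)" "j \<in> I" "rep_iso (sub_rep V A) (Vs j)"
      and e: "e \<in> Hom V (sub_rep V A)" "e ` rep_space V = A"
      by (rule irreducible_part[OF V less.prems(2) False])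
    let ?K = "{v\<in>rep_space V. e v = 0}"
    have fK: "fd_rep L (sub_rep V ?K)" by (rule sub_rep_fd[OF V kernel_subrep[OF V A(3) e(1)]])
    have ss': "sub_rep (sub_rep V A) A = sub_rep V A" by (simp add: sub_rep_def)
    have IH: "hdim (sub_rep V ?K) W = (\<Sum>i\<in>I. hdim (Vs i) (sub_rep V ?K) * hdim (Vs i) W)"
      by (rule less.hyps[OF _ fK supported_ker[OF V A(3) e(1) less.prems(2)]])
        (use dim_split[OF V A(1,2) e] in simp)
    have "hdim V W = hdim (sub_rep V A) W + hdim (sub_rep V ?K) W"
      using hdim_ker_im(2)[OF ss W V A(3) e(1)] e(2) ss' by simp
    also have "hdim (sub_rep V A) W = hdim (Vs j) W" by (rule hdim_iso(2)[OF ss W A(3) irr_fd'[OF A(4)] A(5)])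
    also have "hdim (Vs j) W = (\<Sum>i\<in>I. if i = j then hdim (Vs i) W else 0)" using A(4) finI by simp
    also have "\<dots> + hdim (sub_rep V ?K) W = (\<Sum>i\<in>I. hdim (Vs i) V * hdim (Vs i) W)"
      unfolding IH sum.distrib[symmetric]
    proof (rule sum.cong[OF refl])
      fix i assume i: "i \<in> I"
      have "hdim (Vs i) V = hdim (Vs i) (sub_rep V ?K) + hdim (Vs i) (sub_rep V A)"
        using hdim_ker_im(1)[OF ss irr_fd'[OF i] V A(3) e(1)] e(2) ss' by simp
      moreover have "hdim (Vs i) (sub_rep V A) = hdim (Vs i) (Vs j)"
        by (rule hdim_iso(1)[OF ss irr_fd'[OF i] A(3) irr_fd'[OF A(4)] A(5)])
      ultimately show "(if i = j then hdim (Vs i) W else 0) + hdim (Vs i) (sub_rep V ?K) * hdim (Vs i) W = hdim (Vs i) V * hdim (Vs i) W"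
        using hdim_Vs[OF i A(4)] by (simp add: add_mult_distrib)
    qed
    finally show ?thesis .
  qed
qed

text \<open>The image of \<open>f\<close> contains a copy of some \<open>Vs j\<close>, and a
  generalized inverse of \<open>f\<close> lifts this copy to \<open>V\<close>.\<close>

lemma nonzero_detected:
  assumes V: "fd_rep L V" and W: "fd_rep L W" and s: "supported V" and f: "f \<in> Hom V W" "f \<noteq> 0"
  obtains i \<phi> u where "i \<in> I" "\<phi> \<in> Hom (Vs i) V" "u \<in> rep_space (Vs i)" "f (\<phi> u) \<noteq> 0"
proof -
  let ?T = "f ` rep_space V"
  have fT: "fd_rep L (sub_rep W ?T)" by (rule sub_rep_fd[OF W image_subrep[OF V W f(1)]])
  have "rep_space (sub_rep W ?T) \<noteq> {0}" using Hom_nonzero[OF f] by auto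
  then obtain A e j where A: "subrep (sub_rep W ?T) A" "A \<noteq> {0}" "fd_rep L (sub_rep (sub_rep W ?T) A)" "j \<in> I"
      "rep_iso (sub_rep (sub_rep W ?T) A) (Vs j)"
      and e: "e \<in> Hom (sub_rep W ?T) (sub_rep (sub_rep W ?T) A)" "e ` rep_space (sub_rep W ?T) = A"
    by (rule irreducible_part[OF fT supported_im[OF V W f(1) s]])
  obtain b where b: "b \<in> Hom (Vs j) (sub_rep (sub_rep W ?T) A)" "bij_betw b (rep_space (Vs j)) A"
    using rep_iso_sym[OF A(3) irr_fd'[OF A(4)] A(5)] by (auto simp: rep_iso_def)
  have TW: "?T \<subseteq> rep_space W" using Hom_in[OF f(1)] by blast
  have AT: "A \<subseteq> ?T" using A(1) by (simp add: subrep_def)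
  have bA: "sub_rep (sub_rep W ?T) A = sub_rep W A" by (simp add: sub_rep_def)
  have bW: "b \<in> Hom (Vs j) W" using b(1) Hom_sub_target[OF order_trans[OF AT TW]] unfolding bA by blast
  obtain f' where f': "f' \<in> Hom W V" "\<And>v. f (f' (f v)) = f v" "\<And>w. f' (f (f' w)) = f' w"
    using generalized_inverse[OF ss V W f(1)] by blast
  have h: "(\<lambda>u. f' (b u)) \<in> Hom (Vs j) V" by (rule Hom_comp[OF bW f'(1) W])
  have bim: "b ` rep_space (Vs j) = A" using b(2) by (simp add: bij_betw_def)
  have "0 \<in> A" using fd_zero[OF A(3)] by simp
  then obtain w where "w \<in> A" "w \<noteq> 0" using A(2) by blast
  then obtain u where u: "u \<in> rep_space (Vs j)" "b u \<noteq> 0" "b u \<in> A" using bim by blast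
  then obtain v where "b u = f v" using AT by blast
  then have "f (f' (b u)) \<noteq> 0" using f'(2) u(2) by simp
  then show ?thesis by (rule that[OF A(4) h u(1)])
qed

abbreviation mults :: "('g, 'v::ab_group_add) rep \<Rightarrow> ('g, 'w::ab_group_add) rep \<Rightarrow> ('v \<Rightarrow> 'w) \<Rightarrow> nat \<Rightarrow> nat"
  where "mults V W f i \<equiv> hdim (Vs i) (sub_rep W (f ` rep_space V))"

text \<open>Induction on the total multiplicity. If \<open>p\<close> misses the target by one at
  \<open>j\<close>, then \<open>Vs j\<close> still occurs in the kernels of \<open>p\<close> and of
  \<open>q\<close>, and \<open>p\<close> is enlarged by a map that carries the copy in the kernel of
  \<open>p\<close> to the one in the kernel of \<open>q\<close>.\<close>

lemma rank_exists:
  fixes V :: "('g, 'v::ab_group_add) rep" and W :: "('g, 'w::ab_group_add) rep"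
  assumes V: "fd_rep L V" and W: "fd_rep L W"
    and t: "\<And>i. i \<in> I \<Longrightarrow> t i \<le> hdim (Vs i) V" "\<And>i. i \<in> I \<Longrightarrow> t i \<le> hdim (Vs i) W"
  shows "\<exists>p\<in>Hom V W. \<forall>i\<in>I. mults V W p i = t i"
  using t
proof (induction "\<Sum>i\<in>I. t i" arbitrary: t)
  case 0
  let ?p = "\<lambda>v::'v. 0::'w"
  have p: "?p \<in> Hom V W" by (rule Hom_zero[OF W])
  have "?p ` rep_space V = {0}" using fd_zero[OF V] by auto
  then have "mults V W ?p i = t i" if "i \<in> I" for i
    using hdim_0(1)[OF irr_fd'[OF that] sub_rep_fd[OF W zero_subrep[OF W]]] 0(1) finI that by simp
  then show ?case using p by blast
next
  case (Suc n)
  obtain j where j: "j \<in> I" "t j \<noteq> 0" using Suc.hyps(2) by (metis nat.distinct(1) sum.neutral)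
  define t' where "t' = t(j := t j - 1)"
  have "(\<Sum>i\<in>I. t i) = t j + (\<Sum>i\<in>I - {j}. t i)" using j(1) finI by (simp add: sum.remove)
  moreover have "(\<Sum>i\<in>I. t' i) = t' j + (\<Sum>i\<in>I - {j}. t' i)" using j(1) finI by (simp add: sum.remove)
  moreover have "(\<Sum>i\<in>I - {j}. t' i) = (\<Sum>i\<in>I - {j}. t i)" by (rule sum.cong) (auto simp: t'_def)
  ultimately have "n = (\<Sum>i\<in>I. t' i)" using Suc.hyps(2) j(2) by (simp add: t'_def)
  moreover have "t' i \<le> hdim (Vs i) V" "t' i \<le> hdim (Vs i) W" if "i \<in> I" for i
    using Suc.prems[OF that] by (auto simp: t'_def)
  ultimately obtain p where p: "p \<in> Hom V W" "\<And>i. i \<in> I \<Longrightarrow> mults V W p i = t' i" using Suc.hyps(1)[of t'] by blast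
  obtain q where q: "q \<in> Hom W V" "\<And>v. p (q (p v)) = p v" "\<And>w. q (p (q w)) = q w"
    using generalized_inverse[OF ss V W p(1)] by blast
  note fj = irr_fd'[OF j(1)]
  let ?K = "{v\<in>rep_space V. p v = 0}" and ?D = "{w\<in>rep_space W. q w = 0}"
  have fK: "fd_rep L (sub_rep V ?K)" by (rule sub_rep_fd[OF V kernel_subrep[OF V W p(1)]])
  have fD: "fd_rep L (sub_rep W ?D)" by (rule sub_rep_fd[OF W kernel_subrep[OF W V q(1)]])
  have "hdim (Vs j) (sub_rep V ?K) \<noteq> 0"
    using hdim_ker_im(1)[OF ss fj V W p(1)] p(2)[OF j(1)] Suc.prems(1)[OF j(1)] j(2) by (simp add: t'_def)
  then obtain \<phi> where \<phi>: "\<phi> \<in> Hom (Vs j) (sub_rep V ?K)" "\<phi> \<noteq> 0" by (rule hdim_pos[OF fK])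
  have "hdim (Vs j) (sub_rep W ?D) \<noteq> 0"
    using hdim_coker[OF ss fj V W p(1) q] p(2)[OF j(1)] Suc.prems(2)[OF j(1)] j(2) by (simp add: t'_def)
  then obtain \<psi> where \<psi>: "\<psi> \<in> Hom (Vs j) (sub_rep W ?D)" "\<psi> \<noteq> 0" by (rule hdim_pos[OF fD])
  have \<phi>V: "\<phi> \<in> Hom (Vs j) V" and \<psi>W: "\<psi> \<in> Hom (Vs j) W" using \<phi>(1) \<psi>(1) Hom_sub_target[of ?K V] Hom_sub_target[of ?D W] by blast+
  have p\<phi>: "p (\<phi> u) = 0" and q\<psi>: "q (\<psi> u) = 0" if "u \<in> rep_space (Vs j)" for u
    using Hom_in[OF \<phi>(1) that] Hom_in[OF \<psi>(1) that] by auto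
  note \<phi>inj = irr_Hom_inj[OF irr[OF j(1)] V \<phi>V \<phi>(2)] and \<psi>inj = irr_Hom_inj[OF irr[OF j(1)] W \<psi>W \<psi>(2)]
  obtain \<phi>0 where \<phi>0: "\<phi>0 \<in> Hom V (Vs j)" "\<And>u. \<phi> (\<phi>0 (\<phi> u)) = \<phi> u" "\<And>v. \<phi>0 (\<phi> (\<phi>0 v)) = \<phi>0 v"
    using generalized_inverse[OF ss fj V \<phi>V] by metis
  have \<phi>0\<phi>: "\<phi>0 (\<phi> u) = u" if "u \<in> rep_space (Vs j)" for u
    using inj_onD[OF \<phi>inj \<phi>0(2)] that Hom_in[OF \<phi>0(1) Hom_in[OF \<phi>V that]] by blast
  define \<phi>' where "\<phi>' = (\<lambda>v. \<phi>0 (rep_id V v - q (p v)))"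
  have \<phi>'H: "\<phi>' \<in> Hom V (Vs j)"
    unfolding \<phi>'_def by (rule Hom_comp[OF Hom_minus[OF V rep_id_Hom[OF V] Hom_comp[OF p(1) q(1) W]] \<phi>0(1) V])
  have \<phi>'\<phi>: "\<phi>' (\<phi> u) = u" if "u \<in> rep_space (Vs j)" for u
    using \<phi>0\<phi>[OF that] p\<phi>[OF that] Hom_0[OF q(1) W] Hom_in[OF \<phi>V that] by (simp add: \<phi>'_def)
  define p1 where "p1 = (\<lambda>v. p v + \<psi> (\<phi>' v))"
  have \<psi>\<phi>: "(\<lambda>v. \<psi> (\<phi>' v)) \<in> Hom V W" by (rule Hom_comp[OF \<phi>'H \<psi>W fj])
  have p1H: "p1 \<in> Hom V W" unfolding p1_def by (rule Hom_plus[OF W p(1) \<psi>\<phi>])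
  have ker1: "{v\<in>rep_space V. p1 v = 0} = {v\<in>?K. \<phi>' v = 0}"
  proof -
    have "p v = 0 \<and> \<phi>' v = 0" if v: "v \<in> rep_space V" "p1 v = 0" for v
    proof -
      have u: "\<phi>' v \<in> rep_space (Vs j)" by (rule Hom_in[OF \<phi>'H v(1)])
      \<comment> \<open>Applying \<open>q\<close> removes the second summand, because
        \<open>\<psi>\<close> maps into the kernel of \<open>q\<close>. So the two summands of
        \<open>p1 v = 0\<close> vanish separately.\<close>
      have "q (p v + \<psi> (\<phi>' v)) = q (p v) + q (\<psi> (\<phi>' v))"
        by (rule Hom_add[OF q(1) Hom_in[OF p(1) v(1)] Hom_in[OF \<psi>W u]])
      then have "q (p v) = 0" using v(2) q\<psi>[OF u] Hom_0[OF q(1) W] by (simp add: p1_def)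
      then have pv: "p v = 0" using q(2)[of v] Hom_0[OF p(1) V] by simp
      then have "\<psi> (\<phi>' v) = \<psi> 0" using v(2) Hom_0[OF \<psi>W fj] by (simp add: p1_def)
      then have "\<phi>' v = 0" using inj_onD[OF \<psi>inj] u fd_zero[OF fj] by blast
      then show ?thesis using pv by simp
    qed
    then show ?thesis using Hom_0[OF \<psi>W fj] by (auto simp: p1_def)
  qed
  \<comment> \<open>On the kernel of \<open>p\<close>, the map \<open>\<phi>'\<close> is onto
    \<open>Vs j\<close> and its kernel is that of \<open>p1\<close>; so the kernel loses exactly one
    copy of \<open>Vs j\<close>.\<close>
  let ?r = "\<lambda>v. if v \<in> ?K then \<phi>' v else 0"
  have rH: "?r \<in> Hom (sub_rep V ?K) (Vs j)" by (rule Hom_restrict[OF V kernel_subrep[OF V W p(1)] \<phi>'H])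
  have rim: "?r ` ?K = rep_space (Vs j)"
  proof
    show "?r ` ?K \<subseteq> rep_space (Vs j)" using Hom_in[OF \<phi>'H] by auto
    show "rep_space (Vs j) \<subseteq> ?r ` ?K"
    proof
      fix u assume u: "u \<in> rep_space (Vs j)"
      have "\<phi> u \<in> ?K" using Hom_in[OF \<phi>(1) u] by simp
      then show "u \<in> ?r ` ?K" using \<phi>'\<phi>[OF u] by (intro image_eqI[of _ _ "\<phi> u"]) auto
    qed
  qed
  have kerr: "{v\<in>rep_space (sub_rep V ?K). ?r v = 0} = {v\<in>rep_space V. p1 v = 0}" unfolding ker1 by auto
  have "mults V W p1 i = t i" if i: "i \<in> I" for i
  proof -
    note fi = irr_fd'[OF i]
    have a: "hdim (Vs i) V = hdim (Vs i) (sub_rep V {v\<in>rep_space V. p1 v = 0}) + mults V W p1 i"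
      by (rule hdim_ker_im(1)[OF ss fi V W p1H])
    have b: "hdim (Vs i) V = hdim (Vs i) (sub_rep V ?K) + t' i"
      using hdim_ker_im(1)[OF ss fi V W p(1)] p(2)[OF i] by simp
    have "hdim (Vs i) (sub_rep V ?K) = hdim (Vs i) (sub_rep (sub_rep V ?K) {v\<in>rep_space (sub_rep V ?K). ?r v = 0})
        + hdim (Vs i) (sub_rep (Vs j) (?r ` rep_space (sub_rep V ?K)))"
      by (rule hdim_ker_im(1)[OF ss fi fK fj rH])
    moreover have "sub_rep (Vs j) (?r ` rep_space (sub_rep V ?K)) = Vs j" using rim by (simp add: sub_rep_def)
    moreover have "sub_rep (sub_rep V ?K) {v\<in>rep_space (sub_rep V ?K). ?r v = 0} = sub_rep V {v\<in>rep_space V. p1 v = 0}"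
      unfolding kerr by (simp add: sub_rep_def)
    ultimately have "hdim (Vs i) (sub_rep V ?K) = hdim (Vs i) (sub_rep V {v\<in>rep_space V. p1 v = 0}) + (if i = j then 1 else 0)"
      using hdim_Vs[OF i j(1)] by simp
    then have "mults V W p1 i = t' i + (if i = j then 1 else 0)" using a b by simp
    then show ?thesis using j(2) by (simp add: t'_def)
  qed
  then show ?case using p1H by blast
qed

text \<open>Otherwise the identity would be a nonzero morphism, detected by a map from some
  \<open>Vs i\<close>.\<close>

lemma supported_trivial:
  assumes A: "fd_rep L A" "supported A" and z: "\<And>i. i \<in> I \<Longrightarrow> hdim (Vs i) A = 0"
  shows "rep_space A = {0}"
proof -
  have id0: "rep_id A = 0"
  proof (rule ccontr)
    assume "rep_id A \<noteq> 0"
    from nonzero_detected[OF A(1) A rep_id_Hom[OF A(1)] this]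
    obtain i \<phi> u where i: "i \<in> I" and \<phi>: "\<phi> \<in> Hom (Vs i) A" and u: "u \<in> rep_space (Vs i)" "rep_id A (\<phi> u) \<noteq> 0" .
    interpret c: cvec "hom_scale A :: complex \<Rightarrow> ('u \<Rightarrow> 'a) \<Rightarrow> _" by (rule hom_cvec[OF A(1)])
    have "Hom (Vs i) A = {0}"
      using z[OF i] c.fdim_dim_0[OF Hom_fdim[OF irr_fd'[OF i] A(1)]] by (simp add: hdim_def)
    then have "\<phi> u = 0" using \<phi> by auto
    then show False using u(2) fd_zero[OF A(1)] by simp
  qed
  have "v = 0" if "v \<in> rep_space A" for v using fun_cong[OF id0, of v] that by simp
  then show ?thesis using fd_zero[OF A(1)] by blast
qed

text \<open>For a morphism of the largest possible rank, its kernel and the kernel of its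
  generalized inverse have no multiplicities left, so both are 0.\<close>

lemma mult_eq_iso:
  fixes V :: "('g, 'v::ab_group_add) rep" and W :: "('g, 'w::ab_group_add) rep"
  assumes V: "fd_rep L V" and W: "fd_rep L W" and s: "supported V" "supported W"
    and eq: "\<And>i. i \<in> I \<Longrightarrow> hdim (Vs i) V = hdim (Vs i) W"
  shows "rep_iso V W"
proof -
  obtain p where p: "p \<in> Hom V W" "\<forall>i\<in>I. mults V W p i = hdim (Vs i) V"
    using rank_exists[OF V W, of "\<lambda>i. hdim (Vs i) V"] eq by auto
  obtain q where q: "q \<in> Hom W V" "\<And>v. p (q (p v)) = p v" "\<And>w. q (p (q w)) = q w"
    using generalized_inverse[OF ss V W p(1)] by blast
  have kp: "rep_space (sub_rep V {v\<in>rep_space V. p v = 0}) = {0}"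
  proof (rule supported_trivial[OF sub_rep_fd[OF V kernel_subrep[OF V W p(1)]] supported_ker[OF V W p(1) s(1)]])
    show "hdim (Vs i) (sub_rep V {v\<in>rep_space V. p v = 0}) = 0" if "i \<in> I" for i
      using hdim_ker_im(1)[OF ss irr_fd'[OF that] V W p(1)] p(2) that by simp
  qed
  have kq: "rep_space (sub_rep W {w\<in>rep_space W. q w = 0}) = {0}"
  proof (rule supported_trivial[OF sub_rep_fd[OF W kernel_subrep[OF W V q(1)]] supported_ker[OF W V q(1) s(2)]])
    show "hdim (Vs i) (sub_rep W {w\<in>rep_space W. q w = 0}) = 0" if "i \<in> I" for i
      using hdim_coker[OF ss irr_fd'[OF that] V W p(1) q] p(2) eq that by simp
  qed
  interpret vw: cvec2 "rep_scale V" "rep_scale W" by (intro cvec2.intro fd_cvec[OF V] fd_cvec[OF W])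
  have "inj_on p (rep_space V)"
    using vw.inj_on_iff_kernel[OF fd_subspace[OF V] Hom_linear[OF p(1)]] kp by auto
  moreover have "p ` rep_space V = rep_space W"
  proof
    show "rep_space W \<subseteq> p ` rep_space V"
    proof
      fix w assume w: "w \<in> rep_space W"
      have pq: "p (q w) \<in> rep_space W" by (rule Hom_in[OF p(1) Hom_in[OF q(1) w]])
      have "q (w - p (q w)) = 0" using Hom_diff[OF q(1) W w pq] q(3) by simp
      then have "w - p (q w) \<in> rep_space (sub_rep W {w\<in>rep_space W. q w = 0})" using fd_diff[OF W w pq] by simp
      then have "w = p (q w)" unfolding kq by simp
      then show "w \<in> p ` rep_space V" using Hom_in[OF q(1) w] by (rule image_eqI)
    qed
  qed (use Hom_in[OF p(1)] in blast)
  ultimately show ?thesis using p(1) unfolding rep_iso_def bij_betw_def by blast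
qed

end

section \<open>Krull dimension of subsets of affine space\<close>

text \<open>\<open>u\<close> factors through \<open>v\<close>. The domain \<open>Z\<close> need not
  be finite dimensional: it will consist of the polynomial functions of bounded degree, whose values
  off the affine space are arbitrary.\<close>

lemma (in cvec2) dim_le_via:
  assumes Z: "v1.subspace Z" and u: "linear_on Z s1 s2 u"
    and v: "linear_on Z s1 s3 v" and s3: "cvec s3" and S: "cvec.fdim s3 S" "v ` Z \<subseteq> S"
    and ker: "\<And>z. z \<in> Z \<Longrightarrow> v z = 0 \<Longrightarrow> u z = 0"
  shows "v2.dim (u ` Z) \<le> vector_space.dim s3 S"
proof -
  interpret a: cvec2 s1 s3 by (intro cvec2.intro v1.cvec_axioms s3)
  interpret b: cvec2 s3 s2 by (intro cvec2.intro v2.cvec_axioms s3)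
  define w where "w y = u (SOME z. z \<in> Z \<and> v z = y)" for y
  have wv: "w (v z) = u z" if z: "z \<in> Z" for z
  proof -
    define z' where "z' = (SOME z'. z' \<in> Z \<and> v z' = v z)"
    have z': "z' \<in> Z \<and> v z' = v z" unfolding z'_def by (rule someI[of _ z]) (use z in simp)
    have "v (z' - z) = 0" using a.linear_on_diff[OF v Z] z z' by simp
    then have "u (z' - z) = 0" using ker v1.subspace_diff[OF Z] z z' by blast
    then have "u z' = u z" using linear_on_diff[OF u Z] z z' by simp
    then show ?thesis by (simp add: w_def z'_def)
  qed
  have wl: "linear_on (v ` Z) s3 s2 w"
    unfolding linear_on_def
  proof (intro conjI ballI allI)
    fix x y assume "x \<in> v ` Z" "y \<in> v ` Z"
    then obtain z z' where z: "z \<in> Z" "z' \<in> Z" "x = v z" "y = v z'" by blast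
    have "w (v z + v z') = w (v (z + z'))" by (simp only: a.linear_on_add[OF v z(1,2)])
    also have "\<dots> = u z + u z'" by (simp only: wv[OF v1.subspace_add[OF Z z(1,2)]] linear_on_add[OF u z(1,2)])
    finally show "w (x + y) = w x + w y" using z wv by simp
  next
    fix c x assume "x \<in> v ` Z"
    then obtain z where z: "z \<in> Z" "x = v z" by blast
    have "w (s3 c (v z)) = w (v (s1 c z))" by (simp only: a.linear_on_scale[OF v z(1)])
    also have "\<dots> = s2 c (u z)" by (simp only: wv[OF v1.subspace_scale[OF Z z(1)]] linear_on_scale[OF u z(1)])
    finally show "w (s3 c x) = s2 c (w x)" using z wv by simp
  qed
  have fv: "a.v2.fdim (v ` Z)" and le: "a.v2.dim (v ` Z) \<le> a.v2.dim S"
    using a.v2.fdim_sub(1,2)[OF S(1) a.subspace_image_on[OF v Z] S(2)] by auto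
  have "w ` v ` Z = u ` Z" using wv by force
  then have "v2.dim (u ` Z) \<le> a.v2.dim (v ` Z)" using b.dim_image_kernel(2)[OF fv wl] by simp
  then show ?thesis using le by simp
qed

section \<open>Degree bounds and Hilbert functions\<close>

inductive polyd :: "(complex \<Rightarrow> 'e::ab_group_add \<Rightarrow> 'e) \<Rightarrow> 'e set \<Rightarrow> nat \<Rightarrow> ('e \<Rightarrow> complex) \<Rightarrow> bool"
  for sc E where
  const: "polyd sc E 0 (\<lambda>x. c)"
| linear: "linear_on E sc (*) f \<Longrightarrow> polyd sc E 1 f"
| add: "polyd sc E n f \<Longrightarrow> polyd sc E n g \<Longrightarrow> polyd sc E n (\<lambda>x. f x + g x)"
| mult: "polyd sc E n f \<Longrightarrow> polyd sc E m g \<Longrightarrow> polyd sc E (n + m) (\<lambda>x. f x * g x)"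
| mono: "polyd sc E n f \<Longrightarrow> n \<le> m \<Longrightarrow> polyd sc E m f"

lemma polyd_poly: "polyd sc E n f \<Longrightarrow> f \<in> poly_functions sc E"
  by (induction rule: polyd.induct) (auto intro: poly_functions.intros)

lemma poly_polyd: "f \<in> poly_functions sc E \<Longrightarrow> \<exists>n. polyd sc E n f"
proof (induction rule: poly_functions.induct)
  case (add f g)
  then obtain n m where "polyd sc E n f" "polyd sc E m g" by blast
  then have "polyd sc E (max n m) f" "polyd sc E (max n m) g" by (auto intro: polyd.mono)
  then show ?case using polyd.add by blast
qed (blast intro: polyd.intros)+

lemma polyd_scale: "polyd sc E n f \<Longrightarrow> polyd sc E n (\<lambda>x. c * f x)"
  using polyd.mult[OF polyd.const[of sc E c], of n f] by simp

lemma polyd_sum: "(\<And>i. i \<in> I \<Longrightarrow> polyd sc E n (f i)) \<Longrightarrow> polyd sc E n (\<lambda>x. \<Sum>i\<in>I. f i x)"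
proof (induction I rule: infinite_finite_induct)
  case (insert i I)
  then show ?case using polyd.add[of sc E n "f i" "\<lambda>x. \<Sum>i\<in>I. f i x"] by simp
qed (auto intro: polyd.mono[OF polyd.const])

abbreviation cfun_scale :: "complex \<Rightarrow> ('e \<Rightarrow> complex) \<Rightarrow> 'e \<Rightarrow> complex"
  where "cfun_scale \<equiv> fun_scale (*)"

lemma cfun_cvec: "cvec (cfun_scale :: complex \<Rightarrow> ('e \<Rightarrow> complex) \<Rightarrow> _)"
  by unfold_locales (auto simp: fun_scale_def fun_eq_iff algebra_simps)

text \<open>Extension by 0 turns agreement on \<open>C\<close> into equality of functions.\<close>

definition res :: "'e set \<Rightarrow> ('e \<Rightarrow> complex) \<Rightarrow> 'e \<Rightarrow> complex"
  where "res C f = (\<lambda>x. if x \<in> C then f x else 0)"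

lemma res_linear: "linear_on Z cfun_scale cfun_scale (res C)"
  by (auto simp: linear_on_def res_def fun_scale_def fun_eq_iff)

lemma res_eq_0: "res C f = 0 \<longleftrightarrow> (\<forall>x\<in>C. f x = 0)"
  by (auto simp: res_def fun_eq_iff)

definition hilb_space :: "(complex \<Rightarrow> 'e::ab_group_add \<Rightarrow> 'e) \<Rightarrow> 'e set \<Rightarrow> 'e set \<Rightarrow> nat \<Rightarrow> ('e \<Rightarrow> complex) set"
  where "hilb_space sc E C n = res C ` {f. polyd sc E n f}"

text \<open>The affine Hilbert function of \<open>C\<close>.\<close>

definition hilb :: "(complex \<Rightarrow> 'e::ab_group_add \<Rightarrow> 'e) \<Rightarrow> 'e set \<Rightarrow> 'e set \<Rightarrow> nat \<Rightarrow> nat"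
  where "hilb sc E C n = vector_space.dim cfun_scale (hilb_space sc E C n)"

lemma polyd_subspace: "module.subspace cfun_scale {f. polyd sc E n f}"
proof -
  interpret F: cvec "cfun_scale :: complex \<Rightarrow> ('a \<Rightarrow> complex) \<Rightarrow> _" by (rule cfun_cvec)
  show ?thesis
    by (rule F.subspaceI)
      (auto simp: plus_fun_def zero_fun_def fun_scale_def intro: polyd.add polyd_scale polyd.mono[OF polyd.const])
qed

lemma closedin_locus:
  assumes "P \<subseteq> poly_functions sc E"
  shows "closedin (subtopology (zariski sc E) C) (zero_locus E P \<inter> C)"
  unfolding closedin_subtopology closedin_zariski
  by (rule exI[of _ "zero_locus E P"], intro conjI refl exI[of _ P] assms)

lemma closedin_locusE:
  assumes "closedin (subtopology (zariski sc E) C) A"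
  obtains P where "P \<subseteq> poly_functions sc E" "A = zero_locus E P \<inter> C"
  using assms unfolding closedin_subtopology closedin_zariski by (elim exE conjE) simp

locale affine_space = cvec sc for sc :: "complex \<Rightarrow> 'e::ab_group_add \<Rightarrow> 'e" +
  fixes E :: "'e set"
  assumes fdE: "fdim E"
begin

interpretation F: cvec "cfun_scale :: complex \<Rightarrow> ('e \<Rightarrow> complex) \<Rightarrow> _"
  by (rule cfun_cvec)

lemmas sE = fdim_subspace[OF fdE]

text \<open>Both arguments are expanded in a basis of \<open>E\<close>. It accounts for the
  quadratic part of the chart.\<close>

lemma bilinear_polyd:
  assumes B: "\<And>y. y \<in> E \<Longrightarrow> linear_on E sc (*) (\<lambda>x. B x y)" "\<And>x. x \<in> E \<Longrightarrow> linear_on E sc (*) (B x)"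
  obtains g where "polyd sc E 2 g" "\<And>x. x \<in> E \<Longrightarrow> g x = B x x"
proof -
  interpret c: cvec2 sc "(*)" by (rule cvec2_complex)
  obtain X where X: "finite X" "independent X" "X \<subseteq> E" "span X = E" "card X = dim E"
    by (rule fdim_basis[OF fdE])
  have co: "linear_on E sc (*) (\<lambda>x. representation X x b)" for b
    unfolding linear_on_def using X(4) by (simp add: representation_add[OF X(2)] representation_scale[OF X(2)])
  let ?g = "\<lambda>x. \<Sum>a\<in>X. \<Sum>b\<in>X. B a b * (representation X x a * representation X x b)"
  have "polyd sc E (1 + 1) (\<lambda>x. representation X x a * representation X x b)" for a b
    by (intro polyd.mult polyd.linear co)
  then have "polyd sc E 2 ?g" by (intro polyd_sum polyd_scale) (simp add: numeral_2_eq_2)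
  moreover have "?g x = B x x" if x: "x \<in> E" for x
  proof -
    have e: "x = (\<Sum>a\<in>X. sc (representation X x a) a)"
      using sum_representation_eq[OF X(2) _ X(1)] x X(4) by simp
    have sX: "sc t a \<in> E" if "a \<in> X" for a t using that X(3) subspace_scale[OF sE] by blast
    have "B x x = (\<Sum>a\<in>X. B (sc (representation X x a) a) x)"
      by (subst (1) e) (rule c.linear_on_sum[OF B(1)[OF x] sE sX])
    also have "\<dots> = (\<Sum>a\<in>X. representation X x a * B a x)"
      by (rule sum.cong[OF refl]) (use c.linear_on_scale[OF B(1)[OF x]] X(3) in blast)
    also have "\<dots> = (\<Sum>a\<in>X. representation X x a * (\<Sum>b\<in>X. representation X x b * B a b))"
    proof (rule sum.cong[OF refl])
      fix a assume "a \<in> X"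
      then have a: "a \<in> E" using X(3) by blast
      have "B a x = (\<Sum>b\<in>X. B a (sc (representation X x b) b))"
        by (subst (1) e) (rule c.linear_on_sum[OF B(2)[OF a] sE sX])
      also have "\<dots> = (\<Sum>b\<in>X. representation X x b * B a b)"
        by (rule sum.cong[OF refl]) (use c.linear_on_scale[OF B(2)[OF a]] X(3) in blast)
      finally show "representation X x a * B a x = representation X x a * (\<Sum>b\<in>X. representation X x b * B a b)" by simp
    qed
    finally show ?thesis by (simp add: sum_distrib_left algebra_simps)
  qed
  ultimately show ?thesis using that by blast
qed

text \<open>On \<open>E\<close> a polynomial of degree at most \<open>n\<close> is a combination of
  monomials with every exponent at most \<open>n\<close>. This box of \<open>(n + 1) ^ dim E\<close>
  exponents contains the simplex of total degree \<open>n\<close> and has the same order of growth,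
  which is all that counts.\<close>

lemma hilb_bound:
  assumes C: "C \<subseteq> E"
  shows "F.fdim (hilb_space sc E C n)" "hilb sc E C n \<le> (n + 1) ^ dim E"
proof -
  interpret c: cvec2 sc "(*)" by (rule cvec2_complex)
  obtain X where X: "finite X" "independent X" "X \<subseteq> E" "span X = E" "card X = dim E"
    by (rule fdim_basis[OF fdE])
  have co: "linear_on E sc (*) (\<lambda>x. representation X x b)" for b
    unfolding linear_on_def using X(4) by (simp add: representation_add[OF X(2)] representation_scale[OF X(2)])
  define A where "A n = X \<rightarrow>\<^sub>E {..n}" for n :: nat
  define mon where "mon e = (\<lambda>x. \<Prod>b\<in>X. representation X x b ^ e b)" for e :: "'e \<Rightarrow> nat"
  define M where "M n = mon ` A n" for n
  have M_mono: "M n \<subseteq> M m" if "n \<le> m" for n m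
    unfolding M_def A_def using that by (intro image_mono PiE_mono) auto
  have mon_mult: "(\<lambda>x. mon e x * mon e' x) \<in> M (n + m)" if e: "e \<in> A n" "e' \<in> A m" for e e' n m
  proof -
    have "(\<lambda>x. mon e x * mon e' x) = mon (\<lambda>b\<in>X. e b + e' b)"
      by (simp add: mon_def fun_eq_iff power_add prod.distrib)
    moreover have "(\<lambda>b\<in>X. e b + e' b) \<in> A (n + m)" using e by (auto simp: A_def intro: add_mono)
    ultimately show ?thesis by (auto simp: M_def)
  qed
  have span_mult1: "(\<lambda>x. g x * mon e x) \<in> F.span (M (n + m))" if "e \<in> A m" "g \<in> F.span (M n)" for g e n m
    using that(2)
  proof (induction rule: F.span_induct_alt)
    case base
    have "(\<lambda>x. (0 :: 'e \<Rightarrow> complex) x * mon e x) = 0" by auto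
    then show ?case using F.span_zero by simp
  next
    case (step a f g)
    obtain e' where e': "f = mon e'" "e' \<in> A n" using step(1) by (auto simp: M_def)
    have "(\<lambda>x. (cfun_scale a f + g) x * mon e x) = cfun_scale a (\<lambda>x. mon e' x * mon e x) + (\<lambda>x. g x * mon e x)"
      by (auto simp: fun_eq_iff fun_scale_def e'(1) algebra_simps)
    then show ?case
      using F.span_add[OF F.span_scale[OF F.span_base[OF mon_mult[OF e'(2) that(1)]]] step(2)] by simp
  qed
  have span_mult: "(\<lambda>x. g x * h x) \<in> F.span (M (n + m))" if g: "g \<in> F.span (M n)" and h: "h \<in> F.span (M m)" for g h n m
    using h
  proof (induction rule: F.span_induct_alt)
    case base
    have "(\<lambda>x. g x * (0 :: 'e \<Rightarrow> complex) x) = 0" by auto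
    then show ?case using F.span_zero by simp
  next
    case (step a f h)
    obtain e' where e': "f = mon e'" "e' \<in> A m" using step(1) by (auto simp: M_def)
    have "(\<lambda>x. g x * (cfun_scale a f + h) x) = cfun_scale a (\<lambda>x. g x * mon e' x) + (\<lambda>x. g x * h x)"
      by (auto simp: fun_eq_iff fun_scale_def e'(1) algebra_simps)
    then show ?case
      using F.span_add[OF F.span_scale[OF span_mult1[OF e'(2) g]] step(2)] by simp
  qed
  have rep: "\<exists>g\<in>F.span (M n). \<forall>x\<in>E. f x = g x" if "polyd sc E n f" for f n
    using that
  proof (induction rule: polyd.induct)
    case (const c)
    have "mon (\<lambda>b\<in>X. 0) \<in> M 0" by (auto simp: M_def A_def)
    then have "cfun_scale c (mon (\<lambda>b\<in>X. 0)) \<in> F.span (M 0)" by (intro F.span_scale F.span_base)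
    moreover have "cfun_scale c (mon (\<lambda>b\<in>X. 0)) = (\<lambda>x. c)" by (simp add: mon_def fun_scale_def)
    ultimately show ?case by (intro bexI[of _ "\<lambda>x. c"]) auto
  next
    case (linear f)
    define d where "d b = (\<lambda>b'\<in>X. if b' = b then 1 else 0 :: nat)" for b :: 'e
    have md: "mon (d b) = (\<lambda>x. representation X x b)" if "b \<in> X" for b
    proof
      fix x
      have "mon (d b) x = (\<Prod>b'\<in>X. if b' = b then representation X x b' else 1)"
        unfolding mon_def d_def by (rule prod.cong) auto
      then show "mon (d b) x = representation X x b" using that X(1) by simp
    qed
    have dA: "d b \<in> A 1" for b by (auto simp: A_def d_def)
    let ?g = "\<Sum>b\<in>X. cfun_scale (f b) (mon (d b))"
    have "?g \<in> F.span (M 1)" by (intro F.span_sum F.span_scale F.span_base) (use dA in \<open>auto simp: M_def simp del: One_nat_def\<close>)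
    moreover have "f x = ?g x" if x: "x \<in> E" for x
    proof -
      have e: "x = (\<Sum>a\<in>X. sc (representation X x a) a)"
        using sum_representation_eq[OF X(2) _ X(1)] x X(4) by simp
      have sX: "sc t a \<in> E" if "a \<in> X" for a t using that X(3) subspace_scale[OF sE] by blast
      have "f x = (\<Sum>a\<in>X. f (sc (representation X x a) a))"
        by (subst (1) e) (rule c.linear_on_sum[OF linear sE sX])
      also have "\<dots> = (\<Sum>a\<in>X. representation X x a * f a)"
        by (rule sum.cong[OF refl]) (use c.linear_on_scale[OF linear] X(3) in blast)
      finally show ?thesis by (simp add: sum_fun_apply fun_scale_def md mult.commute)
    qed
    ultimately show ?case by blast
  next
    case (add n f g)
    then obtain f' g' where "f' \<in> F.span (M n)" "\<forall>x\<in>E. f x = f' x" "g' \<in> F.span (M n)" "\<forall>x\<in>E. g x = g' x" by blast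
    then show ?case using F.span_add[of f' "M n" g'] by (intro bexI[of _ "f' + g'"]) auto
  next
    case (mult n f m g)
    then obtain f' g' where fg: "f' \<in> F.span (M n)" "\<forall>x\<in>E. f x = f' x" "g' \<in> F.span (M m)" "\<forall>x\<in>E. g x = g' x" by blast
    then show ?case using span_mult[OF fg(1,3)] by (intro bexI[of _ "\<lambda>x. f' x * g' x"]) auto
  next
    case (mono n f m)
    then show ?case using F.span_mono[OF M_mono[of n m]] by blast
  qed
  have finA: "finite (A n) \<and> card (A n) = (n + 1) ^ card X"
    using X(1) by (auto simp: A_def card_PiE intro: finite_PiE)
  have "clinear cfun_scale cfun_scale (res C)"
    unfolding Vector_Spaces.linear_iff using F.vector_space_axioms
    by (auto simp: res_def fun_scale_def fun_eq_iff)
  then have "res C ` F.span (M n) = F.span (res C ` M n)" by (rule F.self.linear_span_image[symmetric])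
  moreover have "hilb_space sc E C n \<subseteq> res C ` F.span (M n)"
  proof
    fix u assume "u \<in> hilb_space sc E C n"
    then obtain f where f: "polyd sc E n f" "u = res C f" by (auto simp: hilb_space_def)
    obtain g where "g \<in> F.span (M n)" "\<forall>x\<in>E. f x = g x" using rep[OF f(1)] by blast
    then show "u \<in> res C ` F.span (M n)" using f(2) C by (intro image_eqI[of _ _ g]) (auto simp: res_def fun_eq_iff)
  qed
  ultimately have sub: "hilb_space sc E C n \<subseteq> F.span (res C ` M n)" by simp
  have fin: "finite (res C ` M n)" using finA by (simp add: M_def)
  have sp: "F.subspace (hilb_space sc E C n)"
    unfolding hilb_space_def by (rule F.self.subspace_image_on[OF res_linear polyd_subspace])
  show "F.fdim (hilb_space sc E C n)" by (rule F.fdim_sub(1)[OF F.fdim_span[OF fin] sp sub])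
  have "hilb sc E C n \<le> card (res C ` M n)" unfolding hilb_def by (rule F.dim_le_card[OF sub fin])
  also have "\<dots> \<le> card (M n)" using finA by (intro card_image_le) (simp add: M_def)
  also have "\<dots> \<le> card (A n)" unfolding M_def using finA by (intro card_image_le) simp
  also have "\<dots> \<le> (n + 1) ^ dim E" using finA X(5) by simp
  finally show "hilb sc E C n \<le> (n + 1) ^ dim E" .
qed

text \<open>The zero loci of \<open>f\<close> and \<open>g\<close> are closed and cover
  \<open>C\<close>.\<close>

lemma irreducible_integral:
  assumes irr: "irreducible_space (subtopology (zariski sc E) C)" and C: "C \<subseteq> E"
    and f: "f \<in> poly_functions sc E" and g: "g \<in> poly_functions sc E" and z: "\<And>x. x \<in> C \<Longrightarrow> f x * g x = 0"
  shows "(\<forall>x\<in>C. f x = 0) \<or> (\<forall>x\<in>C. g x = 0)"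
proof -
  have cl: "closedin (subtopology (zariski sc E) C) (zero_locus E {h} \<inter> C)" if "h \<in> poly_functions sc E" for h
    by (rule closedin_locus) (use that in simp)
  have top: "topspace (subtopology (zariski sc E) C) = C" using C by (auto simp: topspace_zariski)
  have "C = (zero_locus E {f} \<inter> C) \<union> (zero_locus E {g} \<inter> C)" (is "_ = ?A \<union> ?B")
  proof
    show "C \<subseteq> ?A \<union> ?B"
    proof
      fix x assume x: "x \<in> C"
      then have "f x = 0 \<or> g x = 0" using z[OF x] by simp
      then show "x \<in> ?A \<union> ?B" using x C unfolding zero_locus_def by blast
    qed
  qed blast
  then have "closedin (subtopology (zariski sc E) C) ?A \<and> closedin (subtopology (zariski sc E) C) ?B \<and> C = ?A \<union> ?B"
    using cl[OF f] cl[OF g] by blast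
  moreover have "closedin (subtopology (zariski sc E) C) A \<and> closedin (subtopology (zariski sc E) C) B \<and> C = A \<union> B
      \<longrightarrow> A = C \<or> B = C" for A B
    using irr unfolding irreducible_space_def top by (elim conjE allE)
  ultimately have "?A = C \<or> ?B = C" by (rule rev_mp)
  then show ?thesis unfolding zero_locus_def by blast
qed

text \<open>Multiplication by \<open>g\<close> takes functions of degree \<open>n\<close> on
  \<open>C'\<close> to functions of degree \<open>n + e\<close> in the kernel of restriction to
  \<open>C\<close>. It is injective because the functions on the irreducible \<open>C'\<close> have
  no zero divisors.\<close>

lemma hilb_step:
  assumes irr: "irreducible_space (subtopology (zariski sc E) C')" and C: "C \<subseteq> C'" "C' \<subseteq> E"
    and g: "polyd sc E e g" "\<And>x. x \<in> C \<Longrightarrow> g x = 0" and ne: "x0 \<in> C'" "g x0 \<noteq> 0"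
  shows "hilb sc E C' n + hilb sc E C (n + e) \<le> hilb sc E C' (n + e)"
proof -
  let ?H = "hilb_space sc E C' (n + e)"
  have fH: "F.fdim ?H" and fH': "F.fdim (hilb_space sc E C' n)" using hilb_bound(1)[OF C(2)] by auto
  have rr: "res C (res C' f) = res C f" for f using C(1) by (auto simp: res_def fun_eq_iff)
  have im: "res C ` ?H = hilb_space sc E C (n + e)"
    unfolding hilb_space_def image_image rr ..
  have 1: "F.dim (hilb_space sc E C (n + e)) + F.dim {u\<in>?H. res C u = 0} = F.dim ?H"
    using F.self.dim_image_kernel(2)[OF fH res_linear[of ?H C]] unfolding im .
  let ?m = "\<lambda>u x. u x * g x"
  have ml: "linear_on (hilb_space sc E C' n) cfun_scale cfun_scale ?m"
    by (auto simp: linear_on_def fun_scale_def fun_eq_iff algebra_simps)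
  have inj: "u = 0" if u: "u \<in> hilb_space sc E C' n" "?m u = 0" for u
  proof -
    obtain f where f: "polyd sc E n f" "u = res C' f" using u(1) by (auto simp: hilb_space_def)
    have "f x * g x = 0" if "x \<in> C'" for x using fun_cong[OF u(2), of x] that f(2) by (simp add: res_def)
    then have "(\<forall>x\<in>C'. f x = 0) \<or> (\<forall>x\<in>C'. g x = 0)"
      by (rule irreducible_integral[OF irr C(2) polyd_poly[OF f(1)] polyd_poly[OF g(1)]])
    then show ?thesis using ne f(2) res_eq_0[of C' f] by auto
  qed
  have sub: "?m ` hilb_space sc E C' n \<subseteq> {u\<in>?H. res C u = 0}"
  proof
    fix w assume "w \<in> ?m ` hilb_space sc E C' n"
    then obtain f where f: "polyd sc E n f" "w = ?m (res C' f)" by (auto simp: hilb_space_def)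
    have "w = res C' (\<lambda>x. f x * g x)" using f(2) by (auto simp: res_def fun_eq_iff)
    moreover have "polyd sc E (n + e) (\<lambda>x. f x * g x)" by (rule polyd.mult[OF f(1) g(1)])
    moreover have "res C w = 0" using f(2) g(2) by (auto simp: res_def fun_eq_iff)
    ultimately show "w \<in> {u\<in>?H. res C u = 0}" by (auto simp: hilb_space_def)
  qed
  have fK: "F.fdim {u\<in>?H. res C u = 0}"
    by (rule F.fdim_sub(1)[OF fH F.self.subspace_kernel_on[OF res_linear F.fdim_subspace[OF fH]]]) auto
  have "hilb sc E C' n = F.dim (?m ` hilb_space sc E C' n)"
    unfolding hilb_def by (rule F.self.dim_inj_image[OF fH' ml inj, symmetric])
  also have "\<dots> \<le> F.dim {u\<in>?H. res C u = 0}"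
    by (rule F.fdim_sub(2)[OF fK F.self.subspace_image_on[OF ml F.fdim_subspace[OF fH']] sub])
  finally show ?thesis using 1 by (simp add: hilb_def)
qed

lemma hilb_mono:
  assumes C: "C \<subseteq> C'" "C' \<subseteq> E"
  shows "hilb sc E C n \<le> hilb sc E C' n"
proof -
  have "res C (res C' f) = res C f" for f using C(1) by (auto simp: res_def fun_eq_iff)
  then have "res C ` hilb_space sc E C' n = hilb_space sc E C n"
    unfolding hilb_space_def image_image by simp
  then show ?thesis
    using F.self.dim_image_kernel(2)[OF hilb_bound(1)[OF C(2)] res_linear[of _ C], of n] by (simp add: hilb_def)
qed

lemma hilb_pos:
  assumes "C \<noteq> {}" "C \<subseteq> E"
  shows "1 \<le> hilb sc E C n"
proof -
  have "res C (\<lambda>x. 1) \<in> hilb_space sc E C n"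
    unfolding hilb_space_def by (intro imageI CollectI polyd.mono[OF polyd.const]) simp
  moreover have "res C (\<lambda>x. 1) \<noteq> 0" using assms(1) by (auto simp: res_eq_0)
  ultimately have "hilb_space sc E C n \<noteq> {0}" by auto
  then have "F.dim (hilb_space sc E C n) \<noteq> 0" using F.fdim_dim_0[OF hilb_bound(1)[OF assms(2)]] by simp
  then show ?thesis by (simp add: hilb_def)
qed

text \<open>
  Along a chain of irreducible closed sets the Hilbert functions grow at least like binomial
  coefficients, one degree per step.
\<close>

lemma chain_bound:
  assumes Y: "Y \<subseteq> E" and c: "\<And>n. hilb sc E Y n \<le> (c * n + 1) ^ d"
    and cl: "\<And>i. i \<le> m \<Longrightarrow> closedin (subtopology (zariski sc E) Y) (C i)"
    and irr: "\<And>i. i \<le> m \<Longrightarrow> irreducible_space (subtopology (subtopology (zariski sc E) Y) (C i))"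
    and st: "\<And>i. i < m \<Longrightarrow> C i \<subset> C (Suc i)"
  shows "m \<le> d"
proof -
  have CY: "C i \<subseteq> Y" if "i \<le> m" for i using closedin_subset[OF cl[OF that]] by auto
  have irr': "irreducible_space (subtopology (zariski sc E) (C i))" if "i \<le> m" for i
    using irr[OF that] CY[OF that] by (simp add: subtopology_subtopology Int_absorb1)
  have CE: "C i \<subseteq> E" if "i \<le> m" for i using CY[OF that] Y by auto
  have "\<exists>n g x. polyd sc E n g \<and> (\<forall>x\<in>C i. g x = 0) \<and> x \<in> C (Suc i) \<and> g x \<noteq> 0" if i: "i < m" for i
  proof -
    obtain x where x: "x \<in> C (Suc i)" "x \<notin> C i" using st[OF i] by blast
    obtain P where P: "P \<subseteq> poly_functions sc E" "C i = zero_locus E P \<inter> Y"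
      by (rule closedin_locusE[OF cl[OF less_imp_le[OF i]]])
    have "x \<in> E" "x \<in> Y" using x(1) CY[of "Suc i"] Y i by auto
    then obtain g where g: "g \<in> P" "g x \<noteq> 0" using x(2) P(2) by (auto simp: zero_locus_def)
    obtain n where "polyd sc E n g" using poly_polyd g(1) P(1) by blast
    moreover have "\<forall>x\<in>C i. g x = 0" using P(2) g(1) by (auto simp: zero_locus_def)
    ultimately show ?thesis using x(1) g(2) by blast
  qed
  then have "\<forall>i. \<exists>n g x. i < m \<longrightarrow> polyd sc E n g \<and> (\<forall>x\<in>C i. g x = 0) \<and> x \<in> C (Suc i) \<and> g x \<noteq> 0" by blast
  then obtain N G X where NGX: "\<And>i. i < m \<Longrightarrow> polyd sc E (N i) (G i) \<and> (\<forall>x\<in>C i. G i x = 0) \<and> X i \<in> C (Suc i) \<and> G i (X i) \<noteq> 0"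
    by metis
  \<comment> \<open>A single degree that serves for all the functions \<open>G i\<close>.\<close>
  define e where "e = Suc (\<Sum>i<m. N i)"
  have Ge: "polyd sc E e (G i)" if "i < m" for i
  proof -
    have "N i \<le> (\<Sum>i<m. N i)" by (rule member_le_sum) (use that in auto)
    then show ?thesis using NGX[OF that] by (auto simp: e_def intro: polyd.mono)
  qed
  have ne: "C i \<noteq> {}" if "i \<le> m" for i using irr[OF that] CY[OF that] Y by (auto simp: irreducible_space_def topspace_zariski)
  \<comment> \<open>Pascal's recursion: \<open>hilb_step\<close> bounds the value for
    \<open>C (Suc i)\<close> at \<open>k + 1\<close> by its value at \<open>k\<close> plus the value
    for \<open>C i\<close>.\<close>
  have grow: "i \<le> m \<Longrightarrow> k choose i \<le> hilb sc E (C i) (k * e)" for i k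
  proof (induction i arbitrary: k)
    case 0
    then show ?case using hilb_pos[OF ne CE, of 0] by simp
  next
    case (Suc i)
    note IH = Suc.IH and im = Suc.prems
    show ?case
    proof (induction k)
      case 0
      then show ?case by simp
    next
      case (Suc k)
      have i: "i < m" using im by simp
      have "hilb sc E (C (Suc i)) (k * e) + hilb sc E (C i) (k * e + e) \<le> hilb sc E (C (Suc i)) (k * e + e)"
        by (rule hilb_step[OF irr'[OF im] _ CE[OF im] Ge[OF i]])
          (use NGX[OF i] st[OF i] in auto)
      moreover have "k choose i \<le> Suc k choose i" by (rule binomial_right_mono) simp
      moreover have "Suc k choose i \<le> hilb sc E (C i) (Suc k * e)" by (rule IH) (use i in simp)
      ultimately show ?case using Suc.IH by (simp add: add.commute)
    qed
  qed
  have le: "k choose m \<le> (c * (k * e) + 1) ^ d" for k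
    using grow[of m k] hilb_mono[OF CY[OF order_refl] Y, of "k * e"] c[of "k * e"] by linarith
  show "m \<le> d"
  proof (rule ccontr)
    assume "\<not> m \<le> d"
    then have md: "d < m" by simp
    define a where "a = c * e + 1"
    \<comment> \<open>Chosen so that \<open>(k / m) ^ m\<close>, which is at most the binomial
      coefficient, exceeds \<open>(k a) ^ d\<close>: for \<open>m > d\<close> it suffices that
      \<open>k > m ^ m * a ^ d\<close>.\<close>
    define k where "k = m ^ m * a ^ d + m"
    have k1: "1 \<le> k" "m \<le> k" using md by (auto simp: k_def)
    have "(real k / real m) ^ m \<le> real (k choose m)"
      using binomial_ge_n_over_k_pow_k[of m k, where ?'a = real] k1 by simp
    also have "\<dots> \<le> real ((c * (k * e) + 1) ^ d)" using le[of k] by (simp only: of_nat_le_iff)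
    also have "\<dots> \<le> real ((k * a) ^ d)"
      using k1 by (intro of_nat_mono power_mono) (simp_all add: a_def algebra_simps)
    finally have "real k ^ m / real m ^ m \<le> real k ^ d * real a ^ d"
      by (simp add: power_divide power_mult_distrib)
    then have "real k ^ m \<le> real k ^ d * real a ^ d * real m ^ m"
      using md by (simp add: divide_le_eq)
    moreover have "real k ^ m = real k ^ d * real k ^ (m - d)"
      using md by (simp add: power_add[symmetric])
    ultimately have "real k ^ (m - d) \<le> real a ^ d * real m ^ m"
      using k1 by (simp add: mult.assoc)
    moreover have "real k \<le> real k ^ (m - d)"
      using k1 md by (intro self_le_power) auto
    moreover have "real k > real a ^ d * real m ^ m" using md by (simp add: k_def algebra_simps)
    ultimately show False by linarith
  qed
qed

lemma krull_dim_upper: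
  assumes Y: "Y \<subseteq> E" and c: "\<And>n. hilb sc E Y n \<le> (c * n + 1) ^ d"
  shows "krull_dim (subtopology (zariski sc E) Y) \<le> enat d"
  unfolding krull_dim_def
proof (rule Sup_least, clarify)
  fix m C
  assume h: "\<forall>i\<le>m. closedin (subtopology (zariski sc E) Y) (C i) \<and>
      irreducible_space (subtopology (subtopology (zariski sc E) Y) (C i))" "\<forall>i<m. C i \<subset> C (Suc i)"
  have "m \<le> d" by (rule chain_bound[OF Y c, of m C]) (use h in blast)+
  then show "enat m \<le> enat d" by simp
qed

lemma hilb_mono_le: "C \<subseteq> Y \<Longrightarrow> Y \<subseteq> E \<Longrightarrow> (\<And>n. hilb sc E Y n \<le> (c * n + 1) ^ d) \<Longrightarrow> hilb sc E C n \<le> (c * n + 1) ^ d"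
  using hilb_mono[of C Y n] le_trans by blast

text \<open>A polynomial of degree \<open>n\<close> pulls back along \<open>\<phi>\<close> to one of
  degree \<open>k n\<close>, and by density of the image a function with zero pullback vanishes on
  \<open>Y\<close>. So the Hilbert function of \<open>Y\<close> at \<open>n\<close> is at most that
  of \<open>E'\<close> at \<open>k n\<close>.\<close>

lemma hilb_parametrized:
  fixes sc' :: "complex \<Rightarrow> 'f::ab_group_add \<Rightarrow> 'f"
  assumes E': "affine_space sc' E'" and pull: "\<And>l. linear_on E sc (*) l \<Longrightarrow> \<exists>g. polyd sc' E' k g \<and> (\<forall>x\<in>E'. g x = l (\<phi> x))"
    and \<phi>: "\<And>x. x \<in> E' \<Longrightarrow> \<phi> x \<in> E"
    and dense: "\<And>f. f \<in> poly_functions sc E \<Longrightarrow> (\<And>x. x \<in> E' \<Longrightarrow> f (\<phi> x) = 0) \<Longrightarrow> (\<And>y. y \<in> Y \<Longrightarrow> f y = 0)"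
  shows "hilb sc E Y n \<le> (k * n + 1) ^ vector_space.dim sc' E'"
proof -
  interpret e: affine_space sc' E' by (rule E')
  interpret F': cvec "cfun_scale :: complex \<Rightarrow> ('f \<Rightarrow> complex) \<Rightarrow> _" by (rule cfun_cvec)
  have comp: "\<exists>g. polyd sc' E' (k * n) g \<and> (\<forall>x\<in>E'. g x = f (\<phi> x))" if "polyd sc E n f" for f n
    using that
  proof (induction rule: polyd.induct)
    case (const c)
    show ?case by (rule exI[of _ "\<lambda>x. c"]) (auto intro: polyd.mono[OF polyd.const])
  next
    case (linear l)
    then show ?case using pull by simp
  next
    case (add n f g)
    then obtain f' g' where "polyd sc' E' (k * n) f'" "\<forall>x\<in>E'. f' x = f (\<phi> x)" "polyd sc' E' (k * n) g'" "\<forall>x\<in>E'. g' x = g (\<phi> x)" by blast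
    then show ?case using polyd.add[of sc' E' "k * n" f' g'] by (intro exI[of _ "\<lambda>x. f' x + g' x"]) auto
  next
    case (mult n f m g)
    then obtain f' g' where "polyd sc' E' (k * n) f'" "\<forall>x\<in>E'. f' x = f (\<phi> x)" "polyd sc' E' (k * m) g'" "\<forall>x\<in>E'. g' x = g (\<phi> x)" by blast
    then show ?case using polyd.mult[of sc' E' "k * n" f' "k * m" g']
      by (intro exI[of _ "\<lambda>x. f' x * g' x"]) (auto simp: distrib_left)
  next
    case (mono n f m)
    then show ?case using polyd.mono[of sc' E' "k * n" _ "k * m"] by fastforce
  qed
  let ?v = "\<lambda>f. res E' (\<lambda>x. f (\<phi> x))"
  have vl: "linear_on {f. polyd sc E n f} cfun_scale cfun_scale ?v"
    by (auto simp: linear_on_def res_def fun_scale_def fun_eq_iff)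
  have vim: "?v ` {f. polyd sc E n f} \<subseteq> hilb_space sc' E' E' (k * n)"
  proof
    fix w assume "w \<in> ?v ` {f. polyd sc E n f}"
    then obtain f where f: "polyd sc E n f" "w = ?v f" by blast
    obtain g where g: "polyd sc' E' (k * n) g" "\<forall>x\<in>E'. g x = f (\<phi> x)" using comp[OF f(1)] by blast
    have "w = res E' g" using f(2) g(2) by (auto simp: res_def fun_eq_iff)
    then show "w \<in> hilb_space sc' E' E' (k * n)" using g(1) by (auto simp: hilb_space_def)
  qed
  have "hilb sc E Y n \<le> vector_space.dim cfun_scale (hilb_space sc' E' E' (k * n))"
    unfolding hilb_def hilb_space_def[of sc E Y n]
  proof (rule F.self.dim_le_via[OF polyd_subspace res_linear vl cfun_cvec e.hilb_bound(1)[OF order_refl] vim])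
    fix f assume f: "f \<in> {f. polyd sc E n f}" "?v f = 0"
    then have "f (\<phi> x) = 0" if "x \<in> E'" for x using that by (auto simp: res_eq_0)
    then show "res Y f = 0" using dense[OF polyd_poly[of sc E n f]] f(1) by (auto simp: res_eq_0)
  qed
  also have "\<dots> \<le> (k * n + 1) ^ vector_space.dim sc' E'"
    using e.hilb_bound(2)[OF order_refl, of "k * n"] by (simp add: hilb_def)
  finally show ?thesis .
qed

section \<open>Polynomial functions along parabolas\<close>

lemma curve_poly:
  assumes "a \<in> E" "b \<in> E" "c \<in> E" and f: "f \<in> poly_functions sc E"
  shows "\<exists>q r. (\<forall>t. f (a + sc t b + sc (t * t) c) = poly q t) \<and> (\<forall>t. f (a + sc t b) = poly r t) \<and>
    coeff q 1 = coeff r 1 \<and> coeff q 0 = coeff r 0"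
  using f
proof (induction rule: poly_functions.induct)
  case (const k)
  show ?case by (rule exI[of _ "[:k:]"], rule exI[of _ "[:k:]"]) simp
next
  case (linear l)
  interpret cc: cvec2 sc "(*)" by (rule cvec2_complex)
  note s = subspace_scale[OF sE] subspace_add[OF sE]
  have "l (a + sc t b + sc (t * t) c) = poly [:l a, l b, l c:] t" for t
    using assms by (simp add: cc.linear_on_add[OF linear] cc.linear_on_scale[OF linear] s algebra_simps)
  moreover have "l (a + sc t b) = poly [:l a, l b:] t" for t
    using assms by (simp add: cc.linear_on_add[OF linear] cc.linear_on_scale[OF linear] s)
  ultimately show ?case
    by (intro exI[of _ "[:l a, l b, l c:]"] exI[of _ "[:l a, l b:]"]) simp
next
  case (add f g)
  then obtain q r q' r' where "\<forall>t. f (a + sc t b + sc (t * t) c) = poly q t" "\<forall>t. f (a + sc t b) = poly r t"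
    "coeff q 1 = coeff r 1" "coeff q 0 = coeff r 0"
    "\<forall>t. g (a + sc t b + sc (t * t) c) = poly q' t" "\<forall>t. g (a + sc t b) = poly r' t"
    "coeff q' 1 = coeff r' 1" "coeff q' 0 = coeff r' 0" by blast
  then show ?case by (intro exI[of _ "q + q'"] exI[of _ "r + r'"]) simp
next
  case (mult f g)
  then obtain q r q' r' where "\<forall>t. f (a + sc t b + sc (t * t) c) = poly q t" "\<forall>t. f (a + sc t b) = poly r t"
    "coeff q 1 = coeff r 1" "coeff q 0 = coeff r 0"
    "\<forall>t. g (a + sc t b + sc (t * t) c) = poly q' t" "\<forall>t. g (a + sc t b) = poly r' t"
    "coeff q' 1 = coeff r' 1" "coeff q' 0 = coeff r' 0" by blast
  then show ?case by (intro exI[of _ "q * q'"] exI[of _ "r * r'"]) (simp add: coeff_mult)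
qed

text \<open>A polynomial in \<open>t\<close> with infinitely many zeros is 0, so the exceptional
  parameters are covered as well.\<close>

lemma curve_vanish:
  assumes "a \<in> E" "b \<in> E" "c \<in> E" and f: "f \<in> poly_functions sc E"
    and fin: "finite {t. a + sc t b + sc (t * t) c \<notin> Y}" and z: "\<And>y. y \<in> Y \<Longrightarrow> f y = 0"
  shows "f (a + sc t b + sc (t * t) c) = 0"
proof -
  obtain q where q: "\<And>t. f (a + sc t b + sc (t * t) c) = poly q t" using curve_poly[OF assms(1-4)] by blast
  have "{t. poly q t \<noteq> 0} \<subseteq> {t. a + sc t b + sc (t * t) c \<notin> Y}" using z q by force
  then have "finite {t. poly q t \<noteq> 0}" using fin finite_subset by blast
  moreover have "infinite (UNIV :: complex set)" by (rule infinite_UNIV_char_0)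
  ultimately have "infinite {t. poly q t = 0}"
    using finite_Un[of "{t. poly q t \<noteq> 0}" "{t. poly q t = 0}"] by (auto simp: Un_def)
  then have "q = 0" using poly_roots_finite by blast
  then show ?thesis using q by simp
qed

text \<open>Along the parabola \<open>f\<close> vanishes identically. Along the tangent line it is a
  polynomial with the same linear coefficient, and this coefficient is the derivative.\<close>

lemma curve_tangent:
  assumes "a \<in> E" "b \<in> E" "c \<in> E" and f: "f \<in> poly_functions sc E"
    and fin: "finite {t. a + sc t b + sc (t * t) c \<notin> Y}" and z: "\<And>y. y \<in> Y \<Longrightarrow> f y = 0"
  shows "deriv (\<lambda>t. f (a + sc t b)) 0 = 0"
proof -
  obtain q r where q: "\<And>t. f (a + sc t b + sc (t * t) c) = poly q t" "\<And>t. f (a + sc t b) = poly r t"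
    "coeff q 1 = coeff r 1" using curve_poly[OF assms(1-4)] by blast
  have "poly q = poly 0" using curve_vanish[OF assms] q(1) by auto
  then have "q = 0" by (simp only: poly_eq_poly_eq_iff)
  then have "coeff r 1 = 0" using q(3) by simp
  moreover have "deriv (\<lambda>t. f (a + sc t b)) 0 = poly (pderiv r) 0"
    unfolding q(2) by (rule DERIV_imp_deriv[OF poly_DERIV])
  ultimately show ?thesis by (simp add: poly_0_coeff_0 coeff_pderiv)
qed

text \<open>If the product \<open>f g\<close> vanishes on \<open>Y\<close>, then the product of the
  two polynomials along the curve is 0, although one of them is nonzero at the first point and the
  other at the second.\<close>

lemma irreducible_by_curves:
  assumes Y: "Y \<subseteq> E" "Y \<noteq> {}"
    and cv: "\<And>x y. x \<in> Y \<Longrightarrow> y \<in> Y \<Longrightarrow> \<exists>a b c s. a \<in> E \<and> b \<in> E \<and> c \<in> E \<and> x = a \<and>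
      y = a + sc s b + sc (s * s) c \<and> finite {t. a + sc t b + sc (t * t) c \<notin> Y}"
  shows "irreducible_space (subtopology (zariski sc E) Y)"
  unfolding irreducible_space_def
proof (intro conjI allI impI)
  have top: "topspace (subtopology (zariski sc E) Y) = Y" using Y(1) by (auto simp: topspace_zariski)
  show "topspace (subtopology (zariski sc E) Y) \<noteq> {}" using Y(2) top by simp
  fix C D
  assume h: "closedin (subtopology (zariski sc E) Y) C \<and> closedin (subtopology (zariski sc E) Y) D \<and>
    topspace (subtopology (zariski sc E) Y) = C \<union> D"
  obtain P where P: "P \<subseteq> poly_functions sc E" "C = zero_locus E P \<inter> Y"
    by (rule closedin_locusE[OF conjunct1[OF h]])
  obtain P' where P': "P' \<subseteq> poly_functions sc E" "D = zero_locus E P' \<inter> Y"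
    by (rule closedin_locusE[OF conjunct1[OF conjunct2[OF h]]])
  have CD: "Y = C \<union> D" using h top by simp
  show "C = topspace (subtopology (zariski sc E) Y) \<or> D = topspace (subtopology (zariski sc E) Y)"
  proof (rule ccontr)
    assume "\<not> ?thesis"
    then obtain x y where x: "x \<in> Y" "x \<notin> C" and y: "y \<in> Y" "y \<notin> D" using top CD by blast
    obtain f where f: "f \<in> P" "f x \<noteq> 0" using x P(2) Y(1) by (auto simp: zero_locus_def)
    obtain g where g: "g \<in> P'" "g y \<noteq> 0" using y P'(2) Y(1) by (auto simp: zero_locus_def)
    have fp: "f \<in> poly_functions sc E" "g \<in> poly_functions sc E" using f(1) g(1) P(1) P'(1) by auto
    from cv[OF x(1) y(1)]
    obtain a b c s where abc: "a \<in> E" "b \<in> E" "c \<in> E" "x = a" "y = a + sc s b + sc (s * s) c"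
      "finite {t. a + sc t b + sc (t * t) c \<notin> Y}" by (elim exE conjE) (rule that; assumption)
    have fg: "f z * g z = 0" if z: "z \<in> Y" for z
    proof -
      have "z \<in> C \<or> z \<in> D" using z unfolding CD by (rule UnE) auto
      then have "f z = 0 \<or> g z = 0" using P(2) P'(2) f(1) g(1) unfolding zero_locus_def by blast
      then show ?thesis by simp
    qed
    from curve_poly[OF abc(1-3) fp(1)] obtain q where q: "\<forall>t. f (a + sc t b + sc (t * t) c) = poly q t"
      by (elim exE conjE) (rule that, assumption)
    from curve_poly[OF abc(1-3) fp(2)] obtain r where r: "\<forall>t. g (a + sc t b + sc (t * t) c) = poly r t"
      by (elim exE conjE) (rule that, assumption)
    have "poly (q * r) t = 0" for t
      using curve_vanish[OF abc(1-3) poly_functions.mult[OF fp] abc(6) fg, of t] q r by (simp only: poly_mult)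
    then have "poly (q * r) = poly 0" by auto
    then have "q * r = 0" by (simp only: poly_eq_poly_eq_iff)
    moreover have "poly q 0 \<noteq> 0" using spec[OF q, of 0] f(2) abc(4) by simp
    moreover have "poly r s \<noteq> 0" using spec[OF r, of s] g(2) abc(5) by (simp only:) simp
    ultimately show False by auto
  qed
qed

end

lemma irreducible_closure:
  assumes irr: "irreducible_space (subtopology T S)" and S: "S \<subseteq> topspace T"
  shows "irreducible_space (subtopology T (T closure_of S))"
  unfolding irreducible_space_def
proof (intro conjI allI impI)
  let ?K = "T closure_of S"
  have SK: "S \<subseteq> ?K" by (rule closure_of_subset[OF S])
  have top: "topspace (subtopology T ?K) = ?K" by (simp add: closure_of_subset_topspace Int_absorb1)
  have topS: "topspace (subtopology T S) = S" using S by auto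
  show "topspace (subtopology T ?K) \<noteq> {}" using irr SK unfolding top irreducible_space_def topS by auto
  fix C D
  assume h: "closedin (subtopology T ?K) C \<and> closedin (subtopology T ?K) D \<and> topspace (subtopology T ?K) = C \<union> D"
  then have c: "closedin T C" "closedin T D"
    using closedin_trans_full[OF _ closedin_closure_of] by blast+
  have "closedin (subtopology T S) (C \<inter> S)" "closedin (subtopology T S) (D \<inter> S)"
    using c unfolding closedin_subtopology by blast+
  moreover have "S = (C \<inter> S) \<union> (D \<inter> S)" using h SK unfolding top by blast
  ultimately have "C \<inter> S = S \<or> D \<inter> S = S" using irr unfolding irreducible_space_def topS by blast
  then have "S \<subseteq> C \<or> S \<subseteq> D" by blast
  then have "?K \<subseteq> C \<or> ?K \<subseteq> D" using closure_of_minimal c by metis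
  then show "C = topspace (subtopology T ?K) \<or> D = topspace (subtopology T ?K)" using h unfolding top by blast
qed

text \<open>The sets \<open>S j\<close> need not be closed. Their closures are irreducible, and a
  closed set that contains \<open>S j\<close> but not \<open>S (Suc j)\<close> makes the inclusion
  of the closures strict.\<close>

lemma krull_dim_lower:
  assumes S: "\<And>j. j \<le> d \<Longrightarrow> S j \<subseteq> topspace T" "\<And>j. j \<le> d \<Longrightarrow> irreducible_space (subtopology T (S j))"
    "\<And>j. j < d \<Longrightarrow> S j \<subseteq> S (Suc j)"
    and Z: "\<And>j. j < d \<Longrightarrow> \<exists>Z. closedin T Z \<and> S j \<subseteq> Z \<and> \<not> S (Suc j) \<subseteq> Z"
  shows "enat d \<le> krull_dim T"
  unfolding krull_dim_def
proof (rule Sup_upper, rule CollectI, intro exI[of _ d] exI[of _ "\<lambda>j. T closure_of S j"] conjI allI impI refl)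
  show "closedin T (T closure_of S j)" for j by (rule closedin_closure_of)
  show "irreducible_space (subtopology T (T closure_of S j))" if "j \<le> d" for j
    by (rule irreducible_closure[OF S(2)[OF that] S(1)[OF that]])
  show "T closure_of S j \<subset> T closure_of S (Suc j)" if j: "j < d" for j
  proof -
    obtain Z where Z: "closedin T Z" "S j \<subseteq> Z" "\<not> S (Suc j) \<subseteq> Z" using Z[OF j] by blast
    have "T closure_of S j \<subseteq> Z" by (rule closure_of_minimal[OF Z(2,1)])
    moreover have "S (Suc j) \<subseteq> T closure_of S (Suc j)" using S(1)[of "Suc j"] j by (intro closure_of_subset) auto
    moreover have "T closure_of S j \<subseteq> T closure_of S (Suc j)" by (rule closure_of_mono[OF S(3)[OF j]])
    ultimately show ?thesis using Z(3) by blast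
  qed
qed

section \<open>Minors\<close>

text \<open>The determinant of the upper left block of a matrix indexed by natural numbers. The size
  is a term because it will depend on the multiplicities.\<close>

definition minor :: "nat \<Rightarrow> (nat \<Rightarrow> nat \<Rightarrow> complex) \<Rightarrow> complex"
  where "minor k A = (\<Sum>\<sigma> | \<sigma> permutes {..<k}. of_int (sign \<sigma>) * (\<Prod>i<k. A i (\<sigma> i)))"

lemma minor_cong: "(\<And>i j. i < k \<Longrightarrow> j < k \<Longrightarrow> A i j = B i j) \<Longrightarrow> minor k A = minor k B"
  unfolding minor_def
  by (intro sum.cong refl arg_cong2[of _ _ _ _ "(*)"] prod.cong)
    (metis lessThan_iff mem_Collect_eq permutes_in_image)

text \<open>Composition with the transposition of the two rows permutes the summands and reverses
  their signs, so the sum is its own negative.\<close>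

lemma minor_equal_rows:
  assumes ab: "a < k" "b < k" "a \<noteq> b" and eq: "\<And>j. j < k \<Longrightarrow> A a j = A b j"
  shows "minor k A = 0"
proof -
  let ?\<tau> = "Transposition.transpose a b"
  have t: "?\<tau> permutes {..<k}" using ab by (intro permutes_swap_id) auto
  let ?f = "\<lambda>\<sigma>. of_int (sign \<sigma>) * (\<Prod>i<k. A i (\<sigma> i))"
  have "?f (\<sigma> \<circ> ?\<tau>) = - ?f \<sigma>" if s: "\<sigma> permutes {..<k}" for \<sigma>
  proof -
    have fin: "finite {..<k}" by simp
    have "sign (\<sigma> \<circ> ?\<tau>) = sign \<sigma> * sign ?\<tau>"
      by (rule sign_compose) (use permutation_permutes s t fin in blast)+
    also have "\<dots> = - sign \<sigma>" using ab(3) by (simp add: sign_swap_id)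
    finally have sg: "sign (\<sigma> \<circ> ?\<tau>) = - sign \<sigma>" .
    have "(\<Prod>i<k. A i ((\<sigma> \<circ> ?\<tau>) i)) = (\<Prod>i<k. A (?\<tau> i) (\<sigma> (?\<tau> i)))"
    proof (rule prod.cong[OF refl])
      fix i assume "i \<in> {..<k}"
      then have "\<sigma> (?\<tau> i) < k" using permutes_in_image[OF s] permutes_in_image[OF t] by auto
      then show "A i ((\<sigma> \<circ> ?\<tau>) i) = A (?\<tau> i) (\<sigma> (?\<tau> i))"
        using eq by (auto simp: Transposition.transpose_def)
    qed
    also have "\<dots> = (\<Prod>i<k. A i (\<sigma> i))"
      using prod.permute[OF t, of "\<lambda>i. A i (\<sigma> i)"] by (simp add: comp_def)
    finally show ?thesis using sg by simp
  qed
  then have "sum (\<lambda>\<sigma>. ?f (\<sigma> \<circ> ?\<tau>)) {\<sigma>. \<sigma> permutes {..<k}} = - sum ?f {\<sigma>. \<sigma> permutes {..<k}}"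
    by (simp add: sum_negf[symmetric])
  then have "sum ?f {\<sigma>. \<sigma> permutes {..<k}} = - sum ?f {\<sigma>. \<sigma> permutes {..<k}}"
    using sum_permutations_compose_right[OF t, of ?f] by simp
  then show ?thesis by (simp add: minor_def)
qed

lemma minor_row_sum:
  assumes r: "r < k"
  shows "minor k (A(r := \<lambda>j. \<Sum>i\<in>I. c i * B i j)) = (\<Sum>i\<in>I. c i * minor k (A(r := B i)))"
proof -
  have p: "(\<Prod>i<k. (A(r := X)) i (\<sigma> i)) = X (\<sigma> r) * (\<Prod>i\<in>{..<k} - {r}. A i (\<sigma> i))" for X and \<sigma> :: "nat \<Rightarrow> nat"
    using r by (simp add: prod.remove[of "{..<k}" r])
  show ?thesis
    unfolding minor_def p sum_distrib_left sum_distrib_right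
    by (subst sum.swap) (simp add: algebra_simps)
qed

text \<open>Row \<open>r\<close> is replaced by the vanishing combination. When it is expanded, all
  terms except \<open>c r\<close> times the minor have two equal rows.\<close>

lemma minor_dependent_rows:
  assumes r: "r < k" "c r \<noteq> 0" and dep: "\<And>j. j < k \<Longrightarrow> (\<Sum>i<k. c i * A i j) = 0"
  shows "minor k A = 0"
proof -
  have "minor k (A(r := \<lambda>j. \<Sum>i<k. c i * A i j)) = minor k (A(r := \<lambda>j. \<Sum>i\<in>{}. c i * A i j))"
    by (rule minor_cong) (simp add: dep)
  also have "\<dots> = 0" unfolding minor_row_sum[OF r(1)] by simp
  finally have "(\<Sum>i<k. c i * minor k (A(r := A i))) = 0" by (simp only: minor_row_sum[OF r(1)])
  moreover have "minor k (A(r := A i)) = 0" if "i \<in> {..<k} - {r}" for i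
    by (rule minor_equal_rows[of r _ i]) (use that r in auto)
  ultimately have "c r * minor k (A(r := A r)) = 0"
    using sum.remove[of "{..<k}" r "\<lambda>i. c i * minor k (A(r := A i))"] r(1) by simp
  then show ?thesis using r(2) by simp
qed

lemma permutes_moves: "\<sigma> permutes {..<k} \<Longrightarrow> (\<And>i. i < k \<Longrightarrow> \<sigma> i = i) \<Longrightarrow> \<sigma> = id"
  by (auto simp: fun_eq_iff permutes_def)

lemma minor_identity:
  assumes "\<And>i j. i < k \<Longrightarrow> j < k \<Longrightarrow> A i j = (if i = j then 1 else 0)"
  shows "minor k A = 1"
proof -
  have "of_int (sign \<sigma>) * (\<Prod>i<k. A i (\<sigma> i)) = (if \<sigma> = id then 1 else 0)" if s: "\<sigma> permutes {..<k}" for \<sigma>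
  proof (cases "\<sigma> = id")
    case True
    then show ?thesis using assms by simp
  next
    case False
    then obtain i where i: "i < k" "\<sigma> i \<noteq> i" using permutes_moves[OF s] by blast
    then have "A i (\<sigma> i) = 0" using assms[of i "\<sigma> i"] permutes_in_image[OF s, of i] by auto
    then have "(\<Prod>i<k. A i (\<sigma> i)) = 0" using i(1) by (intro prod_zero) auto
    then show ?thesis using False by simp
  qed
  then show ?thesis
    unfolding minor_def by (simp add: finite_permutations permutes_id)
qed

text \<open>The last row consists of multiples of \<open>t\<close>, so the determinant is
  \<open>H t * t\<close> and its derivative at 0 is \<open>H 0\<close>. There a permutation
  contributes only if it fixes all indices before the last, hence all indices.\<close>

lemma minor_deriv:
  "deriv (\<lambda>t. minor (Suc s) (\<lambda>i j. (if i = j \<and> i < s then 1 else 0) + t * B i j)) 0 = B s s"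
proof -
  define H where "H t = (\<Sum>\<sigma> | \<sigma> permutes {..<Suc s}. of_int (sign \<sigma>) *
    (B s (\<sigma> s) * (\<Prod>i<s. (if i = \<sigma> i \<and> i < s then 1 else 0) + t * B i (\<sigma> i))))" for t
  have m: "minor (Suc s) (\<lambda>i j. (if i = j \<and> i < s then 1 else 0) + t * B i j) = H t * t" for t
    unfolding minor_def H_def sum_distrib_right by (rule sum.cong) (simp_all add: algebra_simps)
  have cont: "isCont H 0" unfolding H_def by (intro continuous_intros)
  have "of_int (sign \<sigma>) * (B s (\<sigma> s) * (\<Prod>i<s. (if i = \<sigma> i \<and> i < s then 1 else 0) + 0 * B i (\<sigma> i)))
      = (if \<sigma> = id then B s s else 0)" if s: "\<sigma> permutes {..<Suc s}" for \<sigma>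
  proof (cases "\<sigma> = id")
    case False
    have "\<exists>i<s. \<sigma> i \<noteq> i"
    proof (rule ccontr)
      assume "\<not> ?thesis"
      then have a: "\<And>i. i < s \<Longrightarrow> \<sigma> i = i" by blast
      have "\<sigma> s \<noteq> i" if "i < s" for i using a[OF that] that permutes_inj[OF s] by (metis injD less_irrefl)
      moreover have "\<sigma> s < Suc s" using permutes_in_image[OF s, of s] by simp
      ultimately have "\<sigma> s = s" by (metis less_antisym)
      then have "\<sigma> = id" using a by (intro permutes_moves[OF s]) (metis less_antisym)
      then show False using False by simp
    qed
    then obtain i where i: "i < s" "i \<noteq> \<sigma> i" by metis
    then have "(\<Prod>i<s. (if i = \<sigma> i \<and> i < s then 1 else 0) + 0 * B i (\<sigma> i)) = 0"
      by (intro prod_zero bexI[of _ i]) auto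
    then show ?thesis using False by simp
  qed simp
  then have H0: "H 0 = B s s"
    unfolding H_def by (simp add: finite_permutations permutes_id)
  have "((\<lambda>t. H t * t) has_field_derivative B s s) (at 0)"
    unfolding CARAT_DERIV by (rule exI[of _ H]) (use cont H0 in simp)
  then show ?thesis unfolding m by (rule DERIV_imp_deriv)
qed

lemma poly_functions_sum: "(\<And>i. i \<in> I \<Longrightarrow> f i \<in> poly_functions sc E) \<Longrightarrow> (\<lambda>x. \<Sum>i\<in>I. f i x) \<in> poly_functions sc E"
  by (induction I rule: infinite_finite_induct) (auto intro: poly_functions.intros)

lemma poly_functions_prod: "(\<And>i. i \<in> I \<Longrightarrow> f i \<in> poly_functions sc E) \<Longrightarrow> (\<lambda>x. \<Prod>i\<in>I. f i x) \<in> poly_functions sc E"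
  by (induction I rule: infinite_finite_induct) (auto intro: poly_functions.intros)

lemma minor_poly:
  assumes "\<And>i j. i < k \<Longrightarrow> linear_on E sc (*) (\<lambda>x. A x i j)"
  shows "(\<lambda>x. minor k (A x)) \<in> poly_functions sc E"
  unfolding minor_def
  by (intro poly_functions_sum poly_functions.mult poly_functions.const poly_functions_prod poly_functions.linear)
    (use assms in auto)

context cvec
begin

lemma independent_dual:
  fixes e :: "nat \<Rightarrow> 'v"
  assumes inj: "inj_on e {..<k}" and ind: "independent (e ` {..<k})"
  obtains l where "\<And>j. clinear scale (*) (l j)"
    "\<And>i j. i < k \<Longrightarrow> j < k \<Longrightarrow> l j (e i) = (if i = j then 1 else 0)"
proof -
  interpret c: cvec2 scale "(*)" by (rule cvec2_complex)
  have "\<exists>l. clinear scale (*) l \<and> (\<forall>x\<in>e ` {..<k}. l x = (if x = e j then 1 else 0))" for j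
    by (rule c.linear_independent_extend[OF ind])
  then obtain l where "\<And>j. clinear scale (*) (l j)"
    "\<And>j x. x \<in> e ` {..<k} \<Longrightarrow> l j x = (if x = e j then 1 else 0)" by metis
  then show ?thesis using that[of l] inj by (auto simp: inj_on_def)
qed

lemma independent_family:
  assumes S: "fdim S" and k: "k \<le> dim S"
  obtains e :: "nat \<Rightarrow> 'v" where "inj_on e {..<k}" "independent (e ` {..<k})" "e ` {..<k} \<subseteq> S"
    "k = dim S \<Longrightarrow> span (e ` {..<k}) = S"
proof -
  obtain B where B: "finite B" "independent B" "B \<subseteq> S" "span B = S" "card B = dim S"
    by (rule fdim_basis[OF S])
  obtain h where h: "bij_betw h {0..<card B} B" using ex_bij_betw_nat_finite[OF B(1)] by blast
  have k': "{..<k} \<subseteq> {0..<card B}" using k B(5) by auto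
  have sub: "h ` {..<k} \<subseteq> B" using k' h by (auto simp: bij_betw_def)
  have "inj_on h {..<k}" using h k' by (auto simp: bij_betw_def intro: inj_on_subset)
  moreover have "independent (h ` {..<k})" using independent_mono[OF B(2) sub] .
  moreover have "span (h ` {..<k}) = S" if "k = dim S"
    using that h B(4,5) by (simp add: bij_betw_def lessThan_atLeast0)
  ultimately show ?thesis using that[of h] sub B(3) by blast
qed

lemma flag_exists:
  assumes S: "fdim S" and T: "subspace T" "T \<subseteq> S"
  obtains F where "F 0 = T" "F (dim S - dim T) = S" "\<forall>j. subspace (F j) \<and> T \<subseteq> F j \<and> F j \<subseteq> S"
    "\<forall>j<dim S - dim T. F j \<subset> F (Suc j)"
proof -
  obtain X where X: "finite X" "independent X" "X \<subseteq> T" "span X = T" "card X = dim T"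
    by (rule fdim_basis[OF fdim_sub(1)[OF S T]])
  obtain B where B: "X \<subseteq> B" "finite B" "independent B" "B \<subseteq> S" "span B = S" "card B = dim S"
    by (rule fdim_extend[OF S X(2) order_trans[OF X(3) T(2)]])
  have c: "card (B - X) = dim S - dim T" using card_Diff_subset[OF X(1) B(1)] X(5) B(6) by simp
  obtain h where h: "bij_betw h {0..<card (B - X)} (B - X)" using ex_bij_betw_nat_finite[of "B - X"] B(2) by blast
  \<comment> \<open>The intersection with \<open>B\<close> keeps \<open>F j\<close> inside
    \<open>S\<close> for every \<open>j\<close>, since \<open>h\<close> is unspecified beyond its
    range.\<close>
  define F where "F j = span (X \<union> (h ` {..<j} \<inter> B))" for j
  have "F j \<subset> F (Suc j)" if j: "j < dim S - dim T" for j
  proof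
    show "F j \<subseteq> F (Suc j)" unfolding F_def by (rule span_mono) auto
    have hj: "h j \<in> B - X" using h j c by (auto simp: bij_betw_def)
    have "X \<union> (h ` {..<j} \<inter> B) \<subseteq> B - {h j}"
    proof
      fix x assume "x \<in> X \<union> (h ` {..<j} \<inter> B)"
      then consider "x \<in> X" | i where "i < j" "x = h i" by blast
      then show "x \<in> B - {h j}"
      proof cases
        case 1
        then show ?thesis using hj B(1) by auto
      next
        case 2
        have "h i \<in> B - X" using 2(1) h j c by (auto simp: bij_betw_def)
        moreover have "h i \<noteq> h j" using 2(1) h j c inj_onD[of h "{0..<card (B - X)}" i j] by (auto simp: bij_betw_def)
        ultimately show ?thesis using 2(2) by simp
      qed
    qed
    then have "h j \<notin> F j" using B(3) hj span_mono unfolding F_def dependent_def by blast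
    moreover have "h j \<in> F (Suc j)" unfolding F_def by (rule span_base) (use hj in simp)
    ultimately show "F j \<noteq> F (Suc j)" by metis
  qed
  moreover have "subspace (F j) \<and> T \<subseteq> F j \<and> F j \<subseteq> S" for j
    using span_mono[of X "X \<union> (h ` {..<j} \<inter> B)"] span_mono[of "X \<union> (h ` {..<j} \<inter> B)" B] X(4) B(1,5)
    by (simp add: F_def)
  moreover have "F 0 = T" by (simp add: F_def X(4))
  moreover have "F (dim S - dim T) = S"
  proof -
    have "X \<union> (h ` {..<dim S - dim T} \<inter> B) = B"
      using h c B(1) by (auto simp: bij_betw_def lessThan_atLeast0)
    then show ?thesis by (simp add: F_def B(5))
  qed
  ultimately show ?thesis using that[of F] by blast
qed

text \<open>For an eigenvalue \<open>a\<close>, the eigenvectors of all other eigenvalues lie in the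
  image of \<open>N - a\<close>, an invariant subspace of smaller dimension.\<close>

lemma finite_eigenvalues:
  assumes "fdim S" "linear_on S scale scale N" "N ` S \<subseteq> S"
  shows "finite {a. \<exists>v\<in>S. v \<noteq> 0 \<and> N v = scale a v}"
  using assms
proof (induction "dim S" arbitrary: S rule: less_induct)
  case less
  note S = less.prems(1) and N = less.prems(2)
  note sS = fdim_subspace[OF S]
  show ?case
  proof (cases "\<exists>a v. v \<in> S \<and> v \<noteq> 0 \<and> N v = scale a v")
    case True
    then obtain a v where v: "v \<in> S" "v \<noteq> 0" "N v = scale a v" by blast
    let ?M = "\<lambda>x. N x - scale a x"
    have M: "linear_on S scale scale ?M"
      unfolding linear_on_def
      by (auto simp: self.linear_on_add[OF N] self.linear_on_scale[OF N] algebra_simps scale_left_commute)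
    have MS: "?M ` S \<subseteq> S" using less.prems(3) sS by (auto intro!: subspace_diff subspace_scale)
    have sM: "subspace (?M ` S)" by (rule self.subspace_image_on[OF M sS])
    have "dim (?M ` S) \<noteq> dim S"
    proof
      assume "dim (?M ` S) = dim S"
      then have "dim {x\<in>S. ?M x = 0} = 0" using self.dim_image_kernel(2)[OF S M] by simp
      moreover have "fdim {x\<in>S. ?M x = 0}" by (rule fdim_sub(1)[OF S self.subspace_kernel_on[OF M sS]]) auto
      ultimately have "{x\<in>S. ?M x = 0} = {0}" using fdim_dim_0 by blast
      moreover have "v \<in> {x\<in>S. ?M x = 0}" using v by simp
      ultimately show False using v(2) by blast
    qed
    then have lt: "dim (?M ` S) < dim S" using fdim_sub(2)[OF S sM MS] by simp
    have "N ` ?M ` S \<subseteq> ?M ` S"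
    proof
      fix y assume "y \<in> N ` ?M ` S"
      then obtain x where x: "x \<in> S" "y = N (?M x)" by blast
      have Nx: "N x \<in> S" using x(1) less.prems(3) by blast
      have "y = ?M (N x)" unfolding x(2)
        using self.linear_on_diff[OF N sS Nx subspace_scale[OF sS x(1)]] self.linear_on_scale[OF N x(1)] by simp
      then show "y \<in> ?M ` S" using Nx by blast
    qed
    moreover have "linear_on (?M ` S) scale scale N" using N MS unfolding linear_on_def by blast
    ultimately have fin: "finite {b. \<exists>v\<in>?M ` S. v \<noteq> 0 \<and> N v = scale b v}"
      by (intro less.hyps[OF lt] fdim_sub(1)[OF S sM MS])
    have "{b. \<exists>v\<in>S. v \<noteq> 0 \<and> N v = scale b v} \<subseteq> insert a {b. \<exists>v\<in>?M ` S. v \<noteq> 0 \<and> N v = scale b v}"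
    proof
      fix b assume "b \<in> {b. \<exists>v\<in>S. v \<noteq> 0 \<and> N v = scale b v}"
      then obtain w where w: "w \<in> S" "w \<noteq> 0" "N w = scale b w" by blast
      show "b \<in> insert a {b. \<exists>v\<in>?M ` S. v \<noteq> 0 \<and> N v = scale b v}"
      proof (cases "b = a")
        case False
        let ?u = "scale (1 / (b - a)) w"
        have u: "?u \<in> S" using subspace_scale[OF sS w(1)] .
        have "?M ?u = scale (1 / (b - a)) (scale b w) - scale a ?u"
          using self.linear_on_scale[OF N w(1)] w(3) by simp
        also have "\<dots> = scale (1 / (b - a) * b - a * (1 / (b - a))) w" by (simp add: scale_left_diff_distrib)
        also have "1 / (b - a) * b - a * (1 / (b - a)) = (b - a) / (b - a)" by (simp only: diff_divide_distrib mult_1_left times_divide_eq_left times_divide_eq_right mult_1_right)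
        also have "\<dots> = 1" using False by (intro divide_self) simp
        finally have "w = ?M ?u" by simp
        then have "w \<in> ?M ` S" using u by blast
        then show ?thesis using w by blast
      qed simp
    qed
    then show ?thesis using fin finite_subset by blast
  next
    case False
    then have "{a. \<exists>v\<in>S. v \<noteq> 0 \<and> N v = scale a v} = {}" by blast
    then show ?thesis by (simp only: finite.emptyI)
  qed
qed

end

text \<open>A linear relation among the vectors \<open>g (\<phi> i)\<close>, or the equality of two
  of them, would carry over to the rows; so a nonzero minor yields \<open>k\<close> independent
  vectors.\<close>

lemma (in cvec2) minor_rank:
  assumes g: "linear_on H s1 s2 g" and H: "v1.fdim H" and \<phi>: "\<And>i. i < k \<Longrightarrow> \<phi> i \<in> H"
    and l: "\<And>j. clinear s2 (*) (l j)" and ne: "minor k (\<lambda>i j. l j (g (\<phi> i))) \<noteq> 0"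
  shows "k \<le> v2.dim (g ` H)"
proof -
  interpret c: cvec2 s2 "(*)" by (rule v2.cvec2_complex)
  let ?e = "\<lambda>i. g (\<phi> i)"
  have dep: "c r = 0" if "r < k" "(\<Sum>i<k. s2 (c i) (?e i)) = 0" for c r
  proof (rule ccontr)
    assume "c r \<noteq> 0"
    have "(\<Sum>i<k. c i * l j (?e i)) = 0" for j
    proof -
      have "(\<Sum>i<k. c i * l j (?e i)) = l j (\<Sum>i<k. s2 (c i) (?e i))"
        by (simp add: c.linear_sum[OF l] c.linear_scale[OF l])
      then show ?thesis using that(2) c.linear_0[OF l] by simp
    qed
    then have "minor k (\<lambda>i j. l j (?e i)) = 0"
      by (intro minor_dependent_rows[of r k c, OF that(1) \<open>c r \<noteq> 0\<close>])
    then show False using ne by simp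
  qed
  have inj: "inj_on ?e {..<k}"
  proof (rule inj_onI, rule ccontr)
    fix a b assume ab: "a \<in> {..<k}" "b \<in> {..<k}" "?e a = ?e b" "a \<noteq> b"
    have "minor k (\<lambda>i j. l j (g (\<phi> i))) = 0"
      by (rule minor_equal_rows[of a _ b]) (use ab in auto)
    then show False using ne by simp
  qed
  have "v2.independent (?e ` {..<k})"
    unfolding v2.independent_explicit_finite_subsets
  proof (intro allI impI ballI)
    fix A u v assume A: "A \<subseteq> ?e ` {..<k}" "finite A" "(\<Sum>v\<in>A. s2 (u v) v) = 0" "v \<in> A"
    define c where "c i = (if ?e i \<in> A then u (?e i) else 0)" for i
    have "(\<Sum>i<k. s2 (c i) (?e i)) = (\<Sum>v\<in>?e ` {..<k}. s2 (if v \<in> A then u v else 0) v)"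
      by (simp add: sum.reindex[OF inj] c_def)
    also have "\<dots> = (\<Sum>v\<in>A. s2 (u v) v)"
      using A(1) by (intro sum.mono_neutral_cong_right) auto
    finally have z: "(\<Sum>i<k. s2 (c i) (?e i)) = 0" using A(3) by simp
    obtain i where "i < k" "v = ?e i" using A(1,4) by blast
    then show "u v = 0" using dep[OF _ z, of i] A(4) by (simp add: c_def)
  qed
  moreover have "?e ` {..<k} \<subseteq> g ` H" using \<phi> by blast
  ultimately have "card (?e ` {..<k}) \<le> v2.dim (g ` H)"
    by (intro v2.fdim_independent(2)[OF dim_image_kernel(1)[OF H g]])
  then show ?thesis using card_image[OF inj] by simp
qed

text \<open>Independent vectors of the image and functionals dual to them give the identity
  matrix.\<close>

lemma (in cvec2) rank_minor:
  assumes g: "linear_on H s1 s2 g" and H: "v1.fdim H" and k: "k \<le> v2.dim (g ` H)"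
  obtains \<phi> l where "\<And>i. i < k \<Longrightarrow> \<phi> i \<in> H" "\<And>j. clinear s2 (*) (l j)"
    "minor k (\<lambda>i j. l j (g (\<phi> i))) \<noteq> 0"
proof -
  obtain e where e: "inj_on e {..<k}" "v2.independent (e ` {..<k})" "e ` {..<k} \<subseteq> g ` H"
    by (rule v2.independent_family[OF dim_image_kernel(1)[OF H g] k])
  obtain l where l: "\<And>j. clinear s2 (*) (l j)"
    "\<And>i j. i < k \<Longrightarrow> j < k \<Longrightarrow> l j (e i) = (if i = j then 1 else 0)"
    using v2.independent_dual[OF e(1,2)] by metis
  have "\<forall>i\<in>{..<k}. \<exists>x\<in>H. g x = e i" using e(3) by force
  then obtain \<phi> where \<phi>: "\<forall>i\<in>{..<k}. \<phi> i \<in> H \<and> g (\<phi> i) = e i" by metis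
  have "minor k (\<lambda>i j. l j (g (\<phi> i))) = 1" by (rule minor_identity) (use \<phi> l(2) in simp)
  then have "minor k (\<lambda>i j. l j (g (\<phi> i))) \<noteq> 0" by simp
  then show ?thesis using that[of \<phi> l] \<phi> l(1) by blast
qed

section \<open>Morphisms of fixed rank\<close>

lemma Hom_rules:
  assumes "f \<in> Hom V W" "fd_rep L V"
  shows "v \<in> rep_space V \<Longrightarrow> f v \<in> rep_space W"
    and "v \<in> rep_space V \<Longrightarrow> w \<in> rep_space V \<Longrightarrow> f (v + w) = f v + f w"
    and "v \<in> rep_space V \<Longrightarrow> w \<in> rep_space V \<Longrightarrow> f (v - w) = f v - f w"
    and "v \<in> rep_space V \<Longrightarrow> f (rep_scale V c v) = rep_scale W c (f v)"
    and "f 0 = 0"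
  using Hom_in[OF assms(1)] Hom_add[OF assms(1)] Hom_diff[OF assms] Hom_scale[OF assms(1)] Hom_0[OF assms]
  by blast+

lemmas fd_rules = fd_zero fd_add fd_scale fd_diff

text \<open>For endomorphisms of a finite dimensional representation this amounts to invertibility;
  as a condition on the kernel it is easy to follow along a line of endomorphisms.\<close>

abbreviation nondeg :: "('g, 'v::ab_group_add) rep \<Rightarrow> ('v \<Rightarrow> 'v) \<Rightarrow> bool"
  where "nondeg V P \<equiv> (\<forall>v\<in>rep_space V. P v = 0 \<longrightarrow> v = 0)"

lemma nondeg_bij:
  assumes V: "fd_rep L V" and P: "P \<in> Hom V V" "nondeg V P"
  shows "bij_betw P (rep_space V) (rep_space V)"
proof -
  interpret cvec "rep_scale V" by (rule fd_cvec[OF V])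
  have "inj_on P (rep_space V)"
    using self.inj_on_iff_kernel[OF fd_subspace[OF V] Hom_linear[OF P(1)]] P(2) by blast
  moreover have "P ` rep_space V = rep_space V"
    by (rule inj_imp_surj_on[OF fd_fdim[OF V] Hom_linear[OF P(1)]]) (use Hom_in[OF P(1)] P(2) in auto)
  ultimately show ?thesis by (simp add: bij_betw_def)
qed

lemma nondeg_inverse:
  assumes V: "fd_rep L V" and P: "P \<in> Hom V V" "nondeg V P"
  obtains P' where "P' \<in> Hom V V" "\<And>v. v \<in> rep_space V \<Longrightarrow> P' (P v) = v" "\<And>v. v \<in> rep_space V \<Longrightarrow> P (P' v) = v"
  by (rule iso_inverse[OF V V P(1) nondeg_bij[OF assms]]) (rule that)

text \<open>\<open>P\<close> is \<open>a\<close> on the image of \<open>e\<close> and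
  \<open>\<kappa>\<close> on the complement \<open>K\<close>. The map \<open>f\<close> kills the
  values of \<open>\<kappa>\<close> and detects those of \<open>a\<close>, so the two parts cannot
  cancel. It serves for \<open>W\<close> with \<open>e = p q\<close> and for \<open>V\<close> with
  \<open>e = q p\<close>.\<close>

lemma glue_nondeg:
  assumes A: "fd_rep L A" and a: "a \<in> Hom A A" and e: "e \<in> Hom A A" and K: "subrep A K"
    and \<kappa>: "\<kappa> \<in> Hom (sub_rep A K) A" and f: "f \<in> Hom A B"
    and eK: "\<And>v. v \<in> rep_space A \<Longrightarrow> v - e v \<in> K" and fa: "\<And>v. v \<in> rep_space A \<Longrightarrow> f (a v) = 0 \<Longrightarrow> e v = 0"
    and ea: "\<And>v. e v = 0 \<Longrightarrow> a v = 0"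
    and f\<kappa>: "\<And>k. k \<in> K \<Longrightarrow> f (\<kappa> k) = 0" and \<kappa>0: "\<And>k. k \<in> K \<Longrightarrow> \<kappa> k = 0 \<Longrightarrow> k = 0"
  shows "\<exists>P. P \<in> Hom A A \<and> nondeg A P \<and> (\<forall>v\<in>rep_space A. f (P v) = f (a v) \<and> (e v = v \<longrightarrow> P v = a v))"
proof -
  define P where "P = (\<lambda>v. a v + \<kappa> (rep_id A v - e v))"
  have KA: "K \<subseteq> rep_space A" using K by (simp add: subrep_def)
  have "(\<lambda>v. rep_id A v - e v) \<in> Hom A (sub_rep A K)"
    unfolding Hom_sub_target[OF KA] using Hom_minus[OF A rep_id_Hom[OF A] e] eK by auto
  from Hom_comp[OF this \<kappa> sub_rep_fd[OF A K]] have P: "P \<in> Hom A A"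
    unfolding P_def by (rule Hom_plus[OF A a])
  have \<kappa>z: "\<kappa> 0 = 0" by (rule Hom_0[OF \<kappa> sub_rep_fd[OF A K]])
  have fP: "f (P v) = f (a v)" if v: "v \<in> rep_space A" for v
  proof -
    have k: "v - e v \<in> K" by (rule eK[OF v])
    then have "\<kappa> (v - e v) \<in> rep_space A" using Hom_in[OF \<kappa>] by simp
    then show ?thesis using Hom_add[OF f Hom_in[OF a v]] f\<kappa>[OF k] v by (simp add: P_def)
  qed
  have "nondeg A P"
  proof (intro ballI impI)
    fix v assume v: "v \<in> rep_space A" "P v = 0"
    then have "f (a v) = 0" using fP[OF v(1)] Hom_0[OF f A] by simp
    then have ev: "e v = 0" by (rule fa[OF v(1)])
    then have "v \<in> K" using eK[OF v(1)] by simp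
    then show "v = 0" using \<kappa>0 v ev ea[OF ev] by (simp add: P_def)
  qed
  moreover have "P v = a v" if "v \<in> rep_space A" "e v = v" for v
    unfolding P_def rep_id_in[OF that(1)] that(2) by (simp add: \<kappa>z)
  ultimately show ?thesis by (intro exI[of _ P] conjI P ballI impI fP) (assumption | simp only:)+
qed

text \<open>With \<open>P'\<close> the inverse of \<open>P\<close>, degeneracy at \<open>t\<close>
  makes \<open>- 1 / t\<close> an eigenvalue of \<open>P' N\<close>, and there are finitely many of
  them.\<close>

lemma finite_degenerate:
  assumes V: "fd_rep L V" and P: "P \<in> Hom V V" "nondeg V P" and N: "N \<in> Hom V V"
  shows "finite {t. \<not> nondeg V (\<lambda>v. P v + rep_scale V t (N v))}"
proof -
  interpret cvec "rep_scale V" by (rule fd_cvec[OF V])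
  obtain P' where P': "P' \<in> Hom V V" "\<And>v. v \<in> rep_space V \<Longrightarrow> P' (P v) = v"
    using nondeg_inverse[OF V P] by metis
  let ?M = "\<lambda>v. P' (N v)"
  have M: "?M \<in> Hom V V" by (rule Hom_comp[OF N P'(1) V])
  let ?A = "{a. \<exists>v\<in>rep_space V. v \<noteq> 0 \<and> ?M v = rep_scale V a v}"
  have fin: "finite ?A"
    by (rule finite_eigenvalues[OF fd_fdim[OF V] Hom_linear[OF M]]) (use Hom_in[OF M] in auto)
  have "{t. \<not> nondeg V (\<lambda>v. P v + rep_scale V t (N v))} \<subseteq> (\<lambda>a. - 1 / a) ` ?A"
  proof
    fix t assume "t \<in> {t. \<not> nondeg V (\<lambda>v. P v + rep_scale V t (N v))}"
    then obtain v where v: "v \<in> rep_space V" "v \<noteq> 0" "P v + rep_scale V t (N v) = 0" by blast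
    have "P' (P v + rep_scale V t (N v)) = v + rep_scale V t (?M v)"
      using v(1) by (simp add: Hom_rules[OF P'(1) V] Hom_rules[OF N V] Hom_rules[OF P(1) V] fd_rules[OF V] P'(2))
    then have e: "v + rep_scale V t (?M v) = 0" using v(3) Hom_rules(5)[OF P'(1) V] by simp
    have t: "t \<noteq> 0" using e v(2) by auto
    have "rep_scale V (- 1 / t) (v + rep_scale V t (?M v)) = 0" using e by simp
    then have "?M v = rep_scale V (- 1 / t) v"
      using t by (simp add: scale_right_distrib add_eq_0_iff)
    then have "- 1 / t \<in> ?A" using v by blast
    then show "t \<in> (\<lambda>a. - 1 / a) ` ?A" by (rule rev_image_eqI) simp
  qed
  then show ?thesis using fin finite_subset by blast
qed

locale rank_variety = isotypic L I Vs
  for L :: "'g::ab_group_add lie" and I and Vs :: "nat \<Rightarrow> ('g, 'u::ab_group_add) rep" +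
  fixes V :: "('g, 'v::ab_group_add) rep" and W :: "('g, 'w::ab_group_add) rep" and s :: "nat \<Rightarrow> nat"
  assumes V: "fd_rep L V" and W: "fd_rep L W" and supp: "supported V" "supported W"
    and s_le: "\<And>i. i \<in> I \<Longrightarrow> s i \<le> hdim (Vs i) V" "\<And>i. i \<in> I \<Longrightarrow> s i \<le> hdim (Vs i) W"
begin

sublocale E: affine_space "hom_scale W" "Hom V W"
  by (intro affine_space.intro hom_cvec[OF W] affine_space_axioms.intro Hom_fdim[OF V W])

abbreviation "polys \<equiv> poly_functions (hom_scale W :: _ \<Rightarrow> ('v \<Rightarrow> 'w) \<Rightarrow> _) (Hom V W)"

abbreviation Z :: "('v \<Rightarrow> 'w) topology" where "Z \<equiv> zariski (hom_scale W) (Hom V W)"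

definition X :: "('v \<Rightarrow> 'w) set" where "X = {f\<in>Hom V W. \<forall>i\<in>I. mults V W f i = s i}"

lemma X_Hom: "f \<in> X \<Longrightarrow> f \<in> Hom V W"
  by (simp add: X_def)

lemmas clV = fd_rules[OF V] and clW = fd_rules[OF W]

lemma E_add: "f \<in> Hom V W \<Longrightarrow> g \<in> Hom V W \<Longrightarrow> f + g \<in> Hom V W"
  and E_diff: "f \<in> Hom V W \<Longrightarrow> g \<in> Hom V W \<Longrightarrow> f - g \<in> Hom V W"
  and E_scale: "f \<in> Hom V W \<Longrightarrow> hom_scale W t f \<in> Hom V W"
  by (rule E.subspace_add[OF E.sE] E.subspace_diff[OF E.sE] E.subspace_scale[OF E.sE]; assumption)+

text \<open>The automorphism \<open>b\<close> does not change the image, and \<open>a\<close>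
  replaces the image by an isomorphic one.\<close>

lemma X_comp:
  assumes p: "p \<in> X" and a: "a \<in> Hom W W" "nondeg W a" and b: "b \<in> Hom V V" "nondeg V b"
  shows "(\<lambda>v. a (p (b v))) \<in> X"
proof -
  note pE = X_Hom[OF p]
  let ?f = "\<lambda>v. a (p (b v))"
  have f: "?f \<in> Hom V W" by (rule Hom_comp[OF Hom_comp[OF b(1) pE V] a(1) W])
  have im: "?f ` rep_space V = a ` p ` rep_space V"
    using bij_betw_imp_surj_on[OF nondeg_bij[OF V b]] by (metis image_image)
  let ?U = "p ` rep_space V"
  have U: "subrep W ?U" by (rule image_subrep[OF V W pE])
  have UW: "?U \<subseteq> rep_space W" using Hom_in[OF pE] by blast
  have aU: "subrep W (a ` ?U)" using image_subrep[OF V W f] unfolding im .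
  have aUW: "a ` ?U \<subseteq> rep_space W" using UW Hom_in[OF a(1)] by blast
  let ?g = "\<lambda>w. if w \<in> ?U then a w else 0"
  have "?g ` ?U = a ` ?U" by (rule image_cong) auto
  then have "?g \<in> Hom (sub_rep W ?U) (sub_rep W (a ` ?U))"
    unfolding Hom_sub_target[OF aUW] using Hom_restrict[OF W U a(1)] by simp
  moreover have "bij_betw ?g ?U (a ` ?U)"
    using inj_on_subset[OF bij_betw_imp_inj_on[OF nondeg_bij[OF W a]] UW]
    by (auto simp: bij_betw_def inj_on_def)
  ultimately have iso: "rep_iso (sub_rep W ?U) (sub_rep W (a ` ?U))" unfolding rep_iso_def by auto
  have "mults V W ?f i = mults V W p i" if "i \<in> I" for i
    unfolding im using hdim_iso(1)[OF ss irr_fd'[OF that] sub_rep_fd[OF W U] sub_rep_fd[OF W aU] iso] by simp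
  then show ?thesis using f p by (simp add: X_def)
qed

lemma curve_eq:
  assumes p: "p \<in> Hom V W" and a: "a \<in> Hom W W" and b: "b \<in> Hom V V"
  shows "p + hom_scale W t (\<lambda>v. a (p v) + p (b v)) + hom_scale W (t * t) (\<lambda>v. a (p (b v)))
    = (\<lambda>v. (\<lambda>w. rep_id W w + rep_scale W t (a w)) (p ((\<lambda>v. rep_id V v + rep_scale V t (b v)) v)))"
    (is "?l = ?r")
    and "(\<lambda>v. a (p v) + p (b v)) \<in> Hom V W" and "(\<lambda>v. a (p (b v))) \<in> Hom V W"
proof -
  interpret v: cvec "rep_scale V" by (rule fd_cvec[OF V])
  interpret w: cvec "rep_scale W" by (rule fd_cvec[OF W])
  show h: "(\<lambda>v. a (p v) + p (b v)) \<in> Hom V W" "(\<lambda>v. a (p (b v))) \<in> Hom V W"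
    by (intro Hom_plus[OF W] Hom_comp[OF p a W] Hom_comp[OF b p V] Hom_comp[OF _ a W])+
  show "?l = ?r"
  proof (rule Hom_eqI)
    show "?l \<in> Hom V W" by (intro E_add E_scale p h)
    show "?r \<in> Hom V W"
      by (rule Hom_comp[OF Hom_comp[OF Hom_plus[OF V rep_id_Hom[OF V] Hom_scaled[OF V b]] p V]
        Hom_plus[OF W rep_id_Hom[OF W] Hom_scaled[OF W a]] W])
    show "?l v = ?r v" if v: "v \<in> rep_space V" for v
      using v by (simp add: hom_scale_def Hom_rules[OF p V] Hom_rules[OF a W] Hom_rules[OF b V] clV clW
        w.scale_right_distrib add.assoc)
  qed
qed

lemma curve_in_X:
  assumes p: "p \<in> X" and a: "a \<in> Hom W W" and b: "b \<in> Hom V V"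
  shows "finite {t. p + hom_scale W t (\<lambda>v. a (p v) + p (b v)) + hom_scale W (t * t) (\<lambda>v. a (p (b v))) \<notin> X}"
proof -
  let ?A = "\<lambda>t w. rep_id W w + rep_scale W t (a w)" and ?B = "\<lambda>t v. rep_id V v + rep_scale V t (b v)"
  have A: "?A t \<in> Hom W W" and B: "?B t \<in> Hom V V" for t
    by (intro Hom_plus[OF W rep_id_Hom[OF W] Hom_scaled[OF W a]] Hom_plus[OF V rep_id_Hom[OF V] Hom_scaled[OF V b]])+
  have "finite {t. \<not> nondeg W (?A t)}" by (rule finite_degenerate[OF W rep_id_Hom[OF W] _ a]) simp
  moreover have "finite {t. \<not> nondeg V (?B t)}" by (rule finite_degenerate[OF V rep_id_Hom[OF V] _ b]) simp
  ultimately have fin: "finite ({t. \<not> nondeg W (?A t)} \<union> {t. \<not> nondeg V (?B t)})" by (rule finite_UnI)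
  show ?thesis
    unfolding curve_eq(1)[OF X_Hom[OF p] a b]
  proof (rule finite_subset[OF _ fin], rule subsetI, rule ccontr)
    fix t assume h: "t \<in> {t. (\<lambda>v. ?A t (p (?B t v))) \<notin> X}"
      and n: "t \<notin> {t. \<not> nondeg W (?A t)} \<union> {t. \<not> nondeg V (?B t)}"
    have "nondeg W (?A t)" "nondeg V (?B t)" using n by blast+
    then have "(\<lambda>v. ?A t (p (?B t v))) \<in> X" by (intro X_comp[OF p A _ B])
    then show False using h by (simp only: mem_Collect_eq not_True_eq_False)
  qed
qed

text \<open>Equal multiplicities make the images of \<open>p\<close> and \<open>y\<close>
  isomorphic, and likewise their kernels and the complements of the images. Gluing yields an
  automorphism \<open>P\<close> of \<open>W\<close> with \<open>P p = \<tau> p\<close> and an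
  automorphism \<open>S\<close> of \<open>V\<close> with \<open>y S = \<tau> p\<close>; then
  \<open>R\<close> is the inverse of \<open>S\<close>.\<close>

lemma rank_orbit:
  assumes p: "p \<in> X" and y: "y \<in> X"
  obtains P R where "P \<in> Hom W W" "R \<in> Hom V V" "\<forall>v. y v = P (p (R v))"
proof -
  note pE = X_Hom[OF p] and yE = X_Hom[OF y]
  obtain q where q: "q \<in> Hom W V" "\<And>v. p (q (p v)) = p v" "\<And>w. q (p (q w)) = q w"
    using generalized_inverse[OF ss V W pE] by blast
  obtain r where r: "r \<in> Hom W V" "\<And>v. y (r (y v)) = y v" "\<And>w. r (y (r w)) = r w"
    using generalized_inverse[OF ss V W yE] by blast
  let ?Kp = "{v\<in>rep_space V. p v = 0}" and ?Ky = "{v\<in>rep_space V. y v = 0}"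
  let ?Dp = "{w\<in>rep_space W. q w = 0}" and ?Dy = "{w\<in>rep_space W. r w = 0}"
  let ?Ip = "p ` rep_space V" and ?Iy = "y ` rep_space V"
  have sub: "subrep V ?Kp" "subrep V ?Ky" "subrep W ?Dp" "subrep W ?Dy" "subrep W ?Ip" "subrep W ?Iy"
    by (rule kernel_subrep[OF V W pE] kernel_subrep[OF V W yE] kernel_subrep[OF W V q(1)] kernel_subrep[OF W V r(1)]
        image_subrep[OF V W pE] image_subrep[OF V W yE])+
  note fd = sub_rep_fd[OF V sub(1)] sub_rep_fd[OF V sub(2)] sub_rep_fd[OF W sub(3)] sub_rep_fd[OF W sub(4)]
    sub_rep_fd[OF W sub(5)] sub_rep_fd[OF W sub(6)]
  have eq: "mults V W p i = mults V W y i" if "i \<in> I" for i using p y that by (simp add: X_def)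
  have "rep_iso (sub_rep W ?Ip) (sub_rep W ?Iy)"
    by (rule mult_eq_iso[OF fd(5,6) supported_im[OF V W pE supp(1)] supported_im[OF V W yE supp(1)] eq])
  then obtain \<tau> where \<tau>: "\<tau> \<in> Hom (sub_rep W ?Ip) (sub_rep W ?Iy)" "bij_betw \<tau> ?Ip ?Iy"
    unfolding rep_iso_def sub_rep_simps by blast
  have "rep_iso (sub_rep V ?Kp) (sub_rep V ?Ky)"
  proof (rule mult_eq_iso[OF fd(1,2) supported_ker[OF V W pE supp(1)] supported_ker[OF V W yE supp(1)]])
    show "hdim (Vs i) (sub_rep V ?Kp) = hdim (Vs i) (sub_rep V ?Ky)" if "i \<in> I" for i
      using hdim_ker_im(1)[OF ss irr_fd'[OF that] V W pE] hdim_ker_im(1)[OF ss irr_fd'[OF that] V W yE] eq[OF that] by simp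
  qed
  then obtain \<sigma> where \<sigma>: "\<sigma> \<in> Hom (sub_rep V ?Kp) (sub_rep V ?Ky)" "bij_betw \<sigma> ?Kp ?Ky"
    unfolding rep_iso_def sub_rep_simps by blast
  have "rep_iso (sub_rep W ?Dp) (sub_rep W ?Dy)"
  proof (rule mult_eq_iso[OF fd(3,4) supported_ker[OF W V q(1) supp(2)] supported_ker[OF W V r(1) supp(2)]])
    show "hdim (Vs i) (sub_rep W ?Dp) = hdim (Vs i) (sub_rep W ?Dy)" if "i \<in> I" for i
      using hdim_coker[OF ss irr_fd'[OF that] V W pE q] hdim_coker[OF ss irr_fd'[OF that] V W yE r] eq[OF that] by simp
  qed
  then obtain \<delta> where \<delta>: "\<delta> \<in> Hom (sub_rep W ?Dp) (sub_rep W ?Dy)" "bij_betw \<delta> ?Dp ?Dy"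
    unfolding rep_iso_def sub_rep_simps by blast
  have sW: "S \<subseteq> rep_space W" if "subrep W S" for S using that by (simp add: subrep_def)
  have sV: "S \<subseteq> rep_space V" if "subrep V S" for S using that by (simp add: subrep_def)
  have \<sigma>V: "\<sigma> \<in> Hom (sub_rep V ?Kp) V" using \<sigma>(1) Hom_sub_target[OF sV[OF sub(2)]] by blast
  have \<delta>W: "\<delta> \<in> Hom (sub_rep W ?Dp) W" using \<delta>(1) Hom_sub_target[OF sW[OF sub(4)]] by blast
  have \<tau>W: "\<tau> \<in> Hom (sub_rep W ?Ip) W" using \<tau>(1) Hom_sub_target[OF sW[OF sub(6)]] by blast
  have z: "\<tau> 0 = 0" "\<sigma> 0 = 0" "\<delta> 0 = 0" "p 0 = 0" "q 0 = 0" "r 0 = 0" "y 0 = 0"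
    using Hom_0[OF \<tau>W fd(5)] Hom_0[OF \<sigma>V fd(1)] Hom_0[OF \<delta>W fd(3)] Hom_0[OF pE V] Hom_0[OF q(1) W] Hom_0[OF r(1) W] Hom_0[OF yE V]
    by auto
  have inj0: "k = 0" if b: "bij_betw f S T" "0 \<in> S" "f 0 = 0" "k \<in> S" "f k = 0" for k S T and f :: "'x::zero \<Rightarrow> 'y::zero"
    using inj_onD[OF bij_betw_imp_inj_on[OF b(1)], of k 0] b by simp
  have \<tau>p: "(\<lambda>v. \<tau> (p v)) \<in> Hom V W" by (rule Hom_comp[OF im_target[OF V W pE] \<tau>W fd(5)])
  have y\<tau>: "y (r (\<tau> (p v))) = \<tau> (p v)" for v
  proof (cases "v \<in> rep_space V")
    case True
    then have "\<tau> (p v) \<in> ?Iy" using Hom_in[OF \<tau>(1), of "p v"] by simp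
    then show ?thesis using r(2) by (elim imageE) simp
  next
    case False
    then show ?thesis using Hom_out[OF pE False] z by simp
  qed
  have \<tau>0: "p v = 0" if "\<tau> (p v) = 0" for v
  proof (cases "v \<in> rep_space V")
    case True
    show ?thesis by (rule inj0[OF \<tau>(2) _ z(1) _ that]) (use True z(4) fd_zero[OF V] in force)+
  qed (rule Hom_out[OF pE])
  have "\<exists>P. P \<in> Hom W W \<and> nondeg W P \<and> (\<forall>w\<in>rep_space W. r (P w) = r (\<tau> (p (q w))) \<and> (p (q w) = w \<longrightarrow> P w = \<tau> (p (q w))))"
  proof (rule glue_nondeg[OF W Hom_comp[OF q(1) \<tau>p V] Hom_comp[OF q(1) pE V] sub(3) \<delta>W r(1)])
    show "w - p (q w) \<in> ?Dp" if "w \<in> rep_space W" for w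
      using that by (simp add: Hom_rules[OF pE V] Hom_rules[OF q(1) W] clW q(3))
    show "p (q w) = 0" if "r (\<tau> (p (q w))) = 0" for w
      by (rule \<tau>0) (use y\<tau>[of "q w"] that z in simp)
    show "\<tau> (p (q w)) = 0" if "p (q w) = 0" for w using that z by simp
    show "r (\<delta> k) = 0" if "k \<in> ?Dp" for k using Hom_in[OF \<delta>(1), of k] that by simp
    show "k = 0" if "k \<in> ?Dp" "\<delta> k = 0" for k
      by (rule inj0[OF \<delta>(2) _ z(3) that]) (use z fd_zero[OF W] in simp)
  qed
  then obtain P where P: "P \<in> Hom W W" "nondeg W P" and Pa: "\<forall>w\<in>rep_space W. r (P w) = r (\<tau> (p (q w))) \<and> (p (q w) = w \<longrightarrow> P w = \<tau> (p (q w)))"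
    by (elim exE conjE)
  have "\<exists>S. S \<in> Hom V V \<and> nondeg V S \<and> (\<forall>v\<in>rep_space V. y (S v) = y (r (\<tau> (p v))) \<and> (q (p v) = v \<longrightarrow> S v = r (\<tau> (p v))))"
  proof (rule glue_nondeg[OF V Hom_comp[OF \<tau>p r(1) W] Hom_comp[OF pE q(1) W] sub(1) \<sigma>V yE])
    show "v - q (p v) \<in> ?Kp" if "v \<in> rep_space V" for v
      using that by (simp add: Hom_rules[OF pE V] Hom_rules[OF q(1) W] clV q(2))
    show "q (p v) = 0" if "y (r (\<tau> (p v))) = 0" for v
      using \<tau>0[of v] that z by (simp add: y\<tau>)
    show "r (\<tau> (p v)) = 0" if "q (p v) = 0" for v using q(2)[of v] that z by simp
    show "y (\<sigma> k) = 0" if "k \<in> ?Kp" for k using Hom_in[OF \<sigma>(1), of k] that by simp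
    show "k = 0" if "k \<in> ?Kp" "\<sigma> k = 0" for k
      by (rule inj0[OF \<sigma>(2) _ z(2) that]) (use z fd_zero[OF V] in simp)
  qed
  then obtain S where S: "S \<in> Hom V V" "nondeg V S" and Sa: "\<forall>v\<in>rep_space V. y (S v) = y (r (\<tau> (p v))) \<and> (q (p v) = v \<longrightarrow> S v = r (\<tau> (p v)))"
    by (elim exE conjE)
  obtain R where R: "R \<in> Hom V V" "\<And>v. v \<in> rep_space V \<Longrightarrow> S (R v) = v" using nondeg_inverse[OF V S] by metis
  have "y v = P (p (R v))" for v
  proof (cases "v \<in> rep_space V")
    case True
    have Rv: "R v \<in> rep_space V" by (rule Hom_in[OF R(1) True])
    have "P (p (R v)) = \<tau> (p (R v))" using bspec[OF Pa Hom_in[OF pE Rv]] q(2)[of "R v"] by simp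
    moreover have "y (S (R v)) = \<tau> (p (R v))" using bspec[OF Sa Rv] y\<tau> by simp
    ultimately show ?thesis using R(2)[OF True] by simp
  next
    case False
    then show ?thesis using Hom_out[OF yE False] Hom_out[OF R(1) False] z Hom_0[OF P(1) W] by simp
  qed
  then show ?thesis using that P(1) R(1) by blast
qed

text \<open>With \<open>a = P - 1\<close> and \<open>b = R - 1\<close>, the point \<open>y\<close>
  has parameter 1 on the parabola through \<open>x\<close>.\<close>

lemma orbit_curve:
  assumes x: "x \<in> X" and y: "y \<in> X"
  obtains a b where "a \<in> Hom W W" "b \<in> Hom V V"
    "y = x + hom_scale W 1 (\<lambda>v. a (x v) + x (b v)) + hom_scale W (1 * 1) (\<lambda>v. a (x (b v)))"
proof -
  note xE = X_Hom[OF x] and yE = X_Hom[OF y]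
  obtain P R where P: "P \<in> Hom W W" and R: "R \<in> Hom V V" and y': "\<forall>v. y v = P (x (R v))"
    by (rule rank_orbit[OF x y])
  note yv = spec[OF y']
  let ?a = "\<lambda>w. P w - rep_id W w" and ?b = "\<lambda>v. R v - rep_id V v"
  have a: "?a \<in> Hom W W" and b: "?b \<in> Hom V V"
    by (intro Hom_minus[OF W P rep_id_Hom[OF W]] Hom_minus[OF V R rep_id_Hom[OF V]])+
  interpret w: cvec "rep_scale W" by (rule fd_cvec[OF W])
  have "y = x + hom_scale W 1 (\<lambda>v. ?a (x v) + x (?b v)) + hom_scale W (1 * 1) (\<lambda>v. ?a (x (?b v)))"
    (is "_ = ?r")
  proof (rule Hom_eqI[OF yE])
    show "?r \<in> Hom V W" by (intro E_add E_scale xE curve_eq(2,3)[OF xE a b])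
    show "y v = ?r v" if "v \<in> rep_space V" for v
      using that by (simp add: yv hom_scale_def Hom_rules[OF xE V] Hom_rules[OF P W] Hom_rules[OF R V] clV clW)
  qed
  then show ?thesis using that a b by blast
qed

lemma X_irreducible: "irreducible_space (subtopology Z X)"
proof (rule E.irreducible_by_curves)
  show "X \<subseteq> Hom V W" by (auto simp: X_def)
  show "X \<noteq> {}" using rank_exists[OF V W s_le] by (auto simp: X_def)
  fix x y assume x: "x \<in> X" and y: "y \<in> X"
  obtain a b where a: "a \<in> Hom W W" and b: "b \<in> Hom V V"
    and "y = x + hom_scale W 1 (\<lambda>v. a (x v) + x (b v)) + hom_scale W (1 * 1) (\<lambda>v. a (x (b v)))"
    by (rule orbit_curve[OF x y])
  then show "\<exists>a b c s. a \<in> Hom V W \<and> b \<in> Hom V W \<and> c \<in> Hom V W \<and> x = a \<and>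
      y = a + hom_scale W s b + hom_scale W (s * s) c \<and>
      finite {t. a + hom_scale W t b + hom_scale W (t * t) c \<notin> X}"
    using X_Hom[OF x] curve_eq(2,3)[OF X_Hom[OF x] a b] curve_in_X[OF x a b] by (intro exI conjI) (assumption | rule refl)+
qed

text \<open>The minors of size \<open>k\<close> of the linear map
  \<open>\<phi> \<mapsto> y \<phi>\<close> from \<open>Hom (Vs i) V\<close> to
  \<open>Hom (Vs i) W\<close>. Rows are given by arbitrary vectors and columns by arbitrary
  functionals, so no bases are fixed. For \<open>k = 0\<close> there is only the constant 1.\<close>

definition minors :: "nat \<Rightarrow> nat \<Rightarrow> (('v \<Rightarrow> 'w) \<Rightarrow> complex) set"
  where "minors i k = {\<lambda>y. minor k (\<lambda>a b. l b (\<lambda>u. y (\<phi> a u))) | \<phi> l.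
    (\<forall>a<k. \<phi> a \<in> Hom (Vs i) V) \<and> (\<forall>j. clinear (hom_scale W) (*) (l j))}"

lemma minorsE:
  assumes "f \<in> minors i k"
  obtains \<phi> l where "f = (\<lambda>y. minor k (\<lambda>a b. l b (\<lambda>u. y (\<phi> a u))))"
    "\<forall>a<k. \<phi> a \<in> Hom (Vs i) V" "\<forall>j. clinear (hom_scale W) (*) (l j)"
  using assms unfolding minors_def mem_Collect_eq by (elim exE conjE)

lemma eval_linear:
  assumes l: "clinear (hom_scale W) (*) l"
  shows "linear_on (Hom V W) (hom_scale W) (*) (\<lambda>y. l (\<lambda>u. y (\<phi> u)))"
proof -
  interpret l: Vector_Spaces.linear "hom_scale W" "(*)" l by (rule l)
  have "(\<lambda>u. (x + y) (\<phi> u)) = (\<lambda>u. x (\<phi> u)) + (\<lambda>u. y (\<phi> u))" for x y :: "'v \<Rightarrow> 'w" by auto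
  moreover have "(\<lambda>u. hom_scale W c x (\<phi> u)) = hom_scale W c (\<lambda>u. x (\<phi> u))" for x :: "'v \<Rightarrow> 'w" and c
    by (simp add: hom_scale_def)
  ultimately show ?thesis unfolding linear_on_def
    by (intro conjI ballI allI) (simp_all only: l.add l.scale)
qed

lemma minors_poly: "minors i k \<subseteq> polys"
proof
  fix f assume "f \<in> minors i k"
  then obtain \<phi> l where f: "f = (\<lambda>y. minor k (\<lambda>a b. l b (\<lambda>u. y (\<phi> a u))))"
    and "\<forall>a<k. \<phi> a \<in> Hom (Vs i) V" and l: "\<forall>j. clinear (hom_scale W) (*) (l j)"
    by (rule minorsE)
  show "f \<in> polys"
    unfolding f by (rule minor_poly) (rule eval_linear[OF spec[OF l]])
qed

lemma minors_rank:
  assumes i: "i \<in> I" and y: "y \<in> Hom V W"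
  shows "(\<forall>f\<in>minors i k. f y = 0) \<longleftrightarrow> mults V W y i < k"
proof -
  interpret c: cvec2 "hom_scale V :: complex \<Rightarrow> ('u \<Rightarrow> 'v) \<Rightarrow> _" "hom_scale W :: complex \<Rightarrow> ('u \<Rightarrow> 'w) \<Rightarrow> _"
    by (intro cvec2.intro hom_cvec[OF V] hom_cvec[OF W])
  let ?g = "\<lambda>\<phi> u. y (\<phi> u)"
  have g: "linear_on (Hom (Vs i) V) (hom_scale V) (hom_scale W) ?g" by (rule linear_on_post[OF y V])
  have H: "c.v1.fdim (Hom (Vs i) V)" by (rule Hom_fdim[OF irr_fd'[OF i] V])
  have dim: "mults V W y i = c.v2.dim (?g ` Hom (Vs i) V)" by (rule hdim_image[OF ss irr_fd'[OF i] V W y])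
  show ?thesis
  proof
    assume z: "\<forall>f\<in>minors i k. f y = 0"
    show "mults V W y i < k"
    proof (rule ccontr)
      assume "\<not> mults V W y i < k"
      then have k: "k \<le> c.v2.dim (?g ` Hom (Vs i) V)" using dim by simp
      obtain \<phi> l where h: "\<And>a. a < k \<Longrightarrow> \<phi> a \<in> Hom (Vs i) V" "\<And>j. clinear (hom_scale W) (*) (l j)"
        "minor k (\<lambda>a b. l b (?g (\<phi> a))) \<noteq> 0" using c.rank_minor[OF g H k] by metis
      have "(\<lambda>y. minor k (\<lambda>a b. l b (\<lambda>u. y (\<phi> a u)))) \<in> minors i k"
        unfolding minors_def mem_Collect_eq using h(1,2)
        by (intro exI[of _ \<phi>] exI[of _ l] conjI refl allI impI)
      from bspec[OF z this] h(3) show False by simp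
    qed
  next
    assume k: "mults V W y i < k"
    show "\<forall>f\<in>minors i k. f y = 0"
    proof
      fix f assume "f \<in> minors i k"
      then obtain \<phi> l where f: "f = (\<lambda>y. minor k (\<lambda>a b. l b (\<lambda>u. y (\<phi> a u))))"
        and h: "\<forall>a<k. \<phi> a \<in> Hom (Vs i) V" "\<forall>j. clinear (hom_scale W) (*) (l j)"
        by (rule minorsE)
      show "f y = 0"
      proof (rule ccontr)
        assume "f y \<noteq> 0"
        then have "k \<le> c.v2.dim (?g ` Hom (Vs i) V)"
          unfolding f by (intro c.minor_rank[OF g H h(1)[rule_format] spec[OF h(2)]])
        then show False using k dim by simp
      qed
    qed
  qed
qed

text \<open>Rank at least \<open>s i\<close> is an open condition, as some minor of size
  \<open>s i\<close> is nonzero; rank at most \<open>s i\<close> is closed, as all minors of size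
  \<open>s i + 1\<close> vanish. The open conditions are finitely many.\<close>

lemma X_subvariety: "subvariety (hom_scale W) (Hom V W) X"
proof -
  have op: "openin Z {y\<in>Hom V W. \<forall>i\<in>J. \<not> (\<forall>f\<in>minors i (s i). f y = 0)}" if "finite J" for J
    using that
  proof induction
    case empty
    then show ?case using openin_topspace[of Z] by (simp add: topspace_zariski)
  next
    case (insert j J)
    have eq: "{y\<in>Hom V W. \<forall>i\<in>insert j J. \<not> (\<forall>f\<in>minors i (s i). f y = 0)} =
      (Hom V W - zero_locus (Hom V W) (minors j (s j))) \<inter> {y\<in>Hom V W. \<forall>i\<in>J. \<not> (\<forall>f\<in>minors i (s i). f y = 0)}"
      by (auto simp: zero_locus_def)
    have "openin Z (Hom V W - zero_locus (Hom V W) (minors j (s j)))"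
      unfolding openin_zariski by (intro exI[of _ "minors j (s j)"] conjI minors_poly refl)
    then show ?case unfolding eq by (rule openin_Int[OF _ insert.IH])
  qed
  have cl: "closedin Z (zero_locus (Hom V W) (\<Union>i\<in>I. minors i (Suc (s i))))"
    unfolding closedin_zariski by (intro exI[of _ "\<Union>i\<in>I. minors i (Suc (s i))"] conjI refl UN_least minors_poly)
  have X: "X = {y\<in>Hom V W. \<forall>i\<in>I. \<not> (\<forall>f\<in>minors i (s i). f y = 0)} \<inter>
      zero_locus (Hom V W) (\<Union>i\<in>I. minors i (Suc (s i)))"
  proof (rule Set.set_eqI)
    fix y
    show "y \<in> X \<longleftrightarrow> y \<in> {y\<in>Hom V W. \<forall>i\<in>I. \<not> (\<forall>f\<in>minors i (s i). f y = 0)} \<inter>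
      zero_locus (Hom V W) (\<Union>i\<in>I. minors i (Suc (s i)))"
    proof (cases "y \<in> Hom V W")
      case True
      have "y \<in> zero_locus (Hom V W) (\<Union>i\<in>I. minors i (Suc (s i))) \<longleftrightarrow>
          (\<forall>i\<in>I. \<forall>f\<in>minors i (Suc (s i)). f y = 0)"
        unfolding zero_locus_def using True by blast
      also have "\<dots> \<longleftrightarrow> (\<forall>i\<in>I. mults V W y i < Suc (s i))"
        by (intro ball_cong refl minors_rank True)
      finally have 1: "y \<in> zero_locus (Hom V W) (\<Union>i\<in>I. minors i (Suc (s i))) \<longleftrightarrow>
          (\<forall>i\<in>I. mults V W y i < Suc (s i))" .
      have 2: "(\<forall>i\<in>I. \<not> (\<forall>f\<in>minors i (s i). f y = 0)) \<longleftrightarrow> (\<forall>i\<in>I. \<not> mults V W y i < s i)"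
        by (intro ball_cong refl arg_cong[of _ _ Not] minors_rank True)
      have "mults V W y i = s i \<longleftrightarrow> \<not> mults V W y i < s i \<and> mults V W y i < Suc (s i)" for i
        by linarith
      then show ?thesis unfolding Int_iff mem_Collect_eq 1 2 X_def using True by blast
    qed (auto simp: X_def zero_locus_def)
  qed
  show ?thesis unfolding subvariety_def by (rule exI, rule exI, rule conjI[OF op[OF finI] conjI[OF cl X]])
qed

text \<open>The image of \<open>f\<close> is supported, so its class is the combination given by its
  multiplicities, and the coefficients of a combination are recovered by pairing with the
  \<open>Vs i\<close>.\<close>

lemma Hom_rank_eq_X: "Hom_rank L V W (comb (\<lambda>i. int (s i))) = X"
proof -
  have "rep_rank L V W f = comb (\<lambda>i. int (s i)) \<longleftrightarrow> (\<forall>i\<in>I. mults V W f i = s i)" if f: "f \<in> Hom V W" for f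
  proof -
    have fd: "fd_rep L (sub_rep W (f ` rep_space V))" by (rule sub_rep_fd[OF W image_subrep[OF V W f]])
    have "cl L (sub_rep W (f ` rep_space V)) = comb (\<lambda>i. int (mults V W f i))"
      by (rule cl_supported[OF fd supported_im[OF V W f supp(1)]])
    moreover have "int (mults V W f i) = int (s i)"
      if "cl L (sub_rep W (f ` rep_space V)) = comb (\<lambda>i. int (s i))" "i \<in> I" for i
      by (rule supported_comb(2)[OF fd that])
    moreover have "comb (\<lambda>i. int (mults V W f i)) = comb (\<lambda>i. int (s i))" if "\<forall>i\<in>I. mults V W f i = s i"
      by (rule comb_cong) (simp add: that)
    ultimately show ?thesis unfolding rep_rank_def image_rep_eq by (metis of_nat_eq_iff)
  qed
  then show ?thesis unfolding Hom_rank_def X_def by blast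
qed

end

section \<open>The quadratic chart at a point\<close>

locale rank_point = rank_variety L I Vs V W s
  for L :: "'g::ab_group_add lie" and I and Vs :: "nat \<Rightarrow> ('g, 'u::ab_group_add) rep"
    and V :: "('g, 'v::ab_group_add) rep" and W :: "('g, 'w::ab_group_add) rep" and s +
  fixes p :: "'v \<Rightarrow> 'w" and q :: "'w \<Rightarrow> 'v"
  assumes pX: "p \<in> X" and q: "q \<in> Hom W V"
    and pqp: "\<And>v. p (q (p v)) = p v" and qpq: "\<And>w. q (p (q w)) = q w"
begin

lemma p: "p \<in> Hom V W" by (rule X_Hom[OF pX])

lemmas pq_rules = Hom_rules[OF p V] Hom_rules[OF q W] clV clW pqp qpq

interpretation v: cvec "rep_scale V" by (rule fd_cvec[OF V])
interpretation w: cvec "rep_scale W" by (rule fd_cvec[OF W])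

lemma qp: "(\<lambda>v. q (p v)) \<in> Hom V V" by (rule Hom_comp[OF p q W])

text \<open>
  With the idempotents \<open>pq\<close> and \<open>qp\<close>, \<open>cut x\<close> is the block \<open>(1 - pq) x (1 - qp)\<close>; the tangent
  space at \<open>p\<close> is its kernel.
\<close>

definition cut :: "('v \<Rightarrow> 'w) \<Rightarrow> 'v \<Rightarrow> 'w"
  where "cut x = (\<lambda>v. (x v - x (q (p v))) - p (q (x v - x (q (p v)))))"

definition tang :: "('v \<Rightarrow> 'w) set" where "tang = {x\<in>Hom V W. cut x = 0}"

text \<open>In addition the block \<open>p q x q p\<close> is 0. Over \<open>p + tang0\<close> the
  chart is inverted exactly by a linear map; elsewhere the error of this inverse lies in
  \<open>tang0\<close>.\<close>

definition tang0 :: "('v \<Rightarrow> 'w) set"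
  where "tang0 = {x\<in>tang. \<forall>v\<in>rep_space V. p (q (x (q (p v)))) = 0}"

definition chart :: "('v \<Rightarrow> 'w) \<Rightarrow> 'v \<Rightarrow> 'w"
  where "chart x = (\<lambda>v. x (q (p v)) + x (q (x v - x (q (p v)))))"

lemma tang_Hom: "x \<in> tang \<Longrightarrow> x \<in> Hom V W" by (simp add: tang_def)

lemma rem_Hom: "x \<in> Hom V W \<Longrightarrow> (\<lambda>v. x v - x (q (p v))) \<in> Hom V W"
  by (rule Hom_minus[OF W _ Hom_comp[OF qp _ V]])

lemma qrem_Hom: "x \<in> Hom V W \<Longrightarrow> (\<lambda>v. q (x v - x (q (p v)))) \<in> Hom V V"
  by (rule Hom_comp[OF rem_Hom q W])

lemma cut_Hom: "x \<in> Hom V W \<Longrightarrow> cut x \<in> Hom V W"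
  unfolding cut_def by (rule Hom_minus[OF W rem_Hom Hom_comp[OF qrem_Hom p V]])

lemma chart_Hom: "x \<in> Hom V W \<Longrightarrow> chart x \<in> Hom V W"
  unfolding chart_def by (rule Hom_plus[OF W Hom_comp[OF qp _ V] Hom_comp[OF qrem_Hom _ V]])

lemma tangD:
  assumes "x \<in> tang"
  shows "p (q (x v - x (q (p v)))) = x v - x (q (p v))"
proof -
  have "cut x v = 0" using assms by (simp add: tang_def)
  then show ?thesis unfolding cut_def by (simp only: right_minus_eq)
qed

lemma tangI:
  assumes "x \<in> Hom V W" "\<And>v. v \<in> rep_space V \<Longrightarrow> p (q (x v - x (q (p v)))) = x v - x (q (p v))"
  shows "x \<in> tang"
proof -
  have "cut x = 0"
    by (rule Hom_eqI[OF cut_Hom[OF assms(1)] Hom_zero_mem[OF W]]) (simp add: cut_def assms(2))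
  then show ?thesis using assms(1) by (simp add: tang_def)
qed

lemma cut_linear: "linear_on (Hom V W) (hom_scale W) (hom_scale W) cut"
  unfolding linear_on_def
proof (intro conjI ballI allI)
  fix x y assume x: "x \<in> Hom V W" and y: "y \<in> Hom V W"
  show "cut (x + y) = cut x + cut y"
    by (rule Hom_eqI[OF cut_Hom[OF E_add[OF x y]] E_add[OF cut_Hom[OF x] cut_Hom[OF y]]])
      (simp add: cut_def Hom_rules[OF x V] Hom_rules[OF y V] pq_rules algebra_simps)
next
  fix c x assume x: "x \<in> Hom V W"
  show "cut (hom_scale W c x) = hom_scale W c (cut x)"
    by (rule Hom_eqI[OF cut_Hom[OF E_scale[OF x]] E_scale[OF cut_Hom[OF x]]])
      (simp add: cut_def hom_scale_def Hom_rules[OF x V] pq_rules w.scale_right_diff_distrib)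
qed

lemma tang_subspace: "E.subspace tang"
  unfolding tang_def by (rule E.self.subspace_kernel_on[OF cut_linear E.sE])

lemma tang_fdim: "E.fdim tang"
  by (rule E.fdim_sub(1)[OF E.fdE tang_subspace]) (auto simp: tang_def)

lemma tang0_subspace: "E.subspace tang0"
proof -
  let ?r = "\<lambda>x v. p (q (x (q (p v))))"
  have r: "?r x \<in> Hom V W" if "x \<in> Hom V W" for x
    by (rule Hom_comp[OF Hom_comp[OF Hom_comp[OF qp that V] q W] p V])
  have l: "linear_on tang (hom_scale W) (hom_scale W) ?r"
    unfolding linear_on_def
  proof (intro conjI ballI allI)
    fix x y assume "x \<in> tang" "y \<in> tang"
    then have x: "x \<in> Hom V W" and y: "y \<in> Hom V W" by (auto simp: tang_def)
    show "?r (x + y) = ?r x + ?r y"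
      by (rule Hom_eqI[OF r[OF E_add[OF x y]] E_add[OF r[OF x] r[OF y]]])
        (simp add: Hom_rules[OF x V] Hom_rules[OF y V] pq_rules)
  next
    fix c x assume "x \<in> tang"
    then have x: "x \<in> Hom V W" by (simp add: tang_def)
    show "?r (hom_scale W c x) = hom_scale W c (?r x)"
      by (rule Hom_eqI[OF r[OF E_scale[OF x]] E_scale[OF r[OF x]]])
        (simp add: hom_scale_def Hom_rules[OF x V] pq_rules)
  qed
  have iff: "(\<forall>v\<in>rep_space V. ?r x v = 0) \<longleftrightarrow> ?r x = 0" if "x \<in> tang" for x
  proof
    show "?r x = 0" if h: "\<forall>v\<in>rep_space V. ?r x v = 0"
      by (rule Hom_eqI[OF r[OF tang_Hom[OF \<open>x \<in> tang\<close>]] Hom_zero_mem[OF W]]) (use bspec[OF h] in simp)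
    show "\<forall>v\<in>rep_space V. ?r x v = 0" if "?r x = 0" using fun_cong[OF that] by simp
  qed
  have "tang0 = {x\<in>tang. ?r x = 0}" unfolding tang0_def using iff by (intro Collect_cong conj_cong refl)
  then show ?thesis using E.self.subspace_kernel_on[OF l tang_subspace] by simp
qed

lemma p_tang: "p \<in> tang"
  by (rule tangI[OF p]) (simp add: pq_rules)

lemma chart_p: "chart p = p"
  by (rule Hom_eqI[OF chart_Hom[OF p] p]) (simp add: chart_def pq_rules)

text \<open>Invertibility of \<open>1 + (x - p) q\<close>, the left factor of the chart.\<close>

abbreviation good :: "('v \<Rightarrow> 'w) \<Rightarrow> bool"
  where "good x \<equiv> nondeg W (\<lambda>w. rep_id W w + (x (q w) - p (q w)))"

lemma good_p: "good p" by simp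

lemma left_Hom: "x \<in> Hom V W \<Longrightarrow> (\<lambda>w. rep_id W w + (x (q w) - p (q w))) \<in> Hom W W"
  by (rule Hom_plus[OF W rep_id_Hom[OF W] Hom_minus[OF W Hom_comp[OF q _ V] Hom_comp[OF q p V]]])

text \<open>
  \<open>chart x\<close> factors as \<open>(1 + (x - p) q) p (1 + q x (1 - qp))\<close>, where the right factor is unipotent.
\<close>

lemma chart_in_X:
  assumes x: "x \<in> tang" and g: "good x"
  shows "chart x \<in> X"
proof -
  note xE = tang_Hom[OF x]
  let ?a = "\<lambda>w. rep_id W w + (x (q w) - p (q w))"
  let ?b = "\<lambda>v. rep_id V v + q (x v - x (q (p v)))"
  have a: "?a \<in> Hom W W" by (rule left_Hom[OF xE])
  have b: "?b \<in> Hom V V"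
    by (rule Hom_plus[OF V rep_id_Hom[OF V] qrem_Hom[OF xE]])
  have nb: "nondeg V ?b"
  proof (intro ballI impI)
    fix v assume v: "v \<in> rep_space V" "?b v = 0"
    define z where "z = q (x v - x (q (p v)))"
    have zV: "z \<in> rep_space V" unfolding z_def by (rule Hom_in[OF qrem_Hom[OF xE] v(1)])
    have "v + z = 0" using v by (simp add: z_def)
    then have vz: "v = 0 - z" by (simp add: eq_neg_iff_add_eq_0)
    \<comment> \<open>\<open>v = - z\<close> lies in the image of \<open>q p\<close>, where
      \<open>1 - q p\<close> vanishes; this forces \<open>z = 0\<close>.\<close>
    have "q (p (0 - z)) = q (p 0) - q (p z)" by (rule Hom_rules(3)[OF qp V clV(1) zV])
    also have "\<dots> = 0 - z" using Hom_rules(5)[OF qp V] by (simp add: z_def qpq)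
    finally have "q (p v) = v" by (simp only: vz)
    then have "z = 0" using Hom_rules(5)[OF q W] by (simp add: z_def)
    then show "v = 0" using vz by simp
  qed
  have "chart x = (\<lambda>v. ?a (p (?b v)))"
  proof (rule Hom_eqI[OF chart_Hom[OF xE] Hom_comp[OF Hom_comp[OF b p V] a W]])
    fix v assume v: "v \<in> rep_space V"
    let ?z = "x v - x (q (p v))"
    have zW: "?z \<in> rep_space W" using v by (simp add: Hom_rules[OF xE V] pq_rules)
    have pb: "p (?b v) = p v + ?z"
      by (simp only: rep_id_in[OF v] Hom_rules(2)[OF p V v Hom_rules(1)[OF q W zW]] tangD[OF x])
    have "p v + ?z \<in> rep_space W" using v zW by (simp add: pq_rules)
    moreover have "q (p v + ?z) = q (p v) + q ?z" by (rule Hom_rules(2)[OF q W _ zW]) (use v in \<open>simp add: pq_rules\<close>)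
    moreover have "x (q (p v) + q ?z) = x (q (p v)) + x (q ?z)"
      by (rule Hom_rules(2)[OF xE V]) (use v zW in \<open>simp_all add: pq_rules\<close>)
    moreover have "p (q (p v) + q ?z) = p v + ?z"
      by (simp only: Hom_rules(2)[OF p V Hom_rules(1)[OF qp V v] Hom_rules(1)[OF q W zW]] tangD[OF x] pqp)
    ultimately show "chart x v = ?a (p (?b v))" unfolding pb by (simp only: chart_def rep_id_in add_diff_cancel_left' diff_add_cancel) simp
  qed
  then show ?thesis using X_comp[OF pX a g b nb] by simp
qed

text \<open>The chart is quadratic, so it takes lines to parabolas: \<open>c1\<close> is its
  derivative at \<open>x\<close> in direction \<open>h\<close>, and \<open>c2\<close> its quadratic
  part at \<open>h\<close>.\<close>

lemma chart_line:
  assumes x: "x \<in> tang" and h: "h \<in> tang"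
  obtains c1 c2 where "c1 \<in> Hom V W" "c2 \<in> Hom V W"
    "\<forall>t. chart (x + hom_scale W t h) = chart x + hom_scale W t c1 + hom_scale W (t * t) c2"
proof -
  note xE = tang_Hom[OF x] and hE = tang_Hom[OF h]
  define c1 where "c1 = (\<lambda>v. h (q (p v)) + h (q (x v - x (q (p v)))) + x (q (h v - h (q (p v)))))"
  define c2 where "c2 = (\<lambda>v. h (q (h v - h (q (p v)))))"
  note r = qrem_Hom[OF xE] qrem_Hom[OF hE]
  have c: "c1 \<in> Hom V W" "c2 \<in> Hom V W"
    unfolding c1_def c2_def
    by (rule Hom_plus[OF W Hom_plus[OF W Hom_comp[OF qp hE V] Hom_comp[OF r(1) hE V]] Hom_comp[OF r(2) xE V]])
      (rule Hom_comp[OF r(2) hE V])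
  have "chart (x + hom_scale W t h) = chart x + hom_scale W t c1 + hom_scale W (t * t) c2" for t
  proof (rule Hom_eqI)
    show "chart (x + hom_scale W t h) \<in> Hom V W" by (intro chart_Hom E_add E_scale xE hE)
    show "chart x + hom_scale W t c1 + hom_scale W (t * t) c2 \<in> Hom V W" by (intro chart_Hom E_add E_scale xE c)
    fix v assume v: "v \<in> rep_space V"
    show "chart (x + hom_scale W t h) v = (chart x + hom_scale W t c1 + hom_scale W (t * t) c2) v"
      using v by (simp add: chart_def c1_def c2_def hom_scale_def Hom_rules[OF xE V] Hom_rules[OF hE V] pq_rules
        w.scale_right_distrib w.scale_right_diff_distrib)
  qed
  then show ?thesis using that c by blast
qed

text \<open>Membership in \<open>U\<close> is witnessed by one polynomial function that is nonzero
  at \<open>t = 0\<close>, and \<open>good\<close> fails for finitely many \<open>t\<close>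
  only.\<close>

lemma chart_line_finite:
  assumes U: "openin Z U" and x: "x \<in> tang" "good x" "chart x \<in> U" and h: "h \<in> tang"
  shows "finite {t. \<not> (good (x + hom_scale W t h) \<and> chart (x + hom_scale W t h) \<in> U)}"
proof -
  note xE = tang_Hom[OF x(1)] and hE = tang_Hom[OF h]
  obtain P where P: "P \<subseteq> polys" "U = Hom V W - zero_locus (Hom V W) P"
    using U unfolding openin_zariski by (elim exE conjE)
  obtain f where f: "f \<in> P" "f (chart x) \<noteq> 0"
    using x(3) unfolding P(2) zero_locus_def by blast
  obtain c1 c2 where c: "c1 \<in> Hom V W" "c2 \<in> Hom V W"
    "\<forall>t. chart (x + hom_scale W t h) = chart x + hom_scale W t c1 + hom_scale W (t * t) c2"
    by (rule chart_line[OF x(1) h])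
  note c3 = spec[OF c(3)]
  have fP: "f \<in> polys" using f(1) P(1) by blast
  obtain Q where Q: "\<forall>t. f (chart x + hom_scale W t c1 + hom_scale W (t * t) c2) = poly Q t"
    using E.curve_poly[OF chart_Hom[OF xE] c(1,2) fP] by (elim exE conjE)
  have "poly Q 0 \<noteq> 0" using spec[OF Q, of 0] f(2) by simp
  then have "Q \<noteq> 0" by auto
  then have f1: "finite {t. poly Q t = 0}" by (rule poly_roots_finite)
  have hq: "(\<lambda>w. h (q w)) \<in> Hom W W" by (rule Hom_comp[OF q hE V])
  have f2: "finite {t. \<not> nondeg W (\<lambda>w. (rep_id W w + (x (q w) - p (q w))) + rep_scale W t (h (q w)))}"
    by (rule finite_degenerate[OF W left_Hom[OF xE] x(2) hq])
  have e: "rep_id W w + ((x + hom_scale W t h) (q w) - p (q w))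
      = (rep_id W w + (x (q w) - p (q w))) + rep_scale W t (h (q w))" for w t
    by (simp add: hom_scale_def)
  show ?thesis
  proof (rule finite_subset[OF _ finite_UnI[OF f1 f2]], rule subsetI, rule ccontr)
    fix t assume t: "t \<in> {t. \<not> (good (x + hom_scale W t h) \<and> chart (x + hom_scale W t h) \<in> U)}"
      and n: "t \<notin> {t. poly Q t = 0} \<union> {t. \<not> nondeg W (\<lambda>w. (rep_id W w + (x (q w) - p (q w))) + rep_scale W t (h (q w)))}"
    have "nondeg W (\<lambda>w. (rep_id W w + (x (q w) - p (q w))) + rep_scale W t (h (q w)))" and Qt: "poly Q t \<noteq> 0"
      using n by blast+
    then have g: "good (x + hom_scale W t h)" unfolding e by blast
    have "f (chart (x + hom_scale W t h)) \<noteq> 0" unfolding c3 using Qt spec[OF Q, of t] by simp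
    moreover have "chart (x + hom_scale W t h) \<in> Hom V W" by (intro chart_Hom E_add E_scale xE hE)
    ultimately have "chart (x + hom_scale W t h) \<in> U"
      unfolding P(2) zero_locus_def using f(1) by blast
    then show False using t g by blast
  qed
qed

text \<open>The image of \<open>p + F\<close> under the chart, restricted to points at which the
  chart is known to land in \<open>X\<close> and in \<open>U\<close>. The closures of slices along a
  flag will form the chain for the lower bound.\<close>

definition slice :: "('v \<Rightarrow> 'w) set \<Rightarrow> ('v \<Rightarrow> 'w) set \<Rightarrow> ('v \<Rightarrow> 'w) set"
  where "slice U F = {chart x | x. x - p \<in> F \<and> good x \<and> chart x \<in> U}"

lemma slice_mem: "x - p \<in> F \<Longrightarrow> good x \<Longrightarrow> chart x \<in> U \<Longrightarrow> chart x \<in> slice U F"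
  unfolding slice_def by blast

lemma sliceE:
  assumes "y \<in> slice U F"
  obtains x where "y = chart x" "x - p \<in> F" "good x" "chart x \<in> U"
  using assms unfolding slice_def mem_Collect_eq by (elim exE conjE)

lemma near_tang: "F \<subseteq> tang \<Longrightarrow> x - p \<in> F \<Longrightarrow> x \<in> tang"
  using E.subspace_add[OF tang_subspace p_tang, of "x - p"] by auto

lemma slice_sub: "F \<subseteq> tang \<Longrightarrow> slice U F \<subseteq> X \<inter> U"
  by (auto elim!: sliceE intro: chart_in_X near_tang)

lemma slice_irreducible:
  assumes U: "openin Z U" "p \<in> U" and F: "E.subspace F" "F \<subseteq> tang"
  shows "irreducible_space (subtopology Z (slice U F))"
proof (rule E.irreducible_by_curves)
  show "slice U F \<subseteq> Hom V W" using slice_sub[OF F(2)] X_Hom by blast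
  have "chart p \<in> slice U F"
    by (rule slice_mem) (use E.subspace_0[OF F(1)] good_p U(2) chart_p in simp_all)
  then show "slice U F \<noteq> {}" by blast
  fix y y' assume "y \<in> slice U F" "y' \<in> slice U F"
  obtain x where x: "y = chart x" "x - p \<in> F" "good x" "chart x \<in> U" by (rule sliceE[OF \<open>y \<in> slice U F\<close>])
  obtain x' where x': "y' = chart x'" "x' - p \<in> F" "good x'" "chart x' \<in> U" by (rule sliceE[OF \<open>y' \<in> slice U F\<close>])
  have xt: "x \<in> tang" by (rule near_tang[OF F(2) x(2)])
  have "(x' - p) - (x - p) \<in> F" by (rule E.subspace_diff[OF F(1) x'(2) x(2)])
  then have h: "x' - x \<in> F" by simp
  have ht: "x' - x \<in> tang" using h F(2) by blast
  obtain c1 c2 where c: "c1 \<in> Hom V W" "c2 \<in> Hom V W"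
    "\<forall>t. chart (x + hom_scale W t (x' - x)) = chart x + hom_scale W t c1 + hom_scale W (t * t) c2"
    by (rule chart_line[OF xt ht])
  note c3 = spec[OF c(3)]
  have "finite {t. chart x + hom_scale W t c1 + hom_scale W (t * t) c2 \<notin> slice U F}"
  proof (rule finite_subset[OF _ chart_line_finite[OF U(1) xt x(3,4) ht]], rule subsetI, rule ccontr)
    fix t assume t: "t \<in> {t. chart x + hom_scale W t c1 + hom_scale W (t * t) c2 \<notin> slice U F}"
      and n: "t \<notin> {t. \<not> (good (x + hom_scale W t (x' - x)) \<and> chart (x + hom_scale W t (x' - x)) \<in> U)}"
    have "(x - p) + hom_scale W t (x' - x) \<in> F"
      by (rule E.subspace_add[OF F(1) x(2) E.subspace_scale[OF F(1) h]])
    moreover have "(x - p) + hom_scale W t (x' - x) = (x + hom_scale W t (x' - x)) - p" by (simp add: algebra_simps)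
    ultimately have "(x + hom_scale W t (x' - x)) - p \<in> F" by (simp only:)
    then have "chart (x + hom_scale W t (x' - x)) \<in> slice U F"
      by (rule slice_mem) (use n in blast)+
    then show False using t unfolding c3 by blast
  qed
  moreover have "y' = chart x + hom_scale W 1 c1 + hom_scale W (1 * 1) c2"
    unfolding c3[symmetric] x'(1) by simp
  ultimately show "\<exists>a b c s. a \<in> Hom V W \<and> b \<in> Hom V W \<and> c \<in> Hom V W \<and> y = a \<and>
      y' = a + hom_scale W s b + hom_scale W (s * s) c \<and>
      finite {t. a + hom_scale W t b + hom_scale W (t * t) c \<notin> slice U F}"
    using chart_Hom[OF tang_Hom[OF xt]] c(1,2) x(1) by (intro exI conjI) (assumption | rule refl)+
qed

text \<open>With \<open>y = x (1 - q p)\<close> the defect is \<open>p q x q y - y\<close>. It has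
  values in the image of \<open>p\<close> and vanishes on the image of \<open>q p\<close>, which
  puts it into \<open>tang0\<close>. If \<open>p q x q p = p\<close>, then
  \<open>p q x q y = p q y = y\<close> and the defect is 0.\<close>

lemma chart_defect:
  assumes x: "x \<in> tang"
  shows "chart x - cut (chart x) - x \<in> tang0"
    and "x - p \<in> tang0 \<Longrightarrow> chart x - cut (chart x) - x = 0"
proof -
  note xE = tang_Hom[OF x]
  define y where "y = (\<lambda>v. x v - x (q (p v)))"
  have yE: "y \<in> Hom V W" unfolding y_def by (rule rem_Hom[OF xE])
  have pqy: "p (q (y v)) = y v" for v using tangD[OF x] by (simp add: y_def)
  have ye: "y (q (p v)) = 0" for v by (simp add: y_def pqp)
  let ?d = "\<lambda>v. p (q (x (q (y v)))) - y v"
  have d: "?d \<in> Hom V W"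
    by (rule Hom_minus[OF W Hom_comp[OF Hom_comp[OF Hom_comp[OF Hom_comp[OF yE q W] xE V] q W] p V] yE])
  have ch: "chart x = (\<lambda>v. x (q (p v)) + x (q (y v)))" by (simp add: chart_def y_def)
  have q0: "q 0 = 0" "x 0 = 0" "p 0 = 0" using Hom_rules(5)[OF q W] Hom_rules(5)[OF xE V] Hom_rules(5)[OF p V] by auto
  have eq: "chart x - cut (chart x) - x = ?d"
  proof (rule Hom_eqI[OF _ d])
    show "chart x - cut (chart x) - x \<in> Hom V W" by (intro E_diff chart_Hom cut_Hom xE)
    fix v assume v: "v \<in> rep_space V"
    have c: "chart x v - chart x (q (p v)) = x (q (y v))"
      unfolding ch by (simp add: pqp ye q0)
    have "x v = x (q (p v)) + y v" by (simp add: y_def)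
    then show "(chart x - cut (chart x) - x) v = ?d v"
      unfolding fun_diff_def cut_def c by (simp add: ch)
  qed
  have dt: "?d \<in> tang"
    by (rule tangI[OF d]) (simp add: ye q0 Hom_rules[OF yE V] Hom_rules[OF xE V] pq_rules pqy)
  show "chart x - cut (chart x) - x \<in> tang0"
    unfolding eq tang0_def using dt by (simp add: ye q0)
  show "chart x - cut (chart x) - x = 0" if "x - p \<in> tang0"
  proof -
    have pqx: "p (q (x (q (p v)))) = p v" if v: "v \<in> rep_space V" for v
    proof -
      have "p (q ((x - p) (q (p v)))) = 0" using \<open>x - p \<in> tang0\<close> v by (simp add: tang0_def)
      moreover have "p (q ((x - p) (q (p v)))) = p (q (x (q (p v)))) - p v"
        using v by (simp add: Hom_rules[OF xE V] pq_rules)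
      ultimately show ?thesis by simp
    qed
    have "?d v = 0" if v: "v \<in> rep_space V" for v
    proof -
      have yv: "q (y v) \<in> rep_space V" using v by (simp add: Hom_rules[OF yE V] pq_rules)
      have "p (q (x (q (p (q (y v)))))) = p (q (y v))" by (rule pqx[OF yv])
      then show ?thesis by (simp add: pqy)
    qed
    then have "?d = 0" by (intro Hom_eqI[OF d Hom_zero_mem[OF W]]) simp
    then show ?thesis using eq by simp
  qed
qed

text \<open>A functional \<open>l\<close> that vanishes on \<open>F\<close> but not on
  \<open>e \<in> F'\<close> gives the affine function \<open>l (y - cut y) - l p\<close>. At
  \<open>chart x\<close> its value is \<open>l (x - p)\<close> plus the value of \<open>l\<close> at
  the defect, and the latter is 0: there is no defect if \<open>F'\<close> lies in
  \<open>tang0\<close>, and \<open>l\<close> kills it if \<open>tang0\<close> lies in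
  \<open>F\<close>.\<close>

lemma slice_separated:
  assumes U: "openin Z U" "p \<in> U" and F: "E.subspace F" "F \<subset> F'" "F' \<subseteq> tang"
    and sF': "E.subspace F'"
    and ad: "F' \<subseteq> tang0 \<or> tang0 \<subseteq> F"
  shows "\<exists>C. closedin Z C \<and> slice U F \<subseteq> C \<and> \<not> slice U F' \<subseteq> C"
proof -
  interpret c: cvec2 "hom_scale W :: complex \<Rightarrow> ('v \<Rightarrow> 'w) \<Rightarrow> _" "(*)" by (rule E.cvec2_complex)
  obtain e where e: "e \<in> F'" "e \<notin> F" using F(2) by blast
  have et: "e \<in> tang" and Ft: "F \<subseteq> tang" using e F(2,3) by auto
  obtain l where l: "clinear (hom_scale W) (*) l" "l e = 1" "\<And>y. y \<in> F \<Longrightarrow> l y = 0"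
    using E.separating_functional[OF tang_fdim F(1) Ft et e(2)] by metis
  let ?f = "\<lambda>y. l (y - cut y) + - l p"
  have "linear_on (Hom V W) (hom_scale W) (*) (\<lambda>y. l (y - cut y))"
  proof -
    have cl: "cut (x + y) = cut x + cut y" if "x \<in> Hom V W" "y \<in> Hom V W" for x y
      by (rule E.self.linear_on_add[OF cut_linear that])
    have cs: "cut (hom_scale W c x) = hom_scale W c (cut x)" if "x \<in> Hom V W" for x c
      by (rule E.self.linear_on_scale[OF cut_linear that])
    show ?thesis
      unfolding linear_on_def
      by (auto simp: cl cs c.linear_add[OF l(1)] c.linear_diff[OF l(1)] c.linear_scale[OF l(1)] algebra_simps)
  qed
  then have f: "?f \<in> polys"
    by (intro poly_functions.add poly_functions.linear poly_functions.const)
  have val: "?f (chart x) = l (x - p)" if x: "x - p \<in> F'" for x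
  proof -
    have xt: "x \<in> tang" by (rule near_tang[OF F(3) x])
    let ?d = "chart x - cut (chart x) - x"
    have "l ?d = 0"
    proof (rule disjE[OF ad])
      assume "F' \<subseteq> tang0"
      then have "?d = 0" using chart_defect(2)[OF xt] x by blast
      then show ?thesis using c.linear_0[OF l(1)] by simp
    next
      assume "tang0 \<subseteq> F"
      then show ?thesis using chart_defect(1)[OF xt] l(3) by blast
    qed
    then show ?thesis by (simp add: c.linear_diff[OF l(1)])
  qed
  let ?C = "zero_locus (Hom V W) {?f}"
  have "closedin Z ?C" unfolding closedin_zariski using f by (intro exI[of _ "{?f}"] conjI refl) simp
  moreover have "slice U F \<subseteq> ?C"
  proof
    fix y assume "y \<in> slice U F"
    then obtain x where x: "y = chart x" "x - p \<in> F" "good x" "chart x \<in> U" by (rule sliceE)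
    have "chart x \<in> Hom V W" by (rule chart_Hom[OF tang_Hom[OF near_tang[OF Ft x(2)]]])
    moreover have "?f (chart x) = 0" using val[OF subsetD[OF psubset_imp_subset[OF F(2)] x(2)]] l(3)[OF x(2)] by (simp only:)
    ultimately show "y \<in> ?C" unfolding zero_locus_def x(1) by blast
  qed
  moreover have "\<not> slice U F' \<subseteq> ?C"
  proof
    assume sub: "slice U F' \<subseteq> ?C"
    have "finite {t. \<not> (good (p + hom_scale W t e) \<and> chart (p + hom_scale W t e) \<in> U)}"
      by (rule chart_line_finite[OF U(1) p_tang good_p _ et]) (simp add: chart_p U(2))
    then have "finite (insert 0 {t. \<not> (good (p + hom_scale W t e) \<and> chart (p + hom_scale W t e) \<in> U)})" by (rule finite.insertI)
    \<comment> \<open>A nonzero parameter off the exceptional set gives a point of the slice in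
      direction \<open>e\<close>, where the affine function takes the value
      \<open>t\<close>.\<close>
    from ex_new_if_finite[OF infinite_UNIV_char_0 this]
    obtain t where n: "t \<notin> insert 0 {t. \<not> (good (p + hom_scale W t e) \<and> chart (p + hom_scale W t e) \<in> U)}" by (rule exE)
    then have n: "t \<noteq> 0 \<and> (good (p + hom_scale W t e) \<and> chart (p + hom_scale W t e) \<in> U)"
      unfolding insert_iff mem_Collect_eq de_Morgan_disj not_not .
    note t = conjunct1[OF n] conjunct2[OF n]
    let ?x = "p + hom_scale W t e"
    have x: "?x - p \<in> F'" using E.subspace_scale[OF sF' e(1), of t] by (simp only: add_diff_cancel_left')
    have "chart ?x \<in> ?C" by (rule subsetD[OF sub slice_mem[OF x conjunct1[OF t(2)] conjunct2[OF t(2)]]])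
    then have "?f (chart ?x) = 0" by (simp only: zero_locus_def mem_Collect_eq ball_simps simp_thms)
    then have "l (hom_scale W t e) = 0" unfolding val[OF x] by (simp only: add_diff_cancel_left')
    then show False using c.linear_scale[OF l(1), of t e] l(2) t(1) by simp
  qed
  ultimately show ?thesis by blast
qed

end

section \<open>Dimension and tangent space at a point\<close>

context rank_point
begin

lemma slice_mono: "F \<subseteq> F' \<Longrightarrow> slice U F \<subseteq> slice U F'"
  unfolding slice_def by blast

lemma krull_dim_ge:
  assumes U: "openin Z U" "p \<in> U"
  shows "enat (E.dim tang) \<le> krull_dim (subtopology Z (X \<inter> U))"
proof -
  have t0: "tang0 \<subseteq> tang" by (auto simp: tang0_def)
  have f0: "E.fdim tang0" by (rule E.fdim_sub(1)[OF tang_fdim tang0_subspace t0])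
  let ?a = "E.dim tang0" and ?d = "E.dim tang"
  have ad: "?a \<le> ?d" by (rule E.fdim_sub(2)[OF tang_fdim tang0_subspace t0])
  have z: "{0} \<subseteq> tang0" using E.subspace_0[OF tang0_subspace] by blast
  obtain F1 where F1: "F1 0 = {0}" "F1 (?a - E.dim {0}) = tang0"
    "\<forall>j. E.subspace (F1 j) \<and> {0} \<subseteq> F1 j \<and> F1 j \<subseteq> tang0" "\<forall>j<?a - E.dim {0}. F1 j \<subset> F1 (Suc j)"
    by (rule E.flag_exists[OF f0 E.subspace_single_0 z])
  obtain F2 where F2: "F2 0 = tang0" "F2 (?d - ?a) = tang"
    "\<forall>j. E.subspace (F2 j) \<and> tang0 \<subseteq> F2 j \<and> F2 j \<subseteq> tang" "\<forall>j<?d - ?a. F2 j \<subset> F2 (Suc j)"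
    by (rule E.flag_exists[OF tang_fdim tang0_subspace t0])
  have F1a: "F1 ?a = tang0" "\<forall>j<?a. F1 j \<subset> F1 (Suc j)" using F1(2,4) by simp_all
  \<comment> \<open>The flag up to \<open>tang0\<close> followed by the one from
    \<open>tang0\<close> to \<open>tang\<close>. No step crosses \<open>tang0\<close>, as the
    separation of slices requires.\<close>
  define G where "G j = (if j < ?a then F1 j else F2 (j - ?a))" for j
  have G: "E.subspace (G j) \<and> G j \<subseteq> tang" for j
    using spec[OF F1(3), of j] spec[OF F2(3), of "j - ?a"] t0 unfolding G_def by (simp, blast)
  have G': "G j \<subset> G (Suc j) \<and> (G (Suc j) \<subseteq> tang0 \<or> tang0 \<subseteq> G j)" if j: "j < ?d" for j
  proof (cases "j < ?a")
    case True
    have "G (Suc j) = F1 (Suc j)"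
    proof (cases "Suc j < ?a")
      case False
      then have e: "Suc j = ?a" using True by simp
      then have "G (Suc j) = tang0" by (simp add: G_def F2(1))
      then show ?thesis using F1a(1) e by simp
    qed (simp add: G_def)
    then show ?thesis using F1a(2) spec[OF F1(3), of "Suc j"] True by (simp add: G_def)
  next
    case False
    then have "Suc j - ?a = Suc (j - ?a)" "j - ?a < ?d - ?a" using j by auto
    then show ?thesis using F2(4) spec[OF F2(3), of "j - ?a"] False by (simp add: G_def)
  qed
  let ?T = "subtopology Z (X \<inter> U)"
  have sub: "slice U (G j) \<subseteq> X \<inter> U" for j by (rule slice_sub[OF conjunct2[OF G]])
  show ?thesis
  proof (rule krull_dim_lower[where S = "\<lambda>j. slice U (G j)"])
    show "slice U (G j) \<subseteq> topspace ?T" for j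
      using sub[of j] by (auto simp: topspace_zariski X_def)
    show "irreducible_space (subtopology ?T (slice U (G j)))" for j
      using slice_irreducible[OF U conjunct1[OF G] conjunct2[OF G], of j] sub[of j]
      by (simp add: subtopology_subtopology Int_absorb1)
    fix j assume j: "j < ?d"
    show "slice U (G j) \<subseteq> slice U (G (Suc j))" by (rule slice_mono) (use G'[OF j] in blast)
    obtain C where C: "closedin Z C" "slice U (G j) \<subseteq> C" "\<not> slice U (G (Suc j)) \<subseteq> C"
      using slice_separated[OF U conjunct1[OF G] conjunct1[OF G'[OF j]] conjunct2[OF G] conjunct1[OF G] conjunct2[OF G'[OF j]]]
      by (elim exE conjE)
    have "closedin ?T (C \<inter> (X \<inter> U))" unfolding closedin_subtopology by (intro exI[of _ C] conjI C(1) refl)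
    then show "\<exists>C. closedin ?T C \<and> slice U (G j) \<subseteq> C \<and> \<not> slice U (G (Suc j)) \<subseteq> C"
      by (rule exI[of _ "C \<inter> (X \<inter> U)", OF conjI]) (use C(2,3) sub[of j] in blast)
  qed
qed

text \<open>The chart equation is solved for \<open>x\<close>. On the image of \<open>q p\<close> it
  has to agree with \<open>y\<close>, and the rest is \<open>p M q y - p\<close>, where
  \<open>M\<close> inverts \<open>q y\<close> on the image of \<open>q p\<close>. The second
  condition says that \<open>y\<close> has no larger image than its restriction to the image of
  \<open>q p\<close>.\<close>

lemma in_chart:
  assumes y: "y \<in> Hom V W" and M: "M \<in> Hom V V"
    and inv: "\<And>v. v \<in> rep_space V \<Longrightarrow> M (q (y (q (p v)))) = q (p v)"
    and im: "\<And>v. v \<in> rep_space V \<Longrightarrow> \<exists>u\<in>rep_space V. y v = y (q (p u))"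
  shows "y \<in> chart ` tang"
proof -
  define x where "x = (\<lambda>v. y (q (p v)) + (p (M (q (y v))) - p v))"
  have x: "x \<in> Hom V W"
    unfolding x_def
    by (rule Hom_plus[OF W Hom_comp[OF qp y V] Hom_minus[OF W Hom_comp[OF Hom_comp[OF Hom_comp[OF y q W] M V] p V] p]])
  have xe: "x (q (p v)) = y (q (p v))" if "v \<in> rep_space V" for v
    unfolding x_def using inv[OF that] by (simp add: pqp)
  have rem: "x v - x (q (p v)) = p (M (q (y v))) - p v" if v: "v \<in> rep_space V" for v
    unfolding xe[OF v] by (simp add: x_def)
  have Mv: "M (q (y v)) \<in> rep_space V" if "v \<in> rep_space V" for v
    by (rule Hom_in[OF Hom_comp[OF Hom_comp[OF y q W] M V] that])
  have "x \<in> tang"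
    by (rule tangI[OF x]) (simp add: rem Mv pq_rules)
  moreover have "chart x = y"
  proof (rule Hom_eqI[OF chart_Hom[OF x] y])
    fix v assume v: "v \<in> rep_space V"
    obtain u where u: "u \<in> rep_space V" "y v = y (q (p u))" using im[OF v] by blast
    have "q (x v - x (q (p v))) = q (p (M (q (y v)) - v))"
      unfolding rem[OF v] using v Mv[OF v] by (simp add: pq_rules)
    then have "chart x v = y (q (p v)) + y (q (p (M (q (y v)) - v)))"
      unfolding chart_def using xe v Mv[OF v] by (simp add: clV)
    also have "\<dots> = y (q (p (M (q (y v)))))"
      using v Mv[OF v] by (simp add: Hom_rules[OF y V] pq_rules)
    also have "\<dots> = y v" unfolding u(2) inv[OF u(1)] by (simp add: pqp)
    finally show "chart x v = y v" .
  qed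
  ultimately show ?thesis by blast
qed

text \<open>\<open>A\<close> and \<open>B\<close> are the blocks \<open>q a p\<close> and
  \<open>q p b q p\<close> on the image of \<open>q p\<close>, completed by the identity on the
  kernel of \<open>p\<close>. If both are invertible, the product of their inverses serves as
  \<open>M\<close> for \<open>a p b\<close>.\<close>

lemma near_chart:
  assumes a: "a \<in> Hom W W" and b: "b \<in> Hom V V"
    and A: "A \<in> Hom V V" "nondeg V A" "\<And>v. v \<in> rep_space V \<Longrightarrow> A v = q (a (p v)) + (v - q (p v))"
    and B: "B \<in> Hom V V" "nondeg V B" "\<And>v. v \<in> rep_space V \<Longrightarrow> B v = q (p (b (q (p v)))) + (v - q (p v))"
  shows "(\<lambda>v. a (p (b v))) \<in> chart ` tang"
proof -
  obtain A' where A': "A' \<in> Hom V V" "\<And>v. v \<in> rep_space V \<Longrightarrow> A' (A v) = v" "\<And>v. v \<in> rep_space V \<Longrightarrow> A (A' v) = v"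
    using nondeg_inverse[OF V A(1,2)] by metis
  obtain B' where B': "B' \<in> Hom V V" "\<And>v. v \<in> rep_space V \<Longrightarrow> B' (B v) = v" "\<And>v. v \<in> rep_space V \<Longrightarrow> B (B' v) = v"
    using nondeg_inverse[OF V B(1,2)] by metis
  note r = Hom_rules[OF a W] Hom_rules[OF b V] pq_rules
  have Ae: "A (q (p v)) = q (a (p v))" if "v \<in> rep_space V" for v
    using that A(3)[of "q (p v)"] by (simp add: r)
  have Be: "B (q (p v)) = q (p (b (q (p v))))" "q (p (B v)) = q (p (b (q (p v))))" if "v \<in> rep_space V" for v
    using that B(3)[of "q (p v)"] B(3)[of v] by (simp_all add: r)
  show ?thesis
  proof (rule in_chart[where M = "\<lambda>v. B' (A' v)"])
    show "(\<lambda>v. a (p (b v))) \<in> Hom V W" by (rule Hom_comp[OF Hom_comp[OF b p V] a W])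
    show "(\<lambda>v. B' (A' v)) \<in> Hom V V" by (rule Hom_comp[OF A'(1) B'(1) V])
    fix v assume v: "v \<in> rep_space V"
    have ev: "q (p v) \<in> rep_space V" using v by (simp add: r)
    have bv: "b (q (p v)) \<in> rep_space V" "b v \<in> rep_space V" using v by (simp_all add: r)
    have "q (a (p (b (q (p v))))) = A (B (q (p v)))" using Ae[OF bv(1)] Be(1)[OF v] by simp
    then show "B' (A' (q (a (p (b (q (p v))))))) = q (p v)"
      using A'(2)[OF Hom_in[OF B(1) ev]] B'(2)[OF ev] by simp
    let ?u = "B' (q (p (b v)))"
    have u: "?u \<in> rep_space V" "B ?u = q (p (b v))" using bv(2) B'(3) Hom_in[OF B'(1)] by (simp_all add: r)
    have "p (b (q (p ?u))) = p (q (p (b (q (p ?u)))))" by (simp only: pqp)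
    also have "\<dots> = p (q (p (B ?u)))" by (simp only: Be(2)[OF u(1)])
    also have "\<dots> = p (b v)" by (simp only: u(2) pqp)
    finally show "\<exists>u\<in>rep_space V. a (p (b v)) = a (p (b (q (p u))))" using u(1) by (intro bexI[of _ ?u]) simp_all
  qed
qed

text \<open>The parabola from \<open>p\<close> to \<open>y\<close> stays in the image of the chart
  up to finitely many parameters, because along it both completed blocks have the form
  \<open>1 + t N\<close>.\<close>

lemma chart_dominant:
  assumes f: "f \<in> polys" and z: "\<And>x. x \<in> tang \<Longrightarrow> f (chart x) = 0" and y: "y \<in> X"
  shows "f y = 0"
proof -
  interpret v: cvec "rep_scale V" by (rule fd_cvec[OF V])
  obtain a b where a: "a \<in> Hom W W" and b: "b \<in> Hom V V"
    and ye: "y = p + hom_scale W 1 (\<lambda>v. a (p v) + p (b v)) + hom_scale W (1 * 1) (\<lambda>v. a (p (b v)))"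
    by (rule orbit_curve[OF pX y])
  note r = Hom_rules[OF a W] Hom_rules[OF b V] pq_rules
  have N: "(\<lambda>v. q (a (p v))) \<in> Hom V V" "(\<lambda>v. q (p (b (q (p v))))) \<in> Hom V V"
    by (rule Hom_comp[OF Hom_comp[OF p a W] q W], rule Hom_comp[OF Hom_comp[OF qp b V] qp V])
  let ?A = "\<lambda>t v. rep_id V v + rep_scale V t (q (a (p v)))" and ?B = "\<lambda>t v. rep_id V v + rep_scale V t (q (p (b (q (p v)))))"
  let ?y = "\<lambda>t. p + hom_scale W t (\<lambda>v. a (p v) + p (b v)) + hom_scale W (t * t) (\<lambda>v. a (p (b v)))"
  have f1: "finite {t. \<not> nondeg V (?A t)}" by (rule finite_degenerate[OF V rep_id_Hom[OF V] _ N(1)]) simp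
  have f2: "finite {t. \<not> nondeg V (?B t)}" by (rule finite_degenerate[OF V rep_id_Hom[OF V] _ N(2)]) simp
  have fin: "finite {t. ?y t \<notin> chart ` tang}"
  proof (rule finite_subset[OF _ finite_UnI[OF f1 f2]], rule subsetI, rule ccontr)
    fix t assume t: "t \<in> {t. ?y t \<notin> chart ` tang}" and n: "t \<notin> {t. \<not> nondeg V (?A t)} \<union> {t. \<not> nondeg V (?B t)}"
    have AB: "nondeg V (?A t)" "nondeg V (?B t)" using n by blast+
    have "?y t \<in> chart ` tang"
      unfolding curve_eq(1)[OF p a b]
    proof (rule near_chart[where A = "?A t" and B = "?B t"])
      show "(\<lambda>w. rep_id W w + rep_scale W t (a w)) \<in> Hom W W" "(\<lambda>v. rep_id V v + rep_scale V t (b v)) \<in> Hom V V"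
        "?A t \<in> Hom V V" "?B t \<in> Hom V V"
        by (intro Hom_plus[OF W rep_id_Hom[OF W] Hom_scaled[OF W a]] Hom_plus[OF V rep_id_Hom[OF V] Hom_scaled[OF V b]]
          Hom_plus[OF V rep_id_Hom[OF V] Hom_scaled[OF V N(1)]] Hom_plus[OF V rep_id_Hom[OF V] Hom_scaled[OF V N(2)]])+
      show "?A t v = q (rep_id W (p v) + rep_scale W t (a (p v))) + (v - q (p v))" if "v \<in> rep_space V" for v
        using that by (simp add: r)
      show "?B t v = q (p (rep_id V (q (p v)) + rep_scale V t (b (q (p v))))) + (v - q (p v))" if "v \<in> rep_space V" for v
        using that by (simp add: r)
    qed (rule AB)+
    then show False using t by blast
  qed
  have "f (?y 1) = 0"
    by (rule E.curve_vanish[OF p curve_eq(2,3)[OF p a b] f fin]) (use z in blast)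
  then show ?thesis by (simp only: ye)
qed

text \<open>The chart is the sum of a linear and a bilinear expression in \<open>x\<close>, so
  linear functions pull back to degree at most 2.\<close>

lemma hilb_X: "hilb (hom_scale W) (Hom V W) X n \<le> (2 * n + 1) ^ E.dim tang"
proof (rule E.hilb_parametrized[where \<phi> = chart])
  show at: "affine_space (hom_scale W) tang"
    by (intro affine_space.intro hom_cvec[OF W] affine_space_axioms.intro tang_fdim)
  show "chart x \<in> Hom V W" if "x \<in> tang" for x by (rule chart_Hom[OF tang_Hom[OF that]])
  show "f y = 0" if "f \<in> polys" "\<And>x. x \<in> tang \<Longrightarrow> f (chart x) = 0" "y \<in> X" for f y
    by (rule chart_dominant[OF that])
  fix l assume l: "linear_on (Hom V W) (hom_scale W) (*) l"
  interpret c: cvec2 "hom_scale W :: complex \<Rightarrow> ('v \<Rightarrow> 'w) \<Rightarrow> _" "(*)" by (rule E.cvec2_complex)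
  interpret t: affine_space "hom_scale W" tang by (rule at)
  define K where "K x y = (\<lambda>v. x (q (y v - y (q (p v)))))" for x y :: "'v \<Rightarrow> 'w"
  have K: "K x y \<in> Hom V W" if "x \<in> tang" "y \<in> tang" for x y
    unfolding K_def by (rule Hom_comp[OF qrem_Hom[OF tang_Hom[OF that(2)]] tang_Hom[OF that(1)] V])
  have e: "(\<lambda>v. x (q (p v))) \<in> Hom V W" if "x \<in> tang" for x by (rule Hom_comp[OF qp tang_Hom[OF that] V])
  note la = c.linear_on_add[OF l] and ls = c.linear_on_scale[OF l]
  have "linear_on tang (hom_scale W) (*) (\<lambda>x. l (\<lambda>v. x (q (p v))))"
    unfolding linear_on_def
  proof (intro conjI ballI allI)
    fix x y assume x: "x \<in> tang" and y: "y \<in> tang"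
    have "(\<lambda>v. (x + y) (q (p v))) = (\<lambda>v. x (q (p v))) + (\<lambda>v. y (q (p v)))" by (simp add: plus_fun_def)
    then show "l (\<lambda>v. (x + y) (q (p v))) = l (\<lambda>v. x (q (p v))) + l (\<lambda>v. y (q (p v)))"
      by (simp only: la[OF e[OF x] e[OF y]])
  next
    fix c x assume x: "x \<in> tang"
    have "(\<lambda>v. hom_scale W c x (q (p v))) = hom_scale W c (\<lambda>v. x (q (p v)))" by (simp add: hom_scale_def)
    then show "l (\<lambda>v. hom_scale W c x (q (p v))) = c * l (\<lambda>v. x (q (p v)))" by (simp only: ls[OF e[OF x]])
  qed
  then have p1: "polyd (hom_scale W) tang 2 (\<lambda>x. l (\<lambda>v. x (q (p v))))"
    by (rule polyd.mono[OF polyd.linear]) simp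
  have lin1: "linear_on tang (hom_scale W) (*) (\<lambda>x. l (K x y))" if y: "y \<in> tang" for y
    unfolding linear_on_def
  proof (intro conjI ballI allI)
    fix x x' assume x: "x \<in> tang" "x' \<in> tang"
    have "K (x + x') y = K x y + K x' y" by (simp add: K_def plus_fun_def)
    then show "l (K (x + x') y) = l (K x y) + l (K x' y)" by (simp only: la[OF K[OF x(1) y] K[OF x(2) y]])
  next
    fix c x assume x: "x \<in> tang"
    have "K (hom_scale W c x) y = hom_scale W c (K x y)" by (simp add: K_def hom_scale_def)
    then show "l (K (hom_scale W c x) y) = c * l (K x y)" by (simp only: ls[OF K[OF x y]])
  qed
  have lin2: "linear_on tang (hom_scale W) (*) (\<lambda>y. l (K x y))" if x: "x \<in> tang" for x
    unfolding linear_on_def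
  proof (intro conjI ballI allI)
    note xE = tang_Hom[OF x]
    fix y y' assume y: "y \<in> tang" "y' \<in> tang"
    note yE = tang_Hom[OF y(1)] tang_Hom[OF y(2)]
    have "K x (y + y') = K x y + K x y'"
      by (rule Hom_eqI[OF K[OF x E.subspace_add[OF tang_subspace y]] E_add[OF K[OF x y(1)] K[OF x y(2)]]])
        (simp add: K_def Hom_rules[OF xE V] Hom_rules[OF yE(1) V] Hom_rules[OF yE(2) V] pq_rules)
    then show "l (K x (y + y')) = l (K x y) + l (K x y')" by (simp only: la[OF K[OF x y(1)] K[OF x y(2)]])
  next
    note xE = tang_Hom[OF x]
    fix c y assume y: "y \<in> tang"
    note yE = tang_Hom[OF y]
    interpret w: cvec "rep_scale W" by (rule fd_cvec[OF W])
    have "K x (hom_scale W c y) = hom_scale W c (K x y)"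
      by (rule Hom_eqI[OF K[OF x E.subspace_scale[OF tang_subspace y]] E_scale[OF K[OF x y]]])
        (simp add: K_def hom_scale_def Hom_rules[OF xE V] Hom_rules[OF yE V] pq_rules w.scale_right_diff_distrib)
    then show "l (K x (hom_scale W c y)) = c * l (K x y)" by (simp only: ls[OF K[OF x y]])
  qed
  obtain g where g: "polyd (hom_scale W) tang 2 g" "\<And>x. x \<in> tang \<Longrightarrow> g x = l (K x x)"
    using t.bilinear_polyd[OF lin1 lin2] by metis
  have "l (chart x) = l (\<lambda>v. x (q (p v))) + g x" if x: "x \<in> tang" for x
  proof -
    have "chart x = (\<lambda>v. x (q (p v))) + K x x" by (simp add: chart_def K_def plus_fun_def)
    then show ?thesis by (simp only: la[OF e[OF x] K[OF x x]] g(2)[OF x])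
  qed
  then show "\<exists>g. polyd (hom_scale W) tang 2 g \<and> (\<forall>x\<in>tang. g x = l (chart x))"
    by (intro exI[of _ "\<lambda>x. l (\<lambda>v. x (q (p v))) + g x"] conjI polyd.add[OF p1 g(1)] ballI) simp
qed

lemma krull_dim_nhd:
  assumes "openin Z U" "p \<in> U"
  shows "krull_dim (subtopology Z (X \<inter> U)) = enat (E.dim tang)"
proof (rule antisym)
  have XE: "X \<subseteq> Hom V W" by (auto simp: X_def)
  show "krull_dim (subtopology Z (X \<inter> U)) \<le> enat (E.dim tang)"
    by (rule E.krull_dim_upper[OF _ E.hilb_mono_le[OF _ XE hilb_X]]) (use XE in auto)
qed (rule krull_dim_ge[OF assms])

text \<open>\<open>cut\<close> maps \<open>Hom V W\<close> onto a copy of the Hom space from the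
  kernel of \<open>p\<close> to the kernel of \<open>q\<close>. For multiplicities \<open>n\<close>,
  \<open>m\<close> and rank \<open>s\<close> each index contributes
  \<open>n m - (n - s) (m - s) = (n + m - s) s\<close>.\<close>

lemma dim_tang: "int (E.dim tang) = (\<Sum>i\<in>I. (int (hdim (Vs i) V) + int (hdim (Vs i) W) - int (s i)) * int (s i))"
proof -
  let ?kV = "{v\<in>rep_space V. p v = 0}" and ?kW = "{w\<in>rep_space W. q w = 0}"
  let ?A = "sub_rep V ?kV" and ?C = "sub_rep W ?kW"
  have fA: "fd_rep L ?A" by (rule sub_rep_fd[OF V kernel_subrep[OF V W p]])
  have fC: "fd_rep L ?C" by (rule sub_rep_fd[OF W kernel_subrep[OF W V q]])
  let ?r = "\<lambda>v. rep_id V v - q (p v)"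
  have rV: "?r \<in> Hom V V" by (rule Hom_minus[OF V rep_id_Hom[OF V] qp])
  have r: "?r \<in> Hom V ?A"
    by (subst Hom_sub_target) (use rV in \<open>auto simp: pq_rules\<close>)
  let ?\<psi> = "\<lambda>g v. g (?r v)"
  have tg: "g \<in> Hom B ?C \<longleftrightarrow> g \<in> Hom B W \<and> g ` rep_space B \<subseteq> ?kW" for B :: "('g, 'v) rep" and g
    by (rule Hom_sub_target) auto
  have im: "?\<psi> ` Hom ?A ?C = cut ` Hom V W"
  proof (intro equalityI subsetI)
    fix y assume "y \<in> ?\<psi> ` Hom ?A ?C"
    then obtain g where g: "g \<in> Hom ?A ?C" "y = ?\<psi> g" by blast
    have y': "y \<in> Hom V ?C" unfolding g(2) by (rule Hom_comp[OF r g(1) fA])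
    then have y: "y \<in> Hom V W" "y ` rep_space V \<subseteq> ?kW" unfolding tg by auto
    have "cut y = y"
    proof (rule Hom_eqI[OF cut_Hom[OF y(1)] y(1)])
      fix v assume v: "v \<in> rep_space V"
      have "y (q (p v)) = 0" unfolding g(2) using v Hom_rules(5)[OF g(1) fA] by (simp add: pq_rules)
      moreover have "q (y v) = 0" using y(2) v by blast
      ultimately show "cut y v = y v" by (simp add: cut_def pq_rules)
    qed
    then show "y \<in> cut ` Hom V W" using y(1) by (metis imageI)
  next
    fix y assume "y \<in> cut ` Hom V W"
    then obtain x where x: "x \<in> Hom V W" "y = cut x" by blast
    let ?h = "\<lambda>v. x v - p (q (x v))" and ?g = "\<lambda>v. if v \<in> ?kV then x v - p (q (x v)) else 0"
    have h: "?h \<in> Hom V W" by (rule Hom_minus[OF W x(1) Hom_comp[OF Hom_comp[OF x(1) q W] p V]])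
    have "?g \<in> Hom ?A W" by (rule Hom_restrict[OF V kernel_subrep[OF V W p] h])
    moreover have "?g ` rep_space ?A \<subseteq> ?kW"
      by (auto simp: Hom_rules[OF x(1) V] pq_rules)
    ultimately have g: "?g \<in> Hom ?A ?C" unfolding tg by blast
    have g': "?\<psi> ?g \<in> Hom V W" using Hom_comp[OF r g fA] unfolding tg by blast
    have yg: "y = ?\<psi> ?g"
      unfolding x(2)
    proof (rule Hom_eqI[OF cut_Hom[OF x(1)] g'])
      fix v assume v: "v \<in> rep_space V"
      have "?r v \<in> ?kV" using Hom_in[OF r v] by simp
      moreover have "x (?r v) = x v - x (q (p v))" using v by (simp add: Hom_rules[OF x(1) V] pq_rules)
      ultimately show "cut x v = ?\<psi> ?g v" unfolding cut_def by (simp only: if_True)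
    qed
    show "y \<in> ?\<psi> ` Hom ?A ?C" unfolding yg by (rule imageI[OF g, of ?\<psi>])
  qed
  have hs: "hom_scale ?C = (hom_scale W :: complex \<Rightarrow> ('v \<Rightarrow> 'w) \<Rightarrow> _)" by (simp add: hom_scale_def fun_eq_iff)
  have fH: "E.fdim (Hom ?A ?C)" using Hom_fdim[OF fA fC] unfolding hs .
  have lin: "linear_on (Hom ?A ?C) (hom_scale W) (hom_scale W) ?\<psi>" by (rule linear_on_pre)
  have inj: "g = 0" if g: "g \<in> Hom ?A ?C" "?\<psi> g = 0" for g
  proof (rule Hom_eqI[OF g(1) Hom_zero_mem[OF fC]])
    fix v assume "v \<in> rep_space ?A"
    then have "?r v = v" by (simp add: pq_rules)
    then show "g v = 0 v" using fun_cong[OF g(2), of v] by simp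
  qed
  have "E.dim (?\<psi> ` Hom ?A ?C) = E.dim (Hom ?A ?C)" by (rule E.self.dim_inj_image[OF fH lin inj])
  moreover have "E.dim (cut ` Hom V W) + E.dim tang = E.dim (Hom V W)"
    using E.self.dim_image_kernel(2)[OF E.fdE cut_linear] unfolding tang_def .
  ultimately have d: "hdim ?A ?C + E.dim tang = hdim V W" unfolding hdim_def hs im by simp
  have nV: "hdim (Vs i) V = hdim (Vs i) ?A + s i" and nW: "hdim (Vs i) W = hdim (Vs i) ?C + s i" if i: "i \<in> I" for i
    using hdim_ker_im(1)[OF ss irr_fd'[OF i] V W p] hdim_coker[OF ss irr_fd'[OF i] V W p q pqp qpq] pX i by (simp_all add: X_def)
  have "int (hdim ?A ?C) + int (E.dim tang) = int (hdim V W)" using d by linarith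
  then have "int (E.dim tang) = (\<Sum>i\<in>I. int (hdim (Vs i) V) * int (hdim (Vs i) W)) - (\<Sum>i\<in>I. int (hdim (Vs i) ?A) * int (hdim (Vs i) ?C))"
    unfolding hdim_supported[OF V supp(1) W] hdim_supported[OF fA supported_ker[OF V W p supp(1)] fC] by simp
  also have "\<dots> = (\<Sum>i\<in>I. (int (hdim (Vs i) V) + int (hdim (Vs i) W) - int (s i)) * int (s i))"
    unfolding sum_subtractf[symmetric] by (rule sum.cong[OF refl]) (simp add: nV nW algebra_simps)
  finally show ?thesis .
qed

text \<open>For \<open>v\<close> in \<open>tang\<close> one has \<open>v = a p + p b\<close> with
  \<open>a = v q\<close> and \<open>b = q v (1 - q p)\<close>. So \<open>v\<close> is the velocity
  at \<open>p\<close> of a parabola that lies in \<open>X\<close> up to finitely many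
  parameters.\<close>

lemma tang_subset: "tang \<subseteq> tangent_space (hom_scale W) (Hom V W) X p"
proof
  fix v assume v: "v \<in> tang"
  note vE = tang_Hom[OF v]
  let ?a = "\<lambda>w. v (q w)" and ?b = "\<lambda>u. q (v u - v (q (p u)))"
  have a: "?a \<in> Hom W W" and b: "?b \<in> Hom V V" by (rule Hom_comp[OF q vE V], rule qrem_Hom[OF vE])
  have "(\<lambda>u. ?a (p u) + p (?b u)) = v" by (simp add: tangD[OF v])
  then have fin: "finite {t. p + hom_scale W t v + hom_scale W (t * t) (\<lambda>u. ?a (p (?b u))) \<notin> X}"
    using curve_in_X[OF pX a b] by (simp only:)
  have "deriv (\<lambda>t. f (p + hom_scale W t v)) 0 = 0"
    if f: "f \<in> polys" "\<forall>x\<in>X. f x = 0" for f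
    by (rule E.curve_tangent[OF p vE curve_eq(3)[OF p a b] f(1) fin]) (use f(2) in blast)
  then show "v \<in> tangent_space (hom_scale W) (Hom V W) X p" unfolding tangent_space_def using vE by blast
qed

text \<open>
  Conversely, if \<open>cut v\<close> is nonzero on some isotypic component, a minor of size \<open>s i + 1\<close> that is
  diagonal with exactly one zero at \<open>p\<close> has nonzero derivative in the direction \<open>v\<close>.
\<close>

lemma tangent_subset: "tangent_space (hom_scale W) (Hom V W) X p \<subseteq> tang"
proof
  fix v assume "v \<in> tangent_space (hom_scale W) (Hom V W) X p"
  then have v: "v \<in> Hom V W" and dv: "\<And>f. f \<in> polys \<Longrightarrow> (\<forall>x\<in>X. f x = 0) \<Longrightarrow>
      deriv (\<lambda>t. f (p + hom_scale W t v)) 0 = 0"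
    unfolding tangent_space_def by blast+
  have "cut v = 0"
  proof (rule ccontr)
    assume "cut v \<noteq> 0"
    from nonzero_detected[OF V W supp(1) cut_Hom[OF v] this]
    obtain i \<phi> u where i: "i \<in> I" and \<phi>: "\<phi> \<in> Hom (Vs i) V" and u: "u \<in> rep_space (Vs i)" "cut v (\<phi> u) \<noteq> 0" .
    note fU = irr_fd'[OF i]
    interpret c: cvec2 "hom_scale V :: complex \<Rightarrow> ('u \<Rightarrow> 'v) \<Rightarrow> _" "hom_scale W :: complex \<Rightarrow> ('u \<Rightarrow> 'w) \<Rightarrow> _"
      by (intro cvec2.intro hom_cvec[OF V] hom_cvec[OF W])
    interpret cc: cvec2 "hom_scale W :: complex \<Rightarrow> ('u \<Rightarrow> 'w) \<Rightarrow> _" "(*)" by (rule c.v2.cvec2_complex)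
    let ?H = "Hom (Vs i) V" and ?g = "\<lambda>\<eta> u. p (\<eta> u)"
    have g: "linear_on ?H (hom_scale V) (hom_scale W) ?g" by (rule linear_on_post[OF p V])
    have H: "c.v1.fdim ?H" by (rule Hom_fdim[OF fU V])
    have ds: "s i = c.v2.dim (?g ` ?H)" using hdim_image[OF ss fU V W p] pX i by (simp add: X_def)
    obtain e where e: "inj_on e {..<s i}" "c.v2.independent (e ` {..<s i})" "e ` {..<s i} \<subseteq> ?g ` ?H"
      "s i = c.v2.dim (?g ` ?H) \<Longrightarrow> c.v2.span (e ` {..<s i}) = ?g ` ?H"
      using c.v2.independent_family[OF c.dim_image_kernel(1)[OF H g] eq_refl[OF ds]] by metis
    \<comment> \<open>The component of \<open>\<phi>\<close> in the kernel of \<open>p\<close>.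
      Composing it with \<open>v\<close> gives a map outside the image of composition with
      \<open>p\<close>, since \<open>1 - p q\<close> does not kill its value at
      \<open>u\<close>.\<close>
    let ?\<phi>' = "\<lambda>u. \<phi> u - q (p (\<phi> u))"
    have \<phi>': "?\<phi>' \<in> ?H" by (rule Hom_minus[OF V \<phi> Hom_comp[OF \<phi> qp V]])
    let ?w = "\<lambda>u. v (?\<phi>' u)"
    have w: "?w \<notin> ?g ` ?H"
    proof
      assume "?w \<in> ?g ` ?H"
      then obtain \<eta> where \<eta>: "?w = ?g \<eta>" by blast
      have "?w u = v (\<phi> u) - v (q (p (\<phi> u)))"
        using Hom_in[OF \<phi> u(1)] by (simp add: Hom_rules[OF v V] pq_rules)
      then have "cut v (\<phi> u) = ?w u - p (q (?w u))" by (simp add: cut_def)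
      also have "\<dots> = 0" unfolding fun_cong[OF \<eta>, of u] by (simp add: pqp)
      finally show False using u(2) by simp
    qed
    define e' where "e' a = (if a < s i then e a else ?w)" for a
    have im: "e' ` {..<Suc (s i)} = insert ?w (e ` {..<s i})" by (auto simp: e'_def lessThan_Suc)
    have ni: "?w \<notin> e ` {..<s i}" using w e(3) by blast
    have "c.v2.independent (e' ` {..<Suc (s i)})"
      unfolding im by (rule c.v2.independent_insertI[OF _ e(2)]) (use w e(4)[OF ds] in simp)
    moreover have "inj_on e' {..<Suc (s i)}"
    proof -
      have "inj_on e' {..<s i}" using e(1) by (simp add: inj_on_def e'_def)
      moreover have "e' ` {..<s i} = e ` {..<s i}" by (rule image_cong) (auto simp: e'_def)
      ultimately show ?thesis using ni by (simp add: lessThan_Suc inj_on_insert e'_def)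
    qed
    ultimately obtain l where l: "\<And>j. clinear (hom_scale W) (*) (l j)"
      "\<And>a b. a < Suc (s i) \<Longrightarrow> b < Suc (s i) \<Longrightarrow> l b (e' a) = (if a = b then 1 else 0)"
      using c.v2.independent_dual by metis
    have "\<forall>a\<in>{..<s i}. \<exists>\<eta>\<in>?H. ?g \<eta> = e a" using e(3) by force
    then obtain \<eta> where \<eta>: "\<forall>a\<in>{..<s i}. \<eta> a \<in> ?H \<and> ?g (\<eta> a) = e a" by metis
    define \<Phi> where "\<Phi> a = (if a < s i then \<eta> a else ?\<phi>')" for a
    have \<Phi>: "\<Phi> a \<in> ?H" for a using \<eta> \<phi>' by (simp add: \<Phi>_def)
    \<comment> \<open>The last row belongs to \<open>\<phi>'\<close> and the last column to the
      functional dual to \<open>v \<phi>'\<close>. At \<open>p\<close> this row is 0, and in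
      direction \<open>v\<close> its last entry grows with slope 1.\<close>
    let ?f = "\<lambda>y. minor (Suc (s i)) (\<lambda>a b. l b (\<lambda>u. y (\<Phi> a u)))"
    have fm: "?f \<in> minors i (Suc (s i))"
      unfolding minors_def mem_Collect_eq using \<Phi> l(1) by (intro exI[of _ \<Phi>] exI[of _ l] conjI refl allI impI)
    have "?f x = 0" if x: "x \<in> X" for x
    proof -
      have "mults V W x i < Suc (s i)" using x i by (simp add: X_def)
      then have "\<forall>f\<in>minors i (Suc (s i)). f x = 0" by (simp only: minors_rank[OF i X_Hom[OF x]])
      from bspec[OF this fm] show ?thesis .
    qed
    then have "deriv (\<lambda>t. ?f (p + hom_scale W t v)) 0 = 0"
      by (intro dv subsetD[OF minors_poly fm] ballI)
    moreover have "?f (p + hom_scale W t v) =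
      minor (Suc (s i)) (\<lambda>a b. (if a = b \<and> a < s i then 1 else 0) + t * l b (\<lambda>u. v (\<Phi> a u)))" for t
    proof (rule minor_cong)
      fix a b assume ab: "a < Suc (s i)" "b < Suc (s i)"
      have "(\<lambda>u. (p + hom_scale W t v) (\<Phi> a u)) = ?g (\<Phi> a) + hom_scale W t (\<lambda>u. v (\<Phi> a u))"
        by (simp add: fun_eq_iff hom_scale_def)
      then have 1: "l b (\<lambda>u. (p + hom_scale W t v) (\<Phi> a u)) = l b (?g (\<Phi> a)) + t * l b (\<lambda>u. v (\<Phi> a u))"
        by (simp only: cc.linear_add[OF l(1)] cc.linear_scale[OF l(1)])
      have "l b (?g (\<Phi> a)) = (if a = b \<and> a < s i then 1 else 0)"
      proof (cases "a < s i")
        case True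
        then have "?g (\<Phi> a) = e' a" using \<eta> by (simp add: \<Phi>_def e'_def)
        then show ?thesis using l(2)[OF ab] True by (simp only: simp_thms)
      next
        case False
        have "?g (\<Phi> a) = 0"
        proof
          fix u show "?g (\<Phi> a) u = 0 u"
          proof (cases "u \<in> rep_space (Vs i)")
            case True
            then show ?thesis using False Hom_in[OF \<phi>] by (simp add: \<Phi>_def pq_rules)
          qed (use False Hom_out[OF \<phi>] in \<open>simp add: \<Phi>_def pq_rules\<close>)
        qed
        then show ?thesis using False cc.linear_0[OF l(1)] by simp
      qed
      then show "l b (\<lambda>u. (p + hom_scale W t v) (\<Phi> a u)) = (if a = b \<and> a < s i then 1 else 0) + t * l b (\<lambda>u. v (\<Phi> a u))"
        using 1 by simp
    qed
    ultimately have "l (s i) (\<lambda>u. v (\<Phi> (s i) u)) = 0"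
      using minor_deriv[of "s i" "\<lambda>a b. l b (\<lambda>u. v (\<Phi> a u))"] by (simp only:)
    moreover have "l (s i) ?w = 1" using l(2)[of "s i" "s i"] by (simp add: e'_def)
    ultimately show False by (simp add: \<Phi>_def)
  qed
  then show "v \<in> tang" using v by (simp add: tang_def)
qed

end

section \<open>Smoothness, dimension and the translation to the representation ring\<close>

context rank_variety
begin

lemma rank_point_at:
  assumes "p \<in> X"
  obtains q where "rank_point L I Vs V W s p q"
proof -
  obtain q where "q \<in> Hom W V" "\<And>v. p (q (p v)) = p v" "\<And>w. q (p (q w)) = q w"
    using generalized_inverse[OF ss V W X_Hom[OF assms]] by metis
  then have "rank_point L I Vs V W s p q"
    using assms by (intro rank_point.intro rank_variety_axioms rank_point_axioms.intro)
  then show ?thesis by (rule that)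
qed

text \<open>All open neighbourhoods of \<open>p\<close> in \<open>X\<close> have the same Krull
  dimension, which is therefore the infimum in \<open>local_dim\<close>.\<close>

lemma X_smooth: "smooth_variety (hom_scale W) (Hom V W) X"
  unfolding smooth_variety_def
proof
  fix p assume pm: "p \<in> X"
  obtain q where "rank_point L I Vs V W s p q" by (rule rank_point_at[OF pm])
  then interpret rank_point L I Vs V W s p q .
  have "local_dim (subtopology Z X) p = enat (E.dim tang)"
    unfolding local_dim_def
  proof (rule antisym)
    have "krull_dim (subtopology (subtopology Z X) (X \<inter> Hom V W)) = enat (E.dim tang)"
      using krull_dim_nhd[of "Hom V W"] openin_topspace[of Z] X_Hom[OF pm]
      by (simp add: topspace_zariski subtopology_subtopology)
    moreover have "openin (subtopology Z X) (X \<inter> Hom V W)"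
      using openin_topspace[of "subtopology Z X"] by (simp add: topspace_zariski Int_commute)
    ultimately show "(INF U\<in>{U. openin (subtopology Z X) U \<and> p \<in> U}. krull_dim (subtopology (subtopology Z X) U)) \<le> enat (E.dim tang)"
      using pm X_Hom[OF pm] by (metis (no_types, lifting) INF_lower IntI mem_Collect_eq)
    show "enat (E.dim tang) \<le> (INF U\<in>{U. openin (subtopology Z X) U \<and> p \<in> U}. krull_dim (subtopology (subtopology Z X) U))"
    proof (rule INF_greatest)
      fix U assume "U \<in> {U. openin (subtopology Z X) U \<and> p \<in> U}"
      then obtain T where T: "openin Z T" "U = T \<inter> X" "p \<in> T" unfolding openin_subtopology by blast
      then show "enat (E.dim tang) \<le> krull_dim (subtopology (subtopology Z X) U)"
        using krull_dim_nhd[OF T(1,3)] by (simp add: subtopology_subtopology Int_commute Int_left_commute)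
    qed
  qed
  moreover have "tangent_space (hom_scale W) (Hom V W) X p = tang"
    using tang_subset tangent_subset by (rule antisym[rotated])
  ultimately show "enat (E.dim (tangent_space (hom_scale W) (Hom V W) X p)) = local_dim (subtopology Z X) p"
    by simp
qed

lemma X_dim:
  obtains d where "krull_dim (subtopology Z X) = enat d"
    "int d = (\<Sum>i\<in>I. (int (hdim (Vs i) V) + int (hdim (Vs i) W) - int (s i)) * int (s i))"
proof -
  obtain p where pm: "p \<in> X" using rank_exists[OF V W s_le] by (auto simp: X_def)
  obtain q where "rank_point L I Vs V W s p q" by (rule rank_point_at[OF pm])
  then interpret rank_point L I Vs V W s p q .
  have "X \<inter> Hom V W = X" by (auto simp: X_def)
  then have "krull_dim (subtopology Z X) = enat (E.dim tang)"
    using krull_dim_nhd[of "Hom V W"] openin_topspace[of Z] X_Hom[OF pm] by (simp add: topspace_zariski)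
  then show ?thesis using that dim_tang by blast
qed

end

theorem proposition25:
  fixes L :: "'g::ab_group_add lie"
    and k :: nat
    and Vs :: "nat \<Rightarrow> ('g, 'u::ab_group_add) rep"
    and V :: "('g, 'v::ab_group_add) rep"
    and W :: "('g, 'w::ab_group_add) rep"
    and n m s :: "nat \<Rightarrow> int"
    and S :: "'g formal_rep set"
  assumes "semisimple L"
    and "\<And>i. i \<in> {1..k} \<Longrightarrow> irreducible_rep L (Vs i)"
    and "\<And>i j. i \<in> {1..k} \<Longrightarrow> j \<in> {1..k} \<Longrightarrow> i \<noteq> j \<Longrightarrow> \<not> rep_iso (Vs i) (Vs j)"
    and "fd_rep L V" and "fd_rep L W"
    and "cl L V = (\<Oplus>\<^bsub>rep_ring L\<^esub>i\<in>{1..k}. [n i] \<cdot>\<^bsub>rep_ring L\<^esub> cl L (Vs i))"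
    and "cl L W = (\<Oplus>\<^bsub>rep_ring L\<^esub>i\<in>{1..k}. [m i] \<cdot>\<^bsub>rep_ring L\<^esub> cl L (Vs i))"
    and "S = (\<Oplus>\<^bsub>rep_ring L\<^esub>i\<in>{1..k}. [s i] \<cdot>\<^bsub>rep_ring L\<^esub> cl L (Vs i))"
    and "rep_le L \<zero>\<^bsub>rep_ring L\<^esub> S"
    and "rep_le L S (rep_min L (cl L V) (cl L W))"
  shows "subvariety (hom_scale W) (Hom V W) (Hom_rank L V W S)
    \<and> irreducible_space (subtopology (zariski (hom_scale W) (Hom V W)) (Hom_rank L V W S))
    \<and> smooth_variety (hom_scale W) (Hom V W) (Hom_rank L V W S)
    \<and> (\<exists>d. krull_dim (subtopology (zariski (hom_scale W) (Hom V W)) (Hom_rank L V W S)) = enat d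
          \<and> int d = (\<Sum>i=1..k. (n i + m i - s i) * s i))"
proof -
  interpret isotypic L "{1..k}" Vs
    by (rule isotypic.intro) (simp_all add: assms(1-3))
  have clV: "cl L V = comb n" and clW: "cl L W = comb m" and S: "S = comb s"
    unfolding comb_def cls_def by (rule assms)+
  \<comment> \<open>Inequalities in the representation ring become inequalities of integer
    coefficients; nonnegativity is what permits passing to \<open>nat (s i)\<close> below.\<close>
  have s0: "0 \<le> s i" if "i \<in> {1..k}" for i
  proof -
    have "S \<ominus>\<^bsub>rep_ring L\<^esub> \<zero>\<^bsub>rep_ring L\<^esub> = comb (\<lambda>i. s i - 0)"
      unfolding S comb_zero[symmetric] by (rule comb_diff)
    then show ?thesis using assms(9) nonneg_comb[OF _ that] unfolding rep_le_def by fastforce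
  qed
  have sm: "s i \<le> min (n i) (m i)" if "i \<in> {1..k}" for i
  proof -
    have "rep_min L (cl L V) (cl L W) \<ominus>\<^bsub>rep_ring L\<^esub> S = comb (\<lambda>i. min (n i) (m i) - s i)"
      unfolding clV clW S min_comb by (rule comb_diff)
    then have "rep_nonneg L (comb (\<lambda>i. min (n i) (m i) - s i))" using assms(10) unfolding rep_le_def by simp
    from nonneg_comb[OF this that] show ?thesis by simp
  qed
  have nV: "int (hdim (Vs i) V) = n i" and nW: "int (hdim (Vs i) W) = m i" if "i \<in> {1..k}" for i
    by (rule supported_comb(2)[OF assms(4) clV that], rule supported_comb(2)[OF assms(5) clW that])
  interpret rank_variety L "{1..k}" Vs V W "\<lambda>i. nat (s i)"
  proof (intro rank_variety.intro rank_variety_axioms.intro isotypic_axioms)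
    show "supported V" "supported W" by (rule supported_comb(1)[OF assms(4) clV], rule supported_comb(1)[OF assms(5) clW])
    show "nat (s i) \<le> hdim (Vs i) V" "nat (s i) \<le> hdim (Vs i) W" if "i \<in> {1..k}" for i
      using sm[OF that] nV[OF that] nW[OF that] by linarith+
  qed (rule assms)+
  have "S = comb (\<lambda>i. int (nat (s i)))" unfolding S by (rule comb_cong) (simp add: s0)
  then have rk: "Hom_rank L V W S = X" by (simp only: Hom_rank_eq_X)
  obtain d where d: "krull_dim (subtopology Z X) = enat d"
    "int d = (\<Sum>i\<in>{1..k}. (int (hdim (Vs i) V) + int (hdim (Vs i) W) - int (nat (s i))) * int (nat (s i)))"
    by (rule X_dim)
  have "int d = (\<Sum>i=1..k. (n i + m i - s i) * s i)"
    unfolding d(2) by (rule sum.cong[OF refl]) (simp add: nV nW s0)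
  then show ?thesis
    unfolding rk using X_subvariety X_irreducible X_smooth d(1) by blast
qed

end
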